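(* Let $n\ge 1$. For every composition $\lambda\in\mathbb{Z}^n$, the Laurent polynomial $E_\lambda^{(n)}(z;t;a,b,c,d)$ given by the recursion in the context is well-defined (i.e. there is a unique family $\{E_\lambda^{(n)}\}_{\lambda\in\mathbb{Z}^n}$ with the prescribed values at partitions and satisfying the recursion), and $$\lim_{q \rightarrow 0} U_{\lambda}^{(n)}(z;q,t;a,b,c,d) = E_{\lambda}^{(n)}(z;t;a,b,c,d),$$ the limit being taken coefficientwise for generic $t,a,b,c,d$, where $U_\lambda^{(n)}$ are the nonsymmetric Koornwinder polynomials (defined in the context).
   Context: A partition $\lambda=(\lambda_1,\dots,\lambda_n)$ with $l(\lambda)\le n$ is a non-increasing string of $n$ non-negative integers (zeros allowed). Elements of $\mathbb{Z}^n$ are compositions; $z^\mu=z_1^{\mu_1}\cdots z_n^{\mu_n}$; $m_k(\lambda)$ is the number of $j\in\{1,\dots,n\}$ with $\lambda_j=k$ ($k\in\mathbb{Z}$). For $1\le i\le n-1$, $s_i\lambda$ is $\lambda$ with $\lambda_i,\lambda_{i+1}$ interchanged; $s_n\lambda$ is $\lambda$ with $\lambda_n$ replaced by $-\lambda_n$. **Orderings.** Dominance on $\mathbb{Z}^n$: $\mu\le\lambda$ iff $\sum_{i=1}^k\mu_i\le\sum_{i=1}^k\lambda_i$ for all $1\le k\le n$; $\mu<\lambda$ means $\mu\le\lambda$, $\mu\neq\lambda$. $\mu^+$ is the partition obtained by rearranging the absolute values of the parts of $\mu$ in non-increasing order. $\mu\prec\lambda$ iff $\mu\ne\lambda$ and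 either (1) $\mu^+<\lambda^+$, or (2) $\mu^+=\lambda^+$ and $\mu\le\lambda$. **Nonsymmetric Koornwinder polynomials.** Put $(x;q)=\prod_{k\ge0}(1-xq^k)$, $(x_1,\dots,x_l;q)=(x_1;q)\cdots(x_l;q)$, with $\pm$ exponents denoting the product over both sign choices, and $$\Delta_{K}^{(n)}(z;q,t;a,b,c,d) = \prod_{1 \leq i \leq n} \frac{(z_{i}^{2}, qz_{i}^{-2};q)}{(az_{i}, bz_{i}, cz_{i}, dz_{i}, aqz_{i}^{-1}, bqz_{i}^{-1}, cz_{i}^{-1},dz_{i}^{-1};q)} \prod_{1 \leq i<j \leq n} \frac{(z_{i}z_{j}^{\pm 1},qz_{i}^{-1}z_{j}^{\pm 1};q)}{(tz_{i}z_{j}^{\pm 1}, qtz_{i}^{-1}z_{j}^{\pm 1};q)} .$$ With $T=\{|z_1|=\dots=|z_n|=1\}$ and $dT=\prod_{j=1}^n\frac{dz_j}{2\pi\sqrt{-1}z_j}$, set $\langle f,g \rangle_{q} = \int_{T} f\, \bar{g}^{\iota}\, \Delta_{K}^{(n)}(z;q,t;a,b,c,d)\, dT$, where $\bar{\phantom{g}}$ sends $z^\nu\mapsto z^{-\nu}$ and fixes parameters, and $\iota$ inverts each of $q,t,a,b,c,d$ in the coefficients and fixes each $z^\nu$; parameters are taken of modulus less than $1$ for the integral. For generic parameters, $\{U_\mu^{(n)}(z;q,t;a,b,c,d)\}_{\mu\in\mathbb{Z}^n}$ are the Laurent polynomials uniquely determined by: (i) $U_{\mu} = z^{\mu} + \sum_{\nu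 \prec \mu} w_{\mu \nu} z^{\nu}$ for some coefficients $w_{\mu\nu}$ depending on $q,t,a,b,c,d$; (ii) $\langle U_{\mu}, z^{\nu} \rangle_{q} = 0$ for all $\nu \prec \mu$. **Hecke operators.** On Laurent polynomials $f(z_1,\dots,z_n)$, $$T_{i}f = tf + \frac{z_{i+1}-tz_{i}}{z_{i+1}-z_{i}}(f^{s_{i}}-f)\ (1\le i\le n-1),\qquad T_{n}f = -abf + \frac{(1-az_{n})(1-bz_{n})}{1-z_{n}^{2}}(f^{s_{n}}-f),$$ where $f^{s_i}$ ($i<n$) is $f$ with $z_i,z_{i+1}$ interchanged and $f^{s_n}$ is $f$ with $z_n$ replaced by $z_n^{-1}$. **Coefficients.** For $\lambda\in\mathbb{Z}^n$ and $1\le i\le n-1$ let $$n_{\lambda} = -|\{ l<i: \lambda_{l} = -1 \text{ or } 0 \}| - 2|\{l>i+1: \lambda_{l} = 0 \}| - 1$$ (depending on $i$), and let $r_\lambda=m_{-1}(\lambda)+m_0(\lambda)-1$ if $\lambda_n\neq 1$, and $r_\lambda=m_{-1}(\lambda)+m_0(\lambda)$ if $\lambda_n=1$. Define $$p_{n}(\lambda) = \begin{cases} -ab-1, & \lambda_{n} < -1 \\ -ab - 1 + abcd\,t^{2r_{\lambda}}, & \lambda_{n} = -1 \\ 0, & \lambda_{n} > 1 \\ -abcd\,t^{2r_{\lambda}}, & \lambda_{n} =1 \\ -ab,& \lambda_{n} = 0 \end{cases}\qquad q_{n}(\lambda) = \begin{cases} -ab, & \lambda_{n} < 0 \\ 0,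 & \lambda_{n} = 0 \\ 1, & \lambda_{n} > 1 \\ 1+cd\,t^{2r_{\lambda}}(-ab-1+abcd\,t^{2r_{\lambda}}), & \lambda_{n} = 1 \end{cases}$$ and for $1\le i\le n-1$ $$p_{i}(\lambda) = \begin{cases} t-1, & \lambda_{i} < \lambda_{i+1},\ (\lambda_{i}, \lambda_{i+1}) \neq (-1,0) \\ \frac{(1-t)t^{n_{\lambda}}}{abcd - t^{n_{\lambda}}}, & (\lambda_{i}, \lambda_{i+1}) = (-1,0) \\ 0, & \lambda_{i} > \lambda_{i+1},\ (\lambda_{i}, \lambda_{i+1}) \neq (0,-1) \\ \frac{(t-1)abcd}{abcd - t^{n_{\lambda}}}, & (\lambda_{i}, \lambda_{i+1}) = (0,-1) \\ t, & \lambda_{i} = \lambda_{i+1} \end{cases}\qquad q_{i}(\lambda) = \begin{cases} t, & \lambda_{i}<\lambda_{i+1}\\ 0,& \lambda_{i} = \lambda_{i+1} \\ 1,& \lambda_{i} > \lambda_{i+1},\ (\lambda_{i}, \lambda_{i+1}) \neq (0,-1) \\ 1-\frac{(1-t)^{2}abcd\,t^{n_{\lambda}-1}}{(abcd-t^{n_{\lambda}})^{2}},& (\lambda_{i}, \lambda_{i+1}) = (0,-1). \end{cases}$$ **Recursion.** For $\lambda$ a partition, $E_{\lambda}^{(n)} = \prod_{i:\,\lambda_{i} > 0} z_{i}^{\lambda_{i}} (1-cz_{i}^{-1})(1-dz_{i}^{-1})$. For general $\lambda\in\mathbb{Z}^n$ the polynomials $E_\lambda^{(n)}(z;t;a,b,c,d)$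 (with coefficients rational functions of $t,a,b,c,d$) are defined by the recursion, for all $\lambda\in\mathbb{Z}^n$ and $1\le i\le n$, $$T_{i}E_{\lambda}^{(n)} = p_{i}(\lambda)E_{\lambda}^{(n)} + q_{i}(\lambda)E_{s_{i}\lambda}^{(n)} .$$
   Formalization: In p_n(λ) and q_n(λ) the printed power t^{2r_λ} is replaced by t^{r_λ}; as printed the claim fails for n=2, since T_2E_(0,1) has z_2-coefficient -abcd t while r_(0,1)=1; n=1 is unaffected. *)

theory Defs
  imports
    "HOL-Analysis.Analysis"
    "HOL-Library.Poly_Mapping"
    "HOL-Computational_Algebra.Polynomial"
    "HOL-Computational_Algebra.Fraction_Field"
begin

section \<open>Compositions and orderings\<close>

text \<open>An element of \<open>\<int>\<^sup>n\<close> is a finitely supported function \<open>nat \<Rightarrow> int\<close> that vanishes outside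
  \<open>{1..n}\<close>; this makes the exponents an additive group, so that Laurent polynomials are the
  elements of a group ring.\<close>

type_synonym comp = "nat \<Rightarrow>\<^sub>0 int"

definition compositions :: "nat \<Rightarrow> comp set" where
  "compositions n = {\<mu>. Poly_Mapping.keys \<mu> \<subseteq> {1..n}}"

definition is_partition :: "nat \<Rightarrow> comp \<Rightarrow> bool" where
  "is_partition n \<mu> \<longleftrightarrow> \<mu> \<in> compositions n
     \<and> (\<forall>i\<in>{1..n}. 0 \<le> Poly_Mapping.lookup \<mu> i)
     \<and> (\<forall>i\<in>{1..<n}. Poly_Mapping.lookup \<mu> (i + 1) \<le> Poly_Mapping.lookup \<mu> i)"

definition mult :: "nat \<Rightarrow> int \<Rightarrow> comp \<Rightarrow> nat" where
  "mult n k \<mu> = card {j \<in> {1..n}. Poly_Mapping.lookup \<mu> j = k}"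

text \<open>The action of \<open>s\<^sub>i\<close>, meaningful for \<open>1 \<le> i \<le> n\<close>.\<close>

definition refl_comp :: "nat \<Rightarrow> nat \<Rightarrow> comp \<Rightarrow> comp" where
  "refl_comp n i \<mu> =
     (if i < n
      then Poly_Mapping.update i (Poly_Mapping.lookup \<mu> (i + 1))
             (Poly_Mapping.update (i + 1) (Poly_Mapping.lookup \<mu> i) \<mu>)
      else Poly_Mapping.update n (- Poly_Mapping.lookup \<mu> n) \<mu>)"

definition dom_le :: "nat \<Rightarrow> comp \<Rightarrow> comp \<Rightarrow> bool" where
  "dom_le n \<mu> \<nu> \<longleftrightarrow> (\<forall>k\<in>{1..n}.
     (\<Sum>i=1..k. Poly_Mapping.lookup \<mu> i) \<le> (\<Sum>i=1..k. Poly_Mapping.lookup \<nu> i))"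

definition dom_less :: "nat \<Rightarrow> comp \<Rightarrow> comp \<Rightarrow> bool" where
  "dom_less n \<mu> \<nu> \<longleftrightarrow> dom_le n \<mu> \<nu> \<and> \<mu> \<noteq> \<nu>"

definition plus_part :: "nat \<Rightarrow> comp \<Rightarrow> comp" where
  "plus_part n \<mu> =
     (let xs = rev (sort (map (\<lambda>j. \<bar>Poly_Mapping.lookup \<mu> j\<bar>) [1..<Suc n]))
      in \<Sum>j\<in>{1..n}. Poly_Mapping.single j (xs ! (j - 1)))"

definition prec :: "nat \<Rightarrow> comp \<Rightarrow> comp \<Rightarrow> bool" where
  "prec n \<mu> \<nu> \<longleftrightarrow> \<mu> \<noteq> \<nu> \<and>
     (dom_less n (plus_part n \<mu>) (plus_part n \<nu>) \<or>
      (plus_part n \<mu> = plus_part n \<nu> \<and> dom_le n \<mu> \<nu>))"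


section \<open>Laurent polynomials\<close>

type_synonym 'k laurent = "comp \<Rightarrow>\<^sub>0 'k"

definition laurent_polys :: "nat \<Rightarrow> ('k::zero) laurent set" where
  "laurent_polys n = {f. Poly_Mapping.keys f \<subseteq> compositions n}"

definition zmon :: "comp \<Rightarrow> ('k::zero_neq_one) laurent" where
  "zmon \<mu> = Poly_Mapping.single \<mu> 1"

definition zvar :: "nat \<Rightarrow> int \<Rightarrow> ('k::zero_neq_one) laurent" where
  "zvar i k = zmon (Poly_Mapping.single i k)"

definition const :: "'k::zero \<Rightarrow> 'k laurent" where
  "const x = Poly_Mapping.single 0 x"

text \<open>The substitution \<open>f\<^bsup>s\<^sub>i\<^esup>\<close> acts on monomials by acting with \<open>s\<^sub>i\<close> on the exponent.\<close>

definition refl_poly :: "nat \<Rightarrow> nat \<Rightarrow> ('k::comm_monoid_add) laurent \<Rightarrow> 'k laurent" where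
  "refl_poly n i f =
     (\<Sum>\<mu>\<in>Poly_Mapping.keys f. Poly_Mapping.single (refl_comp n i \<mu>) (Poly_Mapping.lookup f \<mu>))"

definition bar :: "('k::comm_monoid_add) laurent \<Rightarrow> 'k laurent" where
  "bar f = (\<Sum>\<mu>\<in>Poly_Mapping.keys f. Poly_Mapping.single (- \<mu>) (Poly_Mapping.lookup f \<mu>))"

definition leval :: "complex laurent \<Rightarrow> (nat \<Rightarrow> complex) \<Rightarrow> complex" where
  "leval f z = (\<Sum>\<mu>\<in>Poly_Mapping.keys f. Poly_Mapping.lookup f \<mu> *
     (\<Prod>j\<in>Poly_Mapping.keys \<mu>. z j powi Poly_Mapping.lookup \<mu> j))"


section \<open>Nonsymmetric Koornwinder polynomials\<close>

definition qpoch :: "complex \<Rightarrow> complex \<Rightarrow> complex" where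
  "qpoch q x = prodinf (\<lambda>k. 1 - x * q ^ k)"

definition koornwinder_weight ::
  "nat \<Rightarrow> complex \<Rightarrow> complex \<Rightarrow> complex \<Rightarrow> complex \<Rightarrow> complex \<Rightarrow> complex \<Rightarrow> (nat \<Rightarrow> complex) \<Rightarrow> complex"
where
  "koornwinder_weight n q t a b c d z =
     (\<Prod>i\<in>{1..n}.
        (qpoch q (z i ^ 2) * qpoch q (q / z i ^ 2)) /
        (qpoch q (a * z i) * qpoch q (b * z i) * qpoch q (c * z i) * qpoch q (d * z i) *
         qpoch q (a * q / z i) * qpoch q (b * q / z i) * qpoch q (c / z i) * qpoch q (d / z i))) *
     (\<Prod>i\<in>{1..n}. \<Prod>j\<in>{i<..n}.
        (qpoch q (z i * z j) * qpoch q (z i / z j) *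
         qpoch q (q * z j / z i) * qpoch q (q / (z i * z j))) /
        (qpoch q (t * z i * z j) * qpoch q (t * z i / z j) *
         qpoch q (q * t * z j / z i) * qpoch q (q * t / (z i * z j))))"

text \<open>Integration over the torus against \<open>\<Prod>\<^sub>j dz\<^sub>j / (2\<pi>\<i> z\<^sub>j)\<close>, using \<open>z\<^sub>j = exp (2\<pi>\<i> \<theta>\<^sub>j)\<close>.\<close>

definition torus_integral :: "nat \<Rightarrow> ((nat \<Rightarrow> complex) \<Rightarrow> complex) \<Rightarrow> complex" where
  "torus_integral n h =
     (\<integral>\<theta>. h (\<lambda>j. cis (2 * pi * \<theta> j)) \<partial>(\<Pi>\<^sub>M j\<in>{1..n}. restrict_space lborel {0..1::real}))"

text \<open>Laurent polynomials whose coefficients are functions of \<open>q, t, a, b, c, d\<close>, and the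
  involution \<open>\<iota>\<close> on them.\<close>

type_synonym par_laurent =
  "complex \<Rightarrow> complex \<Rightarrow> complex \<Rightarrow> complex \<Rightarrow> complex \<Rightarrow> complex \<Rightarrow> complex laurent"

definition iota :: "par_laurent \<Rightarrow> par_laurent" where
  "iota g = (\<lambda>q t a b c d. g (inverse q) (inverse t) (inverse a) (inverse b) (inverse c) (inverse d))"

definition koornwinder_inner ::
  "nat \<Rightarrow> complex \<Rightarrow> complex \<Rightarrow> complex \<Rightarrow> complex \<Rightarrow> complex \<Rightarrow> complex \<Rightarrow>
   par_laurent \<Rightarrow> par_laurent \<Rightarrow> complex"
where
  "koornwinder_inner n q t a b c d f g =
     torus_integral n (\<lambda>z. leval (f q t a b c d) z * leval (bar (iota g q t a b c d)) z *
       koornwinder_weight n q t a b c d z)"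

text \<open>The inner product uses its first argument only at the given parameter values, so the
  conditions defining \<open>U\<^sub>\<mu>\<close> can be imposed at each parameter point separately; \<open>u\<close> is the value
  of \<open>U\<^sub>\<mu>\<close> there.\<close>

definition is_koornwinder ::
  "nat \<Rightarrow> complex \<Rightarrow> complex \<Rightarrow> complex \<Rightarrow> complex \<Rightarrow> complex \<Rightarrow> complex \<Rightarrow>
   comp \<Rightarrow> complex laurent \<Rightarrow> bool"
where
  "is_koornwinder n q t a b c d \<mu> u \<longleftrightarrow>
     Poly_Mapping.keys (u - zmon \<mu>) \<subseteq> {\<nu> \<in> compositions n. prec n \<nu> \<mu>} \<and>
     (\<forall>\<nu>\<in>compositions n. prec n \<nu> \<mu> \<longrightarrow>
        koornwinder_inner n q t a b c d (\<lambda>_ _ _ _ _ _. u) (\<lambda>_ _ _ _ _ _. zmon \<nu>) = 0)"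

definition koornwinder ::
  "nat \<Rightarrow> complex \<Rightarrow> complex \<Rightarrow> complex \<Rightarrow> complex \<Rightarrow> complex \<Rightarrow> complex \<Rightarrow>
   comp \<Rightarrow> complex laurent"
where
  "koornwinder n q t a b c d \<mu> = (THE u. is_koornwinder n q t a b c d \<mu> u)"


section \<open>Hecke operators and the recursion\<close>

definition exact_quot :: "'r::idom \<Rightarrow> 'r \<Rightarrow> 'r" where
  "exact_quot x y = (THE w. w * y = x)"

lemma exact_quot_mult: "y \<noteq> 0 \<Longrightarrow> exact_quot (x * y) y = x"
  by (auto simp: exact_quot_def)

text \<open>The difference \<open>f\<^bsup>s\<^sub>i\<^esup> - f\<close> is divisible by the denominator, so the quotients are exact
  divisions in the ring of Laurent polynomials.\<close>

definition hecke ::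
  "nat \<Rightarrow> 'k::field \<Rightarrow> 'k \<Rightarrow> 'k \<Rightarrow> nat \<Rightarrow> 'k laurent \<Rightarrow> 'k laurent"
where
  "hecke n t a b i f =
     (if i < n
      then const t * f +
        exact_quot ((zvar (i + 1) 1 - const t * zvar i 1) * (refl_poly n i f - f))
                   (zvar (i + 1) 1 - zvar i 1)
      else - const (a * b) * f +
        exact_quot ((1 - const a * zvar n 1) * (1 - const b * zvar n 1) * (refl_poly n n f - f))
                   (1 - zvar n 1 ^ 2))"

definition n_exp :: "nat \<Rightarrow> nat \<Rightarrow> comp \<Rightarrow> int" where
  "n_exp n i \<mu> =
     - int (card {l \<in> {1..<i}. Poly_Mapping.lookup \<mu> l = -1 \<or> Poly_Mapping.lookup \<mu> l = 0})
     - 2 * int (card {l \<in> {i+1<..n}. Poly_Mapping.lookup \<mu> l = 0}) - 1"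

definition r_exp :: "nat \<Rightarrow> comp \<Rightarrow> int" where
  "r_exp n \<mu> =
     (if Poly_Mapping.lookup \<mu> n = 1
      then int (mult n (-1) \<mu>) + int (mult n 0 \<mu>)
      else int (mult n (-1) \<mu>) + int (mult n 0 \<mu>) - 1)"

text \<open>In \<open>p\<^sub>n\<close> and \<open>q\<^sub>n\<close> the exponent of \<open>t\<close> is \<open>r\<^sub>\<lambda>\<close>. The exponent \<open>2 r\<^sub>\<lambda>\<close> that is sometimes
  printed is a misprint: for \<open>n = 2\<close> one has
  \<open>E\<^bsub>(0,1)\<^esub> = z\<^sub>2 - t (c + d) + t c d z\<^sub>2\<^sup>-\<^sup>1 - (1 - t) c d z\<^sub>1\<^sup>-\<^sup>1\<close>, and the coefficient of \<open>z\<^sub>2\<close> in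
  \<open>T\<^sub>2 E\<^bsub>(0,1)\<^esub>\<close> is \<open>- a b c d t\<close>, whereas \<open>z\<^sub>2\<close> does not occur in
  \<open>E\<^bsub>(0,-1)\<^esub>\<close> because \<open>(0,1)\<close> does not precede \<open>(0,-1)\<close>; here \<open>r\<^sub>\<lambda> = 1\<close>.\<close>

definition pn_coeff :: "nat \<Rightarrow> 'k::field \<Rightarrow> 'k \<Rightarrow> 'k \<Rightarrow> 'k \<Rightarrow> 'k \<Rightarrow> comp \<Rightarrow> 'k" where
  "pn_coeff n t a b c d \<mu> =
     (let x = Poly_Mapping.lookup \<mu> n; r = r_exp n \<mu> in
      if x < -1 then - a * b - 1
      else if x = -1 then - a * b - 1 + a * b * c * d * t powi r
      else if x > 1 then 0
      else if x = 1 then - a * b * c * d * t powi r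
      else - a * b)"

definition qn_coeff :: "nat \<Rightarrow> 'k::field \<Rightarrow> 'k \<Rightarrow> 'k \<Rightarrow> 'k \<Rightarrow> 'k \<Rightarrow> comp \<Rightarrow> 'k" where
  "qn_coeff n t a b c d \<mu> =
     (let x = Poly_Mapping.lookup \<mu> n; r = r_exp n \<mu> in
      if x < 0 then - a * b
      else if x = 0 then 0
      else if x > 1 then 1
      else 1 + c * d * t powi r * (- a * b - 1 + a * b * c * d * t powi r))"

definition p_coeff :: "nat \<Rightarrow> 'k::field \<Rightarrow> 'k \<Rightarrow> 'k \<Rightarrow> 'k \<Rightarrow> 'k \<Rightarrow> nat \<Rightarrow> comp \<Rightarrow> 'k" where
  "p_coeff n t a b c d i \<mu> =
     (if i < n then
        (let x = Poly_Mapping.lookup \<mu> i; y = Poly_Mapping.lookup \<mu> (i + 1);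
             s = a * b * c * d; w = t powi n_exp n i \<mu> in
         if (x, y) = (-1, 0) then (1 - t) * w / (s - w)
         else if (x, y) = (0, -1) then (t - 1) * s / (s - w)
         else if x < y then t - 1
         else if x > y then 0
         else t)
      else pn_coeff n t a b c d \<mu>)"

definition q_coeff :: "nat \<Rightarrow> 'k::field \<Rightarrow> 'k \<Rightarrow> 'k \<Rightarrow> 'k \<Rightarrow> 'k \<Rightarrow> nat \<Rightarrow> comp \<Rightarrow> 'k" where
  "q_coeff n t a b c d i \<mu> =
     (if i < n then
        (let x = Poly_Mapping.lookup \<mu> i; y = Poly_Mapping.lookup \<mu> (i + 1);
             s = a * b * c * d; m = n_exp n i \<mu> in
         if x < y then t
         else if x = y then 0
         else if (x, y) = (0, -1) then 1 - (1 - t)^2 * s * t powi (m - 1) / (s - t powi m)^2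
         else 1)
      else qn_coeff n t a b c d \<mu>)"

definition E_partition :: "nat \<Rightarrow> 'k::field \<Rightarrow> 'k \<Rightarrow> comp \<Rightarrow> 'k laurent" where
  "E_partition n c d \<mu> =
     (\<Prod>i\<in>{i \<in> {1..n}. Poly_Mapping.lookup \<mu> i > 0}.
        zvar i (Poly_Mapping.lookup \<mu> i) * (1 - const c * zvar i (-1)) * (1 - const d * zvar i (-1)))"

text \<open>Families indexed by compositions are extensional functions, so that uniqueness is not
  affected by values at irrelevant indices.\<close>

definition is_E_family ::
  "nat \<Rightarrow> 'k::field \<Rightarrow> 'k \<Rightarrow> 'k \<Rightarrow> 'k \<Rightarrow> 'k \<Rightarrow> (comp \<Rightarrow> 'k laurent) \<Rightarrow> bool"
where
  "is_E_family n t a b c d E \<longleftrightarrow>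
     E \<in> compositions n \<rightarrow>\<^sub>E laurent_polys n \<and>
     (\<forall>\<mu>. is_partition n \<mu> \<longrightarrow> E \<mu> = E_partition n c d \<mu>) \<and>
     (\<forall>\<mu>\<in>compositions n. \<forall>i\<in>{1..n}.
        hecke n t a b i (E \<mu>) =
          const (p_coeff n t a b c d i \<mu>) * E \<mu> +
          const (q_coeff n t a b c d i \<mu>) * E (refl_comp n i \<mu>))"


section \<open>Rational functions of the parameters\<close>

text \<open>The ring \<open>\<complex>[t][a][b][c][d]\<close> (\<open>t\<close> the innermost variable) and its field of fractions.\<close>

type_synonym par_poly = "complex poly poly poly poly poly"
type_synonym ratfun = "par_poly fract"

definition par_eval ::
  "par_poly \<Rightarrow> complex \<Rightarrow> complex \<Rightarrow> complex \<Rightarrow> complex \<Rightarrow> complex \<Rightarrow> complex"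
where
  "par_eval P t a b c d =
     poly (poly (poly (poly (poly P [:[:[:[:d:]:]:]:]) [:[:[:c:]:]:]) [:[:b:]:]) [:a:]) t"

definition tX :: ratfun where "tX = Fract [:[:[:[:[:0, 1:]:]:]:]:] 1"
definition aX :: ratfun where "aX = Fract [:[:[:[:0, 1:]:]:]:] 1"
definition bX :: ratfun where "bX = Fract [:[:[:0, 1:]:]:] 1"
definition cX :: ratfun where "cX = Fract [:[:0, 1:]:] 1"
definition dX :: ratfun where "dX = Fract [:0, 1:] 1"

lemma par_eval_variables:
  "par_eval [:[:[:[:[:0, 1:]:]:]:]:] t a b c d = t"
  "par_eval [:[:[:[:0, 1:]:]:]:] t a b c d = a"
  "par_eval [:[:[:0, 1:]:]:] t a b c d = b"
  "par_eval [:[:0, 1:]:] t a b c d = c"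
  "par_eval [:0, 1:] t a b c d = d"
  by (simp_all add: par_eval_def)

text \<open>The rational function \<open>r\<close> is regular at the given point, with value \<open>v\<close>.\<close>

definition ratfun_has_value ::
  "ratfun \<Rightarrow> complex \<Rightarrow> complex \<Rightarrow> complex \<Rightarrow> complex \<Rightarrow> complex \<Rightarrow> complex \<Rightarrow> bool"
where
  "ratfun_has_value r t a b c d v \<longleftrightarrow>
     (\<exists>N D. r = Fract N D \<and> par_eval D t a b c d \<noteq> 0 \<and>
            v = par_eval N t a b c d / par_eval D t a b c d)"

definition E_poly :: "nat \<Rightarrow> comp \<Rightarrow> ratfun laurent" where
  "E_poly n = (THE E. is_E_family n tX aX bX cX dX E)"

text \<open>Genericity of \<open>t, a, b, c, d\<close> is meant in the Zariski sense: off the zero set of some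
  nonzero polynomial, within the polydisc in which the inner product is given by the integral.\<close>

definition generic_in_polydisc ::
  "(complex \<Rightarrow> complex \<Rightarrow> complex \<Rightarrow> complex \<Rightarrow> complex \<Rightarrow> bool) \<Rightarrow> bool"
where
  "generic_in_polydisc Q \<longleftrightarrow>
     (\<exists>P::par_poly. P \<noteq> 0 \<and>
        (\<forall>t a b c d. norm t < 1 \<and> norm a < 1 \<and> norm b < 1 \<and> norm c < 1 \<and> norm d < 1 \<and>
           par_eval P t a b c d \<noteq> 0 \<longrightarrow> Q t a b c d))"

end

theory Submission
 imports Defs "HOL-Probability.Infinite_Product_Measure" "Jordan_Normal_Form.Determinant"
begin

text \<open>
 The moments of the weight depend continuously on \<open>q\<close> at \<open>0\<close>, and \<open>U\<^sub>\<mu>\<close> solves a linear system whose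
 coefficients are moments. So \<open>U\<^sub>\<mu>\<close> tends to the Laurent polynomial \<open>z\<^sup>\<mu> + \<dots>\<close> that has only smaller monomials besides \<open>z\<^sup>\<mu>\<close> and is
 orthogonal at \<open>q = 0\<close> to all of them, provided the Gram matrix of the smaller monomials is
 nonsingular at \<open>q = 0\<close> (\<open>koornwinder_limit\<close>). Two things remain: this Gram matrix is generically
 nonsingular, and the recursion produces that polynomial.

 The moments at \<open>q = 0\<close> are rational functions of the parameters, as one sees by integrating out
 one variable after the other (\<open>stage_rational\<close>). For \<open>c = d = 0\<close> the weight
 is integrated by setting \<open>z\<^sub>1, z\<^sub>2, \<dots>\<close> to zero in turn (\<open>moment_one_sided\<close>), so that the Gram matrix in
 lexicographic order is triangular with ones on the diagonal (\<open>gram_det_one_sided\<close>). Hence its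
 determinant is a nonzero rational function (\<open>gram_det_generic\<close>).

 The recursion first gives a candidate: follow one fixed chain of reflections from the partition to
 \<open>\<mu>\<close> (\<open>hecke_fam\<close>). Orthogonality holds for partitions, because the factors of \<open>E\<^sub>\<mu>\<close> cancel the poles of
 the weight at \<open>c\<close> and \<open>d\<close> (\<open>pairing_E_partition\<close>). It is carried along the chain, because \<open>T\<^sub>i\<close> can be
 moved to the other argument of the pairing (\<open>pairing_hecke\<close>): it maps \<open>z\<^sup>\<nu>\<close> to a combination of \<open>z\<^sup>\<nu>\<close>,
 \<open>z\<^bsup>s\<^sub>i \<nu>\<^esup>\<close> and monomials of strictly smaller orbits, and for \<open>z\<^sup>\<nu>\<close> and \<open>z\<^bsup>s\<^sub>i \<nu>\<^esup>\<close> a lifting property of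
 an order of Bruhat type replaces the dominance order (\<open>pairing_orbit\<close>).

 That the candidate has leading term \<open>z\<^sup>\<mu>\<close> is a statement about its coefficients on the orbit of
 \<open>\<mu>\<close> under the hyperoctahedral group, where \<open>T\<^sub>i\<close> acts through a finite-dimensional representation of
 the Hecke algebra. There the recursion is consistent for all reflections, by the quadratic and braid
 relations (\<open>consistent_all\<close>), its member at the antidominant weight is a single monomial
 (\<open>antidominant_fam\<close>), and one climbs from there (\<open>orbit_fam_triangular\<close>).

 Finally \<open>T\<^sub>i E\<^sub>\<mu> - p\<^sub>i(\<mu>) E\<^sub>\<mu> - q\<^sub>i(\<mu>) E\<^bsub>s\<^sub>i \<mu>\<^esub>\<close> has no monomial of the orbit and is orthogonal to all monomials
 of smaller orbits, so it vanishes wherever their Gram matrix is nonsingular. This is the whole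
 recursion at generic points, hence over the field of rational functions
 (\<open>hecke_fam_relation_ratfun\<close>). Uniqueness is clear as \<open>q\<^sub>i(\<mu>) \<noteq> 0\<close> whenever \<open>s\<^sub>i \<mu>\<close> is farther from the
 partition than \<open>\<mu>\<close>.
\<close>

abbreviation lk :: "('a \<Rightarrow>\<^sub>0 'b::zero) \<Rightarrow> 'a \<Rightarrow> 'b" where "lk \<equiv> Poly_Mapping.lookup"
abbreviation supp :: "('a \<Rightarrow>\<^sub>0 'b::zero) \<Rightarrow> 'a set" where "supp \<equiv> Poly_Mapping.keys"

section \<open>Submajorization of compositions\<close>

text \<open>Dominance of the sorted absolute values is equivalent to the inequality of these sums at all
 thresholds \<open>c \<ge> 0\<close>, which needs no sorting.\<close>

definition excess :: "nat \<Rightarrow> int \<Rightarrow> comp \<Rightarrow> int" where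
 "excess n c \<mu> = (\<Sum>j\<in>{1..n}. max (\<bar>lk \<mu> j\<bar> - c) 0)"

definition submaj :: "nat \<Rightarrow> comp \<Rightarrow> comp \<Rightarrow> bool" where
 "submaj n \<xi> \<mu> \<longleftrightarrow> (\<forall>c\<ge>0. excess n c \<xi> \<le> excess n c \<mu>)"

definition same_orbit :: "nat \<Rightarrow> comp \<Rightarrow> comp \<Rightarrow> bool" where
 "same_orbit n \<xi> \<mu> \<longleftrightarrow> (\<forall>c\<ge>0. excess n c \<xi> = excess n c \<mu>)"

definition strict_submaj :: "nat \<Rightarrow> comp \<Rightarrow> comp \<Rightarrow> bool" where
 "strict_submaj n \<xi> \<mu> \<longleftrightarrow> submaj n \<xi> \<mu> \<and> \<not> same_orbit n \<xi> \<mu>"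

lemma same_orbit_iff: "same_orbit n \<xi> \<mu> \<longleftrightarrow> submaj n \<xi> \<mu> \<and> submaj n \<mu> \<xi>"
 unfolding same_orbit_def submaj_def by (auto simp: order_eq_iff)

lemma submaj_refl [simp]: "submaj n \<mu> \<mu>" by (simp add: submaj_def)
lemma same_orbit_refl [simp]: "same_orbit n \<mu> \<mu>" by (simp add: same_orbit_def)
lemma same_orbit_sym: "same_orbit n \<xi> \<mu> \<Longrightarrow> same_orbit n \<mu> \<xi>" by (simp add: same_orbit_def)
lemma same_orbit_trans: "same_orbit n \<xi> \<mu> \<Longrightarrow> same_orbit n \<mu> \<nu> \<Longrightarrow> same_orbit n \<xi> \<nu>"
 by (simp add: same_orbit_def)
lemma submaj_trans: "submaj n \<xi> \<mu> \<Longrightarrow> submaj n \<mu> \<nu> \<Longrightarrow> submaj n \<xi> \<nu>"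
 unfolding submaj_def by (meson order_trans)
lemma same_orbit_submaj: "same_orbit n \<xi> \<mu> \<Longrightarrow> submaj n \<xi> \<mu>" by (simp add: same_orbit_iff)
lemma strict_submaj_trans1: "submaj n \<xi> \<mu> \<Longrightarrow> strict_submaj n \<mu> \<nu> \<Longrightarrow> strict_submaj n \<xi> \<nu>"
 unfolding strict_submaj_def same_orbit_iff by (meson submaj_trans)
lemma strict_submaj_trans2: "strict_submaj n \<xi> \<mu> \<Longrightarrow> submaj n \<mu> \<nu> \<Longrightarrow> strict_submaj n \<xi> \<nu>"
 unfolding strict_submaj_def same_orbit_iff by (meson submaj_trans)

lemma plus_part_lookup:
 "lk (plus_part n \<mu>) i =
  (if i \<in> {1..n} then rev (sort (map (\<lambda>j. \<bar>lk \<mu> j\<bar>) [1..<Suc n])) ! (i - 1) else 0)"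
 by (simp add: plus_part_def Let_def lookup_sum lookup_single when_def sum.delta)

lemma plus_part_decreasing:
 assumes "1 \<le> i" "i \<le> j" "j \<le> n"
 shows "lk (plus_part n \<mu>) j \<le> lk (plus_part n \<mu>) i"
proof -
 let ?xs = "sort (map (\<lambda>j. \<bar>lk \<mu> j\<bar>) [1..<Suc n])"
 have "sorted ?xs" by simp
 have l: "length ?xs = n" by simp
 have "?xs ! (n - j) \<le> ?xs ! (n - i)"
  by (rule sorted_nth_mono) (use assms l in auto)
 moreover have "rev ?xs ! (i - 1) = ?xs ! (n - i)" "rev ?xs ! (j - 1) = ?xs ! (n - j)"
  using assms l by (simp_all only: rev_nth) (auto simp: rev_nth)
 ultimately show ?thesis using assms by (simp only: plus_part_lookup) auto
qed

lemma sum_plus_part: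
 "(\<Sum>j\<in>{1..n}. g (lk (plus_part n \<mu>) j)) = (\<Sum>j\<in>{1..n}. (g \<bar>lk \<mu> j\<bar> :: int))"
proof -
 let ?ys = "map (\<lambda>j. \<bar>lk \<mu> j\<bar>) [1..<Suc n]"
 let ?xs = "rev (sort ?ys)"
 have "(\<Sum>j\<in>{1..n}. g (lk (plus_part n \<mu>) j)) = (\<Sum>j\<in>{1..n}. g (?xs ! (j - 1)))"
  by (rule sum.cong) (auto simp: plus_part_lookup simp del: upt_Suc)
 also have "\<dots> = (\<Sum>j\<in>{0..<n}. g (?xs ! j))"
  by (rule sum.reindex_bij_witness[of _ Suc "\<lambda>j. j - 1"]) auto
 also have "\<dots> = sum_list (map g ?xs)"
  by (simp add: sum_list_sum_nth del: upt_Suc)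
 also have "\<dots> = sum_mset (image_mset g (mset ?xs))"
  by (simp only: mset_map[symmetric] sum_mset_sum_list)
 also have "mset ?xs = mset ?ys" by simp
 also have "sum_mset (image_mset g (mset ?ys)) = sum_list (map g ?ys)"
  by (simp only: mset_map[symmetric] sum_mset_sum_list)
 also have "\<dots> = (\<Sum>j\<in>{1..n}. g \<bar>lk \<mu> j\<bar>)"
  by (simp add: o_def interv_sum_list_conv_sum_set_nat atLeastLessThanSuc_atLeastAtMost
    del: upt_Suc)
 finally show ?thesis .
qed

lemma plus_part_nonneg: "0 \<le> lk (plus_part n \<mu>) i"
proof (cases "i \<in> {1..n}")
 case True
 let ?xs = "rev (sort (map (\<lambda>j. \<bar>lk \<mu> j\<bar>) [1..<Suc n]))"
 have "?xs ! (i - 1) \<in> set ?xs" by (rule nth_mem) (use True in auto)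
 then show ?thesis using True by (auto simp: plus_part_lookup simp del: upt_Suc)
next
 case False
 then show ?thesis by (simp only: plus_part_lookup if_False)
qed

lemma plus_part_composition: "plus_part n \<mu> \<in> compositions n"
 by (auto simp: compositions_def in_keys_iff plus_part_lookup split: if_splits)

lemma excess_plus_part: "excess n c (plus_part n \<mu>) = excess n c \<mu>"
proof -
 have "excess n c (plus_part n \<mu>) = (\<Sum>j\<in>{1..n}. max (lk (plus_part n \<mu>) j - c) 0)"
  using plus_part_nonneg[of n \<mu>] by (simp add: excess_def)
 also have "\<dots> = excess n c \<mu>"
  by (simp only: sum_plus_part[of "\<lambda>x. max (x - c) 0"] excess_def)
 finally show ?thesis .
qed

text \<open>The two inequalities behind the equivalence of the two descriptions of dominance:
 a partial sum never exceeds the bound given by a threshold, and a non-increasing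
 sequence attains it at its own entries.\<close>

lemma partial_sum_le_excess:
 assumes "k \<le> n"
 shows "(\<Sum>j=1..k. lk \<mu> j) \<le> int k * c + excess n c \<mu>"
proof -
 have "(\<Sum>j=1..k. lk \<mu> j) \<le> (\<Sum>j=1..k. c + max (\<bar>lk \<mu> j\<bar> - c) 0)"
  by (rule sum_mono) linarith
 also have "\<dots> = int k * c + (\<Sum>j=1..k. max (\<bar>lk \<mu> j\<bar> - c) 0)"
  by (simp add: sum.distrib)
 also have "(\<Sum>j=1..k. max (\<bar>lk \<mu> j\<bar> - c) 0) \<le> excess n c \<mu>"
  unfolding excess_def by (rule sum_mono2) (use assms in auto)
 finally show ?thesis by simp
qed

lemma partial_sum_eq_excess:
 assumes dec: "\<And>i j. 1 \<le> i \<Longrightarrow> i \<le> j \<Longrightarrow> j \<le> n \<Longrightarrow> lk \<mu> j \<le> lk \<mu> i"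
  and nn: "\<And>i. 0 \<le> lk \<mu> i" and k: "1 \<le> k" "k \<le> n"
 shows "(\<Sum>j=1..k. lk \<mu> j) = int k * lk \<mu> k + excess n (lk \<mu> k) \<mu>"
proof -
 have "excess n (lk \<mu> k) \<mu> = (\<Sum>j=1..k. max (\<bar>lk \<mu> j\<bar> - lk \<mu> k) 0)"
  unfolding excess_def
 proof (rule sum.mono_neutral_right)
  show "\<forall>i\<in>{1..n} - {1..k}. max (\<bar>lk \<mu> i\<bar> - lk \<mu> k) 0 = 0"
   using dec[of k] k nn by force
 qed (use k in auto)
 also have "\<dots> = (\<Sum>j=1..k. lk \<mu> j - lk \<mu> k)"
 proof (rule sum.cong)
  fix x assume "x \<in> {1..k}"
  then show "max (\<bar>lk \<mu> x\<bar> - lk \<mu> k) 0 = lk \<mu> x - lk \<mu> k"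
   using dec[of x k] k nn[of x] by auto
 qed simp
 finally show ?thesis by (simp add: sum_subtractf)
qed

lemma excess_eq_partial_sum:
 assumes dec: "\<And>i j. 1 \<le> i \<Longrightarrow> i \<le> j \<Longrightarrow> j \<le> n \<Longrightarrow> lk \<mu> j \<le> lk \<mu> i"
  and nn: "\<And>i. 0 \<le> lk \<mu> i"
 shows "\<exists>k\<le>n. excess n c \<mu> = (\<Sum>j=1..k. lk \<mu> j) - int k * c"
proof -
 define A where "A = {j \<in> {1..n}. c < lk \<mu> j}"
 obtain k where k: "k \<le> n" "A = {1..k}"
 proof (cases "A = {}")
  case True then show ?thesis using that[of 0] by simp
 next
  case False
  have "finite A" by (simp add: A_def)
  then have M: "Max A \<in> A" using False by simp
  have "A = {1..Max A}"
  proof safe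
   fix j assume "j \<in> A" then show "j \<in> {1..Max A}" using \<open>finite A\<close> by (auto simp: A_def)
  next
   fix j assume "j \<in> {1..Max A}"
   then show "j \<in> A" using M dec[of j "Max A"] by (auto simp: A_def)
  qed
  with M show ?thesis using that[of "Max A"] by (auto simp: A_def)
 qed
 have "excess n c \<mu> = (\<Sum>j\<in>A. max (\<bar>lk \<mu> j\<bar> - c) 0)"
  unfolding excess_def
  by (rule sum.mono_neutral_right) (use nn in \<open>auto simp: A_def max_def\<close>)
 also have "\<dots> = (\<Sum>j\<in>A. lk \<mu> j - c)"
  by (rule sum.cong) (use nn in \<open>auto simp: A_def max_def\<close>)
 finally show ?thesis using k by (auto simp: sum_subtractf)
qed

lemma dom_le_plus_part_iff:
 "dom_le n (plus_part n \<xi>) (plus_part n \<mu>) \<longleftrightarrow> submaj n \<xi> \<mu>"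
proof
 assume d: "dom_le n (plus_part n \<xi>) (plus_part n \<mu>)"
 show "submaj n \<xi> \<mu>" unfolding submaj_def
 proof (intro allI impI)
  fix c :: int assume "0 \<le> c"
  obtain k where k: "k \<le> n"
   "excess n c (plus_part n \<xi>) = (\<Sum>j=1..k. lk (plus_part n \<xi>) j) - int k * c"
   using excess_eq_partial_sum[of n "plus_part n \<xi>" c] plus_part_decreasing plus_part_nonneg
   by blast
  have "(\<Sum>j=1..k. lk (plus_part n \<xi>) j) \<le> (\<Sum>j=1..k. lk (plus_part n \<mu>) j)"
   using d k(1) by (cases "k = 0") (auto simp: dom_le_def)
  with partial_sum_le_excess[OF k(1), of "plus_part n \<mu>" c] k(2)
  show "excess n c \<xi> \<le> excess n c \<mu>" by (simp add: excess_plus_part)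
 qed
next
 assume s: "submaj n \<xi> \<mu>"
 show "dom_le n (plus_part n \<xi>) (plus_part n \<mu>)" unfolding dom_le_def
 proof
  fix k assume k: "k \<in> {1..n}"
  let ?c = "lk (plus_part n \<mu>) k"
  have "(\<Sum>j=1..k. lk (plus_part n \<mu>) j) = int k * ?c + excess n ?c \<mu>"
   using partial_sum_eq_excess[of n "plus_part n \<mu>" k] plus_part_decreasing plus_part_nonneg k
   by (simp add: excess_plus_part)
  moreover have "(\<Sum>j=1..k. lk (plus_part n \<xi>) j) \<le> int k * ?c + excess n ?c \<xi>"
   using partial_sum_le_excess[of k n "plus_part n \<xi>" ?c] k by (simp add: excess_plus_part)
  moreover have "excess n ?c \<xi> \<le> excess n ?c \<mu>"
   using s plus_part_nonneg by (simp add: submaj_def)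
  ultimately show "(\<Sum>j=1..k. lk (plus_part n \<xi>) j) \<le> (\<Sum>j=1..k. lk (plus_part n \<mu>) j)"
   by linarith
 qed
qed

lemma dom_le_antisym:
 assumes "dom_le n \<mu> \<nu>" "dom_le n \<nu> \<mu>" "\<mu> \<in> compositions n" "\<nu> \<in> compositions n"
 shows "\<mu> = \<nu>"
proof (rule poly_mapping_eqI)
 fix k
 have eq: "(\<Sum>j=1..k. lk \<mu> j) = (\<Sum>j=1..k. lk \<nu> j)" if "k \<le> n" for k
  using that assms(1,2) by (cases "k = 0") (auto simp: dom_le_def intro!: order_antisym)
 show "lk \<mu> k = lk \<nu> k"
 proof (cases "k \<in> {1..n}")
  case True
  then obtain m where m: "k = Suc m" by (cases k) auto
  then show ?thesis using eq[of k] eq[of m] True by simp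
 next
  case False
  then have "k \<notin> supp \<mu>" "k \<notin> supp \<nu>"
   using assms(3,4) unfolding compositions_def by blast+
  then show ?thesis by (simp add: in_keys_iff)
 qed
qed

lemma plus_part_eq_iff: "plus_part n \<xi> = plus_part n \<mu> \<longleftrightarrow> same_orbit n \<xi> \<mu>"
proof
 assume "plus_part n \<xi> = plus_part n \<mu>"
 then show "same_orbit n \<xi> \<mu>" unfolding same_orbit_def by (metis excess_plus_part)
next
 assume "same_orbit n \<xi> \<mu>"
 then show "plus_part n \<xi> = plus_part n \<mu>"
  by (intro dom_le_antisym[of n]) (auto simp: dom_le_plus_part_iff same_orbit_iff plus_part_composition)
qed

lemma prec_iff:
 "prec n \<nu> \<mu> \<longleftrightarrow> \<nu> \<noteq> \<mu> \<and> (strict_submaj n \<nu> \<mu> \<or> same_orbit n \<nu> \<mu> \<and> dom_le n \<nu> \<mu>)"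
 by (auto simp: prec_def dom_less_def dom_le_plus_part_iff plus_part_eq_iff strict_submaj_def)

lemma lookup_outside: "\<mu> \<in> compositions n \<Longrightarrow> j \<notin> {1..n} \<Longrightarrow> lk \<mu> j = 0"
 unfolding compositions_def by (metis (mono_tags) in_keys_iff mem_Collect_eq subsetD)

lemma compositionsI: "(\<And>j. j \<notin> {1..n} \<Longrightarrow> lk \<mu> j = 0) \<Longrightarrow> \<mu> \<in> compositions n"
 unfolding compositions_def by (metis (mono_tags) in_keys_iff mem_Collect_eq subsetI)

lemma compositions_add: "\<mu> \<in> compositions n \<Longrightarrow> \<nu> \<in> compositions n \<Longrightarrow> \<mu> + \<nu> \<in> compositions n"
 by (rule compositionsI) (simp add: lookup_add lookup_outside)

lemma compositions_uminus: "\<mu> \<in> compositions n \<Longrightarrow> - \<mu> \<in> compositions n"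
 by (rule compositionsI) (simp add: lookup_outside)

lemma compositions_diff: "\<mu> \<in> compositions n \<Longrightarrow> \<nu> \<in> compositions n \<Longrightarrow> \<mu> - \<nu> \<in> compositions n"
 by (rule compositionsI) (simp add: lookup_minus lookup_outside)

lemma composition_eqI:
 assumes "\<mu> \<in> compositions n" "\<nu> \<in> compositions n" "\<And>j. j \<in> {1..n} \<Longrightarrow> lk \<mu> j = lk \<nu> j"
 shows "\<mu> = \<nu>"
 by (rule poly_mapping_eqI) (metis assms lookup_outside)

lemma abs_le_if_submaj:
 assumes "submaj n \<nu> \<mu>" "j \<in> {1..n}" "c \<ge> 0" "\<And>i. i \<in> {1..n} \<Longrightarrow> \<bar>lk \<mu> i\<bar> \<le> c"
 shows "\<bar>lk \<nu> j\<bar> \<le> c"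
proof -
 have "max (\<bar>lk \<nu> j\<bar> - c) 0 \<le> excess n c \<nu>"
  unfolding excess_def by (rule member_le_sum) (use assms in auto)
 also have "\<dots> \<le> excess n c \<mu>" using assms by (simp add: submaj_def)
 also have "\<dots> = 0" using assms by (auto simp: excess_def intro!: sum.neutral)
 finally show ?thesis by simp
qed

lemma finite_submaj: "finite {\<nu> \<in> compositions n. submaj n \<nu> \<mu>}"
proof -
 define B where "B = (\<Sum>j\<in>{1..n}. \<bar>lk \<mu> j\<bar>)"
 have B: "\<bar>lk \<mu> i\<bar> \<le> B" if "i \<in> {1..n}" for i
  unfolding B_def by (rule member_le_sum) (use that in auto)
 have B0: "B \<ge> 0" by (simp add: B_def sum_nonneg)
 have "finite (PiE {1..n} (\<lambda>_. {-B..B}))" by (intro finite_PiE) auto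
 moreover have "inj_on (\<lambda>\<nu>. restrict (lk \<nu>) {1..n}) {\<nu> \<in> compositions n. submaj n \<nu> \<mu>}"
  by (intro inj_onI composition_eqI[of _ n]) (auto simp: restrict_def fun_eq_iff, metis)
 moreover have "(\<lambda>\<nu>. restrict (lk \<nu>) {1..n}) ` {\<nu> \<in> compositions n. submaj n \<nu> \<mu>}
   \<subseteq> PiE {1..n} (\<lambda>_. {-B..B})"
 proof -
  have "\<bar>lk \<nu> j\<bar> \<le> B" if "submaj n \<nu> \<mu>" "j \<in> {1..n}" for \<nu> j
   using abs_le_if_submaj[OF that B0 B] .
  then show ?thesis by (fastforce simp: abs_le_iff)
 qed
 ultimately show ?thesis by (meson finite_imageD finite_subset)
qed

lemma finite_prec: "finite {\<nu> \<in> compositions n. prec n \<nu> \<mu>}"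
 by (rule finite_subset[OF _ finite_submaj[of n \<mu>]])
   (auto simp: prec_iff strict_submaj_def same_orbit_iff)

section \<open>Reflections\<close>

definition pair_root :: "nat \<Rightarrow> nat \<Rightarrow> comp \<Rightarrow> int" where
 "pair_root n i \<mu> = (if i < n then lk \<mu> i - lk \<mu> (i + 1) else 2 * lk \<mu> n)"

lemma refl_lookup:
 "lk (refl_comp n i \<mu>) j = (if i < n
   then (if j = i then lk \<mu> (i + 1) else if j = i + 1 then lk \<mu> i else lk \<mu> j)
   else (if j = n then - lk \<mu> n else lk \<mu> j))"
 by (auto simp: refl_comp_def lookup_update)

lemma refl_refl [simp]: "refl_comp n i (refl_comp n i \<mu>) = \<mu>"
 by (rule poly_mapping_eqI) (auto simp: refl_lookup)

lemma refl_composition: "i \<in> {1..n} \<Longrightarrow> \<mu> \<in> compositions n \<Longrightarrow> refl_comp n i \<mu> \<in> compositions n"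
 by (rule compositionsI) (auto simp: refl_lookup lookup_outside)

lemma pair_root_refl [simp]: "pair_root n i (refl_comp n i \<mu>) = - pair_root n i \<mu>"
 by (simp add: pair_root_def refl_lookup)

lemma refl_fixed: "pair_root n i \<mu> = 0 \<Longrightarrow> refl_comp n i \<mu> = \<mu>"
 by (rule poly_mapping_eqI) (auto simp: refl_lookup pair_root_def split: if_splits)

lemma refl_add: "refl_comp n i (\<mu> + \<nu>) = refl_comp n i \<mu> + refl_comp n i \<nu>"
 by (rule poly_mapping_eqI) (simp add: refl_lookup lookup_add)

lemma refl_comp_uminus: "refl_comp n i (- \<mu>) = - refl_comp n i \<mu>"
 by (rule poly_mapping_eqI) (auto simp: refl_lookup)

lemma sum_refl:
 assumes "i \<in> {1..n}"
  and "\<And>x. g (- x) = g x"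
 shows "(\<Sum>j\<in>{1..n}. g (lk (refl_comp n i \<mu>) j)) = (\<Sum>j\<in>{1..n}. (g (lk \<mu> j)::int))"
proof (cases "i < n")
 case True
 show ?thesis
  by (rule sum.reindex_bij_witness[of _ "\<lambda>j. if j = i then i+1 else if j = i+1 then i else j"
     "\<lambda>j. if j = i then i+1 else if j = i+1 then i else j"])
    (use True assms in \<open>auto simp: refl_lookup\<close>)
next
 case False
 then show ?thesis using assms by (intro sum.cong) (auto simp: refl_lookup)
qed

lemma excess_refl: "i \<in> {1..n} \<Longrightarrow> excess n c (refl_comp n i \<mu>) = excess n c \<mu>"
 unfolding excess_def by (rule sum_refl[of i n "\<lambda>x. max (\<bar>x\<bar> - c) 0"]) auto

lemma same_orbit_refl_comp [simp]: "i \<in> {1..n} \<Longrightarrow> same_orbit n (refl_comp n i \<mu>) \<mu>"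
 by (simp add: same_orbit_def excess_refl)

lemma excess_uminus: "excess n c (- \<mu>) = excess n c \<mu>"
 by (simp add: excess_def)

lemma submaj_uminus: "submaj n (- \<xi>) (- \<mu>) = submaj n \<xi> \<mu>"
 by (simp add: submaj_def excess_uminus)

lemma strict_submaj_uminus: "strict_submaj n (- \<xi>) (- \<mu>) = strict_submaj n \<xi> \<mu>"
 by (simp add: strict_submaj_def submaj_def same_orbit_def excess_uminus)

section \<open>Strings\<close>

text \<open>The multiple \<open>k \<alpha>\<^sub>i\<close> of the root \<open>\<alpha>\<^sub>i = \<epsilon>\<^bsub>i+1\<^esub> - \<epsilon>\<^sub>i\<close>, or \<open>\<alpha>\<^sub>n = - \<epsilon>\<^sub>n\<close>. The sign and the factor \<open>2\<close> in
 \<open>pair_root\<close> are chosen such that \<open>s\<^sub>i \<mu>\<close> is \<open>\<mu>\<close> plus \<open>pair_root n i \<mu>\<close> times \<open>\<alpha>\<^sub>i\<close>.\<close>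

definition rootvec :: "nat \<Rightarrow> nat \<Rightarrow> int \<Rightarrow> comp" where
 "rootvec n i k = (if i < n then Poly_Mapping.single (i + 1) k - Poly_Mapping.single i k
         else - Poly_Mapping.single n k)"

lemma rootvec_lookup: "lk (rootvec n i k) j = (if i < n
   then (if j = i then - k else if j = i + 1 then k else 0) else (if j = n then - k else 0))"
 by (auto simp: rootvec_def lookup_minus lookup_single when_def)

lemma rootvec_composition: "i \<in> {1..n} \<Longrightarrow> rootvec n i k \<in> compositions n"
 by (rule compositionsI) (auto simp: rootvec_lookup)

lemma refl_eq_rootvec: "refl_comp n i \<mu> = \<mu> + rootvec n i (pair_root n i \<mu>)"
 by (rule poly_mapping_eqI) (auto simp: refl_lookup lookup_add rootvec_lookup pair_root_def)

lemma rootvec_add: "rootvec n i (k + l) = rootvec n i k + rootvec n i l"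
 by (rule poly_mapping_eqI) (auto simp: lookup_add rootvec_lookup)

lemma rootvec_zero [simp]: "rootvec n i 0 = 0"
 by (rule poly_mapping_eqI) (auto simp: rootvec_lookup)

lemma rootvec_inject: "i \<in> {1..n} \<Longrightarrow> rootvec n i k = rootvec n i l \<longleftrightarrow> k = l"
 by (metis rootvec_lookup neg_equal_iff_equal not_less atLeastAtMost_iff le_antisym)

text \<open>Strictly inside a reflection string the absolute values shrink: every entry that changes is
 strictly smaller in modulus than the larger of the two old ones.\<close>

lemma excess_decomp:
 assumes "i \<in> {1..n}"
 shows "excess n c \<mu> = (if i < n
   then max (\<bar>lk \<mu> i\<bar> - c) 0 + max (\<bar>lk \<mu> (i+1)\<bar> - c) 0
    + (\<Sum>j\<in>{1..n}-{i,i+1}. max (\<bar>lk \<mu> j\<bar> - c) 0)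
   else max (\<bar>lk \<mu> n\<bar> - c) 0 + (\<Sum>j\<in>{1..n}-{n}. max (\<bar>lk \<mu> j\<bar> - c) 0))"
proof (cases "i < n")
 case True
 have "{1..n} = insert i (insert (i+1) ({1..n}-{i,i+1}))" using True assms by auto
 then have "excess n c \<mu> = (\<Sum>j\<in>insert i (insert (i+1) ({1..n}-{i,i+1})). max (\<bar>lk \<mu> j\<bar> - c) 0)"
  unfolding excess_def by simp
 then show ?thesis using True by (simp add: algebra_simps)
next
 case False
 then have "n \<in> {1..n}" using assms by auto
 then show ?thesis using False sum.remove[of "{1..n}" n "\<lambda>j. max (\<bar>lk \<mu> j\<bar> - c) 0"]
  unfolding excess_def by simp
qed

lemma excess_string_rest:
 assumes "i \<in> {1..n}"
 shows "i < n \<Longrightarrow> (\<Sum>j\<in>{1..n}-{i,i+1}. max (\<bar>lk (\<mu> + rootvec n i k) j\<bar> - c) 0)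
    = (\<Sum>j\<in>{1..n}-{i,i+1}. max (\<bar>lk \<mu> j\<bar> - c) 0)"
  and "\<not> i < n \<Longrightarrow> (\<Sum>j\<in>{1..n}-{n}. max (\<bar>lk (\<mu> + rootvec n i k) j\<bar> - c) 0)
    = (\<Sum>j\<in>{1..n}-{n}. max (\<bar>lk \<mu> j\<bar> - c) 0)"
 by (auto intro!: sum.cong simp: lookup_add rootvec_lookup)

definition in_string :: "int \<Rightarrow> int \<Rightarrow> bool" where
 "in_string d k \<longleftrightarrow> (0 \<le> k \<and> k \<le> d) \<or> (d \<le> k \<and> k \<le> 0)"

lemma max_abs_string:
 fixes x y k c :: int
 assumes "in_string (x - y) k" "0 \<le> c"
 shows "max (\<bar>x - k\<bar> - c) 0 + max (\<bar>y + k\<bar> - c) 0 \<le> max (\<bar>x\<bar> - c) 0 + max (\<bar>y\<bar> - c) 0"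
proof -
 have lower: "z - c \<le> max (\<bar>z\<bar> - c) 0" "- z - c \<le> max (\<bar>z\<bar> - c) 0" "0 \<le> max (\<bar>z\<bar> - c) 0"
  and cases: "max (\<bar>z\<bar> - c) 0 = z - c \<or> max (\<bar>z\<bar> - c) 0 = - z - c \<or> max (\<bar>z\<bar> - c) 0 = 0" for z
  by linarith+
 show ?thesis
  using lower[of x] lower[of y] cases[of "x - k"] cases[of "y + k"] assms unfolding in_string_def
  by (elim disjE conjE) linarith+
qed

lemma string_submaj:
 assumes i: "i \<in> {1..n}" and k: "in_string (pair_root n i \<mu>) k"
 shows "submaj n (\<mu> + rootvec n i k) \<mu>"
proof (unfold submaj_def, intro allI impI)
 fix c :: int assume c: "0 \<le> c"
 show "excess n c (\<mu> + rootvec n i k) \<le> excess n c \<mu>"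
 proof (cases "i < n")
  case True
  then show ?thesis
   using k max_abs_string[of "lk \<mu> i" "lk \<mu> (i+1)" k c] c excess_string_rest(1)[OF i True, of \<mu> k c]
   by (simp add: excess_decomp[OF i, of c] lookup_add rootvec_lookup pair_root_def)
 next
  case False
  then have "\<bar>lk \<mu> n - k\<bar> \<le> \<bar>lk \<mu> n\<bar>" using k by (auto simp: in_string_def pair_root_def)
  then have "max (\<bar>lk \<mu> n - k\<bar> - c) 0 \<le> max (\<bar>lk \<mu> n\<bar> - c) 0" by (auto simp: max_def)
  then show ?thesis using False excess_string_rest(2)[OF i False, of \<mu> k c]
   by (simp add: excess_decomp[OF i, of c] lookup_add rootvec_lookup)
 qed
qed

lemma string_interior_strict:
 assumes i: "i \<in> {1..n}" and k: "in_string (pair_root n i \<mu>) k" "k \<noteq> 0" "k \<noteq> pair_root n i \<mu>"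
 shows "strict_submaj n (\<mu> + rootvec n i k) \<mu>"
proof -
 \<comment> \<open>The witnessing threshold is one below the largest modulus among the affected entries.\<close>
 define c where "c = (if i < n then max \<bar>lk \<mu> i\<bar> \<bar>lk \<mu> (i+1)\<bar> - 1 else \<bar>lk \<mu> n\<bar> - 1)"
 have c: "0 \<le> c"
 proof -
  have "lk \<mu> i \<noteq> 0 \<or> lk \<mu> (i+1) \<noteq> 0" if "i < n"
   using k that by (auto simp: in_string_def pair_root_def)
  moreover have "lk \<mu> n \<noteq> 0" if "\<not> i < n"
   using k that by (auto simp: in_string_def pair_root_def)
  ultimately show ?thesis by (auto simp: c_def)
 qed
 have "excess n c (\<mu> + rootvec n i k) < excess n c \<mu>"
 proof (cases "i < n")
  case True
  have "\<bar>lk \<mu> i - k\<bar> \<le> c" "\<bar>lk \<mu> (i+1) + k\<bar> \<le> c"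
  proof -
   have b: "\<bar>lk \<mu> i\<bar> \<le> c + 1" "\<bar>lk \<mu> (i+1)\<bar> \<le> c + 1" using True by (auto simp: c_def)
   have d: "pair_root n i \<mu> = lk \<mu> i - lk \<mu> (i+1)" using True by (simp add: pair_root_def)
   show "\<bar>lk \<mu> i - k\<bar> \<le> c" "\<bar>lk \<mu> (i+1) + k\<bar> \<le> c"
    using k b unfolding d in_string_def abs_le_iff by (elim disjE conjE; linarith)+
  qed
  then have "max (\<bar>lk \<mu> i - k\<bar> - c) 0 = 0" "max (\<bar>lk \<mu> (i+1) + k\<bar> - c) 0 = 0" by simp_all
  moreover have "1 \<le> max (\<bar>lk \<mu> i\<bar> - c) 0 \<or> 1 \<le> max (\<bar>lk \<mu> (i+1)\<bar> - c) 0"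
   using True by (simp add: c_def le_max_iff_disj) (metis linorder_le_cases max.absorb1 max.absorb2 order_refl)
  moreover have "0 \<le> max (\<bar>lk \<mu> i\<bar> - c) 0" "0 \<le> max (\<bar>lk \<mu> (i+1)\<bar> - c) 0" by simp_all
  ultimately have "max (\<bar>lk \<mu> i - k\<bar> - c) 0 + max (\<bar>lk \<mu> (i+1) + k\<bar> - c) 0
    < max (\<bar>lk \<mu> i\<bar> - c) 0 + max (\<bar>lk \<mu> (i+1)\<bar> - c) 0" by linarith
  then show ?thesis using excess_string_rest(1)[OF i True, of \<mu> k c] True
   by (simp add: excess_decomp[OF i, of c] lookup_add rootvec_lookup)
 next
  case False
  have "\<bar>lk \<mu> n - k\<bar> \<le> c" using k False by (auto simp: c_def in_string_def pair_root_def)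
  then have "max (\<bar>lk \<mu> n - k\<bar> - c) 0 < max (\<bar>lk \<mu> n\<bar> - c) 0" using False by (auto simp: c_def)
  then show ?thesis using excess_string_rest(2)[OF i False, of \<mu> k c] False
   by (simp add: excess_decomp[OF i, of c] lookup_add rootvec_lookup)
 qed
 then show ?thesis using c string_submaj[OF i k(1)]
  by (auto simp: strict_submaj_def same_orbit_def)
qed

section \<open>Hecke operators on monomials\<close>

definition eta :: "nat \<Rightarrow> 'r::comm_ring_1 \<Rightarrow> 'r \<Rightarrow> 'r \<Rightarrow> nat \<Rightarrow> 'r" where
 "eta n t a b i = (if i < n then t else - (a * b))"

definition gap_coeff :: "nat \<Rightarrow> 'r::comm_ring_1 \<Rightarrow> 'r \<Rightarrow> 'r \<Rightarrow> nat \<Rightarrow> int \<Rightarrow> 'r" where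
 "gap_coeff n t a b i k = (if i < n \<or> even k then 1 - eta n t a b i else - (a + b))"

text \<open>The coefficient of \<open>z\<^bsup>\<mu> + k \<alpha>\<^sub>i\<^esup>\<close> in \<open>T\<^sub>i z\<^sup>\<mu>\<close> depends on \<open>\<mu>\<close> only through \<open>d\<close>, the value of
 \<open>pair_root\<close>. The two operators are treated together: \<open>eta\<close> is the eigenvalue of \<open>T\<^sub>i\<close> on
 invariants, and \<open>gap_coeff\<close> is, up to sign, the coefficient at the points other than the ends.\<close>

definition string_coeff :: "nat \<Rightarrow> 'r::comm_ring_1 \<Rightarrow> 'r \<Rightarrow> 'r \<Rightarrow> nat \<Rightarrow> int \<Rightarrow> int \<Rightarrow> 'r" where
 "string_coeff n t a b i d k =
   (if d = 0 then (if k = 0 then eta n t a b i else 0)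
   else if 0 < d then (if k = d then 1 else if 0 < k \<and> k < d then gap_coeff n t a b i k else 0)
   else (if k = d then eta n t a b i else if d < k \<and> k \<le> 0 then - gap_coeff n t a b i k else 0))"

lemma string_coeff_outside: "\<not> in_string d k \<Longrightarrow> string_coeff n t a b i d k = 0"
 by (auto simp: string_coeff_def in_string_def)

definition string_set :: "int \<Rightarrow> int set" where "string_set d = {min 0 d..max 0 d}"

lemma string_set_iff: "k \<in> string_set d \<longleftrightarrow> in_string d k"
 by (auto simp: string_set_def in_string_def)

lemma finite_string_set [simp]: "finite (string_set d)"
 by (simp add: string_set_def)

definition string_sum :: "nat \<Rightarrow> 'r::comm_ring_1 \<Rightarrow> 'r \<Rightarrow> 'r \<Rightarrow> nat \<Rightarrow> (int \<Rightarrow> 'r) \<Rightarrow> int \<Rightarrow> 'r" where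
 "string_sum n t a b i W d = (\<Sum>k\<in>string_set d. string_coeff n t a b i d k * W k)"

lemma string_sum_pos:
 assumes "0 < d"
 shows "string_sum n t a b i W d = (\<Sum>k\<in>{0<..<d}. gap_coeff n t a b i k * W k) + W d"
proof -
 have "string_set d = insert 0 (insert d {0<..<d})" using assms by (auto simp: string_set_def)
 then have "string_sum n t a b i W d = (\<Sum>k\<in>{0<..<d}. string_coeff n t a b i d k * W k) + W d"
  using assms by (simp add: string_sum_def string_coeff_def)
 also have "(\<Sum>k\<in>{0<..<d}. string_coeff n t a b i d k * W k)
   = (\<Sum>k\<in>{0<..<d}. gap_coeff n t a b i k * W k)"
  by (rule sum.cong) (auto simp: string_coeff_def)
 finally show ?thesis .
qed

lemma string_sum_neg:
 assumes "d \<le> 0"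
 shows "string_sum n t a b i W d
  = eta n t a b i * W d - (\<Sum>k\<in>{d<..0}. gap_coeff n t a b i k * W k)"
proof (cases "d = 0")
 case True
 then show ?thesis by (simp add: string_sum_def string_set_def string_coeff_def)
next
 case False
 have "string_set d = insert d {d<..0}" using assms by (auto simp: string_set_def)
 then have "string_sum n t a b i W d
   = eta n t a b i * W d + (\<Sum>k\<in>{d<..0}. string_coeff n t a b i d k * W k)"
  using assms False by (simp add: string_sum_def string_coeff_def)
 also have "(\<Sum>k\<in>{d<..0}. string_coeff n t a b i d k * W k)
   = (\<Sum>k\<in>{d<..0}. - (gap_coeff n t a b i k * W k))"
  by (rule sum.cong) (use assms False in \<open>auto simp: string_coeff_def\<close>)
 finally show ?thesis by (simp add: sum_negf)
qed

text \<open>Both operators share one telescoping recursion in the length of the string.\<close>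

lemma string_sum_step_swap:
 assumes "i < n"
 shows "string_sum n t a b i W (d + 1) = string_sum n t a b i W d + W (d + 1) - t * W d"
proof (cases "0 \<le> d")
 case True
 show ?thesis
 proof (cases "d = 0")
  case False
  have "{0<..<d+1} = insert d {0<..<d}" using False True by auto
  with True False assms show ?thesis
   by (simp add: string_sum_pos gap_coeff_def eta_def algebra_simps)
 next
  case True
  have "{0<..<1::int} = {}" by auto
  with True assms show ?thesis by (simp add: string_sum_pos string_sum_neg eta_def)
 qed
next
 case False
 have "{d<..0} = insert (d+1) {d+1<..0}" using False by auto
 with False assms show ?thesis
  by (simp add: string_sum_neg gap_coeff_def eta_def algebra_simps)
qed

lemma string_sum_step_flip:
 assumes "\<not> i < n" "even d"
 shows "string_sum n t a b i W (d + 2) = string_sum n t a b i W d + W (d + 2)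
      - (a + b) * W (d + 1) + a * b * W d"
proof (cases "0 \<le> d")
 case True
 show ?thesis
 proof (cases "d = 0")
  case False
  have "{0<..<d+2} = insert (d+1) (insert d {0<..<d})" using False True by auto
  with True False assms show ?thesis
   by (simp add: string_sum_pos gap_coeff_def eta_def algebra_simps)
 next
  case True
  have "{0<..<2::int} = {1}" by auto
  with True assms show ?thesis
   by (simp add: string_sum_pos string_sum_neg eta_def gap_coeff_def algebra_simps)
 qed
next
 case False
 then have "d \<le> -2" using assms(2) by presburger
 then have "{d<..0} = insert (d+1) (insert (d+2) {d+2<..0})" by auto
 with False assms \<open>d \<le> -2\<close> show ?thesis
  by (simp add: string_sum_neg gap_coeff_def eta_def algebra_simps)
qed

text \<open>The definitions of \<open>T\<^sub>i\<close> with cleared denominators, where \<open>W k\<close> stands for \<open>z\<^bsup>k \<alpha>\<^sub>i\<^esup>\<close>. The ring is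
 arbitrary since the identities are needed for Laurent polynomials and for their values on the torus.\<close>

lemma string_sum_swap:
 assumes "i < n" and W0: "W 0 = 1" and W: "\<And>k l. W (k + l) = W k * W l"
 shows "(W 1 - 1) * (string_sum n t a b i W d - t) = (W 1 - t) * (W d - 1)"
proof (induction d rule: int_induct[where k = 0])
 case base
 then show ?case using assms by (simp add: string_sum_neg eta_def)
next
 case (step1 d)
 have e: "string_sum n t a b i W (d+1) = string_sum n t a b i W d + W (d + 1) - t * W d"
  by (rule string_sum_step_swap[OF assms(1)])
 have "(W 1 - 1) * (string_sum n t a b i W (d+1) - t)
   = (W 1 - 1) * (string_sum n t a b i W d - t) + (W 1 - 1) * (W (d+1) - t * W d)"
  unfolding e by (simp add: ring_distribs)
 then show ?case unfolding step1.IH by (simp add: W algebra_simps)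
next
 case (step2 d)
 have e: "string_sum n t a b i W d = string_sum n t a b i W (d-1) + W d - t * W (d-1)"
  using string_sum_step_swap[OF assms(1), of t a b W "d-1"] by (simp only: diff_add_cancel)
 have Wd: "W d = W (d - 1) * W 1" using W[of "d-1" 1] by simp
 have "(W 1 - 1) * (string_sum n t a b i W (d-1) - t)
   = (W 1 - 1) * (string_sum n t a b i W d - t) - (W 1 - 1) * (W d - t * W (d-1))"
  unfolding e by (simp add: ring_distribs)
 then show ?case unfolding step2.IH by (simp add: Wd algebra_simps)
qed

lemma string_sum_flip:
 assumes "\<not> i < n" and W0: "W 0 = 1" and W: "\<And>k l. W (k + l) = W k * W l"
 shows "(W 2 - 1) * (string_sum n t a b i W (2 * d) + a * b)
      = (W 1 - a) * (W 1 - b) * (W (2 * d) - 1)"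
proof (induction d rule: int_induct[where k = 0])
 case base
 then show ?case using assms by (simp add: string_sum_neg eta_def)
next
 case (step1 d)
 have W2: "W 2 = W 1 * W 1" using W[of 1 1] by simp
 have e: "2 * (d + 1) = 2 * d + 2" by simp
 have Wd: "W (2 * d + 2) = W (2*d) * W 1 * W 1" "W (2 * d + 1) = W (2*d) * W 1"
  using W[of "2*d" 2] W[of "2*d" 1] W2 by (simp_all add: ac_simps)
 have S: "string_sum n t a b i W (2 * d + 2) = string_sum n t a b i W (2 * d) + W (2 * d + 2)
      - (a + b) * W (2 * d + 1) + a * b * W (2 * d)"
  by (rule string_sum_step_flip[OF assms(1)]) simp
 have "(W 2 - 1) * (string_sum n t a b i W (2 * d + 2) + a * b)
   = (W 2 - 1) * (string_sum n t a b i W (2 * d) + a * b)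
    + (W 2 - 1) * (W (2 * d + 2) - (a + b) * W (2 * d + 1) + a * b * W (2 * d))"
  unfolding S by (simp add: ring_distribs)
 also have "\<dots> = (W 1 - a) * (W 1 - b) * (W (2 * d + 2) - 1)"
  unfolding step1.IH unfolding Wd W2 by (simp add: algebra_simps)
 finally show ?case unfolding e .
next
 case (step2 d)
 have W2: "W 2 = W 1 * W 1" using W[of 1 1] by simp
 define m where "m = 2 * (d - 1)"
 have e: "2 * d = m + 2" by (simp add: m_def)
 have Wd: "W (m + 2) = W m * W 1 * W 1" "W (m + 1) = W m * W 1"
  using W[of m 2] W[of m 1] W2 by (simp_all add: ac_simps)
 have S: "string_sum n t a b i W (m + 2) = string_sum n t a b i W m + W (m + 2)
      - (a + b) * W (m + 1) + a * b * W m"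
  by (rule string_sum_step_flip[OF assms(1)]) (simp add: m_def)
 have IH: "(W 2 - 1) * (string_sum n t a b i W (m + 2) + a * b)
      = (W 1 - a) * (W 1 - b) * (W (m + 2) - 1)"
  using step2.IH unfolding e .
 have "(W 2 - 1) * (string_sum n t a b i W m + a * b)
   = (W 2 - 1) * (string_sum n t a b i W (m + 2) + a * b)
    - (W 2 - 1) * (W (m + 2) - (a + b) * W (m + 1) + a * b * W m)"
  unfolding S by (simp add: ring_distribs)
 also have "\<dots> = (W 1 - a) * (W 1 - b) * (W m - 1)"
  unfolding IH unfolding Wd W2 by (simp add: algebra_simps)
 finally show ?case unfolding m_def .
qed

lemma zmon_add: "zmon (\<mu> + \<nu>) = zmon \<mu> * (zmon \<nu> :: 'k::field laurent)"
 by (simp add: zmon_def mult_single)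

lemma zmon_0: "zmon 0 = 1"
 by (simp add: zmon_def)

lemma const_add: "const (x + y) = const x + const (y::'k::field)" by (simp add: const_def single_add)
lemma const_mult: "const (x * y) = const x * const (y::'k::field)" by (simp add: const_def mult_single)
lemma const_uminus: "const (- x) = - const (x::'k::field)" by (simp add: const_def single_uminus)
lemma const_diff: "const (x - y) = const x - const (y::'k::field)" by (simp add: const_def single_diff)
lemma const_0: "const 0 = 0" by (simp add: const_def)
lemma const_1: "const 1 = 1" by (simp add: const_def)

lemma const_zmon: "const x * zmon \<mu> = Poly_Mapping.single \<mu> (x::'k::field)"
 by (simp add: const_def zmon_def mult_single)

lemma lookup_const_mult: "lk (const x * f) \<xi> = x * lk f \<xi>" for x :: "'k::field"
proof -
 have "lk (Poly_Mapping.single 0 x * f) (0 + \<xi>) = x * lk f \<xi>"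
  by (simp add: lookup_mult lookup_single when_mult Sum_any_when_equal prod_fun_def)
 then show ?thesis by (simp add: const_def)
qed

lemma laurent_expansion: "(f :: 'k::field laurent) = (\<Sum>\<mu>\<in>supp f. const (lk f \<mu>) * zmon \<mu>)"
proof (rule poly_mapping_eqI)
 fix \<xi>
 have "lk (\<Sum>\<mu>\<in>supp f. const (lk f \<mu>) * zmon \<mu>) \<xi>
   = (\<Sum>\<mu>\<in>supp f. lk f \<mu> when \<mu> = \<xi>)"
  by (simp add: lookup_sum const_zmon lookup_single)
 also have "\<dots> = lk f \<xi>" by (simp add: when_def sum.delta in_keys_iff)
 finally show "lk f \<xi> = lk (\<Sum>\<mu>\<in>supp f. const (lk f \<mu>) * zmon \<mu>) \<xi>" ..
qed

definition hecke_mon :: "nat \<Rightarrow> 'k::field \<Rightarrow> 'k \<Rightarrow> 'k \<Rightarrow> nat \<Rightarrow> comp \<Rightarrow> 'k laurent" where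
 "hecke_mon n t a b i \<mu> = (\<Sum>k\<in>string_set (pair_root n i \<mu>).
   const (string_coeff n t a b i (pair_root n i \<mu>) k) * zmon (\<mu> + rootvec n i k))"

lemma const_string_coeff:
 "const (string_coeff n t a b i d k) = string_coeff n (const t) (const a) (const (b::'k::field)) i d k"
 by (simp add: string_coeff_def gap_coeff_def eta_def const_0 const_1 const_uminus const_mult
   const_diff const_add)

lemma hecke_mon_string_sum:
 "hecke_mon n t a b i \<mu> = zmon \<mu> *
   string_sum n (const t) (const a) (const b) i (\<lambda>k. zmon (rootvec n i k)) (pair_root n i \<mu>)"
 unfolding hecke_mon_def string_sum_def const_string_coeff zmon_add sum_distrib_left
 by (simp add: ac_simps)

lemma refl_poly_expansion:
 "refl_poly n i f = (\<Sum>\<mu>\<in>supp f. const (lk f \<mu>) * zmon (refl_comp n i \<mu>))"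
 for f :: "'k::field laurent"
 by (simp add: refl_poly_def const_zmon)

lemma hecke_mon_swap:
 assumes "i < n"
 shows "(hecke_mon n t a b i \<mu> - const t * zmon \<mu>) * (zvar (i + 1) 1 - zvar i 1)
  = (zvar (i + 1) 1 - const t * zvar i 1) * (zmon (refl_comp n i \<mu>) - zmon \<mu>)"
proof -
 let ?W = "\<lambda>k. zmon (rootvec n i k) :: 'a laurent"
 let ?d = "pair_root n i \<mu>"
 have z: "zvar (i + 1) 1 = zvar i 1 * ?W 1"
  using assms by (simp add: zvar_def rootvec_def flip: zmon_add)
 have r: "zmon (refl_comp n i \<mu>) = zmon \<mu> * ?W ?d"
  by (simp add: refl_eq_rootvec zmon_add)
 have "(?W 1 - 1) * (string_sum n (const t) (const a) (const b) i ?W ?d - const t)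
   = (?W 1 - const t) * (?W ?d - 1)"
  by (rule string_sum_swap[OF assms]) (simp_all add: zmon_0 rootvec_add zmon_add)
 then have "zvar i 1 * zmon \<mu> * ((?W 1 - 1) * (string_sum n (const t) (const a) (const b) i ?W ?d - const t))
   = zvar i 1 * zmon \<mu> * ((?W 1 - const t) * (?W ?d - 1))" by simp
 then show ?thesis unfolding hecke_mon_string_sum z r by (simp add: algebra_simps)
qed

lemma hecke_mon_flip:
 assumes "\<not> i < n"
 shows "(hecke_mon n t a b i \<mu> + const (a * b) * zmon \<mu>) * (1 - zvar n 1 ^ 2)
  = (1 - const a * zvar n 1) * (1 - const b * zvar n 1) * (zmon (refl_comp n i \<mu>) - zmon \<mu>)"
proof -
 let ?W = "\<lambda>k. zmon (rootvec n i k) :: 'a laurent"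
 let ?d = "pair_root n i \<mu>"
 have z: "zvar n 1 * ?W 1 = 1"
  using assms by (simp add: zvar_def rootvec_def zmon_0 flip: zmon_add)
 have W2: "?W 2 = ?W 1 * ?W 1" by (simp flip: zmon_add rootvec_add)
 have r: "zmon (refl_comp n i \<mu>) = zmon \<mu> * ?W ?d"
  by (simp add: refl_eq_rootvec zmon_add)
 have d: "?d = 2 * lk \<mu> n" using assms by (simp add: pair_root_def)
 have "(?W 2 - 1) * (string_sum n (const t) (const a) (const b) i ?W ?d + const a * const b)
   = (?W 1 - const a) * (?W 1 - const b) * (?W ?d - 1)"
  unfolding d by (rule string_sum_flip[OF assms]) (simp_all add: zmon_0 rootvec_add zmon_add)
 then have eq: "zvar n 1 ^ 2 * zmon \<mu> * ((?W 2 - 1) * (string_sum n (const t) (const a) (const b) i ?W ?d + const a * const b))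
   = zvar n 1 ^ 2 * zmon \<mu> * ((?W 1 - const a) * (?W 1 - const b) * (?W ?d - 1))" by simp
 have h1: "zvar n 1 ^ 2 * (?W 2 - 1) = 1 - zvar n 1 ^ 2"
  and h2: "zvar n 1 ^ 2 * ((?W 1 - const a) * (?W 1 - const b)) = (1 - const a * zvar n 1) * (1 - const b * zvar n 1)"
 proof -
  have "zvar n 1 ^ 2 * (?W 2 - 1) = (zvar n 1 * ?W 1) * (zvar n 1 * ?W 1) - zvar n 1 ^ 2"
   unfolding W2 by (simp add: power2_eq_square algebra_simps)
  then show "zvar n 1 ^ 2 * (?W 2 - 1) = 1 - zvar n 1 ^ 2" unfolding z by simp
  have "zvar n 1 ^ 2 * ((?W 1 - const a) * (?W 1 - const b))
    = (zvar n 1 * ?W 1 - const a * zvar n 1) * (zvar n 1 * ?W 1 - const b * zvar n 1)"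
   by (simp add: power2_eq_square algebra_simps)
  then show "zvar n 1 ^ 2 * ((?W 1 - const a) * (?W 1 - const b)) = (1 - const a * zvar n 1) * (1 - const b * zvar n 1)"
   unfolding z .
 qed
 let ?S = "string_sum n (const t) (const a) (const b) i ?W ?d"
 have "(hecke_mon n t a b i \<mu> + const (a * b) * zmon \<mu>) * (1 - zvar n 1 ^ 2)
   = zvar n 1 ^ 2 * zmon \<mu> * ((?W 2 - 1) * (?S + const a * const b))"
  unfolding hecke_mon_string_sum const_mult h1[symmetric] by (simp only: ring_distribs ac_simps)
 also have "\<dots> = zvar n 1 ^ 2 * ((?W 1 - const a) * (?W 1 - const b)) * (zmon \<mu> * ?W ?d - zmon \<mu>)"
  unfolding eq by (simp add: ring_distribs ac_simps)
 finally show ?thesis unfolding h2 r .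
qed

lemma exact_quot_eqI: "y \<noteq> 0 \<Longrightarrow> w * y = x \<Longrightarrow> exact_quot x y = w"
 using exact_quot_mult by blast

lemma zmon_eq_iff: "zmon \<mu> = (zmon \<nu> :: 'k::field laurent) \<longleftrightarrow> \<mu> = \<nu>"
 by (metis zmon_def keys_single one_neq_zero singleton_inject)

theorem hecke_expansion:
 fixes f :: "'k::field laurent"
 assumes "i \<in> {1..n}"
 shows "hecke n t a b i f = (\<Sum>\<mu>\<in>supp f. const (lk f \<mu>) * hecke_mon n t a b i \<mu>)"
proof (cases "i < n")
 case True
 let ?K = "supp f"
 let ?den = "zvar (i + 1) 1 - zvar i 1 :: 'k laurent"
 let ?num = "zvar (i + 1) 1 - const t * zvar i 1 :: 'k laurent"
 have "zvar (i + 1) 1 \<noteq> (zvar i 1 :: 'k laurent)"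
  unfolding zvar_def zmon_eq_iff by (metis Suc_eq_plus1 lookup_single_eq lookup_single_not_eq n_not_Suc_n zero_neq_one)
 then have den: "?den \<noteq> 0" by simp
 have "(\<Sum>\<mu>\<in>?K. const (lk f \<mu>) * (hecke_mon n t a b i \<mu> - const t * zmon \<mu>)) * ?den
   = (\<Sum>\<mu>\<in>?K. const (lk f \<mu>) * (?num * (zmon (refl_comp n i \<mu>) - zmon \<mu>)))"
  unfolding sum_distrib_right mult.assoc hecke_mon_swap[OF True] ..
 also have "\<dots> = ?num * (refl_poly n i f - f)"
 proof -
  have "refl_poly n i f - f = (\<Sum>\<mu>\<in>?K. const (lk f \<mu>) * (zmon (refl_comp n i \<mu>) - zmon \<mu>))"
   by (subst (2) laurent_expansion)
     (simp add: refl_poly_expansion right_diff_distrib sum_subtractf)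
  then show ?thesis by (simp add: sum_distrib_left mult.left_commute)
 qed
 finally have "hecke n t a b i f = const t * f + (\<Sum>\<mu>\<in>?K. const (lk f \<mu>) * (hecke_mon n t a b i \<mu> - const t * zmon \<mu>))"
  using True exact_quot_eqI[OF den] unfolding hecke_def by (simp only: if_True)
 also have "const t * f = (\<Sum>\<mu>\<in>?K. const (lk f \<mu>) * (const t * zmon \<mu>))"
  using arg_cong[OF laurent_expansion[of f], of "(*) (const t)"]
  by (simp add: sum_distrib_left mult.left_commute)
 finally show ?thesis by (simp add: right_diff_distrib sum_subtractf)
next
 case False
 with assms have i: "i = n" by auto
 let ?K = "supp f"
 let ?den = "1 - zvar n 1 ^ 2 :: 'k laurent"
 let ?num = "(1 - const a * zvar n 1) * (1 - const b * zvar n 1) :: 'k laurent"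
 have "zvar n 1 ^ 2 = (zmon (Poly_Mapping.single n 2) :: 'k laurent)"
  by (simp add: zvar_def power2_eq_square flip: zmon_add single_add)
 moreover have "Poly_Mapping.single n (2::int) \<noteq> 0"
  by (metis lookup_single_eq lookup_zero zero_neq_numeral)
 ultimately have den: "?den \<noteq> 0" using zmon_0 zmon_eq_iff by (metis right_minus_eq)
 have "(\<Sum>\<mu>\<in>?K. const (lk f \<mu>) * (hecke_mon n t a b i \<mu> + const (a * b) * zmon \<mu>)) * ?den
   = (\<Sum>\<mu>\<in>?K. const (lk f \<mu>) * (?num * (zmon (refl_comp n i \<mu>) - zmon \<mu>)))"
  unfolding sum_distrib_right mult.assoc[of "const _" "_ + _"] hecke_mon_flip[OF False] ..
 also have "\<dots> = ?num * (refl_poly n i f - f)"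
 proof -
  have "refl_poly n i f - f = (\<Sum>\<mu>\<in>?K. const (lk f \<mu>) * (zmon (refl_comp n i \<mu>) - zmon \<mu>))"
   by (subst (2) laurent_expansion)
     (simp add: refl_poly_expansion right_diff_distrib sum_subtractf)
  then show ?thesis by (simp add: sum_distrib_left mult.left_commute)
 qed
 finally have "hecke n t a b i f = - const (a * b) * f + (\<Sum>\<mu>\<in>?K. const (lk f \<mu>) * (hecke_mon n t a b i \<mu> + const (a * b) * zmon \<mu>))"
  using i False exact_quot_eqI[OF den] unfolding hecke_def by (simp only: if_False)
 also have "- const (a * b) * f = - (\<Sum>\<mu>\<in>?K. const (lk f \<mu>) * (const (a * b) * zmon \<mu>))"
  using arg_cong[OF laurent_expansion[of f], of "(*) (const (a * b))"]
  by (simp add: sum_distrib_left mult.left_commute)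
 finally show ?thesis by (simp add: distrib_left sum.distrib)
qed

lemma hecke_expansion_superset:
 fixes f :: "'k::field laurent"
 assumes "i \<in> {1..n}" "finite A" "supp f \<subseteq> A"
 shows "hecke n t a b i f = (\<Sum>\<mu>\<in>A. const (lk f \<mu>) * hecke_mon n t a b i \<mu>)"
 unfolding hecke_expansion[OF assms(1)]
 by (rule sum.mono_neutral_left) (use assms in \<open>auto simp: in_keys_iff const_0\<close>)

lemma lookup_hecke_mon:
 assumes "i \<in> {1..n}"
 shows "lk (hecke_mon n t a b i \<mu>) (\<mu> + rootvec n i k) = string_coeff n t a b i (pair_root n i \<mu>) k"
proof -
 have "lk (hecke_mon n t a b i \<mu>) (\<mu> + rootvec n i k) = (\<Sum>l\<in>string_set (pair_root n i \<mu>).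
   string_coeff n t a b i (pair_root n i \<mu>) l when l = k)"
  using rootvec_inject[OF assms]
  by (simp add: hecke_mon_def lookup_sum const_zmon lookup_single)
 also have "\<dots> = string_coeff n t a b i (pair_root n i \<mu>) k"
  using string_coeff_outside by (fastforce simp: when_def sum.delta string_set_iff)
 finally show ?thesis .
qed

lemma keys_hecke_mon:
 assumes "\<xi> \<in> supp (hecke_mon n t a b i \<mu>)"
 shows "\<exists>k. in_string (pair_root n i \<mu>) k \<and> \<xi> = \<mu> + rootvec n i k"
proof (rule ccontr)
 assume "\<not> ?thesis"
 then have "lk (hecke_mon n t a b i \<mu>) \<xi> = 0"
  by (auto simp: hecke_mon_def lookup_sum const_zmon lookup_single string_set_iff when_def
    intro!: sum.neutral)
 with assms show False by (simp add: in_keys_iff)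
qed

lemma lookup_hecke:
 fixes f :: "'k::field laurent"
 assumes "i \<in> {1..n}" "finite A" "supp f \<subseteq> A"
 shows "lk (hecke n t a b i f) \<xi> = (\<Sum>\<mu>\<in>A. lk f \<mu> * lk (hecke_mon n t a b i \<mu>) \<xi>)"
 by (simp add: hecke_expansion_superset[OF assms] lookup_sum lookup_const_mult)

text \<open>The action on the monomials of a whole orbit, modulo smaller orbits.\<close>

definition orbit_op :: "nat \<Rightarrow> 'k::field \<Rightarrow> 'k \<Rightarrow> 'k \<Rightarrow> nat \<Rightarrow> (comp \<Rightarrow> 'k) \<Rightarrow> comp \<Rightarrow> 'k" where
 "orbit_op n t a b i \<phi> \<xi> =
   (if pair_root n i \<xi> \<ge> 0 then eta n t a b i * \<phi> (refl_comp n i \<xi>)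
   else \<phi> (refl_comp n i \<xi>) + (eta n t a b i - 1) * \<phi> \<xi>)"

definition laurent_below :: "nat \<Rightarrow> comp \<Rightarrow> ('k::field) laurent set" where
 "laurent_below n \<sigma> = {f. supp f \<subseteq> {\<xi> \<in> compositions n. submaj n \<xi> \<sigma>}}"

lemma hecke_below:
 fixes f :: "'k::field laurent"
 assumes i: "i \<in> {1..n}" and f: "f \<in> laurent_below n \<sigma>"
 shows "hecke n t a b i f \<in> laurent_below n \<sigma>"
proof -
 have "\<xi> \<in> compositions n \<and> submaj n \<xi> \<sigma>" if k: "\<xi> \<in> supp (hecke n t a b i f)" for \<xi>
 proof -
  have "(\<Sum>\<mu>\<in>supp f. lk f \<mu> * lk (hecke_mon n t a b i \<mu>) \<xi>) \<noteq> 0"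
   using k lookup_hecke[OF i _ order_refl, of f t a b \<xi>] by (simp add: in_keys_iff)
  then obtain \<mu> where m: "\<mu> \<in> supp f" "lk f \<mu> * lk (hecke_mon n t a b i \<mu>) \<xi> \<noteq> 0"
   by (meson sum.neutral)
  then have "\<xi> \<in> supp (hecke_mon n t a b i \<mu>)" by (simp add: in_keys_iff)
  then obtain k where "in_string (pair_root n i \<mu>) k" "\<xi> = \<mu> + rootvec n i k"
   using keys_hecke_mon by blast
  moreover have "\<mu> \<in> compositions n" "submaj n \<mu> \<sigma>"
   using m(1) f by (auto simp: laurent_below_def)
  ultimately show ?thesis
   using string_submaj[OF i] submaj_trans rootvec_composition[OF i] compositions_add by blast
 qed
 then show ?thesis by (auto simp: laurent_below_def)
qed

text \<open>Interior points of a string lie in strictly smaller orbits, so only \<open>\<xi>\<close> and \<open>s\<^sub>i \<xi>\<close> contribute.\<close>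

lemma lookup_hecke_top:
 fixes f :: "'k::field laurent"
 assumes i: "i \<in> {1..n}" and f: "f \<in> laurent_below n \<sigma>" and \<xi>: "same_orbit n \<xi> \<sigma>"
 shows "lk (hecke n t a b i f) \<xi> = orbit_op n t a b i (lk f) \<xi>"
proof -
 let ?s = "refl_comp n i \<xi>" and ?H = "hecke_mon n t a b i"
 let ?A = "supp f \<union> {\<xi>, ?s}"
 have zero: "lk f \<mu> * lk (?H \<mu>) \<xi> = 0" if "\<mu> \<in> ?A - {\<xi>, ?s}" for \<mu>
 proof (rule ccontr)
  assume "\<not> ?thesis"
  then have "\<mu> \<in> supp f" "\<xi> \<in> supp (?H \<mu>)" by (auto simp: in_keys_iff)
  then obtain k where k: "in_string (pair_root n i \<mu>) k" "\<xi> = \<mu> + rootvec n i k"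
   using keys_hecke_mon by blast
  have "submaj n \<mu> \<sigma>" using f \<open>\<mu> \<in> supp f\<close> by (auto simp: laurent_below_def)
  then have "submaj n \<mu> \<xi>" using \<xi> by (meson same_orbit_sym same_orbit_submaj submaj_trans)
  moreover have "k \<noteq> 0" using that k by auto
  moreover have "k \<noteq> pair_root n i \<mu>"
   using that k by (metis DiffD2 insertCI refl_eq_rootvec refl_refl)
  ultimately show False
   using string_interior_strict[OF i k(1)] k(2)
   by (auto simp: strict_submaj_def same_orbit_iff)
 qed
 have "lk (hecke n t a b i f) \<xi> = (\<Sum>\<mu>\<in>?A. lk f \<mu> * lk (?H \<mu>) \<xi>)"
  by (rule lookup_hecke[OF i]) auto
 also have "\<dots> = (\<Sum>\<mu>\<in>{\<xi>, ?s}. lk f \<mu> * lk (?H \<mu>) \<xi>)"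
  by (rule sum.mono_neutral_right) (use zero in auto)
 also have "\<dots> = orbit_op n t a b i (lk f) \<xi>"
 proof -
  have h1: "lk (?H \<xi>) \<xi> = string_coeff n t a b i (pair_root n i \<xi>) 0"
   using lookup_hecke_mon[OF i, of t a b \<xi> 0] by simp
  have "\<xi> = ?s + rootvec n i (- pair_root n i \<xi>)"
   by (metis refl_eq_rootvec refl_refl pair_root_refl)
  then have h2: "lk (?H ?s) \<xi> = string_coeff n t a b i (- pair_root n i \<xi>) (- pair_root n i \<xi>)"
   using lookup_hecke_mon[OF i, of t a b ?s "- pair_root n i \<xi>"] by simp
  have "\<xi> \<noteq> ?s" if "pair_root n i \<xi> \<noteq> 0"
   using that by (metis pair_root_refl equal_neg_zero)
  then have ne: "(\<Sum>\<mu>\<in>{\<xi>, ?s}. lk f \<mu> * lk (?H \<mu>) \<xi>)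
    = lk f \<xi> * lk (?H \<xi>) \<xi> + lk f ?s * lk (?H ?s) \<xi>" if "pair_root n i \<xi> \<noteq> 0"
   using that by simp
  consider "pair_root n i \<xi> = 0" | "0 < pair_root n i \<xi>" | "pair_root n i \<xi> < 0" by linarith
  then show ?thesis
  proof cases
   case 1
   then have "?s = \<xi>" by (rule refl_fixed)
   then show ?thesis using 1 h1 by (simp add: orbit_op_def string_coeff_def)
  next
   case 2
   then show ?thesis using h1 h2 ne by (simp add: orbit_op_def string_coeff_def)
  next
   case 3
   then have "lk (?H \<xi>) \<xi> = eta n t a b i - 1"
    using h1 by (simp add: string_coeff_def gap_coeff_def)
   with 3 show ?thesis using h2 ne
    by (simp add: orbit_op_def string_coeff_def mult.commute)
  qed
 qed
 finally show ?thesis .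
qed

section \<open>Descending along reflections\<close>

text \<open>The pairing of \<open>\<mu>\<close> with the dominant vector \<open>(n, \<dots>, 1)\<close>, negated and shifted by a quantity that
 depends only on the orbit, so that it becomes a natural number.\<close>

definition height :: "nat \<Rightarrow> comp \<Rightarrow> nat" where
 "height n \<mu> = nat (\<Sum>j\<in>{1..n}. int n * \<bar>lk \<mu> j\<bar> - (int n + 1 - int j) * lk \<mu> j)"

lemma height_refl:
 assumes i: "i \<in> {1..n}" and d: "pair_root n i \<mu> < 0"
 shows "height n (refl_comp n i \<mu>) < height n \<mu>"
proof -
 define w where "w \<mu> = (\<Sum>j\<in>{1..n}. (int n + 1 - int j) * lk \<mu> j)" for \<mu>
 define a where "a \<mu> = (\<Sum>j\<in>{1..n}. int n * \<bar>lk \<mu> j\<bar>)" for \<mu>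
 have h: "height n \<mu> = nat (a \<mu> - w \<mu>)" for \<mu>
  by (simp add: height_def a_def w_def sum_subtractf)
 have aeq: "a (refl_comp n i \<mu>) = a \<mu>"
  unfolding a_def using sum_refl[OF i, of "\<lambda>x. int n * \<bar>x\<bar>"] by simp
 have "w (refl_comp n i \<mu>) - w \<mu> = (\<Sum>j\<in>{1..n}. (int n + 1 - int j) * (lk (refl_comp n i \<mu>) j - lk \<mu> j))"
  by (simp add: w_def sum_subtractf right_diff_distrib)
 also have "\<dots> > 0"
 proof (cases "i < n")
  case True
  have "(\<Sum>j\<in>{1..n}. (int n + 1 - int j) * (lk (refl_comp n i \<mu>) j - lk \<mu> j))
    = (\<Sum>j\<in>{i,i+1}. (int n + 1 - int j) * (lk (refl_comp n i \<mu>) j - lk \<mu> j))"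
   by (rule sum.mono_neutral_right) (use True i in \<open>auto simp: refl_lookup\<close>)
  also have "\<dots> = lk \<mu> (i+1) - lk \<mu> i" using True by (simp add: refl_lookup algebra_simps)
  finally show ?thesis using d True by (simp add: pair_root_def)
 next
  case False
  have "(\<Sum>j\<in>{1..n}. (int n + 1 - int j) * (lk (refl_comp n i \<mu>) j - lk \<mu> j))
    = (\<Sum>j\<in>{n}. (int n + 1 - int j) * (lk (refl_comp n i \<mu>) j - lk \<mu> j))"
   by (rule sum.mono_neutral_right) (use False i in \<open>auto simp: refl_lookup\<close>)
  also have "\<dots> = - 2 * lk \<mu> n" using False by (simp add: refl_lookup)
  finally show ?thesis using d False by (simp add: pair_root_def)
 qed
 finally have "w \<mu> < w (refl_comp n i \<mu>)" by simp
 moreover have "w \<nu> \<le> a \<nu>" for \<nu>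
  unfolding w_def a_def
 proof (rule sum_mono)
  fix j assume "j \<in> {1..n}"
  then have "(int n + 1 - int j) * lk \<nu> j \<le> (int n + 1 - int j) * \<bar>lk \<nu> j\<bar>"
   "(int n + 1 - int j) * \<bar>lk \<nu> j\<bar> \<le> int n * \<bar>lk \<nu> j\<bar>"
   by (auto intro!: mult_left_mono mult_right_mono)
  then show "(int n + 1 - int j) * lk \<nu> j \<le> int n * \<bar>lk \<nu> j\<bar>" by linarith
 qed
 ultimately show ?thesis unfolding h aeq using \<open>\<And>\<nu>. w \<nu> \<le> a \<nu>\<close>[of "refl_comp n i \<mu>"] aeq
  by linarith
qed

lemma is_partition_iff:
 "is_partition n \<mu> \<longleftrightarrow> \<mu> \<in> compositions n \<and> (\<forall>i\<in>{1..n}. 0 \<le> pair_root n i \<mu>)"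
proof
 assume p: "is_partition n \<mu>"
 then show "\<mu> \<in> compositions n \<and> (\<forall>i\<in>{1..n}. 0 \<le> pair_root n i \<mu>)"
  by (auto simp: is_partition_def pair_root_def)
next
 assume a: "\<mu> \<in> compositions n \<and> (\<forall>i\<in>{1..n}. 0 \<le> pair_root n i \<mu>)"
 have dec: "lk \<mu> (i+1) \<le> lk \<mu> i" if "i \<in> {1..<n}" for i
  using a[THEN conjunct2, THEN bspec[of _ _ i]] that by (auto simp: pair_root_def)
 have "0 \<le> lk \<mu> i" if "i \<in> {1..n}" for i
 proof -
  have "i \<le> n" using that by simp
  then show ?thesis using that
  proof (induction i rule: inc_induct)
   case base
   then show ?case using a[THEN conjunct2, THEN bspec[of _ _ n]] by (auto simp: pair_root_def)
  next
   case (step m)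
   then show ?case using dec[of m] by auto
  qed
 qed
 with a dec show "is_partition n \<mu>" by (auto simp: is_partition_def)
qed

text \<open>A family that starts at the partitions and is extended along the least ascent. The values are
 left abstract because the same path is followed by Laurent polynomials over two fields and by their
 coefficients on an orbit.\<close>

function path_fam :: "nat \<Rightarrow> (comp \<Rightarrow> 'v) \<Rightarrow> (nat \<Rightarrow> comp \<Rightarrow> 'v \<Rightarrow> 'v) \<Rightarrow> comp \<Rightarrow> 'v" where
 "path_fam n B st \<mu> =
   (if \<exists>i. i \<in> {1..n} \<and> pair_root n i \<mu> < 0
   then let i = (LEAST i. i \<in> {1..n} \<and> pair_root n i \<mu> < 0)
      in st i (refl_comp n i \<mu>) (path_fam n B st (refl_comp n i \<mu>))
   else B \<mu>)"
 by pat_completeness auto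
termination
proof (relation "Wellfounded.measure (\<lambda>(n, B, st, \<mu>). height n \<mu>)")
 fix n :: nat and \<mu> :: comp and i and B :: "comp \<Rightarrow> 'a" and st :: "nat \<Rightarrow> comp \<Rightarrow> 'a \<Rightarrow> 'a"
 assume ex: "\<exists>i. i \<in> {1..n} \<and> pair_root n i \<mu> < 0"
  and i: "i = (LEAST i. i \<in> {1..n} \<and> pair_root n i \<mu> < 0)"
 show "((n, B, st, refl_comp n i \<mu>), n, B, st, \<mu>) \<in> Wellfounded.measure (\<lambda>(n, B, st, \<mu>). height n \<mu>)"
  using height_refl[of i n \<mu>] LeastI_ex[OF ex] i by simp
qed simp

declare path_fam.simps [simp del]

lemma path_fam_dominant:
 assumes "\<And>i. i \<in> {1..n} \<Longrightarrow> 0 \<le> pair_root n i \<mu>"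
 shows "path_fam n B st \<mu> = B \<mu>"
proof -
 have "\<not> (\<exists>i. i \<in> {1..n} \<and> pair_root n i \<mu> < 0)" using assms by fastforce
 then show ?thesis by (subst path_fam.simps) (simp only: if_False)
qed

lemma path_fam_step:
 assumes "\<not> (\<forall>i\<in>{1..n}. 0 \<le> pair_root n i \<mu>)"
 obtains i where "i \<in> {1..n}" "pair_root n i \<mu> < 0"
  "\<And>B st. path_fam n B st \<mu> = st i (refl_comp n i \<mu>) (path_fam n B st (refl_comp n i \<mu>))"
proof -
 define i where "i = (LEAST i. i \<in> {1..n} \<and> pair_root n i \<mu> < 0)"
 have ex: "\<exists>i. i \<in> {1..n} \<and> pair_root n i \<mu> < 0" using assms by force
 have i: "i \<in> {1..n}" "pair_root n i \<mu> < 0" using LeastI_ex[OF ex] by (simp_all add: i_def)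
 have "path_fam n B st \<mu> = st i (refl_comp n i \<mu>) (path_fam n B st (refl_comp n i \<mu>))"
  for B :: "comp \<Rightarrow> 'a" and st
  using ex by (subst path_fam.simps) (simp only: if_True Let_def i_def)
 then show ?thesis using that i by blast
qed

lemma height_induct [consumes 0, case_names step]:
 assumes "\<And>\<mu>. (\<And>\<nu>. height n \<nu> < height n \<mu> \<Longrightarrow> P \<nu>) \<Longrightarrow> P \<mu>"
 shows "P \<mu>"
 using assms by (induction \<mu> rule: measure_induct_rule[of "height n"]) blast

text \<open>The step equation appears at two types so that two families can be followed in parallel.\<close>

lemma descend_induct [case_names dominant ascent]:
 assumes "\<mu> \<in> compositions n"
  and "\<And>\<mu>. is_partition n \<mu> \<Longrightarrow> P \<mu>"
  and "\<And>\<mu> i. \<mu> \<in> compositions n \<Longrightarrow> i \<in> {1..n} \<Longrightarrow> pair_root n i \<mu> < 0 \<Longrightarrow>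
      refl_comp n i \<mu> \<in> compositions n \<Longrightarrow> P (refl_comp n i \<mu>) \<Longrightarrow>
      (\<And>B (st::nat \<Rightarrow> comp \<Rightarrow> 'v \<Rightarrow> 'v). path_fam n B st \<mu> =
       st i (refl_comp n i \<mu>) (path_fam n B st (refl_comp n i \<mu>))) \<Longrightarrow>
      (\<And>B (st::nat \<Rightarrow> comp \<Rightarrow> 'w \<Rightarrow> 'w). path_fam n B st \<mu> =
       st i (refl_comp n i \<mu>) (path_fam n B st (refl_comp n i \<mu>))) \<Longrightarrow> P \<mu>"
 shows "P \<mu>"
 using assms(1)
proof (induction \<mu> rule: height_induct[of n])
 case (step \<mu>)
 show ?case
 proof (cases "is_partition n \<mu>")
  case True then show ?thesis by (rule assms(2))
 next
  case False
  then have ex: "\<exists>i. i \<in> {1..n} \<and> pair_root n i \<mu> < 0"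
   using step.prems by (force simp: is_partition_iff)
  define i where "i = (LEAST i. i \<in> {1..n} \<and> pair_root n i \<mu> < 0)"
  have i: "i \<in> {1..n}" "pair_root n i \<mu> < 0" using LeastI_ex[OF ex] by (simp_all add: i_def)
  show ?thesis
  proof (rule assms(3)[OF step.prems i])
   show r: "refl_comp n i \<mu> \<in> compositions n" by (rule refl_composition[OF i(1) step.prems])
   show "P (refl_comp n i \<mu>)" by (rule step.IH[OF height_refl[OF i] r])
  qed (use ex in \<open>subst path_fam.simps, simp only: if_True Let_def i_def\<close>)+
 qed
qed

section \<open>The coefficients of the recursion\<close>

text \<open>The excluded equations are those at which a denominator of \<open>p\<^sub>i\<close> or \<open>q\<^sub>i\<close> vanishes, or \<open>q\<^sub>i\<close> itself
 where it must not; the exponents \<open>n_exp\<close>, \<open>n_exp \<plusminus> 1\<close> and \<open>- r_exp\<close> lie in the given range.\<close>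

definition good_params :: "nat \<Rightarrow> 'k::field \<Rightarrow> 'k \<Rightarrow> 'k \<Rightarrow> 'k \<Rightarrow> 'k \<Rightarrow> bool" where
 "good_params n t a b c d \<longleftrightarrow> t \<noteq> 0 \<and> a \<noteq> 0 \<and> b \<noteq> 0 \<and>
   (\<forall>N\<in>{- 3 * int n - 3..3 * int n + 3}. a * b * c * d \<noteq> t powi N \<and> c * d \<noteq> t powi N)"

lemma n_exp_bounds:
 assumes "i \<in> {1..<n}"
 shows "n_exp n i \<mu> \<le> -1" "- 2 * int n - 1 \<le> n_exp n i \<mu>"
proof -
 have "card {l \<in> {1..<i}. lk \<mu> l = -1 \<or> lk \<mu> l = 0} \<le> card {1..<i}"
  "card {l \<in> {i+1<..n}. lk \<mu> l = 0} \<le> card {i+1<..n}"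
  by (rule card_mono; auto)+
 then show "n_exp n i \<mu> \<le> -1" "- 2 * int n - 1 \<le> n_exp n i \<mu>"
  using assms by (auto simp: n_exp_def)
qed

definition small_count :: "nat \<Rightarrow> comp \<Rightarrow> nat" where
 "small_count m \<mu> = card {l \<in> {1..m}. lk \<mu> l = -1 \<or> lk \<mu> l = 0}"

lemma mult_small_count: "Defs.mult n (-1) \<mu> + Defs.mult n 0 \<mu> = small_count n \<mu>"
proof -
 have "{l \<in> {1..n}. lk \<mu> l = -1 \<or> lk \<mu> l = 0} = {l \<in> {1..n}. lk \<mu> l = -1} \<union> {l \<in> {1..n}. lk \<mu> l = 0}"
  by auto
 moreover have "card ({l \<in> {1..n}. lk \<mu> l = -1} \<union> {l \<in> {1..n}. lk \<mu> l = 0})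
  = card {l \<in> {1..n}. lk \<mu> l = -1} + card {l \<in> {1..n}. lk \<mu> l = 0}"
  by (rule card_Un_disjoint) auto
 ultimately show ?thesis by (simp add: small_count_def Defs.mult_def)
qed

lemma small_count_Suc:
 "small_count (Suc m) \<mu> = small_count m \<mu> + (if lk \<mu> (Suc m) \<in> {-1, 0} then 1 else 0)"
proof -
 have "{l \<in> {1..Suc m}. lk \<mu> l = -1 \<or> lk \<mu> l = 0} =
  (if lk \<mu> (Suc m) \<in> {-1, 0} then insert (Suc m) {l \<in> {1..m}. lk \<mu> l = -1 \<or> lk \<mu> l = 0}
   else {l \<in> {1..m}. lk \<mu> l = -1 \<or> lk \<mu> l = 0})" by (auto simp: le_Suc_eq)
 then show ?thesis by (simp add: small_count_def)
qed

lemma small_count_cong: "(\<And>l. l \<in> {1..m} \<Longrightarrow> lk \<mu> l = lk \<nu> l) \<Longrightarrow> small_count m \<mu> = small_count m \<nu>"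
 unfolding small_count_def by (rule arg_cong[of _ _ card]) auto

definition zero_count :: "nat \<Rightarrow> nat \<Rightarrow> comp \<Rightarrow> nat" where
 "zero_count n m \<mu> = card {l \<in> {m..n}. lk \<mu> l = 0}"

lemma zero_count_step:
 assumes "m \<le> n"
 shows "zero_count n m \<mu> = (if lk \<mu> m = 0 then 1 else 0) + zero_count n (Suc m) \<mu>"
proof -
 have "{l \<in> {m..n}. lk \<mu> l = 0} = (if lk \<mu> m = 0 then insert m {l \<in> {Suc m..n}. lk \<mu> l = 0}
  else {l \<in> {Suc m..n}. lk \<mu> l = 0})"
 proof -
  have "{m..n} = insert m {Suc m..n}" using assms by auto
  then show ?thesis by auto
 qed
 then show ?thesis by (simp add: zero_count_def)
qed

lemma zero_count_cong: "(\<And>l. l \<in> {m..n} \<Longrightarrow> lk \<mu> l = lk \<nu> l) \<Longrightarrow> zero_count n m \<mu> = zero_count n m \<nu>"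
 unfolding zero_count_def by (rule arg_cong[of _ _ card]) auto

lemma n_exp_counts: "n_exp n i \<mu> = - int (small_count (i - 1) \<mu>) - 2 * int (zero_count n (i + 2) \<mu>) - 1"
proof -
 have "{1..<i} = {1..i-1}" "{i+1<..n} = {i+2..n}" by auto
 then show ?thesis by (simp add: n_exp_def small_count_def zero_count_def)
qed

lemma count_swap:
 assumes "j < n" "j \<in> A \<longleftrightarrow> j + 1 \<in> A"
 shows "card {l \<in> A. P (lk (refl_comp n j \<mu>) l)} = card {l \<in> A. P (lk \<mu> l)}"
 by (rule bij_betw_same_card[of "\<lambda>l. if l = j then j+1 else if l = j+1 then j else l"],
   rule bij_betw_byWitness[where f' = "\<lambda>l. if l = j then j+1 else if l = j+1 then j else l"])
   (use assms in \<open>auto simp: refl_lookup\<close>)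

lemma n_exp_far:
 assumes "i < n" "j \<in> {1..n}" "j + 1 < i \<or> i + 1 < j \<or> j = i"
 shows "n_exp n i (refl_comp n j \<mu>) = n_exp n i \<mu>"
proof -
 have 1: "card {l \<in> {1..<i}. lk (refl_comp n j \<mu>) l = -1 \<or> lk (refl_comp n j \<mu>) l = 0}
   = card {l \<in> {1..<i}. lk \<mu> l = -1 \<or> lk \<mu> l = 0}"
 proof (cases "j + 1 < i")
  case True
  then show ?thesis using assms by (intro count_swap[of j n _ "\<lambda>x. x = -1 \<or> x = 0"]) auto
 next
  case False
  then show ?thesis using assms by (intro arg_cong[of _ _ card]) (auto simp: refl_lookup)
 qed
 have 2: "card {l \<in> {i+1<..n}. lk (refl_comp n j \<mu>) l = 0} = card {l \<in> {i+1<..n}. lk \<mu> l = 0}"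
 proof (cases "i + 1 < j \<and> j < n")
  case True
  then show ?thesis using assms by (intro count_swap[of j n _ "\<lambda>x. x = 0"]) auto
 next
  case False
  then show ?thesis using assms by (intro arg_cong[of _ _ card]) (auto simp: refl_lookup)
 qed
 show ?thesis unfolding n_exp_def 1 2 ..
qed

lemma r_exp_alt: "r_exp n \<mu> = int (small_count n \<mu>) - (if lk \<mu> n = 1 then 0 else 1)"
 using mult_small_count[of n \<mu>] by (auto simp: r_exp_def)

lemma r_exp_far:
 assumes "j + 1 < n" "1 \<le> j"
 shows "r_exp n (refl_comp n j \<mu>) = r_exp n \<mu>"
proof -
 have "small_count n (refl_comp n j \<mu>) = small_count n \<mu>" unfolding small_count_def
  by (rule count_swap[of j n _ "\<lambda>x. x = -1 \<or> x = 0"]) (use assms in auto)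
 moreover have "lk (refl_comp n j \<mu>) n = lk \<mu> n" using assms by (simp add: refl_lookup)
 ultimately show ?thesis unfolding r_exp_alt by simp
qed

lemma r_exp_flip:
 assumes "lk \<mu> n = 1" "1 \<le> n"
 shows "r_exp n (refl_comp n n \<mu>) = r_exp n \<mu>"
proof -
 obtain m where m: "n = Suc m" using assms by (cases n) auto
 have "small_count m (refl_comp n n \<mu>) = small_count m \<mu>"
  by (rule small_count_cong) (auto simp: refl_lookup m)
 then show ?thesis using assms unfolding r_exp_alt unfolding m
  by (simp add: small_count_Suc refl_lookup)
qed

lemma coeff_far:
 assumes "i \<in> {1..n}" "j \<in> {1..n}" "j + 1 < i \<or> i + 1 < j"
 shows "p_coeff n t a b c d i (refl_comp n j \<mu>) = p_coeff n t a b c d i \<mu>"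
  "q_coeff n t a b c d i (refl_comp n j \<mu>) = q_coeff n t a b c d i \<mu>"
proof -
 have e: "lk (refl_comp n j \<mu>) i = lk \<mu> i" "i < n \<Longrightarrow> lk (refl_comp n j \<mu>) (i+1) = lk \<mu> (i+1)"
  using assms by (auto simp: refl_lookup)
 have "p_coeff n t a b c d i (refl_comp n j \<mu>) = p_coeff n t a b c d i \<mu> \<and>
  q_coeff n t a b c d i (refl_comp n j \<mu>) = q_coeff n t a b c d i \<mu>"
 proof (cases "i < n")
  case True
  then show ?thesis using e n_exp_far[OF True assms(2), of \<mu>] assms
   by (auto simp: p_coeff_def q_coeff_def)
 next
  case False
  then have "i = n" using assms by auto
  then show ?thesis using e r_exp_far[of j n \<mu>] assms
   by (simp add: p_coeff_def q_coeff_def pn_coeff_def qn_coeff_def)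
 qed
 then show "p_coeff n t a b c d i (refl_comp n j \<mu>) = p_coeff n t a b c d i \<mu>"
  "q_coeff n t a b c d i (refl_comp n j \<mu>) = q_coeff n t a b c d i \<mu>" by auto
qed

text \<open>For an upper member of a two-element string the pair of coefficients is either the
 standard pair \<open>(0, 1)\<close> or one of two special ones.\<close>

lemma coeff_upper:
 assumes "i \<in> {1..n}" "0 < pair_root n i \<mu>"
 shows "i < n \<Longrightarrow> (lk \<mu> i, lk \<mu> (i+1)) \<noteq> (0, -1) \<Longrightarrow> p_coeff n t a b c d i \<mu> = 0"
  "i < n \<Longrightarrow> (lk \<mu> i, lk \<mu> (i+1)) \<noteq> (0, -1) \<Longrightarrow> q_coeff n t a b c d i \<mu> = 1"
  "i = n \<Longrightarrow> lk \<mu> n \<noteq> 1 \<Longrightarrow> p_coeff n t a b c d i \<mu> = 0"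
  "i = n \<Longrightarrow> lk \<mu> n \<noteq> 1 \<Longrightarrow> q_coeff n t a b c d i \<mu> = 1"
 using assms by (auto simp: pair_root_def p_coeff_def q_coeff_def pn_coeff_def qn_coeff_def Let_def)

lemma coeff_special_swap:
 fixes t a b c d :: "'k::field"
 assumes "i < n" "lk \<mu> i = 0" "lk \<mu> (i+1) = -1"
 defines "s \<equiv> a * b * c * d" and "w \<equiv> t powi n_exp n i \<mu>"
 shows "p_coeff n t a b c d i \<mu> = (t - 1) * s / (s - w)"
  "t \<noteq> 0 \<Longrightarrow> q_coeff n t a b c d i \<mu> = 1 - (1 - t)^2 * s * w / (t * (s - w)^2)"
 using assms by (auto simp: p_coeff_def q_coeff_def Let_def power_int_diff)

lemma coeff_special_flip:
 fixes t a b c d :: "'k::field"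
 assumes "lk \<mu> n = 1"
 defines "s \<equiv> a * b * c * d" and "w \<equiv> t powi r_exp n \<mu>"
 shows "p_coeff n t a b c d n \<mu> = - s * w"
  "q_coeff n t a b c d n \<mu> = (1 - c * d * w) * (1 - s * w)"
 using assms by (auto simp: p_coeff_def q_coeff_def pn_coeff_def qn_coeff_def Let_def algebra_simps)

lemma coeff_fixed:
 assumes "i \<in> {1..n}" "pair_root n i \<mu> = 0"
 shows "p_coeff n t a b c d i \<mu> = eta n t a b i" "q_coeff n t a b c d i \<mu> = 0"
 using assms by (auto simp: pair_root_def p_coeff_def q_coeff_def pn_coeff_def qn_coeff_def
   Let_def eta_def split: if_splits)

text \<open>The pair of coefficients at \<open>s\<^sub>i \<mu>\<close> is forced by that at \<open>\<mu>\<close>: on the span of \<open>E\<^sub>\<mu>\<close> and \<open>E\<^bsub>s\<^sub>i \<mu>\<^esub>\<close> the operator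
 \<open>T\<^sub>i\<close> has trace \<open>eta - 1\<close> and determinant \<open>- eta\<close>.\<close>

lemma coeff_lower:
 assumes i: "i \<in> {1..n}" and d: "0 < pair_root n i \<mu>" and g: "good_params n t a b c d"
 defines "\<nu> \<equiv> refl_comp n i \<mu>"
 shows "p_coeff n t a b c d i \<nu> = eta n t a b i - 1 - p_coeff n t a b c d i \<mu>" (is ?p)
  "q_coeff n t a b c d i \<nu> = eta n t a b i" (is ?q)
  "(eta n t a b i - p_coeff n t a b c d i \<mu>) * (1 + p_coeff n t a b c d i \<mu>)
    = eta n t a b i * q_coeff n t a b c d i \<mu>" (is ?r)
  "q_coeff n t a b c d i \<mu> \<noteq> 0" (is ?z)
  "eta n t a b i \<noteq> 0" (is ?e)
proof -
 have t0: "t \<noteq> 0" and e0: ?e using g by (auto simp: good_params_def eta_def)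
 then show ?e by blast
 have "?p \<and> ?q \<and> ?r \<and> ?z"
 proof (cases "i < n")
  case True
  have e: "eta n t a b i = t" using True by (simp add: eta_def)
  have n: "n_exp n i \<nu> = n_exp n i \<mu>" unfolding \<nu>_def by (rule n_exp_far) (use i True in auto)
  have v: "lk \<nu> i = lk \<mu> (i+1)" "lk \<nu> (i+1) = lk \<mu> i" using True by (simp_all add: \<nu>_def refl_lookup)
  have lt: "lk \<nu> i < lk \<nu> (i+1)" using d True v by (simp add: pair_root_def)
  show ?thesis
  proof (cases "lk \<mu> i = 0 \<and> lk \<mu> (i+1) = -1")
   case False
   then show ?thesis using coeff_upper(1,2)[OF i d True, of t a b c d] True v lt e
    by (auto simp: p_coeff_def q_coeff_def Let_def)
  next
   case special: True
   define s w where "s = a * b * c * d" and "w = t powi n_exp n i \<mu>"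
   have bd: "n_exp n i \<mu> \<le> -1" "- 2 * int n - 1 \<le> n_exp n i \<mu>"
    using n_exp_bounds[of i n \<mu>] i True by auto
   have pw: "w * t = t powi (n_exp n i \<mu> + 1)" "w / t = t powi (n_exp n i \<mu> - 1)"
    using t0 by (simp_all add: w_def power_int_add power_int_diff)
   have ne: "s \<noteq> w" "s \<noteq> w * t" "s \<noteq> w / t"
    unfolding pw using g bd by (auto simp: good_params_def s_def w_def)
   have p: "p_coeff n t a b c d i \<mu> = (t - 1) * s / (s - w)"
    and q: "q_coeff n t a b c d i \<mu> = 1 - (1 - t)^2 * s * w / (t * (s - w)^2)"
    using coeff_special_swap[of i n \<mu> t a b c d] True special t0 by (auto simp: s_def w_def)
   have p': "p_coeff n t a b c d i \<nu> = (1 - t) * w / (s - w)"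
    using True special v by (auto simp: p_coeff_def Let_def n s_def w_def)
   have q': "q_coeff n t a b c d i \<nu> = t"
    using True lt by (simp add: q_coeff_def Let_def)
   have sw: "s - w \<noteq> 0" using ne by simp
   have q2: "q_coeff n t a b c d i \<mu> = (s - t * w) * (t * s - w) / (t * (s - w)^2)"
    unfolding q using sw t0 by (simp add: divide_simps) (simp add: power2_eq_square algebra_simps)
   have "t * s \<noteq> w" using ne(3) t0 by (auto simp: field_simps)
   then have "?z" using q2 sw t0 ne(2) by (simp add: mult.commute)
   moreover have ?p unfolding p p' e using sw by (simp add: divide_simps) (simp add: algebra_simps)
   moreover have ?r unfolding p q2 e using sw t0
    by (simp add: divide_simps) (simp add: power2_eq_square algebra_simps)
   ultimately show ?thesis using q' e by simp
  qed
 next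
  case False
  then have in': "i = n" using i by auto
  have e: "eta n t a b i = - (a * b)" using in' by (simp add: eta_def)
  have pos: "0 < lk \<mu> n" using d in' by (simp add: pair_root_def)
  have v: "lk \<nu> n = - lk \<mu> n" using in' by (simp add: \<nu>_def refl_lookup)
  show ?thesis
  proof (cases "lk \<mu> n = 1")
   case False
   then show ?thesis using coeff_upper(3,4)[OF i d in', of t a b c d] in' v pos e
    by (auto simp: p_coeff_def q_coeff_def pn_coeff_def qn_coeff_def Let_def)
  next
   case special: True
   define s w where "s = a * b * c * d" and "w = t powi r_exp n \<mu>"
   have r: "r_exp n \<nu> = r_exp n \<mu>"
    using r_exp_flip[of \<mu> n] special i in' by (auto simp: \<nu>_def)
   have "small_count n \<mu> \<le> card {1..n}" unfolding small_count_def by (rule card_mono) auto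
   then have rb: "0 \<le> r_exp n \<mu>" "r_exp n \<mu> \<le> int n" using special by (auto simp: r_exp_alt)
   have p: "p_coeff n t a b c d i \<mu> = - s * w"
    and q: "q_coeff n t a b c d i \<mu> = (1 - c * d * w) * (1 - s * w)"
    using coeff_special_flip[of \<mu> n t a b c d] special in' by (auto simp: s_def w_def)
   have p': "p_coeff n t a b c d i \<nu> = - a * b - 1 + s * w"
    using in' special v by (simp add: p_coeff_def pn_coeff_def Let_def r s_def w_def)
   have q': "q_coeff n t a b c d i \<nu> = - (a * b)"
    using in' special v by (simp add: q_coeff_def qn_coeff_def Let_def)
   have "1 / w = t powi (- r_exp n \<mu>)" by (simp add: w_def power_int_minus divide_inverse)
   then have "s \<noteq> 1 / w" "c * d \<noteq> 1 / w"
    using g rb by (auto simp: good_params_def s_def)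
   moreover have "w \<noteq> 0" using t0 by (simp add: w_def)
   ultimately have "1 - s * w \<noteq> 0" "1 - c * d * w \<noteq> 0" by (auto simp: field_simps)
   then have "?z" unfolding q by simp
   moreover have ?r unfolding p q e by (simp add: s_def algebra_simps)
   ultimately show ?thesis using p p' q' e by simp
  qed
 qed
 then show ?p ?q ?r ?z by auto
qed

section \<open>The Hecke algebra acting on the orbits\<close>

lemma orbit_op_linear:
 "orbit_op n t a b i (\<lambda>\<xi>. x * f \<xi> + y * g \<xi>) = (\<lambda>\<xi>. x * orbit_op n t a b i f \<xi> + y * orbit_op n t a b i g \<xi>)"
 by (rule ext) (simp add: orbit_op_def algebra_simps)

lemma orbit_op_quadratic:
 "orbit_op n t a b i (orbit_op n t a b i f)
  = (\<lambda>\<xi>. (eta n t a b i - 1) * orbit_op n t a b i f \<xi> + eta n t a b i * f \<xi>)"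
proof
 fix \<xi>
 consider "pair_root n i \<xi> = 0" | "0 < pair_root n i \<xi>" | "pair_root n i \<xi> < 0" by linarith
 then show "orbit_op n t a b i (orbit_op n t a b i f) \<xi>
   = (eta n t a b i - 1) * orbit_op n t a b i f \<xi> + eta n t a b i * f \<xi>"
  by cases (use refl_fixed[of n i \<xi>] in \<open>simp_all add: orbit_op_def algebra_simps\<close>)
qed

lemma orbit_op_symmetric:
 assumes "\<And>\<xi>. f (refl_comp n i \<xi>) = f \<xi>"
 shows "orbit_op n t a b i f = (\<lambda>\<xi>. eta n t a b i * f \<xi>)"
 using assms by (auto simp: orbit_op_def algebra_simps)

lemma refl_far:
 assumes "i + 1 < j" "j \<le> n"
 shows "refl_comp n i (refl_comp n j \<xi>) = refl_comp n j (refl_comp n i \<xi>)"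
 by (rule poly_mapping_eqI) (use assms in \<open>auto simp: refl_lookup\<close>)

lemma pair_root_far:
 assumes "i + 1 < j \<or> j + 1 < i" "i \<le> n" "j \<le> n"
 shows "pair_root n i (refl_comp n j \<xi>) = pair_root n i \<xi>"
 using assms by (auto simp: pair_root_def refl_lookup)

lemma orbit_op_far:
 assumes "i + 1 < j" "j \<le> n"
 shows "orbit_op n t a b i (orbit_op n t a b j f) = orbit_op n t a b j (orbit_op n t a b i f)"
 by (rule ext) (use assms in \<open>simp add: orbit_op_def pair_root_far refl_far[OF assms] algebra_simps\<close>)

lemma refl_braid3:
 assumes "k + 1 < n"
 shows "refl_comp n k (refl_comp n (k+1) (refl_comp n k \<xi>)) = refl_comp n (k+1) (refl_comp n k (refl_comp n (k+1) \<xi>))"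
 by (rule poly_mapping_eqI) (use assms in \<open>auto simp: refl_lookup\<close>)

lemma orbit_op_braid3:
 assumes k: "k + 1 < n"
 shows "orbit_op n t a b k (orbit_op n t a b (k+1) (orbit_op n t a b k f))
    = orbit_op n t a b (k+1) (orbit_op n t a b k (orbit_op n t a b (k+1) f))"
proof
 fix \<xi> :: comp
 define x y z where "x = lk \<xi> k" "y = lk \<xi> (k+1)" "z = lk \<xi> (k+2)"
 let ?s = "refl_comp n k" and ?r = "refl_comp n (k+1)"
 have P: "pair_root n k \<xi> = x - y" "pair_root n (k+1) \<xi> = y - z"
  "pair_root n (k+1) (?s \<xi>) = x - z" "pair_root n k (?r \<xi>) = x - z"
  "pair_root n k (?r (?s \<xi>)) = y - z" "pair_root n (k+1) (?s (?r \<xi>)) = x - y"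
  using k by (auto simp: pair_root_def refl_lookup x_y_z_def)
 have E: "eta n t a b k = t" "eta n t a b (k+1) = t" using k by (auto simp: eta_def)
 have br: "?s (?r (?s \<xi>)) = ?r (?s (?r \<xi>))" by (rule refl_braid3[OF k])
 have d1: "?s \<xi> = \<xi>" if "x = y" using that refl_fixed[of n k \<xi>] P by simp
 have d2: "?r \<xi> = \<xi>" if "y = z" using that refl_fixed[of n "k+1" \<xi>] P by simp
 have d3: "?r (?s \<xi>) = ?s \<xi>" "?s (?r \<xi>) = ?r \<xi>" if "x = z"
  using that refl_fixed[of n "k+1" "?s \<xi>"] refl_fixed[of n k "?r \<xi>"] P by simp_all
 have d4: "?s (?r (?s \<xi>)) = ?r (?s \<xi>)" if "y = z"
  using that refl_fixed[of n k "?r (?s \<xi>)"] P by simp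
 have d5: "?r (?s (?r \<xi>)) = ?s (?r \<xi>)" if "x = y"
  using that refl_fixed[of n "k+1" "?s (?r \<xi>)"] P by simp
 consider "x < y" | "x = y" | "x > y" by linarith
 then show "orbit_op n t a b k (orbit_op n t a b (k+1) (orbit_op n t a b k f)) \<xi>
    = orbit_op n t a b (k+1) (orbit_op n t a b k (orbit_op n t a b (k+1) f)) \<xi>"
  unfolding orbit_op_def[of n t a b k] orbit_op_def[of n t a b "k+1"] E pair_root_refl P refl_refl
  using d1 d2 d3 d4 d5 br
  apply cases
  subgoal by (cases y z rule: linorder_cases; cases x z rule: linorder_cases) (simp_all add: algebra_simps)
  subgoal by (cases y z rule: linorder_cases) (simp_all add: algebra_simps)
  subgoal by (cases y z rule: linorder_cases; cases x z rule: linorder_cases) (simp_all add: algebra_simps)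
  done
qed

lemma refl_braid4:
 assumes "n = Suc k"
 shows "refl_comp n k (refl_comp n n (refl_comp n k (refl_comp n n \<xi>)))
    = refl_comp n n (refl_comp n k (refl_comp n n (refl_comp n k \<xi>)))"
 by (rule poly_mapping_eqI) (use assms in \<open>auto simp: refl_lookup\<close>)

lemma orbit_op_braid4:
 assumes k: "n = Suc k"
 shows "orbit_op n t a b k (orbit_op n t a b n (orbit_op n t a b k (orbit_op n t a b n f)))
    = orbit_op n t a b n (orbit_op n t a b k (orbit_op n t a b n (orbit_op n t a b k f)))"
proof
 fix \<xi> :: comp
 define x y where "x = lk \<xi> k" "y = lk \<xi> n"
 let ?s = "refl_comp n k" and ?r = "refl_comp n n"
 have P: "pair_root n k \<xi> = x - y" "pair_root n n \<xi> = 2 * y"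
  "pair_root n n (?s \<xi>) = 2 * x" "pair_root n k (?r \<xi>) = x + y"
  "pair_root n k (?r (?s \<xi>)) = y + x" "pair_root n n (?s (?r \<xi>)) = 2 * x"
  "pair_root n n (?s (?r (?s \<xi>))) = 2 * y" "pair_root n k (?r (?s (?r \<xi>))) = x - y"
  using k by (auto simp: pair_root_def refl_lookup x_y_def)
 define h where "h = eta n t a b n"
 have E: "eta n t a b k = t" "eta n t a b n = h" using k by (auto simp: eta_def h_def)
 have br: "?s (?r (?s (?r \<xi>))) = ?r (?s (?r (?s \<xi>)))" by (rule refl_braid4[OF k])
 have d1: "?s \<xi> = \<xi>" "?s (?r (?s (?r \<xi>))) = ?r (?s (?r \<xi>))" if "x = y"
  using that refl_fixed[of n k \<xi>] refl_fixed[of n k "?r (?s (?r \<xi>))"] P by simp_all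
 have d2: "?r \<xi> = \<xi>" "?r (?s (?r (?s \<xi>))) = ?s (?r (?s \<xi>))" if "y = 0"
  using that refl_fixed[of n n \<xi>] refl_fixed[of n n "?s (?r (?s \<xi>))"] P by simp_all
 have d3: "?r (?s \<xi>) = ?s \<xi>" "?r (?s (?r \<xi>)) = ?s (?r \<xi>)" if "x = 0"
  using that refl_fixed[of n n "?s \<xi>"] refl_fixed[of n n "?s (?r \<xi>)"] P by simp_all
 have d4: "?s (?r \<xi>) = ?r \<xi>" "?s (?r (?s \<xi>)) = ?r (?s \<xi>)" if "x + y = 0"
  using that refl_fixed[of n k "?r \<xi>"] refl_fixed[of n k "?r (?s \<xi>)"] P by (simp_all add: add.commute)
 have c: "(0 \<le> x - y) = (y \<le> x)" "(0 \<le> - (x - y)) = (x \<le> y)" "(0 \<le> 2 * y) = (0 \<le> y)"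
  "(0 \<le> - (2 * y)) = (y \<le> 0)" "(0 \<le> 2 * x) = (0 \<le> x)" "(0 \<le> - (2 * x)) = (x \<le> 0)"
  "(0 \<le> y + x) = (- y \<le> x)" "(0 \<le> x + y) = (- y \<le> x)" "(0 \<le> - (y + x)) = (x \<le> - y)"
  "(0 \<le> - (x + y)) = (x \<le> - y)" by auto
 have "(x < y \<or> x = y \<or> y < x) \<and> (y < 0 \<or> y = 0 \<or> 0 < y) \<and> (x < 0 \<or> x = 0 \<or> 0 < x)
   \<and> (x < - y \<or> x = - y \<or> - y < x)" by linarith
 then show "orbit_op n t a b k (orbit_op n t a b n (orbit_op n t a b k (orbit_op n t a b n f))) \<xi>
    = orbit_op n t a b n (orbit_op n t a b k (orbit_op n t a b n (orbit_op n t a b k f))) \<xi>"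
  unfolding orbit_op_def[of n t a b k] orbit_op_def[of n t a b n] E pair_root_refl P refl_refl c
  using d1 d2 d3 d4 br
  by (elim conjE disjE) (simp_all add: algebra_simps)
qed

section \<open>Rank two computations\<close>

text \<open>The solution \<open>f'\<close> of \<open>A f = p f + q f'\<close>.\<close>

definition step_op :: "(('x \<Rightarrow> 'k::field) \<Rightarrow> 'x \<Rightarrow> 'k) \<Rightarrow> 'k \<Rightarrow> 'k \<Rightarrow> ('x \<Rightarrow> 'k) \<Rightarrow> 'x \<Rightarrow> 'k" where
 "step_op A p q f = (\<lambda>\<xi>. (A f \<xi> - p * f \<xi>) / q)"

locale linear_op =
 fixes A :: "('x \<Rightarrow> 'k::field) \<Rightarrow> 'x \<Rightarrow> 'k"
 assumes lin: "A (\<lambda>\<xi>. x * f \<xi> + y * g \<xi>) = (\<lambda>\<xi>. x * A f \<xi> + y * A g \<xi>)"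
begin

lemma lin_scale: "A (\<lambda>\<xi>. x * f \<xi>) = (\<lambda>\<xi>. x * A f \<xi>)"
 using lin[of x f 0 f] by simp

lemma lin_step: "A (\<lambda>\<xi>. (f \<xi> - p * g \<xi>) / q) = (\<lambda>\<xi>. (A f \<xi> - p * A g \<xi>) / q)"
 using lin[of "1/q" f "-p/q" g] by (simp add: diff_divide_distrib mult.commute)

end

text \<open>Let \<open>A\<close> and \<open>B\<close> be two generators of the Hecke algebra. If \<open>v\<close> belongs to the lowest element of a
 coset of the rank two group, the steps along the two reduced words to the highest element give the
 same vector; if \<open>v\<close> is an eigenvector of one generator for the eigenvalue of invariants, so is the vector
 at the other end for the corresponding generator. The hypotheses on \<open>p\<close>, \<open>p'\<close> and \<open>r\<close> are what the special coefficients satisfy.\<close>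

lemma rank2_commute:
 assumes "linear_op A" "linear_op B" and AB: "\<And>v. A (B v) = B (A v)"
 shows "step_op A p q (step_op B p' q' v) = step_op B p' q' (step_op A p q v)"
  and "A v = (\<lambda>\<xi>. h * v \<xi>) \<Longrightarrow> A (step_op B p' q' v) = (\<lambda>\<xi>. h * step_op B p' q' v \<xi>)"
proof -
 interpret A: linear_op A by fact
 interpret B: linear_op B by fact
 show "step_op A p q (step_op B p' q' v) = step_op B p' q' (step_op A p q v)"
  unfolding step_op_def A.lin_step B.lin_step AB
  by (rule ext) (cases "q = 0"; cases "q' = 0"; simp add: field_simps)
 assume v: "A v = (\<lambda>\<xi>. h * v \<xi>)"
 show "A (step_op B p' q' v) = (\<lambda>\<xi>. h * step_op B p' q' v \<xi>)"
  unfolding step_op_def A.lin_step AB v B.lin_scale by (rule ext) (simp add: algebra_simps)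
qed

lemma rank2_braid3_regular:
 assumes "linear_op A" "linear_op B" and br: "\<And>v. A (B (A v)) = B (A (B v))"
  and p: "p = 0 \<or> r = 0"
 shows "step_op A r q'' (step_op B 0 q' (step_op A p q v))
    = step_op B p q (step_op A 0 q' (step_op B r q'' v))"
proof -
 interpret A: linear_op A by fact
 interpret B: linear_op B by fact
 show ?thesis using p
  unfolding step_op_def A.lin_step B.lin_step br
  by (intro ext; elim disjE) (cases "q = 0"; cases "q' = 0"; cases "q'' = 0"; simp add: field_simps)+
qed

lemma rank2_braid3_fixed:
 assumes "linear_op A" "linear_op B" and br: "\<And>v. A (B (A v)) = B (A (B v))"
  and quad: "\<And>v. A (A v) = (\<lambda>\<xi>. (h - 1) * A v \<xi> + h * v \<xi>)"
  and v: "B v = (\<lambda>\<xi>. h * v \<xi>)" and p: "p' * (1 + p) = h * p"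
 shows "A (step_op B p' q' (step_op A p q v)) = (\<lambda>\<xi>. h * step_op B p' q' (step_op A p q v) \<xi>)"
proof -
 interpret A: linear_op A by fact
 interpret B: linear_op B by fact
 have br': "A (B (A v)) = (\<lambda>\<xi>. h * B (A v) \<xi>)"
  unfolding br v A.lin_scale B.lin_scale ..
 show ?thesis
 proof
  fix \<xi>
  let ?l = "(h * B (A v) \<xi> - p * (h * A v \<xi>)) - p' * (((h - 1) * A v \<xi> + h * v \<xi>) - p * A v \<xi>)"
  let ?r = "h * ((B (A v) \<xi> - p * (h * v \<xi>)) - p' * (A v \<xi> - p * v \<xi>))"
  have "?l - ?r = (A v \<xi> - h * v \<xi>) * (p' * (1 + p) - h * p)" by (simp add: algebra_simps)
  then have eq: "?l = ?r" using p by simp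
  show "A (step_op B p' q' (step_op A p q v)) \<xi> = h * step_op B p' q' (step_op A p q v) \<xi>"
   unfolding step_op_def A.lin_step B.lin_step br' quad v A.lin_scale
   by (simp only: times_divide_eq_right diff_divide_distrib[symmetric] eq)
 qed
qed

lemma rank2_braid4_regular:
 assumes "linear_op A" "linear_op B" and br: "\<And>v. A (B (A (B v))) = B (A (B (A v)))"
 shows "step_op B p q (step_op A 0 1 (step_op B 0 1 (step_op A 0 1 v)))
    = step_op A 0 1 (step_op B 0 1 (step_op A 0 1 (step_op B p q v)))"
proof -
 interpret A: linear_op A by fact
 interpret B: linear_op B by fact
 have s: "step_op A 0 1 v = A v" "step_op B 0 1 v = B v" for v by (simp_all add: step_op_def)
 show ?thesis unfolding s unfolding step_op_def A.lin_step B.lin_step br ..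
qed

lemma rank2_braid4_equal:
 assumes "linear_op A" "linear_op B" and br: "\<And>v. A (B (A (B v))) = B (A (B (A v)))"
  and quad: "\<And>v. A (A v) = (\<lambda>\<xi>. (h - 1) * A v \<xi> + h * v \<xi>)"
  and v: "A v = (\<lambda>\<xi>. h * v \<xi>)" and p: "p' = h * p"
 shows "A (step_op B p' q' (step_op A 0 1 (step_op B p q v)))
    = (\<lambda>\<xi>. h * step_op B p' q' (step_op A 0 1 (step_op B p q v)) \<xi>)"
proof -
 interpret A: linear_op A by fact
 interpret B: linear_op B by fact
 have s: "step_op A 0 1 v = A v" for v by (simp add: step_op_def)
 have br': "A (B (A (B v))) = (\<lambda>\<xi>. h * B (A (B v)) \<xi>)"
  unfolding br v A.lin_scale B.lin_scale ..
 show ?thesis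
  unfolding s unfolding step_op_def A.lin_step B.lin_step br' unfolding quad v B.lin_scale A.lin_scale p
  by (rule ext) (cases "q = 0"; cases "q' = 0"; simp add: field_simps)
qed

lemma rank2_braid4_zero:
 assumes "linear_op A" "linear_op B" and br: "\<And>v. A (B (A (B v))) = B (A (B (A v)))"
  and quadA: "\<And>v. A (A v) = (\<lambda>\<xi>. (t - 1) * A v \<xi> + t * v \<xi>)"
  and quadB: "\<And>v. B (B v) = (\<lambda>\<xi>. (h - 1) * B v \<xi> + h * v \<xi>)"
  and v: "B v = (\<lambda>\<xi>. h * v \<xi>)" and p: "p' * (1 + p) = (t - 1) * p"
 shows "B (step_op A p' q' (step_op B p q (step_op A 0 1 v)))
    = (\<lambda>\<xi>. h * step_op A p' q' (step_op B p q (step_op A 0 1 v)) \<xi>)"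
proof -
 interpret A: linear_op A by fact
 interpret B: linear_op B by fact
 have s: "step_op A 0 1 v = A v" for v by (simp add: step_op_def)
 have br': "B (A (B (A v))) = (\<lambda>\<xi>. h * A (B (A v)) \<xi>)"
  unfolding br[symmetric] v A.lin_scale B.lin_scale ..
 show ?thesis
 proof
  fix \<xi>
  let ?l = "(h * A (B (A v)) \<xi> - p * ((t - 1) * B (A v) \<xi> + t * (h * v \<xi>)))
     - p' * (((h - 1) * B (A v) \<xi> + h * A v \<xi>) - p * B (A v) \<xi>)"
  let ?r = "h * ((A (B (A v)) \<xi> - p * ((t - 1) * A v \<xi> + t * v \<xi>)) - p' * (B (A v) \<xi> - p * A v \<xi>))"
  have "?l - ?r = (B (A v) \<xi> - h * A v \<xi>) * (p' * (1 + p) - (t - 1) * p)" by (simp add: algebra_simps)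
  then have eq: "?l = ?r" using p by simp
  show "B (step_op A p' q' (step_op B p q (step_op A 0 1 v))) \<xi>
    = h * step_op A p' q' (step_op B p q (step_op A 0 1 v)) \<xi>"
   unfolding s unfolding step_op_def A.lin_step B.lin_step br'
   unfolding quadA quadB B.lin v
   by (simp only: times_divide_eq_right diff_divide_distrib[symmetric] eq)
 qed
qed

section \<open>Consistency of the recursion on an orbit\<close>

text \<open>Of \<open>z\<^sup>x (1 - c / z) (1 - d / z) = z\<^sup>x - (c + d) z\<^bsup>x-1\<^esup> + c d z\<^bsup>x-2\<^esup>\<close> with \<open>x > 0\<close> only the first term has
 an exponent of modulus \<open>x\<close>, except that \<open>c d z\<^sup>-\<^sup>1\<close> survives for \<open>x = 1\<close>.\<close>

definition top_weight :: "'k::field \<Rightarrow> int \<Rightarrow> int \<Rightarrow> 'k" where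
 "top_weight cd x y = (if y = x then 1 else if x = 1 \<and> y = -1 then cd else 0)"

definition top_base :: "nat \<Rightarrow> 'k::field \<Rightarrow> comp \<Rightarrow> comp \<Rightarrow> 'k" where
 "top_base n cd \<mu> \<xi> = (\<Prod>j\<in>{1..n}. top_weight cd (lk \<mu> j) (lk \<xi> j))"

lemma n_exp_shift:
 assumes k: "1 \<le> k" "k + 1 < n"
  and eq: "\<And>l. l \<notin> {k, k+1, k+2} \<Longrightarrow> lk \<xi>' l = lk \<xi> l" "lk \<xi>' k = lk \<xi> (k+2)"
 shows "n_exp n (k+1) \<xi>' = n_exp n k \<xi> + (if lk \<xi> (k+2) = 0 then 1 else if lk \<xi> (k+2) = -1 then -1 else 0)"
proof -
 obtain m where m: "k = Suc m" using k by (cases k) auto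
 have s: "small_count m \<xi>' = small_count m \<xi>" by (rule small_count_cong) (use eq m in auto)
 have z: "zero_count n (Suc (k+2)) \<xi>' = zero_count n (Suc (k+2)) \<xi>"
  by (rule zero_count_cong) (use eq m in auto)
 have "zero_count n (k+2) \<xi> = (if lk \<xi> (k+2) = 0 then 1 else 0) + zero_count n (Suc (k+2)) \<xi>"
  by (rule zero_count_step) (use k in auto)
 moreover have "small_count k \<xi>' = small_count m \<xi>' + (if lk \<xi>' k \<in> {-1,0} then 1 else 0)"
  unfolding m by (rule small_count_Suc)
 ultimately show ?thesis using s z eq(2) m by (simp add: n_exp_counts)
qed

lemma small_count_last_two:
 assumes "n = Suc k" "1 \<le> k"
 shows "small_count n \<mu> = small_count (k - 1) \<mu> + (if lk \<mu> k \<in> {-1, 0} then 1 else 0)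
   + (if lk \<mu> n \<in> {-1, 0} then 1 else 0)"
proof -
 obtain m where m: "k = Suc m" using assms by (cases k) auto
 show ?thesis unfolding assms(1) m small_count_Suc by simp
qed

locale hecke_point =
 fixes n :: nat and t a b c d :: "'k::field"
 assumes good: "good_params n t a b c d"
begin

abbreviation Op where "Op \<equiv> orbit_op n t a b"
abbreviation s where "s \<equiv> refl_comp n"
abbreviation dd where "dd \<equiv> pair_root n"
abbreviation P where "P \<equiv> p_coeff n t a b c d"
abbreviation Q where "Q \<equiv> q_coeff n t a b c d"
abbreviation h where "h \<equiv> eta n t a b"

definition st where "st i \<mu> = step_op (Op i) (P i \<mu>) (Q i \<mu>)"

text \<open>The coefficients of \<open>E\<^sub>\<mu>\<close> on the orbit of \<open>\<mu>\<close>, as the path determines them.\<close>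

definition orbit_fam :: "comp \<Rightarrow> comp \<Rightarrow> 'k" where
 "orbit_fam = path_fam n (top_base n (c * d)) st"

abbreviation e where "e \<equiv> orbit_fam"

definition consistent :: "comp \<Rightarrow> bool" where
 "consistent \<mu> \<longleftrightarrow> (\<forall>i\<in>{1..n}. (dd i \<mu> < 0 \<longrightarrow> e \<mu> = st i (s i \<mu>) (e (s i \<mu>))) \<and>
   (dd i \<mu> = 0 \<longrightarrow> Op i (e \<mu>) = (\<lambda>\<xi>. h i * e \<mu> \<xi>)))"

lemma lin: "linear_op (Op i)"
 by unfold_locales (rule orbit_op_linear)

lemma t0: "t \<noteq> 0" using good by (simp add: good_params_def)

lemma consistent_far:
 assumes ij: "i \<in> {1..n}" "j \<in> {1..n}" "j + 1 < i \<or> i + 1 < j"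
  and IH: "\<And>\<nu>. height n \<nu> < height n \<mu> \<Longrightarrow> consistent \<nu>"
  and j: "dd j \<mu> < 0" "e \<mu> = st j (s j \<mu>) (e (s j \<mu>))"
 shows "dd i \<mu> < 0 \<Longrightarrow> e \<mu> = st i (s i \<mu>) (e (s i \<mu>))"
  "dd i \<mu> = 0 \<Longrightarrow> Op i (e \<mu>) = (\<lambda>\<xi>. h i * e \<mu> \<xi>)"
proof -
 have dj: "dd i (s j \<mu>) = dd i \<mu>" and di: "dd j (s i \<mu>) = dd j \<mu>"
  using ij by (auto intro!: pair_root_far)
 have com: "s i (s j \<mu>) = s j (s i \<mu>)" using ij refl_far[of i j n \<mu>] refl_far[of j i n \<mu>] by auto
 have OO: "Op i (Op j v) = Op j (Op i v)" for v
  using ij orbit_op_far[of i j n t a b v] orbit_op_far[of j i n t a b v] by auto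
 have hj: "height n (s j \<mu>) < height n \<mu>" by (rule height_refl[OF ij(2) j(1)])
 have cj: "consistent (s j \<mu>)" by (rule IH[OF hj])
 {
  assume i: "dd i \<mu> < 0"
  have ci: "consistent (s i \<mu>)" by (rule IH[OF height_refl[OF ij(1) i]])
  let ?\<mu> = "s i (s j \<mu>)"
  have 1: "e (s j \<mu>) = st i ?\<mu> (e ?\<mu>)" using cj ij i dj by (simp add: consistent_def)
  have 2: "e (s i \<mu>) = st j ?\<mu> (e ?\<mu>)" using ci ij j di com by (simp add: consistent_def)
  have 3: "st j (s j \<mu>) = st j ?\<mu>" unfolding st_def using coeff_far[of j n i t a b c d] ij by auto
  have 4: "st i (s i \<mu>) = st i ?\<mu>" unfolding st_def com using coeff_far[of i n j t a b c d] ij by auto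
  show "e \<mu> = st i (s i \<mu>) (e (s i \<mu>))"
   unfolding j(2) 1 2 3 4 unfolding st_def
   by (rule rank2_commute(1)[OF lin lin]) (simp add: OO)
 next
  assume i: "dd i \<mu> = 0"
  have "Op i (e (s j \<mu>)) = (\<lambda>\<xi>. h i * e (s j \<mu>) \<xi>)" using cj ij i dj by (simp add: consistent_def)
  then show "Op i (e \<mu>) = (\<lambda>\<xi>. h i * e \<mu> \<xi>)"
   unfolding j(2) st_def by (rule rank2_commute(2)[OF lin lin OO])
 }
qed

lemma standard_coeff:
 assumes "i < n" "lk \<mu> (i+1) < lk \<mu> i" "lk \<mu> i \<noteq> 0 \<or> lk \<mu> (i+1) \<noteq> -1"
 shows "P i \<mu> = 0" "Q i \<mu> = 1"
 using assms by (auto simp: p_coeff_def q_coeff_def Let_def)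

lemma consistent_ascent:
 "consistent \<mu> \<Longrightarrow> i \<in> {1..n} \<Longrightarrow> dd i \<mu> < 0 \<Longrightarrow> e \<mu> = st i (s i \<mu>) (e (s i \<mu>))"
 by (simp add: consistent_def)

lemma consistent_fixed:
 "consistent \<mu> \<Longrightarrow> i \<in> {1..n} \<Longrightarrow> dd i \<mu> = 0 \<Longrightarrow> Op i (e \<mu>) = (\<lambda>\<xi>. h i * e \<mu> \<xi>)"
 by (simp add: consistent_def)

lemma consistent_swap_swap:
 assumes k: "1 \<le> k" "k + 1 < n"
  and IH: "\<And>\<nu>. height n \<nu> < height n \<mu> \<Longrightarrow> consistent \<nu>"
  and asc: "dd k \<mu> < 0" "dd (k+1) \<mu> < 0"
 shows "st k (s k \<mu>) (e (s k \<mu>)) = st (k+1) (s (k+1) \<mu>) (e (s (k+1) \<mu>))"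
proof -
 define x y z where "x = lk \<mu> k" "y = lk \<mu> (k+1)" "z = lk \<mu> (k+2)"
 have lt: "x < y" "y < z" using asc k by (auto simp: pair_root_def x_y_z_def)
 note L = refl_lookup
 have kk: "k \<in> {1..n}" "k + 1 \<in> {1..n}" "k < n" using k by auto
 let ?s = "s k" and ?r = "s (k+1)"
 let ?u = "?s (?r (?s \<mu>))"
 have D: "dd (k+1) (?s \<mu>) < 0" "dd k (?r \<mu>) < 0" "dd k (?r (?s \<mu>)) < 0" "dd (k+1) (?s (?r \<mu>)) < 0"
  using lt k by (auto simp: pair_root_def L x_y_z_def)
 have br: "?u = ?r (?s (?r \<mu>))" using refl_braid3[of k n \<mu>] k by simp
 have h1: "height n (?s \<mu>) < height n \<mu>" "height n (?r \<mu>) < height n \<mu>"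
  using height_refl kk asc by blast+
 have h2: "height n (?r (?s \<mu>)) < height n \<mu>" "height n (?s (?r \<mu>)) < height n \<mu>"
  using height_refl[OF kk(2) D(1)] height_refl[OF kk(1) D(2)] h1 by auto
 have e1: "e (?s \<mu>) = st (k+1) (?r (?s \<mu>)) (e (?r (?s \<mu>)))"
  by (rule consistent_ascent[OF IH[OF h1(1)] kk(2) D(1)])
 have e2: "e (?r \<mu>) = st k (?s (?r \<mu>)) (e (?s (?r \<mu>)))"
  by (rule consistent_ascent[OF IH[OF h1(2)] kk(1) D(2)])
 have e3: "e (?r (?s \<mu>)) = st k ?u (e ?u)"
  by (rule consistent_ascent[OF IH[OF h2(1)] kk(1) D(3)])
 have e4: "e (?s (?r \<mu>)) = st (k+1) ?u (e ?u)"
  unfolding br by (rule consistent_ascent[OF IH[OF h2(2)] kk(2) D(4)])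
 have far: "z \<noteq> 0 \<or> x \<noteq> -1" using lt by auto
 have B: "P (k+1) (?r (?s \<mu>)) = 0" "Q (k+1) (?r (?s \<mu>)) = 1" "P k (?s (?r \<mu>)) = 0" "Q k (?s (?r \<mu>)) = 1"
  by (rule standard_coeff; use k lt far in \<open>auto simp: L x_y_z_def\<close>)+
 have Ac: "P (k+1) (?r \<mu>) = P k ?u \<and> Q (k+1) (?r \<mu>) = Q k ?u"
 proof (cases "z = 0 \<and> y = -1")
  case True
  have "n_exp n (k+1) (?r \<mu>) = n_exp n k ?u"
   using n_exp_shift[of k n "?r \<mu>" ?u] k lt True by (auto simp: L x_y_z_def)
  then show ?thesis using k by (simp add: p_coeff_def q_coeff_def L)
 next
  case False
  have "P (k+1) (?r \<mu>) = 0" "Q (k+1) (?r \<mu>) = 1" "P k ?u = 0" "Q k ?u = 1"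
   by (rule standard_coeff; use k lt False in \<open>auto simp: L x_y_z_def\<close>)+
  then show ?thesis by simp
 qed
 have Cc: "P (k+1) ?u = P k (?s \<mu>) \<and> Q (k+1) ?u = Q k (?s \<mu>)"
 proof (cases "y = 0 \<and> x = -1")
  case True
  have "n_exp n (k+1) ?u = n_exp n k (?s \<mu>)"
   using n_exp_shift[of k n ?u "?s \<mu>"] k lt True by (auto simp: L x_y_z_def)
  then show ?thesis using k by (simp add: p_coeff_def q_coeff_def L)
 next
  case False
  have "P (k+1) ?u = 0" "Q (k+1) ?u = 1" "P k (?s \<mu>) = 0" "Q k (?s \<mu>) = 1"
   by (rule standard_coeff; use k lt False in \<open>auto simp: L x_y_z_def\<close>)+
  then show ?thesis by simp
 qed
 have pr: "P k ?u = 0 \<or> P k (?s \<mu>) = 0"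
 proof (cases "y = 0")
  case True
  then have "P k ?u = 0" by (intro standard_coeff(1)) (use k lt in \<open>auto simp: L x_y_z_def\<close>)
  then show ?thesis ..
 next
  case False
  then have "P k (?s \<mu>) = 0" by (intro standard_coeff(1)) (use k lt in \<open>auto simp: L x_y_z_def\<close>)
  then show ?thesis ..
 qed
 show ?thesis
  unfolding e1 e2 e3 e4 unfolding st_def B Ac[THEN conjunct1] Ac[THEN conjunct2] Cc[THEN conjunct1] Cc[THEN conjunct2]
  by (rule rank2_braid3_regular[OF lin lin _ pr]) (rule orbit_op_braid3[OF k(2)])
qed

text \<open>Two special coefficients whose exponents of \<open>t\<close> differ by one satisfy the relation that
 \<open>rank2_braid3_fixed\<close> asks for.\<close>

lemma special_braid3:
 assumes "s0 = a * b * c * d" "p = (t - 1) * s0 / (s0 - w)" "p' = (t - 1) * s0 / (s0 - w / t)"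
  "s0 \<noteq> w" "s0 \<noteq> w / t"
 shows "p' * (1 + p) = t * p"
proof -
 have p': "p' = (t - 1) * s0 * t / (t * s0 - w)"
  using assms(5) t0 unfolding assms(3) by (simp add: field_simps)
 have "t * s0 - w \<noteq> 0" using assms(5) t0 by (auto simp: field_simps)
 moreover have "1 + p = (t * s0 - w) / (s0 - w)"
  unfolding assms(2) using assms(4) by (simp add: divide_simps) (simp add: algebra_simps)
 ultimately show ?thesis unfolding p' using assms(2,4) by (simp add: mult_ac)
qed

lemma special_braid3_coeff:
 assumes "i < n" "1 \<le> i" "j < n" "1 \<le> j"
  and "lk \<mu> i = 0" "lk \<mu> (i+1) = -1" "lk \<nu> j = 0" "lk \<nu> (j+1) = -1"
  and N: "n_exp n j \<nu> = n_exp n i \<mu> - 1"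
 shows "P j \<nu> * (1 + P i \<mu>) = t * P i \<mu>"
proof -
 have pw: "t powi (n_exp n i \<mu> - 1) = t powi n_exp n i \<mu> / t"
  using t0 by (simp add: power_int_diff)
 have bd: "n_exp n i \<mu> \<le> -1" "- 2 * int n - 1 \<le> n_exp n i \<mu>"
  using n_exp_bounds[of i n \<mu>] assms by auto
 have ne: "a * b * c * d \<noteq> t powi n_exp n i \<mu>" "a * b * c * d \<noteq> t powi n_exp n i \<mu> / t"
  unfolding pw[symmetric] using good bd by (auto simp: good_params_def)
 show ?thesis
  by (rule special_braid3[OF refl coeff_special_swap(1) _ ne])
    (use assms coeff_special_swap(1)[of j n \<nu> t a b c d] pw in auto)
qed

lemma consistent_swap_fixed_left:
 assumes k: "1 \<le> k" "k + 1 < n"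
  and IH: "\<And>\<nu>. height n \<nu> < height n \<mu> \<Longrightarrow> consistent \<nu>"
  and asc: "dd k \<mu> = 0" "dd (k+1) \<mu> < 0"
 defines "f \<equiv> st (k+1) (s (k+1) \<mu>) (e (s (k+1) \<mu>))"
 shows "Op k f = (\<lambda>\<xi>. h k * f \<xi>)"
proof -
 define x z where "x = lk \<mu> k" "z = lk \<mu> (k+2)"
 have lt: "lk \<mu> (k+1) = x" "x < z" using asc k by (auto simp: pair_root_def x_z_def)
 note L = refl_lookup
 have kk: "k \<in> {1..n}" "k + 1 \<in> {1..n}" "k < n" using k by auto
 let ?s = "s k" and ?r = "s (k+1)"
 let ?u = "?s (?r \<mu>)"
 have D: "dd k (?r \<mu>) < 0" "dd (k+1) ?u = 0"
  using lt k by (auto simp: pair_root_def L x_z_def)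
 have h1: "height n (?r \<mu>) < height n \<mu>" using height_refl[OF kk(2) asc(2)] .
 have h2: "height n ?u < height n \<mu>" using height_refl[OF kk(1) D(1)] h1 by auto
 have e1: "e (?r \<mu>) = st k ?u (e ?u)" by (rule consistent_ascent[OF IH[OF h1] kk(1) D(1)])
 have v: "Op (k+1) (e ?u) = (\<lambda>\<xi>. h (k+1) * e ?u \<xi>)"
  by (rule consistent_fixed[OF IH[OF h2] kk(2) D(2)])
 have hh: "h (k+1) = h k" "h k = t" using k by (auto simp: eta_def)
 have p: "P (k+1) (?r \<mu>) * (1 + P k ?u) = h k * P k ?u"
 proof (cases "z = 0 \<and> x = -1")
  case True
  have "n_exp n (k+1) (?r \<mu>) = n_exp n k ?u - 1"
   using n_exp_shift[of k n "?r \<mu>" ?u] k lt True by (auto simp: L x_z_def)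
  then show ?thesis unfolding hh
   by (intro special_braid3_coeff) (use k lt True in \<open>auto simp: L x_z_def\<close>)
 next
  case False
  have "P (k+1) (?r \<mu>) = 0" "P k ?u = 0"
   by (rule standard_coeff; use k lt False in \<open>auto simp: L x_z_def\<close>)+
  then show ?thesis by simp
 qed
 show ?thesis unfolding f_def e1 st_def
  by (rule rank2_braid3_fixed[OF lin lin orbit_op_braid3[OF k(2)] orbit_op_quadratic v[unfolded hh(1)] p])
qed

lemma consistent_swap_fixed_right:
 assumes k: "1 \<le> k" "k + 1 < n"
  and IH: "\<And>\<nu>. height n \<nu> < height n \<mu> \<Longrightarrow> consistent \<nu>"
  and asc: "dd k \<mu> < 0" "dd (k+1) \<mu> = 0"
 defines "f \<equiv> st k (s k \<mu>) (e (s k \<mu>))"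
 shows "Op (k+1) f = (\<lambda>\<xi>. h (k+1) * f \<xi>)"
proof -
 define x z where "x = lk \<mu> k" "z = lk \<mu> (k+2)"
 have lt: "lk \<mu> (k+1) = z" "x < z" using asc k by (auto simp: pair_root_def x_z_def)
 note L = refl_lookup
 have kk: "k \<in> {1..n}" "k + 1 \<in> {1..n}" "k < n" using k by auto
 let ?s = "s k" and ?r = "s (k+1)"
 let ?u = "?r (?s \<mu>)"
 have D: "dd (k+1) (?s \<mu>) < 0" "dd k ?u = 0"
  using lt k by (auto simp: pair_root_def L x_z_def)
 have h1: "height n (?s \<mu>) < height n \<mu>" using height_refl[OF kk(1) asc(1)] .
 have h2: "height n ?u < height n \<mu>" using height_refl[OF kk(2) D(1)] h1 by auto
 have e1: "e (?s \<mu>) = st (k+1) ?u (e ?u)" by (rule consistent_ascent[OF IH[OF h1] kk(2) D(1)])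
 have v: "Op k (e ?u) = (\<lambda>\<xi>. h k * e ?u \<xi>)"
  by (rule consistent_fixed[OF IH[OF h2] kk(1) D(2)])
 have hh: "h k = h (k+1)" "h (k+1) = t" using k by (auto simp: eta_def)
 have p: "P k (?s \<mu>) * (1 + P (k+1) ?u) = h (k+1) * P (k+1) ?u"
 proof (cases "z = 0 \<and> x = -1")
  case True
  have "n_exp n (k+1) ?u = n_exp n k (?s \<mu>) + 1"
   using n_exp_shift[of k n ?u "?s \<mu>"] k lt True by (auto simp: L x_z_def)
  then show ?thesis unfolding hh
   by (intro special_braid3_coeff) (use k lt True in \<open>auto simp: L x_z_def\<close>)
 next
  case False
  have "P k (?s \<mu>) = 0" "P (k+1) ?u = 0"
   by (rule standard_coeff; use k lt False in \<open>auto simp: L x_z_def\<close>)+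
  then show ?thesis by simp
 qed
 show ?thesis unfolding f_def e1 st_def
  by (rule rank2_braid3_fixed[OF lin lin orbit_op_braid3[OF k(2), symmetric] orbit_op_quadratic v[unfolded hh(1)] p])
qed

lemma flip_coeff:
 assumes "0 < lk \<mu> n"
 shows "P n \<mu> = (if lk \<mu> n = 1 then - (a * b * c * d) * t powi r_exp n \<mu> else 0)"
  "lk \<mu> n \<noteq> 1 \<Longrightarrow> Q n \<mu> = 1"
 using assms by (auto simp: p_coeff_def q_coeff_def pn_coeff_def qn_coeff_def Let_def)

lemma consistent_swap_flip:
 assumes n: "n = Suc k" "1 \<le> k"
  and IH: "\<And>\<nu>. height n \<nu> < height n \<mu> \<Longrightarrow> consistent \<nu>"
  and asc: "dd k \<mu> < 0" "dd n \<mu> < 0"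
 shows "st k (s k \<mu>) (e (s k \<mu>)) = st n (s n \<mu>) (e (s n \<mu>))"
proof -
 define x y where "x = lk \<mu> k" "y = lk \<mu> n"
 have lt: "x < y" "y < 0" using asc n by (auto simp: pair_root_def x_y_def)
 note L = refl_lookup
 have kk: "k \<in> {1..n}" "n \<in> {1..n}" "k < n" "k + 1 = n" using n by auto
 let ?s = "s k" and ?r = "s n"
 let ?u = "?s (?r (?s (?r \<mu>)))"
 have br: "?u = ?r (?s (?r (?s \<mu>)))" using refl_braid4[of n k \<mu>] n by simp
 have D: "dd n (?s \<mu>) < 0" "dd k (?r \<mu>) < 0" "dd k (?r (?s \<mu>)) < 0" "dd n (?s (?r \<mu>)) < 0"
  "dd n (?s (?r (?s \<mu>))) < 0" "dd k (?r (?s (?r \<mu>))) < 0"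
  using lt n by (auto simp: pair_root_def L x_y_def)
 have h1: "height n (?s \<mu>) < height n \<mu>" "height n (?r \<mu>) < height n \<mu>"
  using height_refl kk asc by blast+
 have h2: "height n (?r (?s \<mu>)) < height n \<mu>" "height n (?s (?r \<mu>)) < height n \<mu>"
  using height_refl[OF kk(2) D(1)] height_refl[OF kk(1) D(2)] h1 by auto
 have h3: "height n (?s (?r (?s \<mu>))) < height n \<mu>" "height n (?r (?s (?r \<mu>))) < height n \<mu>"
  using height_refl[OF kk(1) D(3)] height_refl[OF kk(2) D(4)] h2 by auto
 have e1: "e (?s \<mu>) = st n (?r (?s \<mu>)) (e (?r (?s \<mu>)))"
  by (rule consistent_ascent[OF IH[OF h1(1)] kk(2) D(1)])
 have e2: "e (?r \<mu>) = st k (?s (?r \<mu>)) (e (?s (?r \<mu>)))"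
  by (rule consistent_ascent[OF IH[OF h1(2)] kk(1) D(2)])
 have e3: "e (?r (?s \<mu>)) = st k (?s (?r (?s \<mu>))) (e (?s (?r (?s \<mu>))))"
  by (rule consistent_ascent[OF IH[OF h2(1)] kk(1) D(3)])
 have e4: "e (?s (?r \<mu>)) = st n (?r (?s (?r \<mu>))) (e (?r (?s (?r \<mu>))))"
  by (rule consistent_ascent[OF IH[OF h2(2)] kk(2) D(4)])
 have e5: "e (?s (?r (?s \<mu>))) = st n ?u (e ?u)"
  unfolding br by (rule consistent_ascent[OF IH[OF h3(1)] kk(2) D(5)])
 have e6: "e (?r (?s (?r \<mu>))) = st k ?u (e ?u)"
  by (rule consistent_ascent[OF IH[OF h3(2)] kk(1) D(6)])
 have A: "P k (?s \<mu>) = 0" "Q k (?s \<mu>) = 1" "P k (?s (?r \<mu>)) = 0" "Q k (?s (?r \<mu>)) = 1"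
  "P k (?s (?r (?s \<mu>))) = 0" "Q k (?s (?r (?s \<mu>))) = 1" "P k ?u = 0" "Q k ?u = 1"
  by (rule standard_coeff; use n lt in \<open>auto simp: L x_y_def\<close>)+
 have B: "P n (?r (?s \<mu>)) = 0" "Q n (?r (?s \<mu>)) = 1" "P n (?r (?s (?r \<mu>))) = 0" "Q n (?r (?s (?r \<mu>))) = 1"
  using flip_coeff[of "?r (?s \<mu>)"] flip_coeff[of "?r (?s (?r \<mu>))"] lt n by (auto simp: L x_y_def)
 have R: "r_exp n ?u = r_exp n (?r \<mu>)" if "y = -1"
 proof -
  have "small_count (k-1) ?u = small_count (k-1) (?r \<mu>)"
   by (rule small_count_cong) (use n in \<open>auto simp: L\<close>)
  then show ?thesis using that lt n unfolding r_exp_alt small_count_last_two[OF n]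
   by (auto simp: L x_y_def)
 qed
 have C: "P n ?u = P n (?r \<mu>) \<and> Q n ?u = Q n (?r \<mu>)"
 proof (cases "y = -1")
  case True
  then show ?thesis using R n lt
   by (simp add: p_coeff_def q_coeff_def pn_coeff_def qn_coeff_def L x_y_def)
 next
  case False
  then show ?thesis using flip_coeff[of ?u] flip_coeff[of "?r \<mu>"] lt n by (auto simp: L x_y_def)
 qed
 show ?thesis
  unfolding e1 e2 e3 e4 e5 e6 unfolding st_def A B C[THEN conjunct1] C[THEN conjunct2]
  by (rule rank2_braid4_regular[OF lin lin, symmetric]) (rule orbit_op_braid4[OF n(1)])
qed

lemma consistent_flip_equal:
 assumes n: "n = Suc k" "1 \<le> k"
  and IH: "\<And>\<nu>. height n \<nu> < height n \<mu> \<Longrightarrow> consistent \<nu>"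
  and asc: "dd k \<mu> = 0" "dd n \<mu> < 0"
 defines "f \<equiv> st n (s n \<mu>) (e (s n \<mu>))"
 shows "Op k f = (\<lambda>\<xi>. h k * f \<xi>)"
proof -
 define x where "x = lk \<mu> n"
 have lt: "lk \<mu> k = x" "x < 0" using asc n by (auto simp: pair_root_def x_def)
 note L = refl_lookup
 have kk: "k \<in> {1..n}" "n \<in> {1..n}" "k < n" "k + 1 = n" using n by auto
 let ?s = "s k" and ?r = "s n"
 let ?u = "?r (?s (?r \<mu>))"
 have D: "dd k (?r \<mu>) < 0" "dd n (?s (?r \<mu>)) < 0" "dd k ?u = 0"
  using lt n by (auto simp: pair_root_def L x_def)
 have h1: "height n (?r \<mu>) < height n \<mu>" using height_refl[OF kk(2) asc(2)] .
 have h2: "height n (?s (?r \<mu>)) < height n \<mu>" using height_refl[OF kk(1) D(1)] h1 by auto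
 have h3: "height n ?u < height n \<mu>" using height_refl[OF kk(2) D(2)] h2 by auto
 have e1: "e (?r \<mu>) = st k (?s (?r \<mu>)) (e (?s (?r \<mu>)))" by (rule consistent_ascent[OF IH[OF h1] kk(1) D(1)])
 have e2: "e (?s (?r \<mu>)) = st n ?u (e ?u)" by (rule consistent_ascent[OF IH[OF h2] kk(2) D(2)])
 have v: "Op k (e ?u) = (\<lambda>\<xi>. h k * e ?u \<xi>)" by (rule consistent_fixed[OF IH[OF h3] kk(1) D(3)])
 have A: "P k (?s (?r \<mu>)) = 0" "Q k (?s (?r \<mu>)) = 1"
  by (rule standard_coeff; use n lt in \<open>auto simp: L x_def\<close>)+
 have p: "P n (?r \<mu>) = h k * P n ?u"
 proof (cases "x = -1")
  case True
  have "small_count (k-1) ?u = small_count (k-1) (?r \<mu>)"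
   by (rule small_count_cong) (use n in \<open>auto simp: L\<close>)
  then have "r_exp n (?r \<mu>) = r_exp n ?u + 1"
   using True lt n unfolding r_exp_alt small_count_last_two[OF n]
   by (auto simp: L x_def)
  then show ?thesis using flip_coeff(1)[of "?r \<mu>"] flip_coeff(1)[of ?u] lt n True t0 kk
   by (simp add: L x_def eta_def power_int_add)
 next
  case False
  then show ?thesis using flip_coeff(1)[of "?r \<mu>"] flip_coeff(1)[of ?u] lt n by (auto simp: L x_def)
 qed
 show ?thesis unfolding f_def e1 e2 unfolding st_def A
  by (rule rank2_braid4_equal[OF lin lin orbit_op_braid4[OF n(1)] orbit_op_quadratic v p])
qed

lemma consistent_swap_zero:
 assumes n: "n = Suc k" "1 \<le> k"
  and IH: "\<And>\<nu>. height n \<nu> < height n \<mu> \<Longrightarrow> consistent \<nu>"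
  and asc: "dd k \<mu> < 0" "dd n \<mu> = 0"
 defines "f \<equiv> st k (s k \<mu>) (e (s k \<mu>))"
 shows "Op n f = (\<lambda>\<xi>. h n * f \<xi>)"
proof -
 define x where "x = lk \<mu> k"
 have lt: "lk \<mu> n = 0" "x < 0" using asc n by (auto simp: pair_root_def x_def)
 note L = refl_lookup
 have kk: "k \<in> {1..n}" "n \<in> {1..n}" "k < n" "k + 1 = n" using n by auto
 let ?s = "s k" and ?r = "s n"
 let ?u = "?s (?r (?s \<mu>))"
 have D: "dd n (?s \<mu>) < 0" "dd k (?r (?s \<mu>)) < 0" "dd n ?u = 0"
  using lt n by (auto simp: pair_root_def L x_def)
 have h1: "height n (?s \<mu>) < height n \<mu>" using height_refl[OF kk(1) asc(1)] .
 have h2: "height n (?r (?s \<mu>)) < height n \<mu>" using height_refl[OF kk(2) D(1)] h1 by auto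
 have h3: "height n ?u < height n \<mu>" using height_refl[OF kk(1) D(2)] h2 by auto
 have e1: "e (?s \<mu>) = st n (?r (?s \<mu>)) (e (?r (?s \<mu>)))" by (rule consistent_ascent[OF IH[OF h1] kk(2) D(1)])
 have e2: "e (?r (?s \<mu>)) = st k ?u (e ?u)" by (rule consistent_ascent[OF IH[OF h2] kk(1) D(2)])
 have v: "Op n (e ?u) = (\<lambda>\<xi>. h n * e ?u \<xi>)" by (rule consistent_fixed[OF IH[OF h3] kk(2) D(3)])
 have A: "P k ?u = 0" "Q k ?u = 1"
  by (rule standard_coeff; use n lt in \<open>auto simp: L x_def\<close>)+
 have hk: "h k = t" using kk by (simp add: eta_def)
 have p: "P k (?s \<mu>) * (1 + P n (?r (?s \<mu>))) = (h k - 1) * P n (?r (?s \<mu>))"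
 proof (cases "x = -1")
  case True
  define m where "m = k - 1"
  have "small_count m (?r (?s \<mu>)) = small_count m \<mu>" "small_count m (?s \<mu>) = small_count m \<mu>"
   by (rule small_count_cong; use n in \<open>auto simp: L m_def\<close>)+
  then have r: "r_exp n (?r (?s \<mu>)) = int (small_count m \<mu>) + 1"
   "n_exp n k (?s \<mu>) = - (int (small_count m \<mu>) + 1)"
   using True lt n unfolding r_exp_alt n_exp_counts small_count_last_two[OF n] m_def
   by (auto simp: L x_def zero_count_def)
  define w where "w = t powi (int (small_count m \<mu>) + 1)"
  have w0: "w \<noteq> 0" using t0 by (simp add: w_def)
  have w1: "t powi n_exp n k (?s \<mu>) = 1 / w" unfolding r w_def power_int_minus divide_inverse by simp
  have bd: "n_exp n k (?s \<mu>) \<le> -1" "- 2 * int n - 1 \<le> n_exp n k (?s \<mu>)"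
   using n_exp_bounds[of k n "?s \<mu>"] n by auto
  define s0 where "s0 = a * b * c * d"
  have ne: "s0 \<noteq> 1 / w" unfolding w1[symmetric] using good bd by (auto simp: good_params_def s0_def)
  have p1: "P k (?s \<mu>) = (t - 1) * s0 / (s0 - 1 / w)"
   using coeff_special_swap(1)[of k n "?s \<mu>" t a b c d] True lt n kk w1 by (simp add: L x_def s0_def)
  have p2: "P n (?r (?s \<mu>)) = - s0 * w"
   using flip_coeff(1)[of "?r (?s \<mu>)"] True lt n r by (simp add: L x_def w_def s0_def)
  have "s0 * w - 1 \<noteq> 0" using ne w0 by (auto simp: field_simps)
  then have "P k (?s \<mu>) = (t - 1) * s0 * w / (s0 * w - 1)"
   unfolding p1 using w0 ne by (simp add: field_simps)
  then show ?thesis unfolding p2 hk using \<open>s0 * w - 1 \<noteq> 0\<close> by (simp add: divide_simps) (simp add: algebra_simps)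
 next
  case False
  have "P k (?s \<mu>) = 0" "P n (?r (?s \<mu>)) = 0"
   using standard_coeff(1)[of k "?s \<mu>"] flip_coeff(1)[of "?r (?s \<mu>)"] lt n kk False by (auto simp: L x_def)
  then show ?thesis by simp
 qed
 show ?thesis unfolding f_def e1 e2 unfolding st_def A
  by (rule rank2_braid4_zero[OF lin lin orbit_op_braid4[OF n(1)] orbit_op_quadratic orbit_op_quadratic v p])
qed

lemma top_base_fixed:
 assumes "i \<in> {1..n}" "dd i \<mu> = 0"
 shows "Op i (top_base n (c * d) \<mu>) = (\<lambda>\<xi>. h i * top_base n (c * d) \<mu> \<xi>)"
proof (rule orbit_op_symmetric)
 fix \<xi>
 show "top_base n (c * d) \<mu> (s i \<xi>) = top_base n (c * d) \<mu> \<xi>"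
 proof (cases "i < n")
  case True
  show ?thesis unfolding top_base_def
   by (rule prod.reindex_bij_witness[of _ "\<lambda>j. if j = i then i+1 else if j = i+1 then i else j"
     "\<lambda>j. if j = i then i+1 else if j = i+1 then i else j"])
    (use True assms in \<open>auto simp: refl_lookup pair_root_def\<close>)
 next
  case False
  then show ?thesis unfolding top_base_def
   by (intro prod.cong) (use assms in \<open>auto simp: refl_lookup pair_root_def top_weight_def\<close>)
 qed
qed

text \<open>Induction on the height. The path leaves \<open>\<mu>\<close> through one ascent \<open>j\<close>; any other \<open>i\<close> generates with
 \<open>j\<close> a rank two group, all of whose other elements on the way down have smaller height, so that the
 rank two computations apply.\<close>

theorem consistent_all: "consistent \<mu>"
proof (induction \<mu> rule: height_induct[of n])
 case (step \<mu>)
 note IH = step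
 show ?case
 proof (cases "\<forall>i\<in>{1..n}. 0 \<le> dd i \<mu>")
  case True
  then have "e \<mu> = top_base n (c * d) \<mu>" unfolding orbit_fam_def by (intro path_fam_dominant) auto
  then show ?thesis using True top_base_fixed by (auto simp: consistent_def)
 next
  case False
  then obtain j where j: "j \<in> {1..n}" "dd j \<mu> < 0" "e \<mu> = st j (s j \<mu>) (e (s j \<mu>))"
   unfolding orbit_fam_def by (rule path_fam_step) blast
  have "(dd i \<mu> < 0 \<longrightarrow> e \<mu> = st i (s i \<mu>) (e (s i \<mu>))) \<and>
    (dd i \<mu> = 0 \<longrightarrow> Op i (e \<mu>) = (\<lambda>\<xi>. h i * e \<mu> \<xi>))" if i: "i \<in> {1..n}" for i
  proof -
   consider "i = j" | "j + 1 < i \<or> i + 1 < j" | "i = j + 1" "i < n" | "j = i + 1" "j < n"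
    | "i = j + 1" "i = n" | "j = i + 1" "j = n"
    using i j(1) unfolding atLeastAtMost_iff by atomize_elim presburger
   then show ?thesis
   proof cases
    case 1 then show ?thesis using j by auto
   next
    case 2 then show ?thesis using consistent_far[OF i j(1) 2 IH j(2,3)] by auto
   next
    case 3
    have k: "1 \<le> j" "j + 1 < n" using 3 j by auto
    show ?thesis
     using consistent_swap_swap[OF k IH j(2)] consistent_swap_fixed_right[OF k IH j(2)] j(3) 3
     by auto
   next
    case 4
    have k: "1 \<le> i" "i + 1 < n" using 4 i by auto
    show ?thesis
     using consistent_swap_swap[OF k IH] consistent_swap_fixed_left[OF k IH] j(2,3) 4
     by auto
   next
    case 5
    have k: "n = Suc j" "1 \<le> j" using 5 j by auto
    show ?thesis
     using consistent_swap_flip[OF k IH j(2)] consistent_swap_zero[OF k IH j(2)] j(3) 5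
     by auto
   next
    case 6
    have k: "n = Suc i" "1 \<le> i" using 6 i by auto
    show ?thesis
     using consistent_swap_flip[OF k IH] consistent_flip_equal[OF k IH] j(2,3) 6
     by auto
   qed
  qed
  then show ?thesis by (simp add: consistent_def)
 qed
qed

theorem orbit_fam_relation:
 assumes i: "i \<in> {1..n}"
 shows "Op i (e \<mu>) = (\<lambda>\<xi>. P i \<mu> * e \<mu> \<xi> + Q i \<mu> * e (s i \<mu>) \<xi>)"
proof -
 have up: "Op i (e \<mu>) = (\<lambda>\<xi>. P i \<mu> * e \<mu> \<xi> + Q i \<mu> * e (s i \<mu>) \<xi>)" if "0 < dd i \<mu>" for \<mu>
 proof -
  have "e (s i \<mu>) = st i \<mu> (e \<mu>)"
   using consistent_ascent[OF consistent_all i, of "s i \<mu>"] that by simp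
  then show ?thesis using coeff_lower(4)[OF i that good]
   by (auto simp: st_def step_op_def fun_eq_iff)
 qed
 consider "dd i \<mu> = 0" | "0 < dd i \<mu>" | "dd i \<mu> < 0" by linarith
 then show ?thesis
 proof cases
  case 1
  then show ?thesis using consistent_fixed[OF consistent_all i 1] coeff_fixed[OF i 1, of t a b c d] by simp
 next
  case 2 then show ?thesis by (rule up)
 next
  case 3
  define \<nu> where "\<nu> = s i \<mu>"
  have \<nu>: "0 < dd i \<nu>" "s i \<nu> = \<mu>" using 3 by (auto simp: \<nu>_def)
  note C = coeff_lower[OF i \<nu>(1) good, unfolded \<nu>(2)]
  have e\<mu>: "e \<mu> = st i \<nu> (e \<nu>)"
   using consistent_ascent[OF consistent_all i 3] by (simp add: \<nu>_def)
  have 1: "Op i (e \<mu>) = (\<lambda>\<xi>. (Op i (Op i (e \<nu>)) \<xi> - P i \<nu> * Op i (e \<nu>) \<xi>) / Q i \<nu>)"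
   unfolding e\<mu> st_def step_op_def by (rule linear_op.lin_step[OF lin])
  show ?thesis
  proof
   fix \<xi>
   have "Op i (e \<nu>) \<xi> = P i \<nu> * e \<nu> \<xi> + Q i \<nu> * e \<mu> \<xi>" using up[OF \<nu>(1)] \<nu>(2) by simp
   then have "Op i (e \<mu>) \<xi> = ((h i - 1 - P i \<nu>) * (P i \<nu> * e \<nu> \<xi> + Q i \<nu> * e \<mu> \<xi>) + h i * e \<nu> \<xi>) / Q i \<nu>"
    unfolding 1 orbit_op_quadratic by (simp add: algebra_simps)
   also have "\<dots> = ((h i - 1 - P i \<nu>) * (Q i \<nu> * e \<mu> \<xi>) + ((h i - P i \<nu>) * (1 + P i \<nu>)) * e \<nu> \<xi>) / Q i \<nu>"
    by (simp add: algebra_simps)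
   also have "\<dots> = P i \<mu> * e \<mu> \<xi> + Q i \<mu> * e (s i \<mu>) \<xi>"
    unfolding C(1,2,3) using C(4) by (simp add: \<nu>_def[symmetric] add_divide_distrib)
   finally show "Op i (e \<mu>) \<xi> = P i \<mu> * e \<mu> \<xi> + Q i \<mu> * e (s i \<mu>) \<xi>" .
  qed
 qed
qed

end

section \<open>A lifting order on orbits\<close>

definition cnt :: "nat \<Rightarrow> int \<Rightarrow> comp \<Rightarrow> int" where
 "cnt k m \<mu> = (\<Sum>j\<in>{1..k}. if m \<le> lk \<mu> j then 1 else 0)"

text \<open>Comparing initial segments entry count by entry count refines the dominance order. Unlike
 dominance it has the lifting property of the Bruhat order, and this is what makes both the
 triangularity and the orthogonality inductive.\<close>

definition bruhat :: "nat \<Rightarrow> comp \<Rightarrow> comp \<Rightarrow> bool" where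
 "bruhat n \<xi> \<mu> \<longleftrightarrow> (\<forall>k\<le>n. \<forall>m. cnt k m \<xi> \<le> cnt k m \<mu>)"

lemma bruhat_trans: "bruhat n \<xi> \<mu> \<Longrightarrow> bruhat n \<mu> \<nu> \<Longrightarrow> bruhat n \<xi> \<nu>"
 unfolding bruhat_def by (meson order_trans)

lemma cnt_Suc: "cnt (Suc k) m \<mu> = cnt k m \<mu> + (if m \<le> lk \<mu> (Suc k) then 1 else 0)"
 by (simp add: cnt_def)

lemma cnt_pos: "1 \<le> k \<Longrightarrow> cnt k m \<mu> = cnt (k - 1) m \<mu> + (if m \<le> lk \<mu> k then 1 else 0)"
 using cnt_Suc[of "k-1" m \<mu>] by simp

lemma cnt_cong: "(\<And>j. j \<in> {1..k} \<Longrightarrow> lk \<mu> j = lk \<nu> j) \<Longrightarrow> cnt k m \<mu> = cnt k m \<nu>"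
 unfolding cnt_def by (rule sum.cong) auto

lemma cnt_refl_other:
 assumes "i \<in> {1..n}" "k \<noteq> i" "k \<le> n"
 shows "cnt k m (refl_comp n i \<mu>) = cnt k m \<mu>"
proof (cases "k < i")
 case True
 then show ?thesis by (intro cnt_cong) (use assms in \<open>auto simp: refl_lookup\<close>)
next
 case False
 then have i: "i < n" "i + 1 \<le> k" using assms by auto
 show ?thesis unfolding cnt_def
  by (rule sum.reindex_bij_witness[of _ "\<lambda>j. if j = i then i+1 else if j = i+1 then i else j"
     "\<lambda>j. if j = i then i+1 else if j = i+1 then i else j"])
    (use i assms in \<open>auto simp: refl_lookup\<close>)
qed

lemma cnt_refl_swap:
 assumes "1 \<le> i" "i < n"
 shows "cnt i m (refl_comp n i \<mu>) = cnt (i - 1) m \<mu> + (if m \<le> lk \<mu> (i+1) then 1 else 0)"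
  "cnt (i+1) m \<mu> = cnt (i - 1) m \<mu> + (if m \<le> lk \<mu> i then 1 else 0) + (if m \<le> lk \<mu> (i+1) then 1 else 0)"
proof -
 have "cnt (i-1) m (refl_comp n i \<mu>) = cnt (i-1) m \<mu>"
  by (rule cnt_cong) (use assms in \<open>auto simp: refl_lookup\<close>)
 then show "cnt i m (refl_comp n i \<mu>) = cnt (i - 1) m \<mu> + (if m \<le> lk \<mu> (i+1) then 1 else 0)"
  using assms by (simp add: cnt_pos[of i] refl_lookup)
 show "cnt (i+1) m \<mu> = cnt (i - 1) m \<mu> + (if m \<le> lk \<mu> i then 1 else 0) + (if m \<le> lk \<mu> (i+1) then 1 else 0)"
  using assms cnt_Suc[of i m \<mu>] by (simp add: cnt_pos[of i])
qed

lemma cnt_refl_flip: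
 assumes "1 \<le> n"
 shows "cnt n m (refl_comp n n \<mu>) = cnt (n - 1) m \<mu> + (if m \<le> - lk \<mu> n then 1 else 0)"
proof -
 have "cnt (n-1) m (refl_comp n n \<mu>) = cnt (n-1) m \<mu>"
  by (rule cnt_cong) (use assms in \<open>auto simp: refl_lookup\<close>)
 then show ?thesis using assms by (simp add: cnt_pos[of n] refl_lookup)
qed

text \<open>In a fixed orbit the number of entries of modulus at least \<open>M\<close> is constant, so the counts
 of all \<open>n\<close> entries at the levels \<open>M\<close> and \<open>1 - M\<close> determine each other.\<close>

lemma cnt_complement:
 assumes "same_orbit n \<xi> \<mu>" "1 \<le> M"
 shows "cnt n M \<xi> - cnt n (1 - M) \<xi> = cnt n M \<mu> - cnt n (1 - M) \<mu>"
proof -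
 have *: "cnt n M \<nu> - cnt n (1 - M) \<nu> = excess n (M - 1) \<nu> - excess n M \<nu> - int n" for \<nu>
 proof -
  have "cnt n M \<nu> - cnt n (1 - M) \<nu> = (\<Sum>j\<in>{1..n}. (if M \<le> lk \<nu> j then 1 else 0) - (if 1 - M \<le> lk \<nu> j then 1 else 0))"
   by (simp add: cnt_def sum_subtractf)
  also have "\<dots> = (\<Sum>j\<in>{1..n}. max (\<bar>lk \<nu> j\<bar> - (M - 1)) 0 - max (\<bar>lk \<nu> j\<bar> - M) 0 - 1)"
   by (rule sum.cong) (use assms(2) in auto)
  finally show ?thesis by (simp add: sum_subtractf excess_def)
 qed
 show ?thesis unfolding * using assms by (simp add: same_orbit_def)
qed

lemma bruhat_refl_lower:
 assumes "i \<in> {1..n}" "0 \<le> pair_root n i \<mu>"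
 shows "bruhat n (refl_comp n i \<mu>) \<mu>"
 unfolding bruhat_def
proof (intro allI impI)
 fix k m assume "k \<le> n"
 show "cnt k m (refl_comp n i \<mu>) \<le> cnt k m \<mu>"
 proof (cases "k = i")
  case False then show ?thesis using cnt_refl_other[OF assms(1)] \<open>k \<le> n\<close> by simp
 next
  case True
  then show ?thesis using assms cnt_refl_swap(1)[of i n m \<mu>] cnt_refl_flip[of n m \<mu>] cnt_pos[of i m \<mu>]
   by (cases "i < n") (auto simp: pair_root_def)
 qed
qed

text \<open>The lifting property. Only the counts of the initial segment of length \<open>i\<close> change. There the
 neighbouring segments, or for \<open>i = n\<close> the complementary levels, force the inequality.\<close>

lemma bruhat_lift_down:
 assumes b: "bruhat n \<mu> \<xi>" and o: "same_orbit n \<mu> \<xi>" and i: "i \<in> {1..n}" "0 < pair_root n i \<mu>"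
 shows "bruhat n (refl_comp n i \<mu>) (refl_comp n i \<xi>)"
 unfolding bruhat_def
proof (intro allI impI)
 fix k m assume "k \<le> n"
 show "cnt k m (refl_comp n i \<mu>) \<le> cnt k m (refl_comp n i \<xi>)"
 proof (cases "k = i")
  case False then show ?thesis using cnt_refl_other[OF i(1)] \<open>k \<le> n\<close> b by (simp add: bruhat_def)
 next
  case k: True
  show ?thesis
  proof (cases "i < n")
   case True
   have "cnt (i-1) m \<mu> \<le> cnt (i-1) m \<xi>" "cnt (i+1) m \<mu> \<le> cnt (i+1) m \<xi>"
    using b True by (auto simp: bruhat_def)
   then show ?thesis using True i k cnt_refl_swap[of i n m \<mu>] cnt_refl_swap[of i n m \<xi>]
    by (auto simp: pair_root_def split: if_splits)
  next
   case False
   then have "i = n" "0 < lk \<mu> n" "1 \<le> n" using i by (auto simp: pair_root_def)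
   have big: "cnt n m (refl_comp n n \<mu>) \<le> cnt n m (refl_comp n n \<xi>)" if "1 \<le> m" for m
   proof -
    have "cnt (n-1) m \<mu> \<le> cnt (n-1) m \<xi>" using b by (auto simp: bruhat_def)
    then show ?thesis using \<open>0 < lk \<mu> n\<close> that by (auto simp: cnt_refl_flip[OF \<open>1 \<le> n\<close>])
   qed
   have "same_orbit n (refl_comp n n \<mu>) (refl_comp n n \<xi>)"
    using o i \<open>i = n\<close> by (simp add: same_orbit_def excess_refl)
   then have "cnt n (1 - m) (refl_comp n n \<mu>) - cnt n m (refl_comp n n \<mu>)
     = cnt n (1 - m) (refl_comp n n \<xi>) - cnt n m (refl_comp n n \<xi>)" if "m \<le> 0"
    using cnt_complement[of n _ _ "1 - m"] that by fastforce
   then show ?thesis using big[of m] big[of "1 - m"] k \<open>i = n\<close> by (cases "1 \<le> m") auto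
  qed
 qed
qed

lemma bruhat_lift_up:
 assumes b: "bruhat n \<xi> \<mu>" and o: "same_orbit n \<xi> \<mu>" and i: "i \<in> {1..n}" "pair_root n i \<mu> < 0"
 shows "bruhat n (refl_comp n i \<xi>) (refl_comp n i \<mu>)"
 unfolding bruhat_def
proof (intro allI impI)
 fix k m assume "k \<le> n"
 show "cnt k m (refl_comp n i \<xi>) \<le> cnt k m (refl_comp n i \<mu>)"
 proof (cases "k = i")
  case False then show ?thesis using cnt_refl_other[OF i(1)] \<open>k \<le> n\<close> b by (simp add: bruhat_def)
 next
  case k: True
  show ?thesis
  proof (cases "i < n")
   case True
   have "cnt (i-1) m \<xi> \<le> cnt (i-1) m \<mu>" "cnt (i+1) m \<xi> \<le> cnt (i+1) m \<mu>"
    using b True by (auto simp: bruhat_def)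
   then show ?thesis using True i k cnt_refl_swap[of i n m \<mu>] cnt_refl_swap[of i n m \<xi>]
    by (auto simp: pair_root_def split: if_splits)
  next
   case False
   then have "i = n" "lk \<mu> n < 0" "1 \<le> n" using i by (auto simp: pair_root_def)
   have small: "cnt n m (refl_comp n n \<xi>) \<le> cnt n m (refl_comp n n \<mu>)" if "m \<le> 0" for m
   proof -
    have "cnt (n-1) m \<xi> \<le> cnt (n-1) m \<mu>" using b by (auto simp: bruhat_def)
    then show ?thesis using \<open>lk \<mu> n < 0\<close> that by (auto simp: cnt_refl_flip[OF \<open>1 \<le> n\<close>])
   qed
   have "same_orbit n (refl_comp n n \<xi>) (refl_comp n n \<mu>)"
    using o i \<open>i = n\<close> by (simp add: same_orbit_def excess_refl)
   then have "cnt n m (refl_comp n n \<xi>) - cnt n (1 - m) (refl_comp n n \<xi>)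
     = cnt n m (refl_comp n n \<mu>) - cnt n (1 - m) (refl_comp n n \<mu>)" if "1 \<le> m"
    using cnt_complement[of n _ _ m] that by fastforce
   then show ?thesis using small[of m] small[of "1 - m"] k \<open>i = n\<close> by (cases "m \<le> 0") auto
  qed
 qed
qed

lemma bruhat_dom_le:
 assumes "bruhat n \<xi> \<mu>"
 shows "dom_le n \<xi> \<mu>"
 unfolding dom_le_def
proof
 fix k assume k: "k \<in> {1..n}"
 define M where "M = (\<Sum>j\<in>{1..k}. \<bar>lk \<xi> j\<bar> + \<bar>lk \<mu> j\<bar>)"
 have M: "\<bar>lk \<nu> j\<bar> \<le> M" if "\<nu> = \<xi> \<or> \<nu> = \<mu>" "j \<in> {1..k}" for \<nu> j
 proof -
  have "\<bar>lk \<xi> j\<bar> + \<bar>lk \<mu> j\<bar> \<le> M" unfolding M_def by (rule member_le_sum) (use that in auto)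
  then show ?thesis using that by auto
 qed
 have "(\<Sum>j=1..k. lk \<nu> j) = (\<Sum>m\<in>{1-M..M}. cnt k m \<nu>) - int k * M" if "\<nu> = \<xi> \<or> \<nu> = \<mu>" for \<nu>
 proof -
  have "(\<Sum>m\<in>{1-M..M}. cnt k m \<nu>) = (\<Sum>j\<in>{1..k}. \<Sum>m\<in>{1-M..M}. if m \<le> lk \<nu> j then 1 else 0)"
   unfolding cnt_def by (rule sum.swap)
  also have "\<dots> = (\<Sum>j\<in>{1..k}. lk \<nu> j + M)"
  proof (rule sum.cong)
   fix j assume j: "j \<in> {1..k}"
   have "(\<Sum>m\<in>{1-M..M}. if m \<le> lk \<nu> j then 1 else 0::int) = (\<Sum>m\<in>{1-M..lk \<nu> j}. 1)"
    by (rule sum.mono_neutral_cong_right) (use M[OF that j] in auto)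
   then show "(\<Sum>m\<in>{1-M..M}. if m \<le> lk \<nu> j then 1 else 0::int) = lk \<nu> j + M"
    using M[OF that j] by simp
  qed simp
  finally show ?thesis by (simp add: sum.distrib)
 qed
 moreover have "(\<Sum>m\<in>{1-M..M}. cnt k m \<xi>) \<le> (\<Sum>m\<in>{1-M..M}. cnt k m \<mu>)"
  by (rule sum_mono) (use assms k in \<open>auto simp: bruhat_def\<close>)
 ultimately show "(\<Sum>j=1..k. lk \<xi> j) \<le> (\<Sum>j=1..k. lk \<mu> j)" by simp
qed

lemma bruhat_antisym:
 "bruhat n \<xi> \<mu> \<Longrightarrow> bruhat n \<mu> \<xi> \<Longrightarrow> \<xi> \<in> compositions n \<Longrightarrow> \<mu> \<in> compositions n \<Longrightarrow> \<xi> = \<mu>"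
 by (meson bruhat_dom_le dom_le_antisym)

section \<open>Partitions\<close>

lemma partition_nonneg: "is_partition n \<sigma> \<Longrightarrow> 0 \<le> lk \<sigma> j"
 by (cases "j \<in> {1..n}") (auto simp: is_partition_def lookup_outside)

lemma partition_decreasing:
 assumes "is_partition n \<sigma>" "1 \<le> i" "i \<le> j"
 shows "lk \<sigma> j \<le> lk \<sigma> i"
 using assms(3)
proof (induction j rule: dec_induct)
 case (step m)
 have "lk \<sigma> (Suc m) \<le> lk \<sigma> m"
 proof (cases "m < n")
  case True
  then show ?thesis using assms step by (auto simp: is_partition_def)
 next
  case False
  then have "lk \<sigma> (Suc m) = 0" using assms by (auto simp: is_partition_def lookup_outside)
  then show ?thesis using partition_nonneg[OF assms(1)] by simp
 qed
 then show ?case using step by simp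
qed simp

text \<open>A partition attains the bound of \<open>partial_sum_le_excess\<close>.\<close>

lemma submaj_partition_partial_sums:
 assumes "is_partition n \<sigma>" "submaj n \<nu> \<sigma>" "k \<le> n"
 shows "(\<Sum>j=1..k. lk \<nu> j) \<le> (\<Sum>j=1..k. lk \<sigma> j)"
proof (cases "k = 0")
 case False
 have "(\<Sum>j=1..k. lk \<sigma> j) = int k * lk \<sigma> k + excess n (lk \<sigma> k) \<sigma>"
  by (rule partial_sum_eq_excess) (use assms False partition_decreasing partition_nonneg in auto)
 moreover have "excess n (lk \<sigma> k) \<nu> \<le> excess n (lk \<sigma> k) \<sigma>"
  using assms partition_nonneg by (auto simp: submaj_def)
 ultimately show ?thesis using partial_sum_le_excess[OF assms(3), of \<nu> "lk \<sigma> k"] by linarith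
qed simp

lemma submaj_partition_dom_le:
 assumes "is_partition n \<sigma>" "submaj n \<nu> \<sigma>"
 shows "dom_le n \<nu> \<sigma>"
 unfolding dom_le_def using submaj_partition_partial_sums[OF assms] by auto

lemma partition_unique:
 assumes "is_partition n \<sigma>" "is_partition n \<tau>" "same_orbit n \<sigma> \<tau>"
 shows "\<sigma> = \<tau>"
 using assms submaj_partition_dom_le[of n \<sigma> \<tau>] submaj_partition_dom_le[of n \<tau> \<sigma>]
 by (intro dom_le_antisym[of n]) (auto simp: same_orbit_iff is_partition_def)

lemma plus_part_partition: "is_partition n (plus_part n \<mu>)"
 unfolding is_partition_def
 using plus_part_composition plus_part_nonneg plus_part_decreasing by auto

lemma plus_part_same_orbit: "same_orbit n (plus_part n \<mu>) \<mu>"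
 by (simp add: same_orbit_def excess_plus_part)

section \<open>The antidominant member of the family\<close>

definition comp_of :: "nat \<Rightarrow> (nat \<Rightarrow> int) \<Rightarrow> comp" where
 "comp_of n f = (\<Sum>j\<in>{1..n}. Poly_Mapping.single j (f j))"

lemma comp_of_lookup: "lk (comp_of n f) j = (if j \<in> {1..n} then f j else 0)"
 by (simp add: comp_of_def lookup_sum lookup_single when_def sum.delta)

lemma comp_of_composition: "comp_of n f \<in> compositions n"
 by (rule compositionsI) (auto simp: comp_of_lookup)

lemma orbit_op_sum:
 assumes "finite A"
 shows "orbit_op n t a b i (\<lambda>\<xi>. \<Sum>l\<in>A. f l \<xi>) = (\<lambda>\<xi>. \<Sum>l\<in>A. orbit_op n t a b i (f l) \<xi>)"
 by (rule ext) (simp add: orbit_op_def sum_distrib_left sum.distrib)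

context hecke_point
begin

context
 fixes \<sigma> :: comp and k :: nat
 assumes part: "is_partition n \<sigma>" and k: "1 \<le> k" "k \<le> n"
begin

abbreviation L where "L \<equiv> lk \<sigma>"

text \<open>The antidominant weight \<open>- \<sigma>\<close> is reached by negating the entries of \<open>\<sigma>\<close> from the last to the first.
 To negate entry \<open>k\<close>, it moves to the end, changes sign, and moves back. Here the entries after \<open>k\<close> are
 already negated and the moving entry \<open>x\<close> is at position \<open>j\<close>.\<close>

definition ins :: "int \<Rightarrow> nat \<Rightarrow> comp" where
 "ins x j = comp_of n (\<lambda>l. if l < k then L l else if l < j then - L (l + 1) else if l = j then x else - L l)"

definition prefix_weight :: "comp \<Rightarrow> 'k" where
 "prefix_weight \<xi> = (\<Prod>j\<in>{1..<k}. top_weight (c * d) (L j) (lk \<xi> j))"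

text \<open>While entry \<open>k\<close> moves, the coefficients factor into a fixed part of the first \<open>k - 1\<close> entries and
 a combination of single monomials in the others.\<close>

definition tail_delta :: "comp \<Rightarrow> comp \<Rightarrow> 'k" where
 "tail_delta w \<xi> = (if \<forall>j\<in>{k..n}. lk \<xi> j = lk w j then prefix_weight \<xi> else 0)"

abbreviation v :: "int \<Rightarrow> nat \<Rightarrow> comp \<Rightarrow> 'k" where "v x j \<equiv> tail_delta (ins x j)"

lemma ins_lookup: "lk (ins x j) l = (if l \<in> {1..n} then if l < k then L l else if l < j then - L (l + 1)
  else if l = j then x else - L l else 0)"
 by (simp add: ins_def comp_of_lookup)

lemma L_nonneg: "0 \<le> L j" by (rule partition_nonneg[OF part])
lemma L_dec: "1 \<le> i \<Longrightarrow> i \<le> j \<Longrightarrow> L j \<le> L i" by (rule partition_decreasing[OF part])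

lemma prefix_weight_refl: "k \<le> i \<Longrightarrow> prefix_weight (s i \<xi>) = prefix_weight \<xi>"
 unfolding prefix_weight_def by (rule prod.cong) (use k in \<open>auto simp: refl_lookup\<close>)

lemma tail_agree_refl:
 assumes "k \<le> i" "i \<le> n"
 shows "(\<forall>j\<in>{k..n}. lk (s i \<xi>) j = lk w j) \<longleftrightarrow> (\<forall>j\<in>{k..n}. lk \<xi> j = lk (s i w) j)"
proof -
 have *: "\<forall>j\<in>{k..n}. lk (s i \<xi>) j = lk (s i w) j" if "\<forall>j\<in>{k..n}. lk \<xi> j = lk w j" for \<xi> w
 proof
  fix j assume "j \<in> {k..n}"
  then show "lk (s i \<xi>) j = lk (s i w) j"
   using that[THEN bspec, of j] that[THEN bspec, of "i+1"] that[THEN bspec, of i] that[THEN bspec, of n] assms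
   by (auto simp: refl_lookup)
 qed
 show ?thesis using *[of "s i \<xi>" w] *[of \<xi> "s i w"] by auto
qed

lemma tail_delta_refl:
 assumes "k \<le> i" "i \<le> n"
 shows "tail_delta w (s i \<xi>) = tail_delta (s i w) \<xi>"
 unfolding tail_delta_def tail_agree_refl[OF assms] prefix_weight_refl[OF assms(1)] ..

lemma tail_delta_pair_root:
 assumes "k \<le> i" "i \<le> n" "tail_delta w \<xi> \<noteq> 0"
 shows "dd i \<xi> = dd i w"
 using assms by (auto simp: tail_delta_def pair_root_def split: if_splits)

lemma Op_tail_delta:
 assumes i: "k \<le> i" "i \<le> n"
 shows "0 < dd i w \<Longrightarrow> Op i (tail_delta w) = tail_delta (s i w)"
  "dd i w = 0 \<Longrightarrow> Op i (tail_delta w) = (\<lambda>\<xi>. h i * tail_delta w \<xi>)"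
  "dd i w < 0 \<Longrightarrow> Op i (tail_delta w) = (\<lambda>\<xi>. (h i - 1) * tail_delta w \<xi> + h i * tail_delta (s i w) \<xi>)"
proof -
 have z1: "tail_delta w \<xi> = 0" if "dd i \<xi> \<noteq> dd i w" for \<xi>
  using tail_delta_pair_root[OF i, of w \<xi>] that by auto
 have z2: "tail_delta (s i w) \<xi> = 0" if "dd i \<xi> \<noteq> - dd i w" for \<xi>
  using tail_delta_pair_root[OF i, of "s i w" \<xi>] that by auto
 note simps = orbit_op_def tail_delta_refl[OF i]
 show "Op i (tail_delta w) = tail_delta (s i w)" if "0 < dd i w"
  by (rule ext) (use that z1 z2 in \<open>auto simp: simps\<close>)
 show "Op i (tail_delta w) = (\<lambda>\<xi>. h i * tail_delta w \<xi>)" if "dd i w = 0"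
  by (rule ext) (use that z1 refl_fixed[of n i w] in \<open>auto simp: simps\<close>)
 show "Op i (tail_delta w) = (\<lambda>\<xi>. (h i - 1) * tail_delta w \<xi> + h i * tail_delta (s i w) \<xi>)" if "dd i w < 0"
  by (rule ext) (use that z1 z2 in \<open>auto simp: simps\<close>)
qed

lemma refl_ins:
 assumes "k \<le> j" "j < n"
 shows "s j (ins x j) = ins x (j + 1)"
 by (rule poly_mapping_eqI) (use assms k in \<open>auto simp: refl_lookup ins_lookup\<close>)

lemma refl_ins_last: "s n (ins x n) = ins (- x) n"
 by (rule poly_mapping_eqI) (use k in \<open>auto simp: refl_lookup ins_lookup\<close>)

lemma dd_ins:
 assumes "k \<le> j" "j < n"
 shows "dd j (ins x j) = x + L (j + 1)"
 using assms k by (auto simp: pair_root_def ins_lookup)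

lemma dd_ins_last: "dd n (ins x n) = 2 * x"
 using k by (auto simp: pair_root_def ins_lookup)

lemma ins_step_down:
 assumes "k \<le> j" "j < n" "0 < x"
 shows "e (ins x (j+1)) = st j (ins x j) (e (ins x j))"
proof -
 have j: "j \<in> {1..n}" using assms k by auto
 have s: "s j (ins x (j+1)) = ins x j" using refl_ins[OF assms(1,2), of x] by (metis refl_refl)
 have "dd j (s j (ins x (j+1))) = x + L (j+1)" unfolding s by (rule dd_ins[OF assms(1,2)])
 then have "dd j (ins x (j+1)) < 0" using L_nonneg[of "j+1"] assms(3) by simp
 then show ?thesis using consistent_ascent[OF consistent_all j, of "ins x (j+1)"] s by simp
qed

lemma ins_step_flip:
 assumes "0 < x"
 shows "e (ins (- x) n) = st n (ins x n) (e (ins x n))"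
 using consistent_ascent[OF consistent_all, of n "ins (-x) n"] refl_ins_last[of "-x"] k assms
 by (simp add: dd_ins_last)

lemma ins_step_back:
 assumes "k \<le> j" "j < n" "x + L (j + 1) < 0"
 shows "e (ins x j) = st j (ins x (j+1)) (e (ins x (j+1)))"
 using consistent_ascent[OF consistent_all, of j "ins x j"] refl_ins[OF assms(1,2), of x] dd_ins[OF assms(1,2), of x] assms k
 by simp

lemma ins_same:
 assumes "k \<le> j" "j < n" "x + L (j + 1) = 0"
 shows "ins x j = ins x (j+1)"
 by (rule poly_mapping_eqI)
   (use assms k in \<open>auto simp: ins_lookup less_Suc_eq eq_neg_iff_add_eq_0\<close>)

text \<open>All coefficients on the way are the standard pair \<open>(0, 1)\<close>, so every step is \<open>T\<^sub>i\<close> itself, which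
 moves a single monomial to a single monomial.\<close>

lemma antidominant_large:
 assumes "2 \<le> L k" and E: "e (ins (L k) k) = (\<lambda>\<xi>. C * v (L k) k \<xi>)"
 shows "e (ins (- L k) k) = (\<lambda>\<xi>. C * v (- L k) k \<xi>)"
proof -
 define x where "x = L k"
 have x: "2 \<le> x" using assms by (simp add: x_def)
 have scale: "Op i (\<lambda>\<xi>. C * f \<xi>) = (\<lambda>\<xi>. C * Op i f \<xi>)" for i f
  by (rule linear_op.lin_scale[OF lin])
 have std: "st i \<mu> f = Op i f" if "P i \<mu> = 0" "Q i \<mu> = 1" for i \<mu> f
  using that by (simp add: st_def step_op_def)
 have down: "j \<le> n \<longrightarrow> e (ins x j) = (\<lambda>\<xi>. C * v x j \<xi>)" if "k \<le> j" for j
  using that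
 proof (induction j rule: dec_induct)
  case base then show ?case using E by (simp add: x_def)
 next
  case (step j)
  show ?case
  proof
   assume "Suc j \<le> n"
   then have j: "j < n" by simp
   have "P j (ins x j) = 0" "Q j (ins x j) = 1"
    by (rule standard_coeff; use j step k x L_nonneg[of "j+1"] in \<open>auto simp: ins_lookup\<close>)+
   then have "e (ins x (j+1)) = Op j (e (ins x j))"
    using ins_step_down[OF step(1) j, of x] x std by simp
   also have "\<dots> = (\<lambda>\<xi>. C * v x (j+1) \<xi>)"
    using step j scale Op_tail_delta(1)[of j "ins x j"] dd_ins[OF step(1) j, of x] x L_nonneg[of "j+1"]
     refl_ins[OF step(1) j, of x] by simp
   finally show "e (ins x (Suc j)) = (\<lambda>\<xi>. C * v x (Suc j) \<xi>)" by simp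
  qed
 qed
 have flip: "e (ins (- x) n) = (\<lambda>\<xi>. C * v (- x) n \<xi>)"
 proof -
  have "P n (ins x n) = 0" "Q n (ins x n) = 1"
   using flip_coeff[of "ins x n"] x k by (auto simp: ins_lookup)
  then have "e (ins (- x) n) = Op n (e (ins x n))" using ins_step_flip[of x] x std by simp
  then show ?thesis
   using down[OF k(2)] scale Op_tail_delta(1)[OF k(2) order_refl, of "ins x n"] dd_ins_last[of x] x
    refl_ins_last[of x] by simp
 qed
 have "e (ins (- x) j) = (\<lambda>\<xi>. C * v (- x) j \<xi>)" if "k \<le> j" "j \<le> n" for j
  using that(2,1)
 proof (induction j rule: inc_induct)
  case base show ?case by (rule flip)
 next
  case (step j)
  then have j: "k \<le> j" "j < n" by auto
  have le: "- x + L (j+1) \<le> 0" using L_dec[of k "j+1"] k j by (auto simp: x_def)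
  show ?case
  proof (cases "- x + L (j+1) = 0")
   case True
   then show ?thesis using step ins_same[OF j True] by simp
  next
   case False
   then have lt: "- x + L (j+1) < 0" using le by simp
   have "P j (ins (-x) (j+1)) = 0" "Q j (ins (-x) (j+1)) = 1"
    by (rule standard_coeff; use j k x lt in \<open>auto simp: ins_lookup\<close>)+
   then have "e (ins (-x) j) = Op j (e (ins (-x) (j+1)))"
    using ins_step_back[OF j lt] std by simp
   moreover have sj: "s j (ins (-x) (j+1)) = ins (-x) j" using refl_ins[OF j, of "-x"] by (metis refl_refl)
   have "0 < dd j (ins (-x) (j+1))"
    using dd_ins[OF j, of "-x"] lt pair_root_refl[of n j "ins (-x) j"] refl_ins[OF j, of "-x"] by simp
   ultimately show ?thesis
    using step j scale Op_tail_delta(1)[of j "ins (-x) (j+1)"] sj by simp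
  qed
 qed
 then show ?thesis using k unfolding x_def by blast
qed

text \<open>The special case of an entry \<open>1\<close>: it leaves a trace on every zero that it passes, and the
 special coefficients are exactly those that wipe the trace out on the way back.\<close>

definition trace :: "nat \<Rightarrow> nat \<Rightarrow> comp \<Rightarrow> 'k" where
 "trace z j \<xi> = (\<Sum>l\<in>{z..<j}. v (-1) l \<xi>)"

lemma trace_Suc: "z \<le> j \<Longrightarrow> trace z (Suc j) \<xi> = trace z j \<xi> + v (-1) j \<xi>"
 by (simp add: trace_def add.commute)

lemma Op_trace:
 assumes z: "k \<le> z" "\<And>l. z < l \<Longrightarrow> L l = 0" and j: "z \<le> j" "j \<le> n"
 shows "Op j (trace z j) = (\<lambda>\<xi>. h j * trace z j \<xi>)"
proof -
 have "Op j (v (-1) l) = (\<lambda>\<xi>. h j * v (-1) l \<xi>)" if "l \<in> {z..<j}" for l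
 proof (rule Op_tail_delta(2))
  show "dd j (ins (-1) l) = 0" using that z j k by (auto simp: pair_root_def ins_lookup)
 qed (use z j in auto)
 then show ?thesis unfolding trace_def
  by (subst orbit_op_sum) (auto simp: sum_distrib_left)
qed

text \<open>On the way right each zero that is passed leaves a term \<open>v (-1) l\<close>. After the sign change these terms
 occur with a common factor \<open>\<rho> n\<close>. One step to the left changes it from \<open>\<rho> (j + 1)\<close> to \<open>\<rho> j\<close> and removes
 one term, so that none is left at \<open>z\<close>.\<close>

lemma antidominant_one:
 assumes Lk: "L k = 1" and E: "e (ins 1 k) = (\<lambda>\<xi>. C * (v 1 k \<xi> + c * d * v (-1) k \<xi>))"
 shows "\<exists>C'. e (ins (-1) k) = (\<lambda>\<xi>. C' * v (-1) k \<xi>)"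
proof -
 \<comment> \<open>\<open>z\<close> is the last position whose entry in the partition is \<open>1\<close>.\<close>
 obtain z where z: "k \<le> z" "z \<le> n" "\<And>l. k \<le> l \<Longrightarrow> l \<le> z \<Longrightarrow> L l = 1" "\<And>l. z < l \<Longrightarrow> L l = 0"
 proof -
  define z where "z = Max {l\<in>{k..n}. L l = 1}"
  have ne: "k \<in> {l\<in>{k..n}. L l = 1}" using Lk k by auto
  then have zin: "z \<in> {l\<in>{k..n}. L l = 1}" unfolding z_def by (intro Max_in) auto
  have "L l = 1" if "k \<le> l" "l \<le> z" for l
   using L_dec[of k l] L_dec[of l z] that zin k Lk by auto
  moreover have "L l = 0" if "z < l" for l
  proof (cases "l \<le> n")
   case True
   have "l \<notin> {l\<in>{k..n}. L l = 1}"
    using Max_ge[of "{l\<in>{k..n}. L l = 1}" l] that unfolding z_def by (metis finite_atLeastAtMost finite_Collect_conjI Collect_mem_eq finite_subset mem_Collect_eq not_less subsetI)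
   then have "L l \<noteq> 1" using True that zin by auto
   moreover have "L l \<le> 1" using L_dec[of k l] that zin k Lk by auto
   ultimately show ?thesis using L_nonneg[of l] by auto
  next
   case False
   then show ?thesis using part by (auto simp: is_partition_def lookup_outside)
  qed
  ultimately show ?thesis using that[of z] zin by auto
 qed
 have scale: "Op i (\<lambda>\<xi>. C * f \<xi>) = (\<lambda>\<xi>. C * Op i f \<xi>)" for i f C
  by (rule linear_op.lin_scale[OF lin])
 have lin2: "Op i (\<lambda>\<xi>. x * f \<xi> + y * g \<xi>) = (\<lambda>\<xi>. x * Op i f \<xi> + y * Op i g \<xi>)" for i f g x y
  by (rule orbit_op_linear)
 have lin3: "Op i (\<lambda>\<xi>. x * f \<xi> + y * g \<xi> + w * g' \<xi>) = (\<lambda>\<xi>. x * Op i f \<xi> + y * Op i g \<xi> + w * Op i g' \<xi>)"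
  for i f g g' x y w
  using orbit_op_linear[of n t a b i 1 "\<lambda>\<xi>. x * f \<xi> + y * g \<xi>" w g'] by (simp add: lin2)
 have std: "st i \<mu> f = Op i f" if "P i \<mu> = 0" "Q i \<mu> = 1" for i \<mu> f
  using that by (simp add: st_def step_op_def)
 have hk: "h j = t" if "j < n" for j using that by (simp add: eta_def)
 have Op1: "Op j (v 1 j) = v 1 (j+1)" if "k \<le> j" "j < n" for j
  using Op_tail_delta(1)[of j "ins 1 j"] that dd_ins[OF that, of 1] L_nonneg[of "j+1"] refl_ins[OF that, of 1] by simp
 define B where "B j = c * d * t ^ (j - k)" for j
 define A where "A j = (t - 1) * B j / t" for j
 have BA: "t * A j = (t - 1) * B j" "A (Suc j) = (t - 1) * B j" "B (Suc j) = t * B j" if "k \<le> j" for j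
  using t0 that by (simp_all add: A_def B_def Suc_diff_le)
 \<comment> \<open>Moving the entry \<open>1\<close> to the right.\<close>
 have block: "j \<le> z \<longrightarrow> e (ins 1 j) = (\<lambda>\<xi>. C * v 1 j \<xi> + C * B j * v (-1) j \<xi>)" if "k \<le> j" for j
  using that
 proof (induction j rule: dec_induct)
  case base then show ?case using E by (auto simp: B_def algebra_simps)
 next
  case (step j)
  show ?case
  proof
   assume "Suc j \<le> z"
   then have j: "k \<le> j" "j < n" "L (j+1) = 1" "j \<le> z" using step z by auto
   have "P j (ins 1 j) = 0" "Q j (ins 1 j) = 1"
    by (rule standard_coeff; use j k in \<open>auto simp: ins_lookup\<close>)+
   then have "e (ins 1 (j+1)) = Op j (e (ins 1 j))"
    using ins_step_down[OF j(1,2), of 1] std by simp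
   moreover have IH: "Op j (e (ins 1 j)) = (\<lambda>\<xi>. C * Op j (v 1 j) \<xi> + C * B j * Op j (v (-1) j) \<xi>)"
    using step j by (simp only: lin2 order.strict_implies_order mp)
   moreover have "Op j (v (-1) j) = (\<lambda>\<xi>. t * v (-1) (j+1) \<xi>)"
    using Op_tail_delta(2)[of j "ins (-1) j"] dd_ins[OF j(1,2), of "-1"] j hk[of j] ins_same[OF j(1,2), of "-1"] by simp
   ultimately show "e (ins 1 (Suc j)) = (\<lambda>\<xi>. C * v 1 (Suc j) \<xi> + C * B (Suc j) * v (-1) (Suc j) \<xi>)"
    using IH Op1[OF j(1,2)] by (simp add: lin2 BA(3)[OF j(1)] mult_ac)
  qed
 qed
 have right: "j \<le> n \<longrightarrow> e (ins 1 j) = (\<lambda>\<xi>. C * v 1 j \<xi> + C * B j * v (-1) j \<xi> + C * A j * trace z j \<xi>)"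
  if "z \<le> j" for j
  using that
 proof (induction j rule: dec_induct)
  case base then show ?case using block[OF z(1)] by (simp add: trace_def)
 next
  case (step j)
  show ?case
  proof
   assume "Suc j \<le> n"
   then have j: "k \<le> j" "j < n" "L (j+1) = 0" "z \<le> j" using step z by auto
   have "P j (ins 1 j) = 0" "Q j (ins 1 j) = 1"
    by (rule standard_coeff; use j k in \<open>auto simp: ins_lookup\<close>)+
   then have e1: "e (ins 1 (j+1)) = Op j (e (ins 1 j))"
    using ins_step_down[OF j(1,2), of 1] std by simp
   have 2: "Op j (v (-1) j) = (\<lambda>\<xi>. (t - 1) * v (-1) j \<xi> + t * v (-1) (j+1) \<xi>)"
    using Op_tail_delta(3)[of j "ins (-1) j"] dd_ins[OF j(1,2), of "-1"] j hk[of j] refl_ins[OF j(1,2), of "-1"] by simp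
   have 3: "Op j (trace z j) = (\<lambda>\<xi>. t * trace z j \<xi>)"
    using Op_trace[of z j] z j hk[of j] by simp
   have "e (ins 1 (j+1)) = (\<lambda>\<xi>. C * v 1 (j+1) \<xi> + C * B j * ((t - 1) * v (-1) j \<xi> + t * v (-1) (j+1) \<xi>)
      + C * A j * (t * trace z j \<xi>))"
    using step j unfolding e1 by (simp add: lin3 Op1[OF j(1,2)] 2 3)
   also have "\<dots> = (\<lambda>\<xi>. C * v 1 (j+1) \<xi> + C * B (j+1) * v (-1) (j+1) \<xi> + C * A (j+1) * trace z (j+1) \<xi>)"
   proof
    fix \<xi>
    have X: "C * A j * (t * trace z j \<xi>) = C * ((t - 1) * B j) * trace z j \<xi>"
     by (simp flip: BA(1)[OF j(1)])
    show "C * v 1 (j+1) \<xi> + C * B j * ((t - 1) * v (-1) j \<xi> + t * v (-1) (j+1) \<xi>)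
       + C * A j * (t * trace z j \<xi>)
      = C * v 1 (j+1) \<xi> + C * B (j+1) * v (-1) (j+1) \<xi> + C * A (j+1) * trace z (j+1) \<xi>"
     unfolding X BA(2,3)[OF j(1), unfolded Suc_eq_plus1] trace_Suc[OF j(4), unfolded Suc_eq_plus1]
     by (simp add: algebra_simps)
   qed
   finally show "e (ins 1 (Suc j)) = (\<lambda>\<xi>. C * v 1 (Suc j) \<xi> + C * B (Suc j) * v (-1) (Suc j) \<xi>
     + C * A (Suc j) * trace z (Suc j) \<xi>)" by simp
  qed
 qed
 define s0 where "s0 = a * b * c * d"
 have scard: "small_count m (ins x j) = m + 1 - k"
  if "k \<le> m + 1" "m < j" "m \<le> n" for x m j
 proof -
  have "{l \<in> {1..m}. lk (ins x j) l = -1 \<or> lk (ins x j) l = 0} = {k..m}"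
  proof (intro equalityI subsetI)
   fix l assume "l \<in> {l \<in> {1..m}. lk (ins x j) l = -1 \<or> lk (ins x j) l = 0}"
   then have l: "l \<in> {1..m}" "lk (ins x j) l = -1 \<or> lk (ins x j) l = 0" by auto
   show "l \<in> {k..m}"
   proof (rule ccontr)
    assume "l \<notin> {k..m}"
    then have "l < k" using l by auto
    then have "1 \<le> L l" using L_dec[of l k] l Lk by auto
    then show False using l that \<open>l < k\<close> by (auto simp: ins_lookup)
   qed
  next
   fix l assume l: "l \<in> {k..m}"
   then have "L (l+1) = 1 \<or> L (l+1) = 0" using z(3)[of "l+1"] z(4)[of "l+1"] by (cases "l + 1 \<le> z") auto
   then show "l \<in> {l \<in> {1..m}. lk (ins x j) l = -1 \<or> lk (ins x j) l = 0}"
    using l k that by (auto simp: ins_lookup)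
  qed
  then show ?thesis by (simp add: small_count_def)
 qed
 \<comment> \<open>The sign change.\<close>
 define N where "N j = int j + int k - 2 * int n" for j
 define \<rho> where "\<rho> j = (t - 1) * s0 / (t * (s0 - t powi N j))" for j
 have good_N: "s0 \<noteq> t powi M" "c * d \<noteq> t powi M" if "- 3 * int n - 3 \<le> M" "M \<le> 3 * int n + 3" for M
  using good that by (auto simp: good_params_def s0_def)
 have N_bounds: "s0 \<noteq> t powi N j" "s0 \<noteq> t powi N j / t" if "j \<le> n" for j
 proof -
  have "t powi N j / t = t powi (N j - 1)" using t0 by (simp add: power_int_diff)
  then show "s0 \<noteq> t powi N j" "s0 \<noteq> t powi N j / t" using good_N[of "N j"] good_N[of "N j - 1"] that k by (auto simp: N_def)
 qed
 have flip: "\<exists>D. e (ins (-1) n) = (\<lambda>\<xi>. D * (v (-1) n \<xi> + \<rho> n * trace z n \<xi>))"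
 proof -
  have "small_count (n-1) (ins 1 n) = n - 1 + 1 - k" by (rule scard) (use k in auto)
  moreover have "small_count n (ins 1 n) = small_count (n-1) (ins 1 n)"
   using small_count_Suc[of "n-1" "ins 1 n"] k by (simp add: ins_lookup)
  ultimately have r: "r_exp n (ins 1 n) = int (n - k)"
   unfolding r_exp_alt using k by (simp add: ins_lookup)
  define w where "w = t ^ (n - k)"
  have w0: "w \<noteq> 0" using t0 by (simp add: w_def)
  have p: "P n (ins 1 n) = - s0 * w"
   using flip_coeff(1)[of "ins 1 n"] k unfolding r power_int_of_nat w_def s0_def by (simp add: ins_lookup)
  have Bn: "B n = c * d * w" by (simp add: B_def w_def)
  have e1: "e (ins (-1) n) = (\<lambda>\<xi>. (Op n (e (ins 1 n)) \<xi> - P n (ins 1 n) * e (ins 1 n) \<xi>) / Q n (ins 1 n))"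
   using ins_step_flip[of 1] by (simp add: st_def step_op_def)
  have hn: "h n = - (a * b)" by (simp add: eta_def)
  have 1: "Op n (v 1 n) = v (-1) n"
   using Op_tail_delta(1)[OF k(2) order_refl, of "ins 1 n"] dd_ins_last[of 1] refl_ins_last[of 1] by simp
  have 2: "Op n (v (-1) n) = (\<lambda>\<xi>. (h n - 1) * v (-1) n \<xi> + h n * v 1 n \<xi>)"
   using Op_tail_delta(3)[OF k(2) order_refl, of "ins (-1) n"] dd_ins_last[of "-1"] refl_ins_last[of "-1"] by simp
  have 3: "Op n (trace z n) = (\<lambda>\<xi>. h n * trace z n \<xi>)"
   using Op_trace[of z n] z by simp
  have en: "e (ins 1 n) = (\<lambda>\<xi>. C * v 1 n \<xi> + C * B n * v (-1) n \<xi> + C * A n * trace z n \<xi>)"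
   using right[OF z(2)] by simp
  have wN: "1 / w = t powi N n"
  proof -
   have "N n = - int (n - k)" using k by (simp add: N_def)
   then show ?thesis by (simp only: power_int_minus power_int_of_nat w_def divide_inverse mult_1)
  qed
  have ne: "1 - s0 * w \<noteq> 0" using N_bounds(1)[of n] w0 unfolding wN[symmetric] by (auto simp: field_simps)
  have \<rho>n: "\<rho> n * (1 - s0 * w) = - (a * b) * A n"
  proof -
   have "t * (s0 - 1 / w) * w = - t * (1 - s0 * w)" using w0 by (simp add: field_simps)
   moreover have "s0 - 1 / w \<noteq> 0" using N_bounds(1)[of n] unfolding wN[symmetric] by simp
   ultimately have "\<rho> n = - (t - 1) * s0 * w / (t * (1 - s0 * w))"
    unfolding \<rho>_def wN[symmetric] using w0 t0 ne by (simp add: field_simps)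
   then show ?thesis using ne t0 unfolding A_def Bn s0_def by (simp add: field_simps)
  qed
  define D where "D = C * (1 - B n) * (1 - s0 * w) / Q n (ins 1 n)"
  have "e (ins (-1) n) \<xi> = D * (v (-1) n \<xi> + \<rho> n * trace z n \<xi>)" for \<xi>
  proof -
   have "Op n (e (ins 1 n)) \<xi> - P n (ins 1 n) * e (ins 1 n) \<xi>
     = C * (1 - B n) * ((1 - s0 * w) * v (-1) n \<xi> - (a * b) * A n * trace z n \<xi>)"
    unfolding en lin3 1 2 3 p hn Bn s0_def by (simp add: algebra_simps)
   also have "\<dots> = C * (1 - B n) * ((1 - s0 * w) * v (-1) n \<xi> + \<rho> n * (1 - s0 * w) * trace z n \<xi>)"
    unfolding \<rho>n by simp
   also have "\<dots> = C * (1 - B n) * (1 - s0 * w) * (v (-1) n \<xi> + \<rho> n * trace z n \<xi>)"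
    by (simp add: algebra_simps)
   finally show ?thesis unfolding e1 D_def by simp
  qed
  then show ?thesis by blast
 qed
 \<comment> \<open>Moving the entry \<open>-1\<close> back to the left.\<close>
 have leftwards: "\<exists>D. e (ins (-1) j) = (\<lambda>\<xi>. D * (v (-1) j \<xi> + \<rho> j * trace z j \<xi>))" if "z \<le> j" "j \<le> n" for j
  using that(2,1)
 proof (induction j rule: inc_induct)
  case base show ?case by (rule flip)
 next
  case (step j)
  then have j: "k \<le> j" "j < n" "L (j+1) = 0" "z \<le> j" using z by auto
  obtain D where D: "e (ins (-1) (j+1)) = (\<lambda>\<xi>. D * v (-1) (j+1) \<xi> + D * \<rho> (j+1) * trace z (j+1) \<xi>)"
   using step by (auto simp: algebra_simps)
  define r where "r = \<rho> (j+1)"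
  have tr: "trace z (j+1) = (\<lambda>\<xi>. trace z j \<xi> + v (-1) j \<xi>)" using trace_Suc[OF j(4)] by auto
  have D': "e (ins (-1) (j+1)) = (\<lambda>\<xi>. D * v (-1) (j+1) \<xi> + D * r * v (-1) j \<xi> + D * r * trace z j \<xi>)"
   unfolding D r_def[symmetric] tr by (auto simp: algebra_simps)
  have e1: "e (ins (-1) j) = (\<lambda>\<xi>. (Op j (e (ins (-1) (j+1))) \<xi> - P j (ins (-1) (j+1)) * e (ins (-1) (j+1)) \<xi>) / Q j (ins (-1) (j+1)))"
   using ins_step_back[OF j(1,2), of "-1"] j(3) by (simp add: st_def step_op_def)
  have sj: "s j (ins (-1) (j+1)) = ins (-1) j" using refl_ins[OF j(1,2), of "-1"] by (metis refl_refl)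
  have dj: "dd j (ins (-1) (j+1)) = 1" using j k by (auto simp: pair_root_def ins_lookup)
  have 1: "Op j (v (-1) (j+1)) = v (-1) j"
   using Op_tail_delta(1)[of j "ins (-1) (j+1)"] dj sj j by simp
  have 2: "Op j (v (-1) j) = (\<lambda>\<xi>. (t - 1) * v (-1) j \<xi> + t * v (-1) (j+1) \<xi>)"
   using Op_tail_delta(3)[of j "ins (-1) j"] dd_ins[OF j(1,2), of "-1"] j hk[of j] refl_ins[OF j(1,2), of "-1"] by simp
  have 3: "Op j (trace z j) = (\<lambda>\<xi>. t * trace z j \<xi>)"
   using Op_trace[of z j] z j hk[of j] by simp
  have ne: "n_exp n j (ins (-1) (j+1)) = N (j+1)"
  proof -
   have "small_count (j - 1) (ins (-1) (j+1)) = j - 1 + 1 - k" by (rule scard) (use j in auto)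
   moreover have "zero_count n (j+2) (ins (-1) (j+1)) = n - (j+1)"
   proof -
    have "{l \<in> {j+2..n}. lk (ins (-1) (j+1)) l = 0} = {j+2..n}"
     using j z k by (auto simp: ins_lookup)
    then show ?thesis by (simp add: zero_count_def)
   qed
   ultimately show ?thesis using j k by (simp add: n_exp_counts N_def)
  qed
  have p: "P j (ins (-1) (j+1)) = t * r"
  proof -
   have "P j (ins (-1) (j+1)) = (t - 1) * s0 / (s0 - t powi N (j+1))"
    using coeff_special_swap(1)[of j n "ins (-1) (j+1)" t a b c d] j k ne by (simp add: ins_lookup s0_def)
   then show ?thesis using t0 by (simp add: r_def \<rho>_def)
  qed
  have rr: "\<rho> j * (1 + t * r) = t * r"
  proof -
   have Nj: "t powi N j = t powi N (j+1) / t" using t0 by (simp add: N_def power_int_diff flip: power_int_add_1)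
     (simp add: algebra_simps power_int_diff power_int_add)
   have "t * \<rho> j * (1 + t * r) = t * (t * r)"
    by (rule special_braid3[OF s0_def]) (use N_bounds[of "j+1"] j Nj t0 in \<open>auto simp: r_def \<rho>_def\<close>)
   then show ?thesis using t0 by (simp add: mult.assoc)
  qed
  define D2 where "D2 = D * (1 - r) * (1 + t * r) / Q j (ins (-1) (j+1))"
  have "e (ins (-1) j) \<xi> = D2 * (v (-1) j \<xi> + \<rho> j * trace z j \<xi>)" for \<xi>
  proof -
   have "Op j (e (ins (-1) (j+1))) \<xi> - P j (ins (-1) (j+1)) * e (ins (-1) (j+1)) \<xi>
     = D * (1 - r) * ((1 + t * r) * v (-1) j \<xi> + t * r * trace z j \<xi>)"
    unfolding D' lin3 1 2 3 p by (simp add: algebra_simps)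
   also have "\<dots> = D * (1 - r) * ((1 + t * r) * v (-1) j \<xi> + \<rho> j * (1 + t * r) * trace z j \<xi>)"
    unfolding rr ..
   also have "\<dots> = D * (1 - r) * (1 + t * r) * (v (-1) j \<xi> + \<rho> j * trace z j \<xi>)"
    by (simp add: algebra_simps)
   finally show ?thesis unfolding e1 D2_def by simp
  qed
  then show ?case by blast
 qed
 obtain D where "e (ins (-1) z) = (\<lambda>\<xi>. D * v (-1) z \<xi>)" using leftwards[OF order_refl z(2)] by (auto simp: trace_def)
 moreover have "ins (-1) z = ins (-1) k"
 proof -
  have "ins (-1) j = ins (-1) k" if "k \<le> j" "j \<le> z" for j
   using that
  proof (induction j rule: dec_induct)
   case (step j)
   then show ?case using ins_same[of j "-1"] z by auto
  qed simp
  then show ?thesis using z by blast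
 qed
 ultimately show ?thesis by metis
qed

end

end

context hecke_point
begin

definition half_flipped :: "comp \<Rightarrow> nat \<Rightarrow> comp" where
 "half_flipped \<sigma> k = comp_of n (\<lambda>j. if j \<le> k then lk \<sigma> j else - lk \<sigma> j)"

definition half_weight :: "comp \<Rightarrow> nat \<Rightarrow> comp \<Rightarrow> 'k" where
 "half_weight \<sigma> k \<xi> = (if \<forall>j\<in>{k<..n}. lk \<xi> j = - lk \<sigma> j
   then \<Prod>j\<in>{1..k}. top_weight (c * d) (lk \<sigma> j) (lk \<xi> j) else 0)"

text \<open>The starting vector for entry \<open>k\<close> is the final vector of entry \<open>k + 1\<close>.\<close>

lemma half_weight_split:
 assumes part: "is_partition n \<sigma>" and k: "1 \<le> k" "k \<le> n"
 shows "half_weight \<sigma> k \<xi> = tail_delta \<sigma> k (ins \<sigma> k (lk \<sigma> k) k) \<xi>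
   + (if lk \<sigma> k = 1 then c * d * tail_delta \<sigma> k (ins \<sigma> k (-1) k) \<xi> else 0)"
  and "half_weight \<sigma> (k - 1) \<xi> = tail_delta \<sigma> k (ins \<sigma> k (- lk \<sigma> k) k) \<xi>"
proof -
 have sp: "{1..k} = insert k {1..<k}" and sp': "{1..k-1} = {1..<k}" using k by auto
 have T: "(\<forall>j\<in>{k..n}. lk \<xi> j = lk (ins \<sigma> k x k) j) \<longleftrightarrow> lk \<xi> k = x \<and> (\<forall>j\<in>{k<..n}. lk \<xi> j = - lk \<sigma> j)" for x
 proof -
  have "{k..n} = insert k {k<..n}" using k by auto
  then show ?thesis using k by (auto simp: ins_lookup[OF part k])
 qed
 show "half_weight \<sigma> k \<xi> = tail_delta \<sigma> k (ins \<sigma> k (lk \<sigma> k) k) \<xi>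
   + (if lk \<sigma> k = 1 then c * d * tail_delta \<sigma> k (ins \<sigma> k (-1) k) \<xi> else 0)"
  unfolding half_weight_def tail_delta_def[OF part k] T prefix_weight_def[OF part k] sp
  by (auto simp: top_weight_def)
 have D: "(\<forall>j\<in>{k - 1<..n}. lk \<xi> j = - lk \<sigma> j) \<longleftrightarrow> lk \<xi> k = - lk \<sigma> k \<and> (\<forall>j\<in>{k<..n}. lk \<xi> j = - lk \<sigma> j)"
 proof -
  have "{k - 1<..n} = insert k {k<..n}" using k by auto
  then show ?thesis by auto
 qed
 show "half_weight \<sigma> (k - 1) \<xi> = tail_delta \<sigma> k (ins \<sigma> k (- lk \<sigma> k) k) \<xi>"
  unfolding half_weight_def tail_delta_def[OF part k] T D prefix_weight_def[OF part k] sp' ..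
qed

lemma half_flipped_ins:
 assumes part: "is_partition n \<sigma>" and k: "1 \<le> k" "k \<le> n"
 shows "half_flipped \<sigma> k = ins \<sigma> k (lk \<sigma> k) k" "half_flipped \<sigma> (k - 1) = ins \<sigma> k (- lk \<sigma> k) k"
 by (rule poly_mapping_eqI; use k in \<open>auto simp: half_flipped_def comp_of_lookup ins_lookup[OF part k]\<close>)+

lemma half_flipped_fam:
 assumes part: "is_partition n \<sigma>" and "k \<le> n"
 shows "\<exists>C. e (half_flipped \<sigma> k) = (\<lambda>\<xi>. C * half_weight \<sigma> k \<xi>)"
 using assms(2)
proof (induction k rule: inc_induct)
 case base
 have "half_flipped \<sigma> n = \<sigma>"
  by (rule composition_eqI[of _ n]) (use part in \<open>auto simp: half_flipped_def comp_of_composition comp_of_lookup is_partition_def\<close>)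
 moreover have "e \<sigma> = top_base n (c * d) \<sigma>"
  unfolding orbit_fam_def by (rule path_fam_dominant) (use part in \<open>auto simp: is_partition_iff\<close>)
 moreover have "top_base n (c * d) \<sigma> = half_weight \<sigma> n"
  by (rule ext) (simp add: top_base_def half_weight_def)
 ultimately show ?case by (metis mult_1)
next
 case (step m)
 define k where "k = Suc m"
 have k: "1 \<le> k" "k \<le> n" using step by (auto simp: k_def)
 have m: "m = k - 1" by (simp add: k_def)
 obtain C where C: "e (half_flipped \<sigma> k) = (\<lambda>\<xi>. C * half_weight \<sigma> k \<xi>)"
  using step by (auto simp: k_def)
 note sp = half_weight_split[OF part k] and hf = half_flipped_ins[OF part k]
 have "0 \<le> lk \<sigma> k" by (rule partition_nonneg[OF part])
 then consider "lk \<sigma> k = 0" | "lk \<sigma> k = 1" | "2 \<le> lk \<sigma> k" by linarith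
 then show ?case
 proof cases
  case 1
  then show ?thesis using C unfolding m hf sp by auto
 next
  case 2
  have "e (ins \<sigma> k 1 k) = (\<lambda>\<xi>. C * (tail_delta \<sigma> k (ins \<sigma> k 1 k) \<xi> + c * d * tail_delta \<sigma> k (ins \<sigma> k (-1) k) \<xi>))"
   using C unfolding hf sp using 2 by simp
  from antidominant_one[OF part k 2 this] show ?thesis unfolding m hf sp using 2 by simp
 next
  case 3
  have "e (ins \<sigma> k (lk \<sigma> k) k) = (\<lambda>\<xi>. C * tail_delta \<sigma> k (ins \<sigma> k (lk \<sigma> k) k) \<xi>)"
   using C unfolding hf sp using 3 by simp
  from antidominant_large[OF part k 3 this] show ?thesis unfolding m hf sp by blast
 qed
qed

lemma antidominant_fam:
 assumes part: "is_partition n \<sigma>" and \<xi>: "\<xi> \<in> compositions n" "\<xi> \<noteq> - \<sigma>"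
 shows "e (- \<sigma>) \<xi> = 0"
proof -
 have "half_flipped \<sigma> 0 = - \<sigma>"
  by (rule composition_eqI[of _ n])
    (use part in \<open>auto simp: half_flipped_def comp_of_composition comp_of_lookup is_partition_def compositions_uminus\<close>)
 then obtain C where "e (- \<sigma>) = (\<lambda>\<xi>. C * half_weight \<sigma> 0 \<xi>)"
  using half_flipped_fam[OF part, of 0] by auto
 moreover have "half_weight \<sigma> 0 \<xi> = 0"
 proof -
  have "\<not> (\<forall>j\<in>{0<..n}. lk \<xi> j = - lk \<sigma> j)"
  proof
   assume "\<forall>j\<in>{0<..n}. lk \<xi> j = - lk \<sigma> j"
   then have "\<xi> = - \<sigma>" using \<xi>(1) part
    by (intro composition_eqI[of _ n]) (auto simp: is_partition_def compositions_uminus)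
   with \<xi> show False by simp
  qed
  then show ?thesis by (auto simp: half_weight_def)
 qed
 ultimately show ?thesis by simp
qed

lemma dd_uminus: "dd i (- \<mu>) = - dd i \<mu>"
 by (auto simp: pair_root_def)

text \<open>The family is unitriangular: starting from the antidominant member, every upward step stays
 inside the lower set of the lifting order.\<close>

lemma orbit_fam_bruhat:
 assumes part: "is_partition n \<sigma>" and \<mu>: "\<mu> \<in> compositions n" "same_orbit n \<mu> \<sigma>"
 shows "(\<forall>\<xi>\<in>compositions n. same_orbit n \<xi> \<sigma> \<longrightarrow> e \<mu> \<xi> \<noteq> 0 \<longrightarrow> bruhat n \<xi> \<mu>) \<and> e \<mu> \<mu> = e (- \<sigma>) (- \<sigma>)"
proof -
 have "\<nu> \<in> compositions n \<longrightarrow> same_orbit n (- \<nu>) \<sigma> \<longrightarrow>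
   (\<forall>\<xi>\<in>compositions n. same_orbit n \<xi> \<sigma> \<longrightarrow> e (- \<nu>) \<xi> \<noteq> 0 \<longrightarrow> bruhat n \<xi> (- \<nu>)) \<and> e (- \<nu>) (- \<nu>) = e (- \<sigma>) (- \<sigma>)" for \<nu>
 proof (induction \<nu> rule: height_induct[of n])
  case (step \<nu>)
  show ?case
  proof (intro impI)
   assume \<nu>: "\<nu> \<in> compositions n" "same_orbit n (- \<nu>) \<sigma>"
   have o\<nu>: "same_orbit n \<nu> \<sigma>" using \<nu> by (simp add: same_orbit_def excess_uminus)
   show "(\<forall>\<xi>\<in>compositions n. same_orbit n \<xi> \<sigma> \<longrightarrow> e (- \<nu>) \<xi> \<noteq> 0 \<longrightarrow> bruhat n \<xi> (- \<nu>)) \<and> e (- \<nu>) (- \<nu>) = e (- \<sigma>) (- \<sigma>)"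
   proof (cases "is_partition n \<nu>")
    case True
    then have "\<nu> = \<sigma>" using partition_unique part o\<nu> by blast
    then show ?thesis using antidominant_fam[OF part] by (auto simp: bruhat_def)
   next
    case False
    then obtain i where i: "i \<in> {1..n}" "dd i \<nu> < 0" using \<nu> by (force simp: is_partition_iff)
    define \<mu> where "\<mu> = - \<nu>"
    define \<rho> where "\<rho> = s i \<mu>"
    have \<rho>: "dd i \<rho> < 0" "s i \<rho> = \<mu>" "\<rho> \<in> compositions n" "\<mu> \<in> compositions n" "0 < dd i \<mu>"
     using i \<nu> by (auto simp: \<rho>_def \<mu>_def dd_uminus refl_composition compositions_uminus)
    have neg: "s i \<nu> = - \<rho>" by (simp add: \<rho>_def \<mu>_def refl_comp_uminus)
    have o\<rho>: "same_orbit n \<rho> \<sigma>" using \<nu>(2) i by (simp add: \<rho>_def \<mu>_def same_orbit_def excess_refl)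
    have IH: "\<forall>\<xi>\<in>compositions n. same_orbit n \<xi> \<sigma> \<longrightarrow> e \<rho> \<xi> \<noteq> 0 \<longrightarrow> bruhat n \<xi> \<rho>" "e \<rho> \<rho> = e (- \<sigma>) (- \<sigma>)"
     using step[OF height_refl[OF i]] o\<rho> \<rho>(3) unfolding neg by (auto simp: compositions_uminus)
    have q: "Q i \<rho> = h i" "h i \<noteq> 0" using coeff_lower(2,5)[OF i(1) \<rho>(5) good] by (auto simp: \<rho>_def)
    have rel: "Op i (e \<rho>) \<xi> = P i \<rho> * e \<rho> \<xi> + h i * e \<mu> \<xi>" for \<xi>
     using orbit_fam_relation[OF i(1), of \<rho>] q \<rho>(2) by (simp add: fun_eq_iff)
    have low: "bruhat n \<rho> \<mu>" unfolding \<rho>_def by (rule bruhat_refl_lower) (use i \<rho> in auto)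
    have supp: "bruhat n \<xi> \<mu>" if \<xi>: "\<xi> \<in> compositions n" "same_orbit n \<xi> \<sigma>" "e \<mu> \<xi> \<noteq> 0" for \<xi>
    proof -
     have "e \<rho> \<xi> \<noteq> 0 \<or> e \<rho> (s i \<xi>) \<noteq> 0"
      using rel[of \<xi>] \<xi>(3) q by (auto simp: orbit_op_def split: if_splits)
     then show ?thesis
     proof
      assume "e \<rho> \<xi> \<noteq> 0"
      then show ?thesis using IH(1) \<xi> low bruhat_trans by blast
     next
      assume "e \<rho> (s i \<xi>) \<noteq> 0"
      moreover have o: "same_orbit n (s i \<xi>) \<sigma>" using \<xi>(2) i by (simp add: same_orbit_def excess_refl)
      ultimately have "bruhat n (s i \<xi>) \<rho>"
       using IH(1) \<xi> refl_composition[OF i(1)] by blast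
      moreover have "same_orbit n (s i \<xi>) \<rho>" using o o\<rho> by (simp add: same_orbit_def)
      ultimately have "bruhat n (s i (s i \<xi>)) (s i \<rho>)"
       using i(1) \<rho>(1) bruhat_lift_up by blast
      then show ?thesis by (simp add: \<rho>(2))
     qed
    qed
    have "e \<mu> \<mu> = e \<rho> \<rho>"
    proof -
     have "\<rho> \<noteq> \<mu>" using \<rho>(1,5) by auto
     then have "\<not> bruhat n \<mu> \<rho>" using low bruhat_antisym \<rho>(3,4) by blast
     moreover have "same_orbit n \<mu> \<sigma>" using \<nu>(2) by (simp add: \<mu>_def)
     ultimately have "e \<rho> \<mu> = 0" using IH(1) \<rho>(4) by blast
     then show ?thesis using rel[of \<mu>] \<rho>(5) q(2) by (simp add: orbit_op_def \<rho>_def[symmetric])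
    qed
    then have "e (- \<nu>) (- \<nu>) = e (- \<sigma>) (- \<sigma>)" using IH(2) by (simp add: \<mu>_def)
    then show ?thesis using supp unfolding \<mu>_def by (intro conjI ballI impI)
   qed
  qed
 qed
 from this[of "- \<mu>"] \<mu> show ?thesis by (simp add: compositions_uminus)
qed

theorem orbit_fam_triangular:
 assumes \<mu>: "\<mu> \<in> compositions n"
 shows "e \<mu> \<mu> = 1"
  and "\<And>\<xi>. \<xi> \<in> compositions n \<Longrightarrow> same_orbit n \<xi> \<mu> \<Longrightarrow> e \<mu> \<xi> \<noteq> 0 \<Longrightarrow> bruhat n \<xi> \<mu>"
proof -
 define \<sigma> where "\<sigma> = plus_part n \<mu>"
 have \<sigma>: "is_partition n \<sigma>" "same_orbit n \<mu> \<sigma>"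
  using plus_part_partition plus_part_same_orbit same_orbit_sym by (auto simp: \<sigma>_def)
 have \<sigma>c: "\<sigma> \<in> compositions n" using \<sigma> by (simp add: is_partition_def)
 have "e \<sigma> = top_base n (c * d) \<sigma>"
  unfolding orbit_fam_def by (rule path_fam_dominant) (use \<sigma> in \<open>auto simp: is_partition_iff\<close>)
 then have "e \<sigma> \<sigma> = 1" by (simp add: top_base_def top_weight_def)
 then have "e (- \<sigma>) (- \<sigma>) = 1" using orbit_fam_bruhat[OF \<sigma>(1) \<sigma>c] by simp
 then show "e \<mu> \<mu> = 1" using orbit_fam_bruhat[OF \<sigma>(1) \<mu> \<sigma>(2)] by simp
 show "bruhat n \<xi> \<mu>" if "\<xi> \<in> compositions n" "same_orbit n \<xi> \<mu>" "e \<mu> \<xi> \<noteq> 0" for \<xi>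
  using orbit_fam_bruhat[OF \<sigma>(1) \<mu> \<sigma>(2)] that same_orbit_trans[OF _ \<sigma>(2)] by blast
qed

end

section \<open>Integration over the torus\<close>

definition unit_measure :: "real measure" where "unit_measure = restrict_space lborel {0..1}"

lemma space_unit_measure [simp]: "space unit_measure = {0..1}"
 by (simp add: unit_measure_def space_restrict_space)

lemma prob_space_unit_measure: "prob_space unit_measure"
 by (rule prob_spaceI) (simp add: unit_measure_def space_restrict_space emeasure_restrict_space)

interpretation U: prob_space unit_measure by (rule prob_space_unit_measure)

interpretation UP: product_sigma_finite "\<lambda>_::nat. unit_measure"
 by unfold_locales

lemma prob_space_PiM_unit: "prob_space (Pi\<^sub>M I (\<lambda>_. unit_measure))"
 by (rule prob_space_PiM) (rule prob_space_unit_measure)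

lemma measurable_ident_unit [measurable]: "(\<lambda>x. x) \<in> borel_measurable unit_measure"
 by (simp add: unit_measure_def measurable_restrict_space1)

abbreviation cis1 :: "real \<Rightarrow> complex" where "cis1 x \<equiv> cis (2 * pi * x)"

lemma measurable_cis1 [measurable]: "cis1 \<in> borel_measurable borel"
 by (intro borel_measurable_continuous_onI continuous_intros)

definition torus_point :: "nat set \<Rightarrow> (nat \<Rightarrow> complex) \<Rightarrow> (nat \<Rightarrow> real) \<Rightarrow> nat \<Rightarrow> complex" where
 "torus_point I w \<theta> j = (if j \<in> I then cis1 (\<theta> j) else w j)"

definition on_torus :: "(nat \<Rightarrow> complex) \<Rightarrow> bool" where "on_torus z \<longleftrightarrow> (\<forall>j. norm (z j) = 1)"

lemma on_torus_point: "on_torus w \<Longrightarrow> on_torus (torus_point I w \<theta>)"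
 by (simp add: on_torus_def torus_point_def)

lemma on_torus_nz: "on_torus z \<Longrightarrow> z j \<noteq> 0"
 by (metis on_torus_def norm_zero zero_neq_one)

lemma on_torus_norm: "on_torus z \<Longrightarrow> norm (z j) = 1"
 by (simp add: on_torus_def)

text \<open>The variables outside \<open>I\<close> are parameters, taken from \<open>w\<close>.\<close>

definition tint :: "nat set \<Rightarrow> (nat \<Rightarrow> complex) \<Rightarrow> ((nat \<Rightarrow> complex) \<Rightarrow> complex) \<Rightarrow> complex" where
 "tint I w f = (\<integral>\<theta>. f (torus_point I w \<theta>) \<partial>(Pi\<^sub>M I (\<lambda>_. unit_measure)))"

text \<open>Bounded functions on the torus that are measurable in every finite set of coordinates. The class
 is closed under the operations below, so that integrability never has to be checked.\<close>

definition torus_fun :: "((nat \<Rightarrow> complex) \<Rightarrow> complex) \<Rightarrow> bool" where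
 "torus_fun f \<longleftrightarrow> (\<exists>B. \<forall>z. on_torus z \<longrightarrow> norm (f z) \<le> B) \<and>
   (\<forall>I w. finite I \<longrightarrow> on_torus w \<longrightarrow>
    (\<lambda>\<theta>. f (torus_point I w \<theta>)) \<in> borel_measurable (Pi\<^sub>M I (\<lambda>_. unit_measure)))"

lemma torus_fun_meas:
 "torus_fun f \<Longrightarrow> finite I \<Longrightarrow> on_torus w \<Longrightarrow>
   (\<lambda>\<theta>. f (torus_point I w \<theta>)) \<in> borel_measurable (Pi\<^sub>M I (\<lambda>_. unit_measure))"
 by (simp add: torus_fun_def)

lemma torus_fun_bound: "torus_fun f \<Longrightarrow> \<exists>B. \<forall>z. on_torus z \<longrightarrow> norm (f z) \<le> B"
 by (simp add: torus_fun_def)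

lemma torus_fun_const [simp]: "torus_fun (\<lambda>_. x)"
 by (auto simp: torus_fun_def)

lemma torus_fun_coord [simp]: "torus_fun (\<lambda>z. z j)"
proof -
 have "(\<lambda>\<theta>. torus_point I w \<theta> j) \<in> borel_measurable (Pi\<^sub>M I (\<lambda>_. unit_measure))" for I w
 proof (cases "j \<in> I")
  case True
  then have "(\<lambda>\<theta>. cis1 (\<theta> j)) \<in> borel_measurable (Pi\<^sub>M I (\<lambda>_. unit_measure))"
   by measurable
  then show ?thesis using True by (simp add: torus_point_def)
 next
  case False
  then show ?thesis by (simp add: torus_point_def)
 qed
 then show ?thesis by (auto simp: torus_fun_def on_torus_def intro!: exI[of _ 1])
qed

lemma torus_fun_add:
 assumes "torus_fun f" "torus_fun g" shows "torus_fun (\<lambda>z. f z + g z)"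
proof -
 obtain A B where "\<forall>z. on_torus z \<longrightarrow> norm (f z) \<le> A" "\<forall>z. on_torus z \<longrightarrow> norm (g z) \<le> B"
  using assms torus_fun_bound by blast
 then have "\<forall>z. on_torus z \<longrightarrow> norm (f z + g z) \<le> A + B" by (meson norm_triangle_mono)
 then show ?thesis unfolding torus_fun_def
  by (intro conjI exI[of _ "A + B"] allI impI borel_measurable_add torus_fun_meas assms) auto
qed

lemma torus_fun_mult:
 assumes "torus_fun f" "torus_fun g" shows "torus_fun (\<lambda>z. f z * g z)"
proof -
 obtain A B where AB: "\<forall>z. on_torus z \<longrightarrow> norm (f z) \<le> A" "\<forall>z. on_torus z \<longrightarrow> norm (g z) \<le> B"
  using assms torus_fun_bound by blast
 have "norm (f z * g z) \<le> A * B" if "on_torus z" for z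
  unfolding norm_mult using AB that order_trans[OF norm_ge_zero] by (intro mult_mono) auto
 then show ?thesis unfolding torus_fun_def
  by (intro conjI exI[of _ "A * B"] allI impI borel_measurable_times torus_fun_meas assms) auto
qed

lemma torus_fun_uminus: "torus_fun f \<Longrightarrow> torus_fun (\<lambda>z. - f z)"
 using torus_fun_mult[of "\<lambda>_. -1" f] by simp

lemma torus_fun_diff: "torus_fun f \<Longrightarrow> torus_fun g \<Longrightarrow> torus_fun (\<lambda>z. f z - g z)"
 using torus_fun_add[of f "\<lambda>z. - g z"] torus_fun_uminus[of g] by simp

lemma torus_fun_prod: "(\<And>i. i \<in> A \<Longrightarrow> torus_fun (f i)) \<Longrightarrow> torus_fun (\<lambda>z. \<Prod>i\<in>A. f i z)"
 by (induction A rule: infinite_finite_induct) (auto intro: torus_fun_mult)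

lemma torus_fun_power: "torus_fun f \<Longrightarrow> torus_fun (\<lambda>z. f z ^ k)"
 by (induction k) (auto intro: torus_fun_mult)

lemma torus_fun_inverse:
 assumes "torus_fun f" "\<delta> > 0" "\<And>z. on_torus z \<Longrightarrow> \<delta> \<le> norm (f z)"
 shows "torus_fun (\<lambda>z. inverse (f z))"
proof -
 have "norm (inverse (f z)) \<le> inverse \<delta>" if "on_torus z" for z
  using assms that by (simp add: norm_inverse le_imp_inverse_le)
 then show ?thesis unfolding torus_fun_def
  by (intro conjI exI[of _ "inverse \<delta>"] allI impI borel_measurable_inverse torus_fun_meas assms) auto
qed

lemma torus_fun_coord_inverse [simp]: "torus_fun (\<lambda>z. inverse (z j))"
 by (rule torus_fun_inverse[of _ 1]) (auto simp: on_torus_def)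

lemma torus_fun_coord_powi [simp]: "torus_fun (\<lambda>z. z j powi k)"
proof (cases "0 \<le> k")
 case True
 then show ?thesis using torus_fun_power[of "\<lambda>z. z j" "nat k"] by (simp add: power_int_def)
next
 case False
 then show ?thesis using torus_fun_power[of "\<lambda>z. inverse (z j)" "nat (- k)"] by (simp add: power_int_def)
qed

lemma torus_fun_geometric:
 assumes "torus_fun f" "\<rho> < 1" "\<And>z. on_torus z \<Longrightarrow> norm (f z) \<le> \<rho>"
 shows "torus_fun (\<lambda>z. inverse (1 - f z))"
proof (rule torus_fun_inverse)
 show "torus_fun (\<lambda>z. 1 - f z)" using assms by (intro torus_fun_diff) auto
 show "1 - \<rho> \<le> norm (1 - f z)" if "on_torus z" for z
  using norm_triangle_ineq2[of 1 "f z"] assms(3)[OF that] by simp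
qed (use assms in auto)

lemma torus_fun_integrable:
 assumes "torus_fun f" "finite I" "on_torus w"
 shows "integrable (Pi\<^sub>M I (\<lambda>_. unit_measure)) (\<lambda>\<theta>. f (torus_point I w \<theta>))"
proof -
 interpret P: prob_space "Pi\<^sub>M I (\<lambda>_. unit_measure)" by (rule prob_space_PiM_unit)
 obtain B where "\<forall>z. on_torus z \<longrightarrow> norm (f z) \<le> B" using torus_fun_bound[OF assms(1)] by blast
 then show ?thesis
  by (intro P.integrable_const_bound[of _ B] torus_fun_meas assms) (auto simp: on_torus_point assms)
qed

lemma tint_cong:
 assumes "\<And>z. on_torus z \<Longrightarrow> f z = g z" "on_torus w"
 shows "tint I w f = tint I w g"
 unfolding tint_def by (rule Bochner_Integration.integral_cong) (auto simp: assms on_torus_point)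

lemma tint_add:
 assumes "torus_fun f" "torus_fun g" "finite I" "on_torus w"
 shows "tint I w (\<lambda>z. f z + g z) = tint I w f + tint I w g"
 unfolding tint_def by (intro Bochner_Integration.integral_add torus_fun_integrable assms)

lemma tint_mult_left: "tint I w (\<lambda>z. x * f z) = x * tint I w f"
 unfolding tint_def by simp

lemma tint_diff:
 assumes "torus_fun f" "torus_fun g" "finite I" "on_torus w"
 shows "tint I w (\<lambda>z. f z - g z) = tint I w f - tint I w g"
 unfolding tint_def by (intro Bochner_Integration.integral_diff torus_fun_integrable assms)

lemma tint_sum:
 assumes "\<And>i. i \<in> A \<Longrightarrow> torus_fun (f i)" "finite I" "on_torus w"
 shows "tint I w (\<lambda>z. \<Sum>i\<in>A. f i z) = (\<Sum>i\<in>A. tint I w (f i))"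
 unfolding tint_def by (intro Bochner_Integration.integral_sum torus_fun_integrable assms)

lemma tint_empty: "tint {} w f = f w"
proof -
 interpret P: prob_space "Pi\<^sub>M ({}::nat set) (\<lambda>_. unit_measure)" by (rule prob_space_PiM_unit)
 have "torus_point {} w \<theta> = w" for \<theta> by (simp add: torus_point_def fun_eq_iff)
 then show ?thesis using P.prob_space by (simp add: tint_def)
qed

definition circle_mean :: "(complex \<Rightarrow> complex) \<Rightarrow> complex" where
 "circle_mean f = (\<integral>x. f (cis1 x) \<partial>unit_measure)"

lemma tint_insert:
 assumes "torus_fun f" "finite I" "i \<notin> I" "on_torus w"
 shows "tint (insert i I) w f = tint I w (\<lambda>z. circle_mean (\<lambda>x. f (z(i := x))))"
proof -
 have "torus_point (insert i I) w (\<theta>(i := x)) = (torus_point I w \<theta>)(i := cis1 x)" for \<theta> x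
  using assms(3) by (auto simp: torus_point_def fun_eq_iff)
 then show ?thesis
  unfolding tint_def circle_mean_def
  by (subst UP.product_integral_insert) (use assms torus_fun_integrable in auto)
qed

lemma tint_Icc:
 assumes "torus_fun f" "on_torus w" "m \<le> n"
 shows "tint {m..n} w f = tint {Suc m..n} w (\<lambda>z. circle_mean (\<lambda>x. f (z(m := x))))"
proof -
 have "{m..n} = insert m {Suc m..n}" using assms(3) by auto
 then show ?thesis using tint_insert[OF assms(1), of "{Suc m..n}" m w] assms by simp
qed

section \<open>Means over the unit circle\<close>

definition circle_fun :: "(complex \<Rightarrow> complex) \<Rightarrow> bool" where
 "circle_fun f \<longleftrightarrow> (\<exists>B. \<forall>x. norm x = 1 \<longrightarrow> norm (f x) \<le> B) \<and> (\<lambda>x. f (cis1 x)) \<in> borel_measurable unit_measure"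

lemma circle_fun_bound: "circle_fun f \<Longrightarrow> \<exists>B. \<forall>x. norm x = 1 \<longrightarrow> norm (f x) \<le> B"
 by (simp add: circle_fun_def)

lemma circle_fun_const [simp]: "circle_fun (\<lambda>_. x)"
 by (auto simp: circle_fun_def)

lemma circle_fun_id [simp]: "circle_fun (\<lambda>x. x)"
proof -
 have "cis1 \<in> borel_measurable unit_measure" by measurable
 then show ?thesis by (auto simp: circle_fun_def intro!: exI[of _ 1])
qed

lemma circle_fun_add:
 assumes "circle_fun f" "circle_fun g" shows "circle_fun (\<lambda>z. f z + g z)"
proof -
 obtain A B where "\<forall>z. norm z = 1 \<longrightarrow> norm (f z) \<le> A" "\<forall>z. norm z = 1 \<longrightarrow> norm (g z) \<le> B"
  using assms circle_fun_bound by blast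
 then have "\<forall>z. norm z = 1 \<longrightarrow> norm (f z + g z) \<le> A + B" by (meson norm_triangle_mono)
 then show ?thesis using assms unfolding circle_fun_def
  by (intro conjI exI[of _ "A + B"] borel_measurable_add) auto
qed

lemma circle_fun_mult:
 assumes "circle_fun f" "circle_fun g" shows "circle_fun (\<lambda>z. f z * g z)"
proof -
 obtain A B where AB: "\<forall>z. norm z = 1 \<longrightarrow> norm (f z) \<le> A" "\<forall>z. norm z = 1 \<longrightarrow> norm (g z) \<le> B"
  using assms circle_fun_bound by blast
 have "norm (f z * g z) \<le> A * B" if "norm z = 1" for z
  unfolding norm_mult using AB that order_trans[OF norm_ge_zero] by (intro mult_mono) auto
 then show ?thesis using assms unfolding circle_fun_def
  by (intro conjI exI[of _ "A * B"] borel_measurable_times) auto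
qed

lemma circle_fun_diff:
 "circle_fun f \<Longrightarrow> circle_fun g \<Longrightarrow> circle_fun (\<lambda>z. f z - g z)"
 using circle_fun_add[of f "\<lambda>z. (-1) * g z"] circle_fun_mult[of "\<lambda>_. -1" g] by simp

lemma circle_fun_power: "circle_fun f \<Longrightarrow> circle_fun (\<lambda>z. f z ^ k)"
 by (induction k) (auto intro: circle_fun_mult)

lemma circle_fun_prod_list:
 "(\<And>u. u \<in> set us \<Longrightarrow> circle_fun (f u)) \<Longrightarrow> circle_fun (\<lambda>x. \<Prod>u\<leftarrow>us. f u x)"
 by (induction us) (auto intro: circle_fun_mult)

lemma circle_fun_inverse:
 assumes "circle_fun f" "\<delta> > 0" "\<And>z. norm z = 1 \<Longrightarrow> \<delta> \<le> norm (f z)"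
 shows "circle_fun (\<lambda>z. inverse (f z))"
proof -
 have "norm (inverse (f z)) \<le> inverse \<delta>" if "norm z = 1" for z
  using assms that by (simp add: norm_inverse le_imp_inverse_le)
 then show ?thesis using assms(1) unfolding circle_fun_def
  by (intro conjI exI[of _ "inverse \<delta>"] borel_measurable_inverse) auto
qed

lemma circle_fun_inverse_id [simp]: "circle_fun inverse"
 using circle_fun_inverse[of "\<lambda>x. x" 1] by simp

lemma circle_fun_powi [simp]: "circle_fun (\<lambda>x. x powi k)"
proof (cases "0 \<le> k")
 case True
 then show ?thesis using circle_fun_power[of "\<lambda>z. z" "nat k"] by (simp add: power_int_def)
next
 case False
 then show ?thesis using circle_fun_power[of inverse "nat (- k)"] by (simp add: power_int_def)
qed

lemma norm_one_minus_ge: "norm (1::complex) - norm (x::complex) \<le> norm (1 - x)"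
 by (rule norm_triangle_ineq2)

lemma circle_fun_geometric:
 assumes "norm u < 1"
 shows "circle_fun (\<lambda>x. inverse (1 - u * x))" "circle_fun (\<lambda>x. inverse (1 - u / x))"
proof -
 have 1: "circle_fun (\<lambda>x. 1 - u * x)" by (intro circle_fun_diff circle_fun_mult) simp_all
 have 2: "circle_fun (\<lambda>x. 1 - u / x)"
  unfolding divide_inverse by (intro circle_fun_diff circle_fun_mult) simp_all
 have "1 - norm u \<le> norm (1 - u * x)" "1 - norm u \<le> norm (1 - u / x)" if "norm x = 1" for x :: complex
  using norm_one_minus_ge[of "u * x"] norm_one_minus_ge[of "u / x"] that
  by (simp_all add: norm_mult norm_divide)
 then show "circle_fun (\<lambda>x. inverse (1 - u * x))" "circle_fun (\<lambda>x. inverse (1 - u / x))"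
  using circle_fun_inverse[OF 1, of "1 - norm u"] circle_fun_inverse[OF 2, of "1 - norm u"] assms by auto
qed

lemma circle_fun_integrable: "circle_fun f \<Longrightarrow> integrable unit_measure (\<lambda>x. f (cis1 x))"
proof -
 assume f: "circle_fun f"
 obtain B where "\<And>x. norm x = 1 \<Longrightarrow> norm (f x) \<le> B" using circle_fun_bound[OF f] by blast
 then show ?thesis using f by (intro U.integrable_const_bound[of _ B]) (auto simp: circle_fun_def)
qed

lemma circle_mean_cong: "(\<And>z. norm z = 1 \<Longrightarrow> f z = g z) \<Longrightarrow> circle_mean f = circle_mean g"
 unfolding circle_mean_def by (rule Bochner_Integration.integral_cong) auto

lemma circle_mean_add:
 "circle_fun f \<Longrightarrow> circle_fun g \<Longrightarrow> circle_mean (\<lambda>x. f x + g x) = circle_mean f + circle_mean g"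
 unfolding circle_mean_def by (intro Bochner_Integration.integral_add circle_fun_integrable)

lemma circle_mean_diff:
 "circle_fun f \<Longrightarrow> circle_fun g \<Longrightarrow> circle_mean (\<lambda>x. f x - g x) = circle_mean f - circle_mean g"
 unfolding circle_mean_def by (intro Bochner_Integration.integral_diff circle_fun_integrable)

lemma circle_mean_mult_left: "circle_mean (\<lambda>x. c * f x) = c * circle_mean f"
 unfolding circle_mean_def by simp

lemma circle_mean_bound:
 assumes "circle_fun f" "\<And>x. norm x = 1 \<Longrightarrow> norm (f x) \<le> B"
 shows "norm (circle_mean f) \<le> B"
proof -
 have "norm (circle_mean f) \<le> (\<integral>x. norm (f (cis1 x)) \<partial>unit_measure)"
  unfolding circle_mean_def by (rule integral_norm_bound)
 also have "\<dots> \<le> (\<integral>x. B \<partial>unit_measure)"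
  by (rule integral_mono) (use assms circle_fun_integrable in auto)
 also have "\<dots> = B" using U.prob_space by simp
 finally show ?thesis .
qed

lemma circle_mean_lborel: "circle_mean f = (\<integral>x. indicator {0..1} x *\<^sub>R f (cis1 x) \<partial>lborel)"
 unfolding circle_mean_def unit_measure_def by (simp add: integral_restrict_space)

lemma circle_mean_powi: "circle_mean (\<lambda>x. x powi k) = (if k = 0 then 1 else 0)"
proof (cases "k = 0")
 case True
 then show ?thesis using U.prob_space by (simp add: circle_mean_def)
next
 case False
 define \<omega> where "\<omega> = 2 * pi * of_int k"
 have \<omega>: "\<omega> \<noteq> 0" using False by (simp add: \<omega>_def)
 have eq: "cis1 x powi k = cis (\<omega> * x)" for x
  by (simp add: cis_power_int \<omega>_def mult_ac)
 define F where "F x = cis (\<omega> * x) / (\<i> * of_real \<omega>)" for x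
 have "circle_mean (\<lambda>x. x powi k) = (\<integral>x. indicator {0..1} x *\<^sub>R cis (\<omega> * x) \<partial>lborel)"
  unfolding circle_mean_lborel eq ..
 also have "\<dots> = F 1 - F 0"
 proof (rule integral_FTC_Icc)
  fix x :: real
  have "(F has_vector_derivative (\<i> * of_real \<omega> * cis (\<omega> * x) / (\<i> * of_real \<omega>))) (at x within {0..1})"
   unfolding F_def cis_conv_exp
   by (auto intro!: derivative_eq_intros has_vector_derivative_real_field simp: mult_ac)
  then show "(F has_vector_derivative cis (\<omega> * x)) (at x within {0..1})" using \<omega> by simp
 qed (auto intro!: continuous_intros)
 also have "F 1 = F 0"
 proof -
  have "cis \<omega> = 1" using eq[of 1] by simp
  then show ?thesis by (simp add: F_def)
 qed
 finally show ?thesis using False by simp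
qed

lemma circle_mean_inversion:
 "circle_mean (\<lambda>x. f (inverse x)) = circle_mean f"
proof -
 have "circle_mean f = (\<integral>x. indicator {0..1} x *\<^sub>R f (cis1 x) \<partial>lborel)" by (rule circle_mean_lborel)
 also have "\<dots> = (\<integral>x. indicator {0..1} (1 + (-1) * x) *\<^sub>R f (cis1 (1 + (-1) * x)) \<partial>lborel)"
  by (subst lborel_integral_real_affine[where c="-1" and t=1]) auto
 also have "\<dots> = (\<integral>x. indicator {0..1} x *\<^sub>R f (inverse (cis1 x)) \<partial>lborel)"
 proof (rule Bochner_Integration.integral_cong)
  fix x :: real
  have "cis1 (1 + (-1) * x) = cis (2 * pi) * cis (- (2 * pi * x))"
   by (simp add: cis_mult algebra_simps)
  then have "cis1 (1 + (-1) * x) = inverse (cis1 x)" by simp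
  moreover have "indicator {0..1} (1 + (-1) * x) = (indicator {0..1} x :: real)"
   by (auto simp: indicator_def)
  ultimately show "indicator {0..1} (1 + (-1) * x) *\<^sub>R f (cis1 (1 + (-1) * x)) = indicator {0..1} x *\<^sub>R f (inverse (cis1 x))"
   by simp
 qed simp
 also have "\<dots> = circle_mean (\<lambda>x. f (inverse x))" by (rule circle_mean_lborel[symmetric])
 finally show ?thesis ..
qed

text \<open>Mean value property for the products that occur, by comparing the moments of \<open>g\<close> and of
 \<open>g / (1 - u x)\<close>.\<close>

definition mean_at_zero :: "(complex \<Rightarrow> complex) \<Rightarrow> bool" where
 "mean_at_zero g \<longleftrightarrow> circle_fun g \<and> (\<forall>b::nat. circle_mean (\<lambda>x. x ^ b * g x) = (if b = 0 then 1 else 0))"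

lemma mean_at_zero_one: "mean_at_zero (\<lambda>_. 1)"
 using circle_mean_powi[of "int _"] by (auto simp: mean_at_zero_def)

lemma mean_at_zero_mult:
 assumes "mean_at_zero g"
 shows "mean_at_zero (\<lambda>x. g x * (1 - u * x))"
proof -
 have c: "circle_fun g" using assms by (simp add: mean_at_zero_def)
 have "circle_mean (\<lambda>x. x ^ b * (g x * (1 - u * x))) = (if b = 0 then 1 else 0)" for b
 proof -
  have "circle_mean (\<lambda>x. x ^ b * (g x * (1 - u * x))) = circle_mean (\<lambda>x. x ^ b * g x - u * (x ^ Suc b * g x))"
   by (rule circle_mean_cong) (simp add: algebra_simps)
  also have "\<dots> = circle_mean (\<lambda>x. x ^ b * g x) - u * circle_mean (\<lambda>x. x ^ Suc b * g x)"
   using c by (subst circle_mean_diff)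
    (auto intro!: circle_fun_mult circle_fun_power simp: circle_mean_mult_left simp del: power_Suc)
  finally show ?thesis using assms by (simp add: mean_at_zero_def del: power_Suc)
 qed
 moreover have "circle_fun (\<lambda>x. g x * (1 - u * x))"
  using c by (intro circle_fun_mult circle_fun_diff) auto
 ultimately show ?thesis by (simp add: mean_at_zero_def)
qed

lemma bounded_recursion_zero:
 fixes m :: "nat \<Rightarrow> complex"
 assumes "\<And>b. m b = u * m (Suc b)" "norm u < 1" "\<And>b. norm (m b) \<le> B"
 shows "m b = 0"
proof -
 have "norm (m b) \<le> norm u ^ N * B" for N
 proof -
  have "m b = u ^ N * m (b + N)" for N
  proof (induction N)
   case (Suc N)
   then show ?case using assms(1)[of "b + N"] by (simp only: power_Suc add_Suc_right mult_ac)
  qed simp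
  then have "norm (m b) = norm u ^ N * norm (m (b + N))" by (metis norm_mult norm_power)
  also have "\<dots> \<le> norm u ^ N * B" by (intro mult_left_mono assms) auto
  finally show ?thesis .
 qed
 moreover have "(\<lambda>N. norm u ^ N * B) \<longlonglongrightarrow> 0 * B"
  using assms(2) by (intro tendsto_mult LIMSEQ_power_zero tendsto_const) auto
 ultimately have "norm (m b) \<le> 0" by (intro LIMSEQ_le_const[of _ 0]) auto
 then show ?thesis by simp
qed

lemma mean_at_zero_divide:
 assumes "mean_at_zero g" "norm u < 1"
 shows "mean_at_zero (\<lambda>x. g x * inverse (1 - u * x))"
proof -
 have c: "circle_fun g" using assms by (simp add: mean_at_zero_def)
 let ?h = "\<lambda>x. g x * inverse (1 - u * x)"
 have ch: "circle_fun ?h" using c circle_fun_geometric[OF assms(2)] by (intro circle_fun_mult)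
 define m where "m b = circle_mean (\<lambda>x. x ^ b * ?h x)" for b
 have rec: "m b = (if b = 0 then 1 else 0) + u * m (Suc b)" for b
 proof -
  have nz: "1 - u * x \<noteq> 0" if "norm x = 1" for x
   using norm_one_minus_ge[of "u * x"] assms(2) that by (auto simp: norm_mult)
  have "m b = circle_mean (\<lambda>x. x ^ b * g x + u * (x ^ Suc b * ?h x))"
   unfolding m_def by (rule circle_mean_cong) (use nz in \<open>simp add: field_simps\<close>)
  also have "\<dots> = circle_mean (\<lambda>x. x ^ b * g x) + u * m (Suc b)"
   unfolding m_def using c ch by (subst circle_mean_add)
    (auto intro!: circle_fun_mult[of "\<lambda>_. u"] circle_fun_mult[of "\<lambda>x. x ^ _"] circle_fun_power simp: circle_mean_mult_left simp del: power_Suc)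
  finally show ?thesis using assms by (simp add: mean_at_zero_def)
 qed
 obtain B where B: "\<And>x. norm x = 1 \<Longrightarrow> norm (?h x) \<le> B" using circle_fun_bound[OF ch] by blast
 have mB: "norm (m b) \<le> B" for b
  unfolding m_def
 proof (rule circle_mean_bound)
  show "circle_fun (\<lambda>x. x ^ b * ?h x)" by (rule circle_fun_mult[OF circle_fun_power[OF circle_fun_id] ch])
  show "norm (x ^ b * ?h x) \<le> B" if "norm x = 1" for x
   using B[OF that] that by (simp add: norm_mult norm_power)
 qed
 have "m (Suc b) = 0" for b
 proof (rule bounded_recursion_zero[of "\<lambda>b. m (Suc b)" u B])
  show "m (Suc b) = u * m (Suc (Suc b))" for b using rec[of "Suc b"] by (simp only: nat.simps if_False add_0)
 qed (rule assms(2), rule mB)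
 then have "m b = (if b = 0 then 1 else 0)" for b by (subst rec) simp
 then show ?thesis using ch by (simp add: mean_at_zero_def m_def)
qed

lemma mean_at_zero_divide_list:
 "mean_at_zero g \<Longrightarrow> (\<And>u. u \<in> set us \<Longrightarrow> norm u < 1) \<Longrightarrow> mean_at_zero (\<lambda>x. g x * (\<Prod>u\<leftarrow>us. inverse (1 - u * x)))"
proof (induction us arbitrary: g)
 case (Cons u us)
 from Cons.IH[OF mean_at_zero_divide[OF Cons.prems(1), of u]] Cons.prems(2) show ?case by (simp add: mult.assoc)
qed simp

section \<open>Circle means of rational functions\<close>

text \<open>The type \<open>'p\<close> of the parameters is left open: when a variable is integrated out, the
 remaining variables are parameters too.\<close>

definition function_ring :: "('p \<Rightarrow> complex) set \<Rightarrow> bool" where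
 "function_ring R \<longleftrightarrow> (\<forall>c. (\<lambda>_. c) \<in> R) \<and> (\<forall>f\<in>R. \<forall>g\<in>R. (\<lambda>p. f p + g p) \<in> R \<and> (\<lambda>p. f p * g p) \<in> R)"

lemma function_ring_add: "function_ring R \<Longrightarrow> f \<in> R \<Longrightarrow> g \<in> R \<Longrightarrow> (\<lambda>p. f p + g p) \<in> R"
 and function_ring_mult: "function_ring R \<Longrightarrow> f \<in> R \<Longrightarrow> g \<in> R \<Longrightarrow> (\<lambda>p. f p * g p) \<in> R"
 and function_ring_const: "function_ring R \<Longrightarrow> (\<lambda>_. c) \<in> R"
 by (auto simp: function_ring_def)

lemma function_ring_diff: "function_ring R \<Longrightarrow> f \<in> R \<Longrightarrow> g \<in> R \<Longrightarrow> (\<lambda>p. f p - g p) \<in> R"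
 using function_ring_add[of R f "\<lambda>p. (-1) * g p"] function_ring_mult[of R "\<lambda>_. -1" g]
  function_ring_const[of R "-1"] by simp

lemma function_ring_prod_list:
 "function_ring R \<Longrightarrow> (\<And>u. u \<in> set us \<Longrightarrow> F u \<in> R) \<Longrightarrow> (\<lambda>p. \<Prod>u\<leftarrow>us. F u p) \<in> R"
 by (induction us) (auto intro: function_ring_mult function_ring_const)

lemma function_ring_prod:
 "function_ring R \<Longrightarrow> (\<And>u. u \<in> A \<Longrightarrow> F u \<in> R) \<Longrightarrow> (\<lambda>p. \<Prod>u\<in>A. F u p) \<in> R"
 by (induction A rule: infinite_finite_induct) (auto intro: function_ring_mult function_ring_const)

lemma function_ring_sum:
 "function_ring R \<Longrightarrow> (\<And>u. u \<in> A \<Longrightarrow> F u \<in> R) \<Longrightarrow> (\<lambda>p. \<Sum>u\<in>A. F u p) \<in> R"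
 by (induction A rule: infinite_finite_induct) (auto intro: function_ring_add function_ring_const)

text \<open>As a function of one variable, the weight is a Laurent polynomial times such a kernel. The mean of
 the kernel has the denominator \<open>cross\<close>.\<close>

definition ker :: "complex list \<Rightarrow> complex list \<Rightarrow> complex \<Rightarrow> complex" where
 "ker xs ys z = (\<Prod>x\<leftarrow>xs. inverse (1 - x * z)) * (\<Prod>y\<leftarrow>ys. inverse (1 - y / z))"

definition cross :: "complex list \<Rightarrow> complex list \<Rightarrow> complex" where
 "cross xs ys = (\<Prod>x\<leftarrow>xs. \<Prod>y\<leftarrow>ys. 1 - x * y)"

definition kmean :: "int \<Rightarrow> complex list \<Rightarrow> complex list \<Rightarrow> complex" where
 "kmean k xs ys = circle_mean (\<lambda>z. z powi k * ker xs ys z)"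

lemma circle_fun_ker:
 "(\<And>x. x \<in> set xs \<Longrightarrow> norm x < 1) \<Longrightarrow> (\<And>y. y \<in> set ys \<Longrightarrow> norm y < 1) \<Longrightarrow> circle_fun (ker xs ys)"
 unfolding ker_def by (intro circle_fun_mult circle_fun_prod_list circle_fun_geometric) auto

lemma circle_fun_powi_ker:
 assumes "\<And>x. x \<in> set xs \<Longrightarrow> norm x < 1" "\<And>y. y \<in> set ys \<Longrightarrow> norm y < 1"
 shows "circle_fun (\<lambda>z. z powi k * ker xs ys z)"
 by (intro circle_fun_mult circle_fun_powi circle_fun_ker assms)

lemma one_minus_nz: "norm x < 1 \<Longrightarrow> 1 - x \<noteq> (0::complex)"
 by auto

lemma geometric_nz:
 assumes "norm x < 1" "norm z = 1"
 shows "1 - x * z \<noteq> (0::complex)" "1 - x / z \<noteq> 0" "1 - x * inverse z \<noteq> 0"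
 using one_minus_nz[of "x * z"] one_minus_nz[of "x / z"] one_minus_nz[of "x * inverse z"] assms
 by (simp_all add: norm_mult norm_divide norm_inverse)

text \<open>The partial fraction identity \<open>(1 - x y) / ((1 - x z) (1 - y / z)) = 1 / (1 - x z) + (y / z) / (1 - y / z)\<close>,
 which separates the poles inside the circle from those outside.\<close>

lemma ker_recurrence:
 assumes "norm x < 1" "norm y < 1" "norm z = 1"
 shows "(1 - x * y) * ker (x # xs) (y # ys) z = ker (x # xs) ys z + y * inverse z * ker xs (y # ys) z"
proof -
 have nz: "1 - x * z \<noteq> 0" "1 - y / z \<noteq> 0" "z \<noteq> 0" "1 - y * inverse z \<noteq> 0"
  using assms by (auto dest: geometric_nz)
 have "(1 - x * y) * (inverse (1 - x * z) * inverse (1 - y * inverse z))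
   = inverse (1 - x * z) + y * inverse z * inverse (1 - y * inverse z)"
  using nz by (simp add: field_simps)
 then have "(1 - x * y) * (inverse (1 - x * z) * inverse (1 - y * inverse z)) * X * Y
   = (inverse (1 - x * z) + y * inverse z * inverse (1 - y * inverse z)) * X * Y" for X Y by simp
 from this[of "\<Prod>x\<leftarrow>xs. inverse (1 - x * z)" "\<Prod>y\<leftarrow>ys. inverse (1 - y / z)"]
 show ?thesis by (simp add: ker_def divide_inverse algebra_simps)
qed

lemma kmean_no_poles:
 assumes "\<And>x. x \<in> set xs \<Longrightarrow> norm x < 1" "0 \<le> k"
 shows "kmean k xs [] = (if k = 0 then 1 else 0)"
proof -
 have "mean_at_zero (\<lambda>z. 1 * (\<Prod>x\<leftarrow>xs. inverse (1 - x * z)))"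
  by (rule mean_at_zero_divide_list[OF mean_at_zero_one]) (use assms in auto)
 then have "circle_mean (\<lambda>x. x ^ nat k * (1 * (\<Prod>u\<leftarrow>xs. inverse (1 - u * x)))) = (if nat k = 0 then 1 else 0)"
  unfolding mean_at_zero_def by blast
 moreover have "x ^ nat k = x powi k" for x :: complex using assms(2) by (simp add: power_int_def)
 ultimately show ?thesis using assms(2) by (simp add: kmean_def ker_def)
qed

lemma kmean_inversion: "kmean k [] ys = kmean (- k) ys []"
proof -
 have "kmean k [] ys = circle_mean (\<lambda>z. inverse z powi k * ker [] ys (inverse z))"
  unfolding kmean_def by (rule circle_mean_inversion[symmetric])
 also have "\<dots> = kmean (- k) ys []"
  unfolding kmean_def by (rule circle_mean_cong)
   (simp add: ker_def power_int_inverse power_int_minus divide_inverse)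
 finally show ?thesis .
qed

lemma kmean_step_down:
 assumes "\<And>x. x \<in> set (x0 # xs) \<Longrightarrow> norm x < 1"
 shows "kmean k (x0 # xs) [] = kmean k xs [] + x0 * kmean (k + 1) (x0 # xs) []"
proof -
 have nz: "1 - x0 * z \<noteq> 0" "z \<noteq> 0" if "norm z = 1" for z
  using that assms[of x0] by (auto dest: geometric_nz)
 have "kmean k (x0 # xs) [] = circle_mean (\<lambda>z. z powi k * ker xs [] z + x0 * (z powi (k + 1) * ker (x0 # xs) [] z))"
  unfolding kmean_def
 proof (rule circle_mean_cong)
  fix z :: complex assume "norm z = 1"
  note nz = nz[OF this]
  have "inverse (1 - x0 * z) = 1 + x0 * z * inverse (1 - x0 * z)" using nz by (simp add: field_simps)
  from arg_cong[OF this, of "\<lambda>u. u * (\<Prod>x\<leftarrow>xs. inverse (1 - x * z))"]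
  have K: "ker (x0 # xs) [] z = ker xs [] z + x0 * z * ker (x0 # xs) [] z"
   by (simp add: ker_def algebra_simps)
  have Z: "z powi (k + 1) = z powi k * z" using nz by (simp add: power_int_add_1)
  show "z powi k * ker (x0 # xs) [] z = z powi k * ker xs [] z + x0 * (z powi (k + 1) * ker (x0 # xs) [] z)"
   unfolding Z by (subst K) (simp add: algebra_simps)
 qed
 also have "\<dots> = kmean k xs [] + x0 * kmean (k + 1) (x0 # xs) []"
  unfolding kmean_def
  by (subst circle_mean_add) (use assms in \<open>auto intro!: circle_fun_powi_ker circle_fun_mult[of "\<lambda>_. x0"] simp: circle_mean_mult_left\<close>)
 finally show ?thesis .
qed

text \<open>With poles on one side of the circle only, the mean is a complete homogeneous symmetric
 polynomial or zero.\<close>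

lemma kmean_one_sided_in_ring:
 assumes R: "function_ring R" and xs: "\<And>x. x \<in> set xs \<Longrightarrow> x \<in> R"
  and b: "\<And>x p. x \<in> set xs \<Longrightarrow> p \<in> \<Omega> \<Longrightarrow> norm (x p) < 1"
 shows "\<exists>r\<in>R. \<forall>p\<in>\<Omega>. kmean k (map (\<lambda>x. x p) xs) [] = r p"
 using xs b
proof (induction xs arbitrary: k)
 case Nil
 have "kmean k [] [] = (if k = 0 then 1 else 0)" by (simp add: kmean_def ker_def circle_mean_powi)
 then show ?case using function_ring_const[OF R] by auto
next
 case (Cons x xs)
 have nl: "norm u < 1" if "p \<in> \<Omega>" "u \<in> set (map (\<lambda>x. x p) (x # xs))" for u p
  using Cons.prems(2)[OF _ that(1)] that(2) by auto
 have "\<exists>r\<in>R. \<forall>p\<in>\<Omega>. kmean (- int m) (map (\<lambda>x. x p) (x # xs)) [] = r p" for m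
 proof (induction m)
  case 0
  have "kmean (- int 0) (map (\<lambda>x. x p) (x # xs)) [] = 1" if "p \<in> \<Omega>" for p
  proof -
   have "kmean 0 (map (\<lambda>x. x p) (x # xs)) [] = (if (0::int) = 0 then 1 else 0)"
    by (rule kmean_no_poles) (use nl[OF that] in auto)
   then show ?thesis by simp
  qed
  with function_ring_const[OF R, of 1] show ?case by (intro bexI[of _ "\<lambda>_. 1"] ballI)
 next
  case (Suc m)
  obtain r where ra: "r \<in> R" and rb: "\<forall>p\<in>\<Omega>. kmean (- int m) (map (\<lambda>x. x p) (x # xs)) [] = r p" using Suc by (rule bexE)
  note r = ra bspec[OF rb]
  have "\<exists>r\<in>R. \<forall>p\<in>\<Omega>. kmean (- int (Suc m)) (map (\<lambda>x. x p) xs) [] = r p"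
  proof (rule Cons.IH)
   show "u \<in> R" if "u \<in> set xs" for u using Cons.prems(1)[of u] that by simp
   show "norm (u p) < 1" if "u \<in> set xs" "p \<in> \<Omega>" for u p using Cons.prems(2)[of u p] that by simp
  qed
  then obtain r' where r'a: "r' \<in> R" and r'b: "\<forall>p\<in>\<Omega>. kmean (- int (Suc m)) (map (\<lambda>x. x p) xs) [] = r' p" by (rule bexE)
  note r' = r'a bspec[OF r'b]
  have "kmean (- int (Suc m)) (map (\<lambda>x. x p) (x # xs)) [] = r' p + x p * r p" if "p \<in> \<Omega>" for p
  proof -
   have "- int (Suc m) + 1 = - int m" by simp
   then show ?thesis
    using kmean_step_down[of "x p" "map (\<lambda>x. x p) xs" "- int (Suc m)", OF nl[OF that, unfolded list.map]]
     r(2)[OF that] r'(2)[OF that] by simp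
  qed
  moreover have "(\<lambda>p. r' p + x p * r p) \<in> R"
   by (intro function_ring_add function_ring_mult R ra r'a Cons.prems(1)) simp
  ultimately show ?case by (intro bexI ballI)
 qed
 note neg = this
 show ?case
 proof (cases "0 \<le> k")
  case True
  show ?thesis
  proof (intro bexI ballI)
   show "kmean k (map (\<lambda>x. x p) (x # xs)) [] = (if k = 0 then 1 else 0)" if "p \<in> \<Omega>" for p
    by (rule kmean_no_poles[OF nl[OF that] True])
  qed (rule function_ring_const[OF R])
 next
  case False
  then show ?thesis using neg[of "nat (- k)"] by simp
 qed
qed

lemma cross_Cons_left: "cross (x # xs) ys = (\<Prod>y\<leftarrow>ys. 1 - x * y) * cross xs ys"
 by (simp add: cross_def)

lemma cross_Cons_right: "cross xs (y # ys) = (\<Prod>x\<leftarrow>xs. 1 - x * y) * cross xs ys"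
 by (induction xs) (simp_all add: cross_def mult_ac)

lemma cross_Nil: "cross xs [] = 1" "cross [] xs = 1"
 by (induction xs) (auto simp: cross_def)

text \<open>The recurrence for \<open>ker\<close> removes one pole at the cost of one factor of \<open>cross\<close>.\<close>

lemma kmean_in_ring:
 assumes R: "function_ring R" and "\<And>x. x \<in> set xs \<union> set ys \<Longrightarrow> x \<in> R"
  and "\<And>x p. x \<in> set xs \<union> set ys \<Longrightarrow> p \<in> \<Omega> \<Longrightarrow> norm (x p) < 1"
 shows "\<exists>r\<in>R. \<forall>p\<in>\<Omega>. cross (map (\<lambda>x. x p) xs) (map (\<lambda>x. x p) ys)
      * kmean k (map (\<lambda>x. x p) xs) (map (\<lambda>x. x p) ys) = r p"
 using assms(2,3)
proof (induction "length xs + length ys" arbitrary: xs ys k rule: less_induct)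
 case less
 consider "ys = []" | "xs = []" | x xs' y ys' where "xs = x # xs'" "ys = y # ys'"
  by (cases xs; cases ys) auto
 then show ?case
 proof cases
  case 1
  then show ?thesis using kmean_one_sided_in_ring[OF R, of xs \<Omega> k] less.prems by (simp add: cross_Nil)
 next
  case 2
  then show ?thesis using kmean_one_sided_in_ring[OF R, of ys \<Omega> "- k"] less.prems
   by (simp add: cross_Nil kmean_inversion)
 next
  case 3
  let ?m = "\<lambda>us p. map (\<lambda>x. x p) us"
  have "\<exists>r\<in>R. \<forall>p\<in>\<Omega>. cross (?m xs p) (?m ys' p) * kmean k (?m xs p) (?m ys' p) = r p"
   using less.prems 3 by (intro less.hyps) auto
  then obtain r where ra: "r \<in> R" and rb: "\<forall>p\<in>\<Omega>. cross (?m xs p) (?m ys' p) * kmean k (?m xs p) (?m ys' p) = r p" by (rule bexE)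
  note r = ra bspec[OF rb]
  have "\<exists>r\<in>R. \<forall>p\<in>\<Omega>. cross (?m xs' p) (?m ys p) * kmean (k - 1) (?m xs' p) (?m ys p) = r p"
   using less.prems 3 by (intro less.hyps) auto
  then obtain r' where r'a: "r' \<in> R" and r'b: "\<forall>p\<in>\<Omega>. cross (?m xs' p) (?m ys p) * kmean (k - 1) (?m xs' p) (?m ys p) = r' p" by (rule bexE)
  note r' = r'a bspec[OF r'b]
  define g where "g p = (\<Prod>u\<leftarrow>xs'. 1 - u p * y p)" for p
  define g' where "g' p = (\<Prod>u\<leftarrow>ys'. 1 - x p * u p)" for p
  have inR: "x \<in> R" "y \<in> R" using less.prems 3 by auto
  have g: "g \<in> R" unfolding g_def[abs_def]
   by (rule function_ring_prod_list[OF R], rule function_ring_diff[OF R function_ring_const[OF R] function_ring_mult[OF R]])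
     (use less.prems 3 inR in auto)
  have g': "g' \<in> R" unfolding g'_def[abs_def]
   by (rule function_ring_prod_list[OF R], rule function_ring_diff[OF R function_ring_const[OF R] function_ring_mult[OF R]])
     (use less.prems 3 inR in auto)
  have "cross (?m xs p) (?m ys p) * kmean k (?m xs p) (?m ys p) = g p * r p + y p * (g' p * r' p)" if p: "p \<in> \<Omega>" for p
  proof -
   have bx: "norm (u p) < 1" if "u \<in> set xs \<union> set ys" for u using less.prems p that by auto
   have k1: "(1 - x p * y p) * kmean k (?m xs p) (?m ys p)
     = kmean k (?m xs p) (?m ys' p) + y p * kmean (k - 1) (?m xs' p) (?m ys p)"
   proof -
    have "(1 - x p * y p) * kmean k (?m xs p) (?m ys p)
     = circle_mean (\<lambda>z. (1 - x p * y p) * (z powi k * ker (?m xs p) (?m ys p) z))"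
     by (simp add: kmean_def circle_mean_mult_left)
    also have "\<dots> = circle_mean (\<lambda>z. z powi k * ker (?m xs p) (?m ys' p) z + y p * (z powi (k - 1) * ker (?m xs' p) (?m ys p) z))"
    proof (rule circle_mean_cong)
     fix z :: complex assume z: "norm z = 1"
     have nz: "z \<noteq> 0" using z by auto
     have "(1 - x p * y p) * ker (?m xs p) (?m ys p) z
       = ker (?m xs p) (?m ys' p) z + y p * inverse z * ker (?m xs' p) (?m ys p) z"
      using ker_recurrence[of "x p" "y p" z "?m xs' p" "?m ys' p"] bx 3 z by simp
     moreover have "z powi (k - 1) = z powi k * inverse z" using nz by (simp add: power_int_diff divide_inverse)
     ultimately show "(1 - x p * y p) * (z powi k * ker (?m xs p) (?m ys p) z)
       = z powi k * ker (?m xs p) (?m ys' p) z + y p * (z powi (k - 1) * ker (?m xs' p) (?m ys p) z)"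
      by (simp only: mult.left_commute[of "1 - x p * y p"]) (simp add: algebra_simps)
    qed
    also have "\<dots> = kmean k (?m xs p) (?m ys' p) + y p * kmean (k - 1) (?m xs' p) (?m ys p)"
     unfolding kmean_def
     by (subst circle_mean_add)
       (use bx 3 in \<open>auto intro!: circle_fun_powi_ker circle_fun_mult[of "\<lambda>_. y p"] simp: circle_mean_mult_left\<close>)
    finally show ?thesis .
   qed
   have c1: "cross (?m xs p) (?m ys p) = (1 - x p * y p) * g p * g' p * cross (?m xs' p) (?m ys' p)"
    and c2: "cross (?m xs p) (?m ys' p) = g' p * cross (?m xs' p) (?m ys' p)"
    and c3: "cross (?m xs' p) (?m ys p) = g p * cross (?m xs' p) (?m ys' p)"
    using 3 by (simp_all add: cross_Cons_right cross_Cons_left g_def g'_def comp_def mult_ac)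
   have "cross (?m xs p) (?m ys p) * kmean k (?m xs p) (?m ys p)
     = g p * g' p * cross (?m xs' p) (?m ys' p) * ((1 - x p * y p) * kmean k (?m xs p) (?m ys p))"
    unfolding c1 by (simp only: mult_ac)
   also have "\<dots> = g p * (cross (?m xs p) (?m ys' p) * kmean k (?m xs p) (?m ys' p))
     + y p * (g' p * (cross (?m xs' p) (?m ys p) * kmean (k - 1) (?m xs' p) (?m ys p)))"
    unfolding k1 c2 c3 by (simp add: algebra_simps)
   finally show ?thesis unfolding r(2)[OF p] r'(2)[OF p] .
  qed
  moreover have "(\<lambda>p. g p * r p + y p * (g' p * r' p)) \<in> R"
   by (intro function_ring_add function_ring_mult R ra r'a g g' inR)
  ultimately show ?thesis by (intro bexI ballI)
 qed
qed

section \<open>The weight at \<open>q = 0\<close>\<close>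

definition pair_ker :: "complex \<Rightarrow> complex \<Rightarrow> complex \<Rightarrow> complex" where
 "pair_ker t u v = inverse (1 - t * v * u) * inverse (1 - t / v * u)"

definition pair_weight :: "complex \<Rightarrow> complex \<Rightarrow> complex \<Rightarrow> complex" where
 "pair_weight t u v = (1 - v * u) * (1 - inverse v * u) * pair_ker t u v"

definition weight0 :: "nat \<Rightarrow> complex \<Rightarrow> complex \<Rightarrow> complex \<Rightarrow> complex \<Rightarrow> complex \<Rightarrow> (nat \<Rightarrow> complex) \<Rightarrow> complex" where
 "weight0 n t a b c d z = (\<Prod>i\<in>{1..n}. (1 - z i ^ 2) * ker [a,b,c,d] [c,d] (z i)) *
   (\<Prod>i\<in>{1..n}. \<Prod>j\<in>{i<..n}. pair_weight t (z i) (z j))"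

lemma qpoch_zero: "qpoch 0 x = 1 - x"
proof -
 have "(\<lambda>k. 1 - x * 0 ^ k) = (\<lambda>k. if k = 0 then 1 - x else 1)" by auto
 then show ?thesis unfolding qpoch_def
  by (simp only:) (use prodinf_finite[of "{0}" "\<lambda>k. if k = 0 then 1 - x else 1"] in auto)
qed

lemma koornwinder_weight_zero: "koornwinder_weight n 0 t a b c d z = weight0 n t a b c d z"
 by (simp add: koornwinder_weight_def weight0_def qpoch_zero ker_def pair_weight_def pair_ker_def divide_inverse mult_ac)

lemma torus_fun_circle_fun:
 assumes "circle_fun g"
 shows "torus_fun (\<lambda>z. g (z j))"
proof -
 have "(\<lambda>\<theta>. g (torus_point I w \<theta> j)) \<in> borel_measurable (Pi\<^sub>M I (\<lambda>_. unit_measure))" for I w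
 proof (cases "j \<in> I")
  case True
  have "(\<lambda>\<theta>. \<theta> j) \<in> measurable (Pi\<^sub>M I (\<lambda>_. unit_measure)) unit_measure"
   using True by measurable
  moreover have "(\<lambda>x. g (cis1 x)) \<in> borel_measurable unit_measure" using assms by (simp add: circle_fun_def)
  ultimately have "(\<lambda>\<theta>. g (cis1 (\<theta> j))) \<in> borel_measurable (Pi\<^sub>M I (\<lambda>_. unit_measure))"
   by (rule measurable_compose)
  then show ?thesis using True by (simp add: torus_point_def)
 next
  case False
  then show ?thesis by (simp add: torus_point_def)
 qed
 moreover obtain B where "\<And>x. norm x = 1 \<Longrightarrow> norm (g x) \<le> B" using circle_fun_bound[OF assms] by blast
 ultimately show ?thesis unfolding torus_fun_def on_torus_def by blast
qed

lemma torus_fun_pair_ker: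
 assumes "norm t < 1"
 shows "torus_fun (\<lambda>z. pair_ker t (z i) (z j))"
proof -
 have "torus_fun (\<lambda>z. t * z j * z i)" by (intro torus_fun_mult) simp_all
 moreover have "torus_fun (\<lambda>z. t * inverse (z j) * z i)" by (intro torus_fun_mult) simp_all
 ultimately show ?thesis unfolding pair_ker_def divide_inverse
  by (intro torus_fun_mult torus_fun_geometric[OF _ assms]) (auto simp: norm_mult norm_inverse on_torus_def)
qed

lemma torus_fun_pair_weight:
 assumes "norm t < 1"
 shows "torus_fun (\<lambda>z. pair_weight t (z i) (z j))"
 unfolding pair_weight_def
 by (intro torus_fun_mult torus_fun_pair_ker assms torus_fun_diff) simp_all

definition staged :: "nat \<Rightarrow> complex \<Rightarrow> (nat \<Rightarrow> complex \<Rightarrow> complex) \<Rightarrow> (nat \<Rightarrow> int) \<Rightarrow> nat \<Rightarrow> (nat \<Rightarrow> complex) \<Rightarrow> complex" where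
 "staged n t g \<beta> m z = (\<Prod>j\<in>{m..n}. z j powi \<beta> j * g j (z j)) * (\<Prod>i\<in>{m..n}. \<Prod>j\<in>{i<..n}. pair_weight t (z i) (z j))"

lemma torus_fun_staged:
 assumes "norm t < 1" "\<And>j. circle_fun (g j)"
 shows "torus_fun (staged n t g \<beta> m)"
 unfolding staged_def
 by (intro torus_fun_mult torus_fun_prod torus_fun_pair_weight torus_fun_circle_fun assms torus_fun_coord_powi)

lemma mean_at_zero_pairs:
 assumes "norm t < 1" "mean_at_zero g" "\<And>j. j \<in> A \<Longrightarrow> norm (z j) = 1" "finite A"
 shows "mean_at_zero (\<lambda>x. g x * (\<Prod>j\<in>A. pair_weight t x (z j)))"
 using assms(4,3)
proof (induction A rule: finite_induct)
 case (insert j A)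
 have n: "norm (z j) = 1" using insert by auto
 have "mean_at_zero (\<lambda>x. g x * (\<Prod>j\<in>A. pair_weight t x (z j)))" using insert by auto
 then have "mean_at_zero (\<lambda>x. g x * (\<Prod>j\<in>A. pair_weight t x (z j)) * (1 - z j * x) * (1 - inverse (z j) * x)
   * inverse (1 - t * z j * x) * inverse (1 - t / z j * x))"
  by (intro mean_at_zero_mult mean_at_zero_divide) (use assms(1) n in \<open>auto simp: norm_mult norm_divide\<close>)
 also have "(\<lambda>x. g x * (\<Prod>j\<in>A. pair_weight t x (z j)) * (1 - z j * x) * (1 - inverse (z j) * x)
   * inverse (1 - t * z j * x) * inverse (1 - t / z j * x)) = (\<lambda>x. g x * (\<Prod>j\<in>insert j A. pair_weight t x (z j)))"
  using insert by (simp add: fun_eq_iff pair_weight_def pair_ker_def mult_ac)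
 finally show ?case .
qed (use assms in simp)

text \<open>The first variable enters the weight only through non-negative powers, apart from the poles
 of \<open>g\<close>; if \<open>g\<close> has none, integrating it out amounts to setting it to zero.\<close>

lemma staged_peel:
 assumes t: "norm t < 1" and g: "\<And>j. circle_fun (g j)" and m: "m \<le> n" "mean_at_zero (g m)" "0 \<le> \<beta> m"
  and w: "on_torus w"
 shows "tint {m..n} w (staged n t g \<beta> m) = (if \<beta> m = 0 then tint {Suc m..n} w (staged n t g \<beta> (Suc m)) else 0)"
proof -
 have sp: "{m..n} = insert m {Suc m..n}" using m by auto
 have "tint {m..n} w (staged n t g \<beta> m)
   = tint {Suc m..n} w (\<lambda>z. circle_mean (\<lambda>x. staged n t g \<beta> m (z(m := x))))"
  by (rule tint_Icc[OF torus_fun_staged[OF t g] w m(1)])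
 also have "\<dots> = tint {Suc m..n} w (\<lambda>z. (if \<beta> m = 0 then 1 else 0) * staged n t g \<beta> (Suc m) z)"
 proof (rule tint_cong[OF _ w])
  fix z assume z: "on_torus z"
  have 1: "(\<Prod>j\<in>{Suc m..n}. (z(m := x)) j powi \<beta> j * g j ((z(m := x)) j)) = (\<Prod>j\<in>{Suc m..n}. z j powi \<beta> j * g j (z j))" for x
   by (rule prod.cong) auto
  have 2: "(\<Prod>i\<in>{Suc m..n}. \<Prod>j\<in>{i<..n}. pair_weight t ((z(m := x)) i) ((z(m := x)) j))
    = (\<Prod>i\<in>{Suc m..n}. \<Prod>j\<in>{i<..n}. pair_weight t (z i) (z j))" for x
   by (intro prod.cong) auto
  have 3: "(\<Prod>j\<in>{m<..n}. pair_weight t x ((z(m := x)) j)) = (\<Prod>j\<in>{m<..n}. pair_weight t x (z j))" for x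
   by (intro prod.cong) auto
  have 4: "x powi \<beta> m = x ^ nat (\<beta> m)" for x :: complex using m(3) by (simp add: power_int_def)
  have "staged n t g \<beta> m (z(m := x)) = staged n t g \<beta> (Suc m) z *
    (x ^ nat (\<beta> m) * (g m x * (\<Prod>j\<in>{m<..n}. pair_weight t x (z j))))" for x
   unfolding staged_def sp by (simp add: 1 2 3 4 mult_ac)
  then have "circle_mean (\<lambda>x. staged n t g \<beta> m (z(m := x))) = staged n t g \<beta> (Suc m) z *
    circle_mean (\<lambda>x. x ^ nat (\<beta> m) * (g m x * (\<Prod>j\<in>{m<..n}. pair_weight t x (z j))))"
   by (simp add: circle_mean_mult_left)
  also have "\<dots> = staged n t g \<beta> (Suc m) z * (if nat (\<beta> m) = 0 then 1 else 0)"
   using mean_at_zero_pairs[OF t m(2), of "{m<..n}" z] z by (simp add: mean_at_zero_def on_torus_def)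
  finally show "circle_mean (\<lambda>x. staged n t g \<beta> m (z(m := x))) = (if \<beta> m = 0 then 1 else 0) * staged n t g \<beta> (Suc m) z"
   using m(3) by simp
 qed
 also have "\<dots> = (if \<beta> m = 0 then tint {Suc m..n} w (staged n t g \<beta> (Suc m)) else 0)"
  by (subst tint_mult_left) simp
 finally show ?thesis .
qed

lemma staged_vanish:
 assumes t: "norm t < 1" and g: "\<And>j. circle_fun (g j)" and w: "on_torus w"
  and l: "m \<le> l" "l \<le> n" "\<And>j. m \<le> j \<Longrightarrow> j \<le> l \<Longrightarrow> mean_at_zero (g j)"
  and \<beta>: "\<And>j. m \<le> j \<Longrightarrow> j < l \<Longrightarrow> \<beta> j = 0" "0 < \<beta> l"
 shows "tint {m..n} w (staged n t g \<beta> m) = 0"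
 using l \<beta>(1)
proof (induction m rule: inc_induct)
 case base
 then show ?case using staged_peel[where m = l and n = n and \<beta> = \<beta>, OF t g _ _ _ w] \<beta>(2) by auto
next
 case (step m)
 then show ?case using staged_peel[where m = m and n = n and \<beta> = \<beta>, OF t g _ _ _ w] by auto
qed

lemma staged_one:
 assumes t: "norm t < 1" and g: "\<And>j. circle_fun (g j)" and w: "on_torus w"
  and l: "m \<le> Suc n" "\<And>j. m \<le> j \<Longrightarrow> j \<le> n \<Longrightarrow> mean_at_zero (g j)" and \<beta>: "\<And>j. m \<le> j \<Longrightarrow> j \<le> n \<Longrightarrow> \<beta> j = 0"
 shows "tint {m..n} w (staged n t g \<beta> m) = 1"
 using l \<beta>
proof (induction m rule: inc_induct)
 case base
 then show ?case by (simp add: tint_empty staged_def)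
next
 case (step m)
 then show ?case using staged_peel[where m = m and n = n and \<beta> = \<beta>, OF t g _ _ _ w] by auto
qed

section \<open>Rationality of the moments\<close>

type_synonym par = "complex \<times> complex \<times> complex \<times> complex \<times> complex"

definition poly_funs :: "(par \<Rightarrow> complex) set" where
 "poly_funs = {f. \<exists>P. \<forall>t a b c d. f (t, a, b, c, d) = par_eval P t a b c d}"

definition polydisc :: "par set" where
 "polydisc = {(t, a, b, c, d). norm t < 1 \<and> norm a < 1 \<and> norm b < 1 \<and> norm c < 1 \<and> norm d < 1}"

lemma par_eval_add: "par_eval (P + Q) t a b c d = par_eval P t a b c d + par_eval Q t a b c d"
 and par_eval_mult: "par_eval (P * Q) t a b c d = par_eval P t a b c d * par_eval Q t a b c d"
 and par_eval_const: "par_eval [:[:[:[:[:x:]:]:]:]:] t a b c d = x"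
 by (simp_all add: par_eval_def)

lemma function_ring_poly_funs: "function_ring poly_funs"
 unfolding function_ring_def poly_funs_def mem_Collect_eq
proof (intro conjI allI ballI)
 fix x show "\<exists>P. \<forall>t a b c d. x = par_eval P t a b c d"
  using par_eval_const by metis
next
 fix f g :: "par \<Rightarrow> complex"
 assume "f \<in> {f. \<exists>P. \<forall>t a b c d. f (t, a, b, c, d) = par_eval P t a b c d}"
  "g \<in> {f. \<exists>P. \<forall>t a b c d. f (t, a, b, c, d) = par_eval P t a b c d}"
 then obtain P Q where "\<forall>t a b c d. f (t, a, b, c, d) = par_eval P t a b c d"
  "\<forall>t a b c d. g (t, a, b, c, d) = par_eval Q t a b c d" by blast
 then show "\<exists>P. \<forall>t a b c d. f (t, a, b, c, d) + g (t, a, b, c, d) = par_eval P t a b c d"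
  "\<exists>P. \<forall>t a b c d. f (t, a, b, c, d) * g (t, a, b, c, d) = par_eval P t a b c d"
  using par_eval_add par_eval_mult by metis+
qed

lemma poly_funs_coords:
 "(\<lambda>(t,a,b,c,d). t) \<in> poly_funs" "(\<lambda>(t,a,b,c,d). a) \<in> poly_funs" "(\<lambda>(t,a,b,c,d). b) \<in> poly_funs"
 "(\<lambda>(t,a,b,c,d). c) \<in> poly_funs" "(\<lambda>(t,a,b,c,d). d) \<in> poly_funs"
 unfolding poly_funs_def mem_Collect_eq prod.case using par_eval_variables by metis+

text \<open>Laurent polynomials in \<open>z\<^sub>m, \<dots>, z\<^sub>n\<close> whose coefficients are polynomials in the parameters.\<close>

inductive_set laurent_funs :: "nat \<Rightarrow> nat \<Rightarrow> (par \<times> (nat \<Rightarrow> complex) \<Rightarrow> complex) set" for n m where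
 par: "f \<in> poly_funs \<Longrightarrow> (\<lambda>x. f (fst x)) \<in> laurent_funs n m"
| var: "m \<le> j \<Longrightarrow> j \<le> n \<Longrightarrow> (\<lambda>x. snd x j) \<in> laurent_funs n m"
| inv: "m \<le> j \<Longrightarrow> j \<le> n \<Longrightarrow> (\<lambda>x. inverse (snd x j)) \<in> laurent_funs n m"
| add: "F \<in> laurent_funs n m \<Longrightarrow> G \<in> laurent_funs n m \<Longrightarrow> (\<lambda>x. F x + G x) \<in> laurent_funs n m"
| mult: "F \<in> laurent_funs n m \<Longrightarrow> G \<in> laurent_funs n m \<Longrightarrow> (\<lambda>x. F x * G x) \<in> laurent_funs n m"

lemma function_ring_laurent_funs: "function_ring (laurent_funs n m)"
 unfolding function_ring_def
 using laurent_funs.par[OF function_ring_const[OF function_ring_poly_funs]] laurent_funs.add laurent_funs.mult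
 by blast

lemma laurent_funs_update: "F \<in> laurent_funs n m \<Longrightarrow> k < m \<Longrightarrow> F (p, z(k := x)) = F (p, z)"
 by (induction rule: laurent_funs.induct) auto

lemma laurent_funs_no_var: "F \<in> laurent_funs n m \<Longrightarrow> n < m \<Longrightarrow> \<exists>f\<in>poly_funs. \<forall>p z. F (p, z) = f p"
proof (induction rule: laurent_funs.induct)
 case (add F G)
 then obtain f g where "f \<in> poly_funs" "\<forall>p z. F (p, z) = f p" "g \<in> poly_funs" "\<forall>p z. G (p, z) = g p" by blast
 then show ?case using function_ring_add[OF function_ring_poly_funs] by (intro bexI[of _ "\<lambda>p. f p + g p"]) auto
next
 case (mult F G)
 then obtain f g where "f \<in> poly_funs" "\<forall>p z. F (p, z) = f p" "g \<in> poly_funs" "\<forall>p z. G (p, z) = g p" by blast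
 then show ?case using function_ring_mult[OF function_ring_poly_funs] by (intro bexI[of _ "\<lambda>p. f p * g p"]) auto
qed auto

lemma laurent_funs_torus_fun: "F \<in> laurent_funs n m \<Longrightarrow> torus_fun (\<lambda>z. F (p, z))"
 by (induction rule: laurent_funs.induct) (auto intro: torus_fun_add torus_fun_mult)

text \<open>Expansion in powers of the first variable.\<close>

inductive_set power_span :: "nat \<Rightarrow> nat \<Rightarrow> (par \<times> (nat \<Rightarrow> complex) \<Rightarrow> complex) set" for n m where
 mono: "G \<in> laurent_funs n (Suc m) \<Longrightarrow> (\<lambda>x. snd x m powi k * G x) \<in> power_span n m"
| add: "F \<in> power_span n m \<Longrightarrow> G \<in> power_span n m \<Longrightarrow> (\<lambda>x. F x + G x) \<in> power_span n m"

text \<open>The variables and their inverses are independent generators of \<open>laurent_funs\<close>, so powers can only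
 be collected up to equality on the torus.\<close>

definition torus_eq :: "(par \<times> (nat \<Rightarrow> complex) \<Rightarrow> complex) \<Rightarrow> (par \<times> (nat \<Rightarrow> complex) \<Rightarrow> complex) \<Rightarrow> bool" where
 "torus_eq F G \<longleftrightarrow> (\<forall>p z. on_torus z \<longrightarrow> F (p, z) = G (p, z))"

lemma power_span_mult:
 assumes "F \<in> power_span n m" "G \<in> power_span n m"
 shows "\<exists>H\<in>power_span n m. torus_eq (\<lambda>x. F x * G x) H"
 using assms
proof (induction rule: power_span.induct)
 case (mono A k)
 from mono(2) show ?case
 proof (induction rule: power_span.induct)
  case (mono B l)
  have "(\<lambda>x. snd x m powi (k + l) * (A x * B x)) \<in> power_span n m"
   by (intro power_span.mono laurent_funs.mult \<open>A \<in> _\<close> mono)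
  moreover have "torus_eq (\<lambda>x. snd x m powi k * A x * (snd x m powi l * B x)) (\<lambda>x. snd x m powi (k + l) * (A x * B x))"
   unfolding torus_eq_def using on_torus_nz by (simp add: power_int_add mult_ac)
  ultimately show ?case by blast
 next
  case (add B C)
  then obtain H1 H2 where H: "H1 \<in> power_span n m" "H2 \<in> power_span n m"
   "torus_eq (\<lambda>x. snd x m powi k * A x * B x) H1" "torus_eq (\<lambda>x. snd x m powi k * A x * C x) H2" by blast
  show ?case
   by (rule bexI[OF _ power_span.add[OF H(1,2)]]) (use H(3,4) in \<open>simp add: torus_eq_def distrib_left\<close>)
 qed
next
 case (add A B)
 then obtain H1 H2 where H: "H1 \<in> power_span n m" "H2 \<in> power_span n m"
  "torus_eq (\<lambda>x. A x * G x) H1" "torus_eq (\<lambda>x. B x * G x) H2" by blast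
 show ?case
  by (rule bexI[OF _ power_span.add[OF H(1,2)]]) (use H(3,4) in \<open>simp add: torus_eq_def distrib_right\<close>)
qed

lemma laurent_funs_power_span:
 assumes "F \<in> laurent_funs n m"
 shows "\<exists>H\<in>power_span n m. torus_eq F H"
 using assms
proof (induction rule: laurent_funs.induct)
 case (par f)
 show ?case
  by (rule bexI[OF _ power_span.mono[OF laurent_funs.par[OF par], where k = 0]]) (simp add: torus_eq_def)
next
 case (var j)
 show ?case
 proof (cases "j = m")
  case True
  show ?thesis
   by (rule bexI[OF _ power_span.mono[OF function_ring_const[OF function_ring_laurent_funs, where c = 1], where k = 1]]) (simp add: torus_eq_def True)
 next
  case False
  then have "(\<lambda>x. snd x j) \<in> laurent_funs n (Suc m)" using var by (intro laurent_funs.var) auto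
  then show ?thesis by (intro bexI[OF _ power_span.mono[where k = 0]]) (auto simp: torus_eq_def)
 qed
next
 case (inv j)
 show ?case
 proof (cases "j = m")
  case True
  show ?thesis
   by (rule bexI[OF _ power_span.mono[OF function_ring_const[OF function_ring_laurent_funs, where c = 1], where k = "-1"]]) (simp add: torus_eq_def True power_int_minus)
 next
  case False
  then have "(\<lambda>x. inverse (snd x j)) \<in> laurent_funs n (Suc m)" using inv by (intro laurent_funs.inv) auto
  then show ?thesis by (intro bexI[OF _ power_span.mono[where k = 0]]) (auto simp: torus_eq_def)
 qed
next
 case (add F G)
 then obtain H1 H2 where H: "H1 \<in> power_span n m" "H2 \<in> power_span n m" "torus_eq F H1" "torus_eq G H2" by blast
 show ?case
  by (rule bexI[OF _ power_span.add[OF H(1,2)]]) (use H(3,4) in \<open>simp add: torus_eq_def\<close>)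
next
 case (mult F G)
 then obtain H1 H2 where H: "H1 \<in> power_span n m" "H2 \<in> power_span n m" "torus_eq F H1" "torus_eq G H2" by blast
 then obtain H where "H \<in> power_span n m" "torus_eq (\<lambda>x. H1 x * H2 x) H" using power_span_mult by blast
 then show ?case using H by (intro bexI[of _ H]) (auto simp: torus_eq_def)
qed

lemma ker_append: "ker (xs @ xs') (ys @ ys') z = ker xs ys z * ker xs' ys' z"
 by (simp add: ker_def mult_ac)

lemma cross_append: "cross (xs @ xs') ys = cross xs ys * cross xs' ys"
 by (simp add: cross_def)

lemma cross_in_ring:
 assumes "function_ring R" "\<And>x. x \<in> set xs \<union> set ys \<Longrightarrow> x \<in> R"
 shows "(\<lambda>p. cross (map (\<lambda>x. x p) xs) (map (\<lambda>x. x p) ys)) \<in> R"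
proof -
 have "(\<lambda>p. \<Prod>x\<leftarrow>xs. \<Prod>y\<leftarrow>ys. 1 - x p * y p) \<in> R"
  by (intro function_ring_prod_list function_ring_diff function_ring_const function_ring_mult) (use assms in auto)
 then show ?thesis by (simp add: cross_def comp_def)
qed

lemma cross_nz:
 assumes "\<And>x. x \<in> set xs \<union> set ys \<Longrightarrow> norm x < 1"
 shows "cross xs ys \<noteq> 0"
proof -
 have "1 - x * y \<noteq> 0" if "x \<in> set xs" "y \<in> set ys" for x y
 proof -
  have "norm x < 1" "norm y < 1" using assms that by auto
  then have "norm x * norm y < 1 * 1" by (intro mult_strict_mono) auto
  then show ?thesis by (intro one_minus_nz) (simp add: norm_mult)
 qed
 then show ?thesis by (auto simp: cross_def prod_list_zero_iff)
qed

definition partner_list :: "nat \<Rightarrow> nat \<Rightarrow> complex \<Rightarrow> (nat \<Rightarrow> complex) \<Rightarrow> complex list" where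
 "partner_list m n t z = concat (map (\<lambda>j. [t * z j, t * inverse (z j)]) [m..<Suc n])"

lemma prod_list_partner:
 "(\<Prod>u\<leftarrow>partner_list m n t z. f u) = (\<Prod>j\<in>{m..n}. f (t * z j) * f (t * inverse (z j)))"
proof -
 have "(\<Prod>u\<leftarrow>concat (map (\<lambda>j. [t * z j, t * inverse (z j)]) js). f u) = (\<Prod>j\<leftarrow>js. f (t * z j) * f (t * inverse (z j)))" for js
  by (induction js) (simp_all add: mult_ac)
 then show ?thesis unfolding partner_list_def
  by (simp add: prod.distinct_set_conv_list[symmetric] atLeastLessThanSuc_atLeastAtMost del: upt_Suc)
qed

lemma ker_partner: "ker (partner_list m n t z) [] x = (\<Prod>j\<in>{m..n}. pair_ker t x (z j))"
 unfolding ker_def prod_list_partner pair_ker_def by (simp add: divide_inverse)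

text \<open>The denominator that arises from the interaction with the variables \<open>z\<^sub>j\<close> is a product of kernels in these
 variables, whose lists are \<open>t\<close> times the old one.\<close>

lemma cross_partner:
 assumes "on_torus z" "norm t < 1" "\<And>y. y \<in> set ys \<Longrightarrow> norm y < 1"
 shows "inverse (cross (partner_list m n t z) ys) = (\<Prod>j\<in>{m..n}. ker (map ((*) t) ys) (map ((*) t) ys) (z j))"
proof -
 have I: "inverse (\<Prod>y\<leftarrow>ys. g y) = (\<Prod>y\<leftarrow>ys. inverse (g y))" for g :: "complex \<Rightarrow> complex"
  by (induction ys) simp_all
 have "cross (partner_list m n t z) ys = (\<Prod>j\<in>{m..n}. (\<Prod>y\<leftarrow>ys. 1 - t * z j * y) * (\<Prod>y\<leftarrow>ys. 1 - t * inverse (z j) * y))"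
  unfolding cross_def prod_list_partner ..
 then show ?thesis
  by (simp add: prod_inversef[symmetric] comp_def I ker_def divide_inverse mult_ac)
qed

text \<open>The integrand that is left when \<open>z\<^sub>1, \<dots>, z\<^bsub>m-1\<^esub>\<close> have been integrated out. Integrating out \<open>z\<^sub>m\<close>
 replaces \<open>xs\<close> and \<open>ys\<close> by longer lists, because each factor \<open>1 - t z\<^sub>j\<^sup>\<plusminus>\<^sup>1 z\<^sub>m\<close> combines with
 each \<open>1 - y / z\<^sub>m\<close> to a factor of the denominator of the mean.\<close>

definition stage_fun :: "nat \<Rightarrow> nat \<Rightarrow> (par \<times> (nat \<Rightarrow> complex) \<Rightarrow> complex) \<Rightarrow> (par \<Rightarrow> complex) list \<Rightarrow> (par \<Rightarrow> complex) list \<Rightarrow> par \<Rightarrow> (nat \<Rightarrow> complex) \<Rightarrow> complex" where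
 "stage_fun n m F xs ys p z = F (p, z) * (\<Prod>j\<in>{m..n}. ker (map (\<lambda>f. f p) xs) (map (\<lambda>f. f p) ys) (z j))
   * (\<Prod>i\<in>{m..n}. \<Prod>j\<in>{i<..n}. pair_ker (fst p) (z i) (z j))"

definition small_funs :: "(par \<Rightarrow> complex) set" where
 "small_funs = {f \<in> poly_funs. \<forall>p\<in>polydisc. norm (f p) < 1}"

lemma polydisc_fst: "p \<in> polydisc \<Longrightarrow> norm (fst p) < 1"
 by (auto simp: polydisc_def)

lemma torus_fun_stage:
 assumes "F \<in> laurent_funs n k" "set xs \<subseteq> small_funs" "set ys \<subseteq> small_funs" "p \<in> polydisc"
 shows "torus_fun (stage_fun n m F xs ys p)"
 unfolding stage_fun_def
 by (intro torus_fun_mult torus_fun_prod torus_fun_circle_fun circle_fun_ker laurent_funs_torus_fun[OF assms(1)] torus_fun_pair_ker polydisc_fst assms)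
   (use assms in \<open>auto simp: small_funs_def\<close>)

definition rat_funs :: "(par \<Rightarrow> complex) set" where
 "rat_funs = {f. \<exists>D\<in>poly_funs. \<exists>P\<in>poly_funs. \<forall>p\<in>polydisc. D p \<noteq> 0 \<and> D p * f p = P p}"

lemma rat_funsE:
 assumes "f \<in> rat_funs"
 obtains D P where "D \<in> poly_funs" "P \<in> poly_funs" "\<And>p. p \<in> polydisc \<Longrightarrow> D p \<noteq> 0" "\<And>p. p \<in> polydisc \<Longrightarrow> D p * f p = P p"
 using assms unfolding rat_funs_def by blast

lemma rat_funsI:
 assumes "D \<in> poly_funs" "P \<in> poly_funs" "\<And>p. p \<in> polydisc \<Longrightarrow> D p \<noteq> 0" "\<And>p. p \<in> polydisc \<Longrightarrow> D p * f p = P p"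
 shows "f \<in> rat_funs"
 unfolding rat_funs_def mem_Collect_eq by (rule bexI[OF bexI[OF _ assms(2)] assms(1)]) (simp add: assms(3,4))

lemma function_ring_rat_funs: "function_ring rat_funs"
 unfolding function_ring_def
proof (intro conjI allI ballI)
 note fr = function_ring_poly_funs
 show "(\<lambda>_. x) \<in> rat_funs" for x
  by (rule rat_funsI[OF function_ring_const[OF fr, of 1] function_ring_const[OF fr, of x]]) simp_all
 fix f g assume "f \<in> rat_funs" "g \<in> rat_funs"
 then obtain D P D' P' where f: "D \<in> poly_funs" "P \<in> poly_funs" "\<And>p. p \<in> polydisc \<Longrightarrow> D p \<noteq> 0" "\<And>p. p \<in> polydisc \<Longrightarrow> D p * f p = P p"
  and g: "D' \<in> poly_funs" "P' \<in> poly_funs" "\<And>p. p \<in> polydisc \<Longrightarrow> D' p \<noteq> 0" "\<And>p. p \<in> polydisc \<Longrightarrow> D' p * g p = P' p"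
  by (elim rat_funsE) (rule that)
 show "(\<lambda>p. f p + g p) \<in> rat_funs"
 proof (rule rat_funsI)
  show "(\<lambda>p. D p * D' p) \<in> poly_funs" "(\<lambda>p. P p * D' p + D p * P' p) \<in> poly_funs"
   by (intro function_ring_add[OF fr] function_ring_mult[OF fr] f g)+
  show "D p * D' p \<noteq> 0" "D p * D' p * (f p + g p) = P p * D' p + D p * P' p" if "p \<in> polydisc" for p
   using f(3)[OF that] g(3)[OF that] unfolding f(4)[OF that, symmetric] g(4)[OF that, symmetric] by (simp_all add: algebra_simps)
 qed
 show "(\<lambda>p. f p * g p) \<in> rat_funs"
 proof (rule rat_funsI)
  show "(\<lambda>p. D p * D' p) \<in> poly_funs" "(\<lambda>p. P p * P' p) \<in> poly_funs"
   by (intro function_ring_mult[OF fr] f g)+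
  show "D p * D' p \<noteq> 0" "D p * D' p * (f p * g p) = P p * P' p" if "p \<in> polydisc" for p
   using f(3)[OF that] g(3)[OF that] unfolding f(4)[OF that, symmetric] g(4)[OF that, symmetric] by (simp_all add: algebra_simps)
 qed
qed

lemma poly_funs_rat_funs: "f \<in> poly_funs \<Longrightarrow> f \<in> rat_funs"
 by (rule rat_funsI[OF function_ring_const[OF function_ring_poly_funs, of 1]]) simp_all

text \<open>The variables taken from \<open>w\<close> do not occur in the integrands in question, so that the integral is a
 function of the parameters alone.\<close>

definition rational_fam :: "(par \<Rightarrow> (nat \<Rightarrow> complex) \<Rightarrow> complex) \<Rightarrow> bool" where
 "rational_fam I \<longleftrightarrow> (\<exists>f\<in>rat_funs. \<forall>p\<in>polydisc. \<forall>w. on_torus w \<longrightarrow> I p w = f p)"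

lemma rational_famI: "f \<in> rat_funs \<Longrightarrow> (\<And>p w. p \<in> polydisc \<Longrightarrow> on_torus w \<Longrightarrow> I p w = f p) \<Longrightarrow> rational_fam I"
 unfolding rational_fam_def by blast

lemma rational_famE:
 assumes "rational_fam I"
 obtains f where "f \<in> rat_funs" "\<And>p w. p \<in> polydisc \<Longrightarrow> on_torus w \<Longrightarrow> I p w = f p"
proof -
 from assms[unfolded rational_fam_def] show ?thesis by (elim bexE) (rule that, assumption, blast)
qed

lemma rational_fam_add:
 assumes "rational_fam I" "rational_fam J" "\<And>p w. p \<in> polydisc \<Longrightarrow> on_torus w \<Longrightarrow> K p w = I p w + J p w"
 shows "rational_fam K"
proof (rule rational_famE[OF assms(1)], rule rational_famE[OF assms(2)])
 fix f g assume f: "f \<in> rat_funs" "\<And>p w. p \<in> polydisc \<Longrightarrow> on_torus w \<Longrightarrow> I p w = f p"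
  and g: "g \<in> rat_funs" "\<And>p w. p \<in> polydisc \<Longrightarrow> on_torus w \<Longrightarrow> J p w = g p"
 show ?thesis
 proof (rule rational_famI[OF function_ring_add[OF function_ring_rat_funs f(1) g(1)]])
  fix p w assume p: "p \<in> polydisc" and w: "on_torus w"
  show "K p w = f p + g p" unfolding assms(3)[OF p w] f(2)[OF p w] g(2)[OF p w] ..
 qed
qed

lemma rational_fam_cong:
 assumes "rational_fam I" "\<And>p w. p \<in> polydisc \<Longrightarrow> on_torus w \<Longrightarrow> K p w = I p w"
 shows "rational_fam K"
proof (rule rational_famE[OF assms(1)])
 fix f assume f: "f \<in> rat_funs" "\<And>p w. p \<in> polydisc \<Longrightarrow> on_torus w \<Longrightarrow> I p w = f p"
 show ?thesis
 proof (rule rational_famI[OF f(1)])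
  fix p w assume p: "p \<in> polydisc" and w: "on_torus w"
  show "K p w = f p" unfolding assms(2)[OF p w] by (rule f(2)[OF p w])
 qed
qed

lemma rational_fam_divide:
 assumes "rational_fam I" "C \<in> poly_funs" "\<And>p. p \<in> polydisc \<Longrightarrow> C p \<noteq> 0"
  "\<And>p w. p \<in> polydisc \<Longrightarrow> on_torus w \<Longrightarrow> C p * K p w = I p w"
 shows "rational_fam K"
proof (rule rational_famE[OF assms(1)])
 fix f assume f: "f \<in> rat_funs" "\<And>p w. p \<in> polydisc \<Longrightarrow> on_torus w \<Longrightarrow> I p w = f p"
 have "(\<lambda>p. inverse (C p)) \<in> rat_funs"
 proof (rule rat_funsI[OF assms(2) function_ring_const[OF function_ring_poly_funs, of 1]])
  show "C p \<noteq> 0" "C p * inverse (C p) = 1" if "p \<in> polydisc" for p using assms(3)[OF that] by auto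
 qed
 from function_ring_mult[OF function_ring_rat_funs this f(1)] show ?thesis
 proof (rule rational_famI)
  fix p w assume p: "p \<in> polydisc" and w: "on_torus w"
  show "K p w = inverse (C p) * f p"
   unfolding f(2)[OF p w, symmetric] assms(4)[OF p w, symmetric] using assms(3)[OF p] by simp
 qed
qed

lemma function_ring_power: "function_ring R \<Longrightarrow> f \<in> R \<Longrightarrow> (\<lambda>p. f p ^ k) \<in> R"
 by (induction k) (simp_all add: function_ring_const function_ring_mult)

lemma laurent_funs_powi:
 assumes "m \<le> j" "j \<le> n"
 shows "(\<lambda>x. snd x j powi k) \<in> laurent_funs n m"
proof (cases "0 \<le> k")
 case True
 have "(\<lambda>x. snd x j ^ nat k) \<in> laurent_funs n m"
  by (rule function_ring_power[OF function_ring_laurent_funs laurent_funs.var[OF assms]])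
 then show ?thesis using True by (simp add: power_int_def)
next
 case False
 have "(\<lambda>x. inverse (snd x j) ^ nat (- k)) \<in> laurent_funs n m"
  by (rule function_ring_power[OF function_ring_laurent_funs laurent_funs.inv[OF assms]])
 then show ?thesis using False by (simp add: power_int_def)
qed

lemma laurent_funs_Suc: "G \<in> laurent_funs n (Suc m) \<Longrightarrow> G \<in> laurent_funs n m"
proof (induction rule: laurent_funs.induct)
 case (par f) then show ?case by (rule laurent_funs.par)
next
 case (var j) then show ?case by (intro laurent_funs.var) auto
next
 case (inv j) then show ?case by (intro laurent_funs.inv) auto
next
 case (add F G) then show ?case by (intro laurent_funs.add)
next
 case (mult F G) then show ?case by (intro laurent_funs.mult)
qed

lemma power_span_laurent_funs:
 assumes "H \<in> power_span n m" "m \<le> n"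
 shows "H \<in> laurent_funs n m"
 using assms(1)
proof (induction rule: power_span.induct)
 case (mono G k)
 show ?case
  by (intro laurent_funs.mult laurent_funs_powi laurent_funs_Suc[OF mono] order_refl assms(2))
next
 case (add F G) then show ?case by (intro laurent_funs.add)
qed

text \<open>Integrate out \<open>z\<^sub>m\<close>: expand the polynomial part in powers of \<open>z\<^sub>m\<close>, and use that the mean of a power
 against a kernel is polynomial up to the factor \<open>cross\<close>. This factor splits into a polynomial in the parameters
 and kernels of the remaining variables, so that the integrand keeps its shape.\<close>

lemma stage_rational:
 assumes "m \<le> Suc n" "F \<in> laurent_funs n m" "set xs \<subseteq> small_funs" "set ys \<subseteq> small_funs"
 shows "rational_fam (\<lambda>p w. tint {m..n} w (stage_fun n m F xs ys p))"
 using assms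
proof (induction m arbitrary: F xs ys rule: inc_induct)
 case base
 then obtain f where f: "f \<in> poly_funs" "\<forall>p z. F (p, z) = f p" using laurent_funs_no_var[of F n "Suc n"] by auto
 have "tint {Suc n..n} w (stage_fun n (Suc n) F xs ys p) = f p" for p w
 proof -
  have "F (p, w) = f p" using f(2) by blast
  then show ?thesis by (simp add: tint_empty stage_fun_def)
 qed
 then show ?case
  by (intro rational_famI[OF poly_funs_rat_funs[OF f(1)]]) simp_all
next
 case (step m)
 have m: "m \<le> n" using step.hyps by simp
 note xs = step.prems(2) and ys = step.prems(3)
 obtain H where H: "H \<in> power_span n m" "torus_eq F H" using laurent_funs_power_span[OF step.prems(1)] by blast
 have span: "H \<in> laurent_funs n m" if "H \<in> power_span n m" for H by (rule power_span_laurent_funs[OF that m])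
 have "rational_fam (\<lambda>p w. tint {m..n} w (stage_fun n m H xs ys p))"
  using H(1)
 proof (induction rule: power_span.induct)
  case (add A B)
  show ?case
  proof (rule rational_fam_add[OF add.IH])
   fix p w assume p: "p \<in> polydisc" and w: "on_torus w"
   have "stage_fun n m (\<lambda>x. A x + B x) xs ys p = (\<lambda>z. stage_fun n m A xs ys p z + stage_fun n m B xs ys p z)"
    by (simp add: stage_fun_def fun_eq_iff distrib_right)
   then show "tint {m..n} w (stage_fun n m (\<lambda>x. A x + B x) xs ys p)
     = tint {m..n} w (stage_fun n m A xs ys p) + tint {m..n} w (stage_fun n m B xs ys p)"
    using tint_add[OF torus_fun_stage[OF span[OF add.hyps(1)] xs ys p]
      torus_fun_stage[OF span[OF add.hyps(2)] xs ys p] finite_atLeastAtMost w] by simp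
  qed
 next
  case (mono G k)
  define Xf :: "(par \<times> (nat \<Rightarrow> complex) \<Rightarrow> complex) list" where "Xf = map (\<lambda>f x. f (fst x)) xs
    @ concat (map (\<lambda>j. [\<lambda>x. fst (fst x) * snd x j, \<lambda>x. fst (fst x) * inverse (snd x j)]) [Suc m..<Suc n])"
  define Yf :: "(par \<times> (nat \<Rightarrow> complex) \<Rightarrow> complex) list" where "Yf = map (\<lambda>f x. f (fst x)) ys"
  let ?\<Omega> = "{(p, z). p \<in> polydisc \<and> on_torus z} :: (par \<times> (nat \<Rightarrow> complex)) set"
  have vals: "map (\<lambda>f. f (p, z)) Xf = map (\<lambda>f. f p) xs @ partner_list (Suc m) n (fst p) z"
   "map (\<lambda>f. f (p, z)) Yf = map (\<lambda>f. f p) ys" for p z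
   by (simp_all add: Xf_def Yf_def partner_list_def map_concat comp_def del: upt_Suc)
  have pt: "fst \<in> poly_funs"
  proof -
   have "(\<lambda>(t,a,b,c,d). t) = (fst :: par \<Rightarrow> complex)" by auto
   then show ?thesis using poly_funs_coords(1) by simp
  qed
  have inR: "x \<in> laurent_funs n (Suc m)" if "x \<in> set Xf \<union> set Yf" for x
  proof -
   have A: "(\<lambda>x. f (fst x)) \<in> laurent_funs n (Suc m)" if "f \<in> set xs \<union> set ys" for f
    by (rule laurent_funs.par) (use that xs ys in \<open>auto simp: small_funs_def\<close>)
   have B: "(\<lambda>x. fst (fst x) * snd x j) \<in> laurent_funs n (Suc m)"
    "(\<lambda>x. fst (fst x) * inverse (snd x j)) \<in> laurent_funs n (Suc m)" if "j \<in> {Suc m..<Suc n}" for j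
    by (rule laurent_funs.mult[OF laurent_funs.par[OF pt] laurent_funs.var]
      laurent_funs.mult[OF laurent_funs.par[OF pt] laurent_funs.inv]; use that in auto)+
   from that consider f where "f \<in> set xs \<union> set ys" "x = (\<lambda>x. f (fst x))"
    | j where "j \<in> {Suc m..<Suc n}" "x = (\<lambda>x. fst (fst x) * snd x j) \<or> x = (\<lambda>x. fst (fst x) * inverse (snd x j))"
    unfolding Xf_def Yf_def by (auto simp del: upt_Suc)
   then show ?thesis using A B by cases auto
  qed
  have nrm: "norm (x q) < 1" if x: "x \<in> set Xf \<union> set Yf" and q0: "q \<in> ?\<Omega>" for x q
  proof -
   obtain p z where q: "q = (p, z)" "p \<in> polydisc" "on_torus z" using q0 by auto
   from x consider f where "f \<in> set xs \<union> set ys" "x = (\<lambda>x. f (fst x))"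
    | j where "x = (\<lambda>x. fst (fst x) * snd x j) \<or> x = (\<lambda>x. fst (fst x) * inverse (snd x j))"
    unfolding Xf_def Yf_def by (auto simp del: upt_Suc)
   then show ?thesis
   proof cases
    case 1
    then have "f \<in> small_funs" using xs ys by auto
    then show ?thesis using 1(2) q by (simp add: small_funs_def)
   next
    case 2
    then show ?thesis using q polydisc_fst[OF q(2)] on_torus_norm[OF q(3), of j]
     by (elim disjE) (simp_all add: norm_mult norm_inverse)
   qed
  qed
  have "\<exists>r\<in>laurent_funs n (Suc m). \<forall>q\<in>?\<Omega>.
    cross (map (\<lambda>x. x q) Xf) (map (\<lambda>x. x q) Yf) * kmean k (map (\<lambda>x. x q) Xf) (map (\<lambda>x. x q) Yf) = r q"
   by (rule kmean_in_ring[OF function_ring_laurent_funs]) (fact inR, fact nrm)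
  then obtain r where r: "r \<in> laurent_funs n (Suc m)"
   and r': "\<forall>q\<in>?\<Omega>. cross (map (\<lambda>x. x q) Xf) (map (\<lambda>x. x q) Yf) * kmean k (map (\<lambda>x. x q) Xf) (map (\<lambda>x. x q) Yf) = r q"
   by (rule bexE)
  let ?ty = "map (\<lambda>f p. fst p * f p) ys"
  have ty: "set ?ty \<subseteq> small_funs"
  proof -
   have "(\<lambda>p. fst p * f p) \<in> small_funs" if "f \<in> set ys" for f
   proof -
    have f: "f \<in> poly_funs" "\<And>p. p \<in> polydisc \<Longrightarrow> norm (f p) < 1" using ys that by (auto simp: small_funs_def)
    have "norm (fst p * f p) < 1 * 1" if "p \<in> polydisc" for p
     unfolding norm_mult using polydisc_fst[OF that] f(2)[OF that] by (intro mult_strict_mono) auto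
    then show ?thesis using function_ring_mult[OF function_ring_poly_funs pt f(1)] by (simp add: small_funs_def)
   qed
   then show ?thesis by auto
  qed
  define F' where "F' x = G x * r x" for x
  have F': "F' \<in> laurent_funs n (Suc m)" unfolding F'_def[abs_def] by (intro laurent_funs.mult mono r)
  have IH: "rational_fam (\<lambda>p w. tint {Suc m..n} w (stage_fun n (Suc m) F' (xs @ ?ty) (ys @ ?ty) p))"
   by (rule step.IH[OF F']) (use xs ys ty in auto)
  let ?X = "\<lambda>p. map (\<lambda>f. f p) xs" and ?Y = "\<lambda>p. map (\<lambda>f. f p) ys"
  show ?case
  proof (rule rational_fam_divide[OF IH, where C = "\<lambda>p. cross (?X p) (?Y p)"])
   show "(\<lambda>p. cross (?X p) (?Y p)) \<in> poly_funs"
    by (rule cross_in_ring[OF function_ring_poly_funs]) (use xs ys in \<open>auto simp: small_funs_def\<close>)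
   show cnz: "cross (?X p) (?Y p) \<noteq> 0" if "p \<in> polydisc" for p
    by (rule cross_nz) (use xs ys that in \<open>auto simp: small_funs_def\<close>)
   fix p w assume p: "p \<in> polydisc" and w: "on_torus w"
   let ?G = "\<lambda>x. snd x m powi k * G x"
   have sp: "{m..n} = insert m {Suc m..n}" and sp2: "{m<..n} = {Suc m..n}" using m by auto
   have "tint {m..n} w (stage_fun n m ?G xs ys p)
     = tint {Suc m..n} w (\<lambda>z. circle_mean (\<lambda>x. stage_fun n m ?G xs ys p (z(m := x))))"
    by (rule tint_Icc[OF torus_fun_stage[OF span[OF power_span.mono[OF mono]] xs ys p] w m])
   then have "cross (?X p) (?Y p) * tint {m..n} w (stage_fun n m ?G xs ys p)
     = tint {Suc m..n} w (\<lambda>z. cross (?X p) (?Y p) * circle_mean (\<lambda>x. stage_fun n m ?G xs ys p (z(m := x))))"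
    by (simp add: tint_mult_left)
   also have "\<dots> = tint {Suc m..n} w (stage_fun n (Suc m) F' (xs @ ?ty) (ys @ ?ty) p)"
   proof (rule tint_cong[OF _ w])
    fix z assume z: "on_torus z"
    have q: "(p, z) \<in> ?\<Omega>" using p z by simp
    let ?E = "partner_list (Suc m) n (fst p) z"
    have 1: "(\<Prod>j\<in>{Suc m..n}. ker (?X p) (?Y p) ((z(m := x)) j)) = (\<Prod>j\<in>{Suc m..n}. ker (?X p) (?Y p) (z j))" for x
     by (rule prod.cong) auto
    have 2: "(\<Prod>i\<in>{Suc m..n}. \<Prod>j\<in>{i<..n}. pair_ker (fst p) ((z(m := x)) i) ((z(m := x)) j))
      = (\<Prod>i\<in>{Suc m..n}. \<Prod>j\<in>{i<..n}. pair_ker (fst p) (z i) (z j))" for x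
     by (intro prod.cong) auto
    have 3: "(\<Prod>j\<in>{m<..n}. pair_ker (fst p) x (z j)) = ker ?E [] x" for x
     unfolding ker_partner sp2 ..
    have 4: "G (p, z(m := x)) = G (p, z)" for x by (rule laurent_funs_update[OF mono]) simp
    define rest where "rest = G (p, z) * (\<Prod>j\<in>{Suc m..n}. ker (?X p) (?Y p) (z j))
      * (\<Prod>i\<in>{Suc m..n}. \<Prod>j\<in>{i<..n}. pair_ker (fst p) (z i) (z j))"
    have "stage_fun n m ?G xs ys p (z(m := x)) = rest * (x powi k * ker (?X p @ ?E) (?Y p) x)" for x
     using ker_append[of "?X p" ?E "?Y p" "[]" x]
     unfolding stage_fun_def sp by (simp add: 1 2 3 4 rest_def mult_ac)
    then have cm: "circle_mean (\<lambda>x. stage_fun n m ?G xs ys p (z(m := x))) = rest * kmean k (?X p @ ?E) (?Y p)"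
     by (simp add: circle_mean_mult_left kmean_def)
    have r1: "cross (?X p) (?Y p) * cross ?E (?Y p) * kmean k (?X p @ ?E) (?Y p) = r (p, z)"
     using bspec[OF r' q] unfolding vals cross_append .
    have E0: "cross ?E (?Y p) \<noteq> 0"
    proof (rule cross_nz)
     fix x assume x: "x \<in> set ?E \<union> set (?Y p)"
     have "set ?E \<subseteq> set (map (\<lambda>f. f (p, z)) Xf)" unfolding vals by auto
     then have "x \<in> (\<lambda>f. f (p, z)) ` (set Xf \<union> set Yf)"
      using x unfolding vals(2)[of p z, symmetric] by auto
     then show "norm x < 1" using nrm[OF _ q] by auto
    qed
    have inv: "inverse (cross ?E (?Y p)) = (\<Prod>j\<in>{Suc m..n}. ker (map ((*) (fst p)) (?Y p)) (map ((*) (fst p)) (?Y p)) (z j))"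
     by (rule cross_partner[OF z polydisc_fst[OF p]]) (use ys p in \<open>auto simp: small_funs_def\<close>)
    have tyv: "map (\<lambda>f. f p) ?ty = map ((*) (fst p)) (?Y p)" by simp
    have "cross (?X p) (?Y p) * (rest * kmean k (?X p @ ?E) (?Y p))
      = rest * (r (p, z) * inverse (cross ?E (?Y p)))"
     unfolding r1[symmetric] using E0 by (simp add: mult_ac)
    also have "\<dots> = stage_fun n (Suc m) F' (xs @ ?ty) (ys @ ?ty) p z"
     unfolding inv stage_fun_def rest_def F'_def map_append tyv ker_append prod.distrib by (simp only: mult_ac)
    finally show "cross (?X p) (?Y p) * circle_mean (\<lambda>x. stage_fun n m ?G xs ys p (z(m := x)))
      = stage_fun n (Suc m) F' (xs @ ?ty) (ys @ ?ty) p z" unfolding cm .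
   qed
   finally show "cross (?X p) (?Y p) * tint {m..n} w (stage_fun n m ?G xs ys p)
     = tint {Suc m..n} w (stage_fun n (Suc m) F' (xs @ ?ty) (ys @ ?ty) p)" .
  qed
 qed
 then show ?case
 proof (rule rational_fam_cong)
  fix p w assume w: "on_torus w"
  have "F (p, z) = H (p, z)" if "on_torus z" for z using H(2) that unfolding torus_eq_def by blast
  then show "tint {m..n} w (stage_fun n m F xs ys p) = tint {m..n} w (stage_fun n m H xs ys p)"
   by (intro tint_cong[OF _ w]) (simp add: stage_fun_def)
 qed
qed

section \<open>Moments\<close>

definition zpow :: "nat \<Rightarrow> comp \<Rightarrow> (nat \<Rightarrow> complex) \<Rightarrow> complex" where
 "zpow n \<beta> z = (\<Prod>j\<in>{1..n}. z j powi lk \<beta> j)"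

definition moment :: "nat \<Rightarrow> complex \<Rightarrow> complex \<Rightarrow> complex \<Rightarrow> complex \<Rightarrow> complex \<Rightarrow> comp \<Rightarrow> complex" where
 "moment n t a b c d \<beta> = tint {1..n} (\<lambda>_. 1) (\<lambda>z. zpow n \<beta> z * weight0 n t a b c d z)"

lemma on_torus_one [simp]: "on_torus (\<lambda>_. 1)" by (simp add: on_torus_def)

definition moment_at :: "nat \<Rightarrow> comp \<Rightarrow> par \<Rightarrow> complex" where
 "moment_at n \<beta> = (\<lambda>(t, a, b, c, d). moment n t a b c d \<beta>)"

lemma moment_rational: "moment_at n \<beta> \<in> rat_funs"
proof -
 define F :: "par \<times> (nat \<Rightarrow> complex) \<Rightarrow> complex" where
  "F x = zpow n \<beta> (snd x) * (\<Prod>i\<in>{1..n}. 1 - snd x i * snd x i)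
   * (\<Prod>i\<in>{1..n}. \<Prod>j\<in>{i<..n}. (1 - snd x j * snd x i) * (1 - inverse (snd x j) * snd x i))" for x
 note fr = function_ring_laurent_funs
 have v: "(\<lambda>x. snd x j) \<in> laurent_funs n 1" "(\<lambda>x. inverse (snd x j)) \<in> laurent_funs n 1" if "j \<in> {1..n}" for j
  by (rule laurent_funs.var laurent_funs.inv; use that in auto)+
 have pm: "(\<lambda>x. snd x j powi k) \<in> laurent_funs n 1" if "j \<in> {1..n}" for j k
  by (rule laurent_funs_powi) (use that in auto)
 have F: "F \<in> laurent_funs n 1"
  unfolding F_def[abs_def] zpow_def
  by (intro function_ring_mult[OF fr] function_ring_prod[OF fr] function_ring_diff[OF fr] function_ring_const[OF fr] pm v) auto
 let ?xs = "[\<lambda>(t,a,b,c,d). a, \<lambda>(t,a,b,c,d). b, \<lambda>(t,a,b,c,d). c, \<lambda>(t,a,b,c,d). d] :: (par \<Rightarrow> complex) list"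
 let ?ys = "[\<lambda>(t,a,b,c,d). c, \<lambda>(t,a,b,c,d). d] :: (par \<Rightarrow> complex) list"
 have "set ?xs \<subseteq> small_funs" "set ?ys \<subseteq> small_funs"
  using poly_funs_coords by (auto simp: small_funs_def polydisc_def)
 from stage_rational[OF _ F this] have R: "rational_fam (\<lambda>p w. tint {1..n} w (stage_fun n 1 F ?xs ?ys p))" by simp
 have "stage_fun n 1 F ?xs ?ys (t,a,b,c,d) = (\<lambda>z. zpow n \<beta> z * weight0 n t a b c d z)" for t a b c d
  by (simp add: fun_eq_iff stage_fun_def F_def weight0_def pair_weight_def prod.distrib power2_eq_square mult_ac)
 then have eq: "moment n t a b c d \<beta> = tint {1..n} (\<lambda>_. 1) (stage_fun n 1 F ?xs ?ys (t,a,b,c,d))" for t a b c d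
  by (simp add: moment_def)
 show ?thesis
 proof (rule rational_famE[OF R], rule rat_funsE)
  fix f D P
  assume f: "\<And>p w. p \<in> polydisc \<Longrightarrow> on_torus w \<Longrightarrow> tint {1..n} w (stage_fun n 1 F ?xs ?ys p) = f p"
   and DP: "D \<in> poly_funs" "P \<in> poly_funs" "\<And>p. p \<in> polydisc \<Longrightarrow> D p \<noteq> 0" "\<And>p. p \<in> polydisc \<Longrightarrow> D p * f p = P p"
  show ?thesis
  proof (rule rat_funsI[OF DP(1-3)])
   fix p assume p: "p \<in> polydisc"
   obtain t a b c d where pt: "p = (t,a,b,c,d)" by (cases p)
   have "moment_at n \<beta> p = f p" unfolding f[OF p on_torus_one, symmetric] unfolding pt moment_at_def prod.case by (rule eq)
   then show "D p * moment_at n \<beta> p = P p" using DP(4)[OF p] by simp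
  qed
 qed
qed

lemma mean_at_zero_one_sided:
 assumes "\<And>x. x \<in> set xs \<Longrightarrow> norm x < 1"
 shows "mean_at_zero (\<lambda>x. (1 - x ^ 2) * ker xs [] x)"
proof -
 have "mean_at_zero (\<lambda>x. 1 * (1 - 1 * x) * (1 - (-1) * x) * (\<Prod>u\<leftarrow>xs. inverse (1 - u * x)))"
  by (intro mean_at_zero_divide_list mean_at_zero_mult mean_at_zero_one assms)
 also have "(\<lambda>x. 1 * (1 - 1 * x) * (1 - (-1) * x) * (\<Prod>u\<leftarrow>xs. inverse (1 - u * x))) = (\<lambda>x. (1 - x ^ 2) * ker xs [] x)"
  by (simp add: fun_eq_iff ker_def power2_eq_square algebra_simps)
 finally show ?thesis .
qed

text \<open>For \<open>c = d = 0\<close> the weight has no pole inside the disc in \<open>z\<^sub>1\<close>. Hence \<open>z\<^sub>1\<close> can be set to zero,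
 then \<open>z\<^sub>2\<close>, and so on.\<close>

lemma moment_one_sided:
 assumes "norm t < 1" "norm a < 1" "norm b < 1"
 shows "moment n t a b 0 0 0 = 1"
  and "1 \<le> l \<Longrightarrow> l \<le> n \<Longrightarrow> (\<And>j. 1 \<le> j \<Longrightarrow> j < l \<Longrightarrow> lk \<beta> j = 0) \<Longrightarrow> 0 < lk \<beta> l \<Longrightarrow> moment n t a b 0 0 \<beta> = 0"
proof -
 let ?g = "\<lambda>(j::nat) x. (1 - x ^ 2) * ker [a, b, 0, 0] [] x"
 have g: "mean_at_zero (?g j)" for j by (rule mean_at_zero_one_sided) (use assms in auto)
 then have gc: "circle_fun (?g j)" for j by (simp add: mean_at_zero_def)
 have k: "ker [a, b, 0, 0] [0, 0] = ker [a, b, 0, 0] []" by (simp add: ker_def fun_eq_iff)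
 have eq: "moment n t a b 0 0 \<beta> = tint {1..n} (\<lambda>_. 1) (staged n t ?g (lk \<beta>) 1)" for \<beta>
 proof -
  have "(\<lambda>z. zpow n \<beta> z * weight0 n t a b 0 0 z) = staged n t ?g (lk \<beta>) 1"
   by (simp add: fun_eq_iff staged_def weight0_def k zpow_def prod.distrib mult_ac)
  then show ?thesis by (simp only: moment_def)
 qed
 show "moment n t a b 0 0 0 = 1"
  unfolding eq by (rule staged_one[OF assms(1) gc]) (use g in auto)
 show "moment n t a b 0 0 \<beta> = 0"
  if "1 \<le> l" "l \<le> n" "\<And>j. 1 \<le> j \<Longrightarrow> j < l \<Longrightarrow> lk \<beta> j = 0" "0 < lk \<beta> l"
  unfolding eq by (rule staged_vanish[OF assms(1) gc, of _ 1 l]) (use that g in auto)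
qed

section \<open>Symmetries of the torus\<close>

lemma tint_swap:
 assumes f: "torus_fun f" and I: "finite I" "i \<in> I" "j \<in> I" and w: "on_torus w"
 shows "tint I w (\<lambda>z. f (\<lambda>k. z (Transposition.transpose i j k))) = tint I w f"
proof -
 let ?s = "Transposition.transpose i j" and ?M = "Pi\<^sub>M I (\<lambda>_. unit_measure)"
 have sI: "?s k \<in> I \<longleftrightarrow> k \<in> I" for k using I by (auto simp: Transposition.transpose_def)
 have sout: "?s k = k" if "k \<notin> I" for k using I that by (auto simp: Transposition.transpose_def)
 have "distr ?M (Pi\<^sub>M I (\<lambda>i. (\<lambda>_. unit_measure) (?s i))) (\<lambda>\<omega>. \<lambda>n\<in>I. \<omega> (?s n)) = Pi\<^sub>M I (\<lambda>i. (\<lambda>_. unit_measure) (?s i))"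
  by (rule distr_PiM_reindex) (use prob_space_unit_measure sI in \<open>auto intro: inj_onI dest: arg_cong[where f="Transposition.transpose i j"]\<close>)
 then have d: "distr ?M ?M (\<lambda>\<omega>. \<lambda>n\<in>I. \<omega> (?s n)) = ?M" by simp
 have m: "(\<lambda>\<omega>. \<lambda>n\<in>I. \<omega> (?s n)) \<in> measurable ?M ?M"
  by (rule measurable_restrict) (simp add: sI measurable_component_singleton)
 have "tint I w f = (\<integral>\<theta>. f (torus_point I w \<theta>) \<partial>distr ?M ?M (\<lambda>\<omega>. \<lambda>n\<in>I. \<omega> (?s n)))"
  unfolding d tint_def ..
 also have "\<dots> = (\<integral>\<theta>. f (torus_point I w (\<lambda>n\<in>I. \<theta> (?s n))) \<partial>?M)"
  by (rule integral_distr[OF m torus_fun_meas[OF f I(1) w]])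
 also have "\<dots> = tint I w (\<lambda>z. f (\<lambda>k. z (?s k)))"
 proof -
  have "torus_point I w (\<lambda>n\<in>I. \<theta> (?s n)) = (\<lambda>k. torus_point I w \<theta> (?s k))" for \<theta>
   using sI sout by (auto simp: torus_point_def fun_eq_iff)
  then show ?thesis by (simp add: tint_def)
 qed
 finally show ?thesis ..
qed

lemma tint_inversion:
 assumes f: "torus_fun f" "torus_fun (\<lambda>z. f (z(i := inverse (z i))))" and I: "finite I" "i \<in> I" and w: "on_torus w"
 shows "tint I w (\<lambda>z. f (z(i := inverse (z i)))) = tint I w f"
proof -
 define J where "J = I - {i}"
 have J: "I = insert i J" "finite J" "i \<notin> J" using I by (auto simp: J_def)
 have "tint I w (\<lambda>z. f (z(i := inverse (z i)))) = tint J w (\<lambda>z. circle_mean (\<lambda>x. f (z(i := inverse x))))"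
  unfolding J(1) by (subst tint_insert[OF f(2) J(2,3) w]) simp
 also have "\<dots> = tint J w (\<lambda>z. circle_mean (\<lambda>x. f (z(i := x))))"
  by (subst circle_mean_inversion) simp
 also have "\<dots> = tint I w f" unfolding J(1) by (rule tint_insert[OF f(1) J(2,3) w, symmetric])
 finally show ?thesis .
qed

lemma zpow_add:
 assumes "on_torus z"
 shows "zpow n (\<beta> + \<gamma>) z = zpow n \<beta> z * zpow n \<gamma> z"
 using on_torus_nz[OF assms] by (simp add: zpow_def lookup_add power_int_add prod.distrib)

lemma zpow_zero [simp]: "zpow n 0 z = 1" by (simp add: zpow_def)

lemma torus_fun_zpow: "torus_fun (zpow n \<beta>)"
 unfolding zpow_def by (intro torus_fun_prod torus_fun_coord_powi)

lemma zpow_refl_swap: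
 assumes "1 \<le> i" "i < n"
 shows "zpow n (refl_comp n i \<beta>) z = zpow n \<beta> (\<lambda>k. z (Transposition.transpose i (i+1) k))"
 unfolding zpow_def
 by (rule prod.reindex_bij_witness[of _ "Transposition.transpose i (i+1)" "Transposition.transpose i (i+1)"])
   (use assms in \<open>auto simp: refl_lookup Transposition.transpose_def\<close>)

lemma zpow_refl_flip: "zpow n (refl_comp n n \<beta>) z = zpow n \<beta> (z(n := inverse (z n)))"
 unfolding zpow_def by (rule prod.cong) (auto simp: refl_lookup power_int_minus power_int_inverse)

definition var_weight :: "complex \<Rightarrow> complex \<Rightarrow> complex \<Rightarrow> complex \<Rightarrow> complex \<Rightarrow> complex" where
 "var_weight a b c d x = (1 - x ^ 2) * ker [a,b,c,d] [c,d] x"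

definition pairs :: "nat \<Rightarrow> (nat \<times> nat) set" where
 "pairs n = {(k, l). 1 \<le> k \<and> k < l \<and> l \<le> n}"

lemma finite_pairs: "finite (pairs n)"
 by (rule finite_subset[of _ "{1..n} \<times> {1..n}"]) (auto simp: pairs_def)

lemma prod_pairs: "(\<Prod>i\<in>{1..n}. \<Prod>j\<in>{i<..n}. g i j) = (\<Prod>(k, l)\<in>pairs n. g k l)"
proof -
 have "pairs n = Sigma {1..n} (\<lambda>i. {i<..n})" by (auto simp: pairs_def)
 then show ?thesis by (simp add: prod.Sigma)
qed

lemma weight0_alt:
 "weight0 n t a b c d z = (\<Prod>i\<in>{1..n}. var_weight a b c d (z i)) * (\<Prod>(k, l)\<in>pairs n. pair_weight t (z k) (z l))"
 unfolding weight0_def prod_pairs var_weight_def ..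

text \<open>The factor of the weight that is left when the coefficient of \<open>f\<^bsup>s\<^esup> - f\<close> in \<open>T\<^sub>i\<close> has cancelled against
 the weight. It is invariant under \<open>s\<^sub>i\<close>.\<close>

definition rest_weight :: "nat \<Rightarrow> complex \<Rightarrow> complex \<Rightarrow> complex \<Rightarrow> complex \<Rightarrow> complex \<Rightarrow> nat \<Rightarrow> (nat \<Rightarrow> complex) \<Rightarrow> complex" where
 "rest_weight n t a b c d i z =
   (if i < n then (\<Prod>i\<in>{1..n}. var_weight a b c d (z i)) * (\<Prod>(k, l)\<in>pairs n - {(i, i+1)}. pair_weight t (z k) (z l))
    * ((1 - z (i+1) * z i) * inverse (1 - t * (z (i+1) * z i)))
   else (\<Prod>i\<in>{1..<n}. var_weight a b c d (z i)) * ker [c,d] [c,d] (z n) * (\<Prod>(k, l)\<in>pairs n. pair_weight t (z k) (z l)))"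

locale unit_params =
 fixes n :: nat and t a b c d :: complex
 assumes norms: "norm t < 1" "norm a < 1" "norm b < 1" "norm c < 1" "norm d < 1"
begin

abbreviation \<Delta> where "\<Delta> \<equiv> weight0 n t a b c d"
abbreviation R where "R \<equiv> rest_weight n t a b c d"
abbreviation mom where "mom \<equiv> moment n t a b c d"

lemma circle_fun_kers: "circle_fun (ker [a,b,c,d] [c,d])" "circle_fun (ker [c,d] [c,d])" "circle_fun (ker [a,b,c,d] [])"
 by (rule circle_fun_ker; use norms in auto)+

lemma circle_fun_var_weight: "circle_fun (var_weight a b c d)"
 unfolding var_weight_def by (intro circle_fun_mult circle_fun_diff circle_fun_power circle_fun_kers) auto

lemma torus_fun_weight: "torus_fun \<Delta>"
 unfolding weight0_alt case_prod_beta
 by (intro torus_fun_mult torus_fun_prod torus_fun_pair_weight norms torus_fun_circle_fun circle_fun_var_weight)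

lemma torus_fun_rest: "torus_fun (R i)"
proof -
 have "torus_fun (\<lambda>z. inverse (1 - t * (z (i+1) * z i)))"
  by (rule torus_fun_geometric[OF _ norms(1)]) (auto intro!: torus_fun_mult simp: norm_mult on_torus_norm)
 moreover have "torus_fun (\<lambda>z. var_weight a b c d (z j))" "torus_fun (\<lambda>z. ker [c,d] [c,d] (z j))" for j
  by (intro torus_fun_circle_fun circle_fun_var_weight circle_fun_kers)+
 moreover have "torus_fun (\<lambda>z. pair_weight t (z j) (z k))" for j k by (rule torus_fun_pair_weight[OF norms(1)])
 ultimately show ?thesis unfolding rest_weight_def case_prod_beta
  by (cases "i < n"; simp only: if_True if_False)
    (assumption | rule torus_fun_mult torus_fun_prod torus_fun_diff torus_fun_const torus_fun_coord)+
qed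

lemma rest_swap:
 assumes "1 \<le> i" "i < n"
 shows "R i (\<lambda>k. z (Transposition.transpose i (i+1) k)) = R i z"
proof -
 let ?s = "Transposition.transpose i (i+1)"
 have 1: "(\<Prod>k\<in>{1..n}. var_weight a b c d (z (?s k))) = (\<Prod>k\<in>{1..n}. var_weight a b c d (z k))"
  by (rule prod.reindex_bij_witness[of _ ?s ?s]) (use assms in \<open>auto simp: Transposition.transpose_def\<close>)
 have 2: "(\<Prod>(k, l)\<in>pairs n - {(i, i+1)}. pair_weight t (z (?s k)) (z (?s l))) = (\<Prod>(k, l)\<in>pairs n - {(i, i+1)}. pair_weight t (z k) (z l))"
  by (rule prod.reindex_bij_witness[of _ "map_prod ?s ?s" "map_prod ?s ?s"])
    (use assms in \<open>auto simp: Transposition.transpose_def pairs_def split: if_splits\<close>)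
 have 3: "?s i = i+1" "?s (i+1) = i" by (simp_all add: Transposition.transpose_def)
 show ?thesis unfolding rest_weight_def if_P[OF assms(2)] 1 2 3 by (simp only: mult.commute[of "z i" "z (i+1)"])
qed

lemma pair_weight_inverse: "pair_weight t u (inverse v) = pair_weight t u v"
 by (simp add: pair_weight_def pair_ker_def divide_inverse mult_ac)

lemma rest_flip:
 assumes "1 \<le> n"
 shows "R n (z(n := inverse (z n))) = R n z"
proof -
 have 1: "(\<Prod>k\<in>{1..<n}. var_weight a b c d ((z(n := inverse (z n))) k)) = (\<Prod>k\<in>{1..<n}. var_weight a b c d (z k))"
  by (rule prod.cong) auto
 have 2: "(\<Prod>x\<in>pairs n. pair_weight t ((z(n := inverse (z n))) (fst x)) ((z(n := inverse (z n))) (snd x)))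
   = (\<Prod>x\<in>pairs n. pair_weight t (z (fst x)) (z (snd x)))"
  by (rule prod.cong) (auto simp: pairs_def pair_weight_inverse)
 have 3: "ker [c,d] [c,d] (inverse (z n)) = ker [c,d] [c,d] (z n)"
  by (simp add: ker_def divide_inverse mult_ac)
 show ?thesis unfolding rest_weight_def case_prod_beta using 1 2 3 by simp
qed

lemma weight_rest_swap:
 assumes i: "1 \<le> i" "i < n" and z: "on_torus z"
 shows "(z (i+1) * inverse (z i) - t) * \<Delta> z = (z (i+1) * inverse (z i) - 1) * R i z"
proof -
 have mem: "(i, i+1) \<in> pairs n" using i by (simp add: pairs_def)
 have nz: "z i \<noteq> 0" "z (i+1) \<noteq> 0" using on_torus_nz[OF z] by auto
 have g: "1 - t * inverse (z (i+1)) * z i \<noteq> 0"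
  by (rule one_minus_nz) (use norms z in \<open>simp add: norm_mult norm_inverse on_torus_norm\<close>)
 define rest where "rest = (\<Prod>i\<in>{1..n}. var_weight a b c d (z i)) * (\<Prod>x\<in>pairs n - {(i, i+1)}. pair_weight t (z (fst x)) (z (snd x)))"
 define e where "e = (1 - z (i+1) * z i) * inverse (1 - t * (z (i+1) * z i))"
 have D: "\<Delta> z = rest * pair_weight t (z i) (z (i+1))"
  unfolding weight0_alt case_prod_beta rest_def
  using prod.remove[OF finite_pairs mem, of "\<lambda>x. pair_weight t (z (fst x)) (z (snd x))"] by simp
 have Rr: "R i z = rest * e" using i by (simp add: rest_weight_def rest_def case_prod_beta e_def)
 have pw: "pair_weight t (z i) (z (i+1)) = e * ((1 - inverse (z (i+1)) * z i) * inverse (1 - t * inverse (z (i+1)) * z i))"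
  by (simp add: pair_weight_def pair_ker_def e_def divide_inverse mult_ac)
 have "(z (i+1) * inverse (z i) - t) * ((1 - inverse (z (i+1)) * z i) * inverse (1 - t * inverse (z (i+1)) * z i))
   = z (i+1) * inverse (z i) - 1"
 proof -
  have "(z (i+1) * inverse (z i) - t) = z (i+1) * inverse (z i) * (1 - t * inverse (z (i+1)) * z i)"
   "z (i+1) * inverse (z i) - 1 = z (i+1) * inverse (z i) * (1 - inverse (z (i+1)) * z i)"
   using nz by (simp_all add: field_simps)
  then show ?thesis using g by simp
 qed
 from arg_cong[OF this, of "\<lambda>x. x * (rest * e)"] show ?thesis unfolding D Rr pw by (simp only: mult_ac)
qed

lemma weight_rest_flip:
 assumes n: "1 \<le> n" and z: "on_torus z"
 shows "(inverse (z n) - a) * (inverse (z n) - b) * \<Delta> z = (inverse (z n) * inverse (z n) - 1) * R n z"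
proof -
 have sp: "{1..n} = insert n {1..<n}" using n by auto
 have nz: "z n \<noteq> 0" using on_torus_nz[OF z] by auto
 have g: "1 - a * z n \<noteq> 0" "1 - b * z n \<noteq> 0"
  using norms geometric_nz(1) z by (auto simp: on_torus_norm)
 define rest where "rest = (\<Prod>i\<in>{1..<n}. var_weight a b c d (z i)) * (\<Prod>x\<in>pairs n. pair_weight t (z (fst x)) (z (snd x)))"
 have D: "\<Delta> z = rest * ker [c,d] [c,d] (z n) * ((1 - z n ^ 2) * inverse (1 - a * z n) * inverse (1 - b * z n))"
  unfolding weight0_alt sp case_prod_beta rest_def by (simp add: var_weight_def ker_def mult_ac)
 have Rr: "R n z = rest * ker [c,d] [c,d] (z n)" by (simp add: rest_weight_def rest_def case_prod_beta mult_ac)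
 have "(inverse (z n) - a) * (inverse (z n) - b) * ((1 - z n ^ 2) * inverse (1 - a * z n) * inverse (1 - b * z n))
   = inverse (z n) * inverse (z n) - 1"
 proof -
  have "inverse (z n) - a = inverse (z n) * (1 - a * z n)" "inverse (z n) - b = inverse (z n) * (1 - b * z n)"
   "inverse (z n) * inverse (z n) - 1 = inverse (z n) * inverse (z n) * (1 - z n ^ 2)"
   using nz by (simp_all add: field_simps power2_eq_square)
  moreover have "u * A * (u * B) * (C * inverse A * inverse B) = u * u * C" if "A \<noteq> 0" "B \<noteq> 0" for u A B C :: complex
   using that by (simp add: field_simps)
  ultimately show ?thesis using g by (simp only:)
 qed
 from arg_cong[OF this, of "\<lambda>x. x * (rest * ker [c,d] [c,d] (z n))"] show ?thesis unfolding D Rr by (simp only: mult_ac)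
qed

text \<open>The Hecke operator on a monomial, integrated against the weight: the part \<open>f\<^bsup>s\<^esup> - f\<close> meets a
 weight that is invariant under the reflection, so it can be moved to the other factor.\<close>

lemma hecke_weight:
 assumes i: "i \<in> {1..n}" and z: "on_torus z" and dd: "\<not> i < n \<Longrightarrow> even e"
 shows "(string_sum n t a b i (\<lambda>k. zpow n (rootvec n i k) z) e - eta n t a b i) * \<Delta> z
    = (zpow n (rootvec n i e) z - 1) * R i z"
proof -
 let ?W = "\<lambda>k. zpow n (rootvec n i k) z"
 have W0: "?W 0 = 1" and W: "?W (k + l) = ?W k * ?W l" for k l by (simp_all add: rootvec_add zpow_add[OF z])
 have nz: "z j \<noteq> 0" for j by (rule on_torus_nz[OF z])
 show ?thesis
 proof (cases "i < n")
  case True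
  have W1: "?W 1 = z (i+1) * inverse (z i)"
  proof -
   have "?W 1 = (\<Prod>j\<in>{i, i+1}. z j powi lk (rootvec n i 1) j)"
    unfolding zpow_def by (rule prod.mono_neutral_right) (use i True in \<open>auto simp: rootvec_lookup\<close>)
   then show ?thesis using True by (simp add: rootvec_lookup power_int_minus mult.commute)
  qed
  have s: "(?W 1 - 1) * (string_sum n t a b i ?W e - t) = (?W 1 - t) * (?W e - 1)"
   by (rule string_sum_swap[OF True W0 W])
  have r: "(?W 1 - t) * \<Delta> z = (?W 1 - 1) * R i z" unfolding W1 by (rule weight_rest_swap[OF _ True z]) (use i in auto)
  have eta: "eta n t a b i = t" using True by (simp add: eta_def)
  show ?thesis
  proof (cases "?W 1 = 1")
   case True
   have We: "?W k = 1" for k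
   proof (induction k rule: int_induct[where k = 0])
    case (step1 k) then show ?case using W[of k 1] True by simp
   next
    case (step2 k) then show ?case using W[of "k-1" 1] True by simp
   qed (simp add: W0)
   have "t \<noteq> 1" using norms(1) by auto
   then have "\<Delta> z = 0" using r True by simp
   then show ?thesis by (simp add: We)
  next
   case False
   have "(?W 1 - 1) * ((string_sum n t a b i ?W e - t) * \<Delta> z) = (?W e - 1) * ((?W 1 - t) * \<Delta> z)"
    using arg_cong[OF s, of "\<lambda>x. x * \<Delta> z"] by (simp only: mult_ac)
   also have "\<dots> = (?W 1 - 1) * ((?W e - 1) * R i z)" unfolding r by (simp add: mult_ac)
   finally show ?thesis using False eta by simp
  qed
 next
  case False
  then have i': "i = n" "1 \<le> n" using i by auto
  obtain e' where e: "e = 2 * e'" using dd False by (auto elim: evenE)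
  have Wk: "?W k = z n powi (- k)" for k
  proof -
   have "?W k = (\<Prod>j\<in>{n}. z j powi lk (rootvec n i k) j)"
    unfolding zpow_def by (rule prod.mono_neutral_right) (use i False in \<open>auto simp: rootvec_lookup\<close>)
   then show ?thesis using False by (simp add: rootvec_lookup)
  qed
  have W1: "?W 1 = inverse (z n)" unfolding Wk by (simp add: power_int_minus)
  have W2: "?W 2 = ?W 1 * ?W 1" using W[of 1 1] by simp
  have s: "(?W 2 - 1) * (string_sum n t a b i ?W e + a * b) = (?W 1 - a) * (?W 1 - b) * (?W e - 1)"
   unfolding e by (rule string_sum_flip[OF False W0 W])
  have r: "(?W 1 - a) * (?W 1 - b) * \<Delta> z = (?W 2 - 1) * R i z"
   unfolding W2 W1 using weight_rest_flip[OF i'(2) z] by (simp only: i'(1))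
  have eta: "eta n t a b i = - (a * b)" using False by (simp add: eta_def)
  show ?thesis
  proof (cases "?W 2 = 1")
   case True
   have We: "?W (2 * k) = 1" for k
   proof (induction k rule: int_induct[where k = 0])
    case (step1 k) then show ?case using W[of "2*k" 2] True by (simp add: distrib_left)
   next
    case (step2 k) then show ?case using W[of "2*(k-1)" 2] True by simp
   qed (simp add: W0)
   have nw: "norm (?W 1) = 1" unfolding W1 using z by (simp add: norm_inverse on_torus_norm)
   have "?W 1 \<noteq> a" "?W 1 \<noteq> b" using norms nw by auto
   then have "\<Delta> z = 0" using r True by simp
   then show ?thesis by (simp add: We e)
  next
   case False
   have "(?W 2 - 1) * ((string_sum n t a b i ?W e + a * b) * \<Delta> z) = (?W e - 1) * ((?W 1 - a) * (?W 1 - b) * \<Delta> z)"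
    using arg_cong[OF s, of "\<lambda>x. x * \<Delta> z"] by (simp only: mult_ac)
   also have "\<dots> = (?W 2 - 1) * ((?W e - 1) * R i z)" unfolding r by (simp add: mult_ac)
   finally show ?thesis using False eta by simp
  qed
 qed
qed

definition rest_moment :: "nat \<Rightarrow> comp \<Rightarrow> complex" where
 "rest_moment i \<beta> = tint {1..n} (\<lambda>_. 1) (\<lambda>z. zpow n \<beta> z * R i z)"

lemma rest_moment_refl:
 assumes i: "i \<in> {1..n}"
 shows "rest_moment i (refl_comp n i \<beta>) = rest_moment i \<beta>"
proof (cases "i < n")
 case True
 have i1: "1 \<le> i" using i by simp
 let ?s = "Transposition.transpose i (i+1)"
 have "rest_moment i (refl_comp n i \<beta>) = tint {1..n} (\<lambda>_. 1) (\<lambda>z. zpow n \<beta> (\<lambda>k. z (?s k)) * R i (\<lambda>k. z (?s k)))"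
  unfolding rest_moment_def zpow_refl_swap[OF i1 True] rest_swap[OF i1 True] ..
 also have "\<dots> = rest_moment i \<beta>" unfolding rest_moment_def
  by (rule tint_swap[of "\<lambda>z. zpow n \<beta> z * R i z"]) (use True i in \<open>auto intro!: torus_fun_mult torus_fun_zpow torus_fun_rest\<close>)
 finally show ?thesis .
next
 case False
 then have n: "i = n" "1 \<le> n" using i by auto
 have eq: "zpow n (refl_comp n n \<beta>) z * R n z = zpow n \<beta> (z(n := inverse (z n))) * R n (z(n := inverse (z n)))" for z
  unfolding zpow_refl_flip rest_flip[OF n(2)] ..
 have tf: "torus_fun (\<lambda>z. zpow n \<gamma> z * R n z)" for \<gamma> by (intro torus_fun_mult torus_fun_zpow torus_fun_rest)
 show ?thesis unfolding rest_moment_def n(1) eq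
  by (rule tint_inversion[of "\<lambda>z. zpow n \<beta> z * R n z"]) (use n tf tf[of "refl_comp n n \<beta>", unfolded eq] in auto)
qed

lemma moment_hecke:
 assumes i: "i \<in> {1..n}"
 shows "(\<Sum>k\<in>string_set (pair_root n i \<mu>). string_coeff n t a b i (pair_root n i \<mu>) k * mom (\<mu> + \<nu> + rootvec n i k))
   = eta n t a b i * mom (\<mu> + \<nu>) + rest_moment i (refl_comp n i \<mu> + \<nu>) - rest_moment i (\<mu> + \<nu>)"
proof -
 let ?e = "pair_root n i \<mu>" and ?w = "\<lambda>_::nat. 1::complex"
 note T = torus_fun_mult torus_fun_zpow torus_fun_rest torus_fun_weight torus_fun_const
 have ev: "even ?e" if "\<not> i < n" using that by (simp add: pair_root_def)
 have "(\<Sum>k\<in>string_set ?e. string_coeff n t a b i ?e k * mom (\<mu> + \<nu> + rootvec n i k))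
   = tint {1..n} ?w (\<lambda>z. \<Sum>k\<in>string_set ?e. string_coeff n t a b i ?e k * (zpow n (\<mu> + \<nu> + rootvec n i k) z * \<Delta> z))"
  unfolding moment_def by (subst tint_sum) (auto intro!: T simp: tint_mult_left)
 also have "\<dots> = tint {1..n} ?w (\<lambda>z. (eta n t a b i * (zpow n (\<mu> + \<nu>) z * \<Delta> z) + zpow n (refl_comp n i \<mu> + \<nu>) z * R i z) - zpow n (\<mu> + \<nu>) z * R i z)"
 proof (rule tint_cong)
  fix z assume z: "on_torus z"
  have "(\<Sum>k\<in>string_set ?e. string_coeff n t a b i ?e k * (zpow n (\<mu> + \<nu> + rootvec n i k) z * \<Delta> z))
   = zpow n (\<mu> + \<nu>) z * (string_sum n t a b i (\<lambda>k. zpow n (rootvec n i k) z) ?e * \<Delta> z)"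
   unfolding string_sum_def zpow_add[OF z, of n "\<mu> + \<nu>"] by (simp add: sum_distrib_left sum_distrib_right mult_ac)
  also have "string_sum n t a b i (\<lambda>k. zpow n (rootvec n i k) z) ?e * \<Delta> z
    = eta n t a b i * \<Delta> z + (zpow n (rootvec n i ?e) z - 1) * R i z"
   using hecke_weight[OF i z ev] by (simp add: algebra_simps)
  also have "zpow n (\<mu> + \<nu>) z * \<dots> = (eta n t a b i * (zpow n (\<mu> + \<nu>) z * \<Delta> z) + zpow n (refl_comp n i \<mu> + \<nu>) z * R i z) - zpow n (\<mu> + \<nu>) z * R i z"
   unfolding refl_eq_rootvec zpow_add[OF z] by (simp add: algebra_simps)
  finally show "(\<Sum>k\<in>string_set ?e. string_coeff n t a b i ?e k * (zpow n (\<mu> + \<nu> + rootvec n i k) z * \<Delta> z)) = \<dots>" .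
 qed simp
 also have "\<dots> = eta n t a b i * mom (\<mu> + \<nu>) + rest_moment i (refl_comp n i \<mu> + \<nu>) - rest_moment i (\<mu> + \<nu>)"
  unfolding rest_moment_def moment_def
  by (subst tint_diff, (auto intro!: T torus_fun_add)[4], subst tint_add, (auto intro!: T)[4]) (simp add: tint_mult_left)
 finally show ?thesis .
qed

text \<open>The inner product of \<open>f\<close> and \<open>z\<^sup>\<nu>\<close> at \<open>q = 0\<close>.\<close>

definition pairing :: "complex laurent \<Rightarrow> comp \<Rightarrow> complex" where
 "pairing f \<nu> = (\<Sum>\<xi>\<in>supp f. lk f \<xi> * mom (\<xi> - \<nu>))"

lemma pairing_superset:
 assumes "finite A" "supp f \<subseteq> A"
 shows "pairing f \<nu> = (\<Sum>\<xi>\<in>A. lk f \<xi> * mom (\<xi> - \<nu>))"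
 unfolding pairing_def by (rule sum.mono_neutral_left) (use assms in \<open>auto simp: in_keys_iff\<close>)

lemma pairing_add: "pairing (f + g) \<nu> = pairing f \<nu> + pairing g \<nu>"
proof -
 let ?A = "supp f \<union> supp g"
 have "supp (f + g) \<subseteq> ?A" by (rule keys_add)
 then show ?thesis
  by (simp add: pairing_superset[of ?A] lookup_add distrib_right sum.distrib)
qed

lemma pairing_const_mult: "pairing (const x * f) \<nu> = x * pairing f \<nu>"
proof -
 have "supp (const x * f) \<subseteq> supp f" by (auto simp: in_keys_iff lookup_const_mult)
 then show ?thesis
  by (simp add: pairing_superset[of "supp f"] lookup_const_mult sum_distrib_left mult.assoc)
qed

lemma pairing_zero: "pairing 0 \<nu> = 0" by (simp add: pairing_def)

lemma pairing_sum: "pairing (\<Sum>i\<in>A. f i) \<nu> = (\<Sum>i\<in>A. pairing (f i) \<nu>)"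
 by (induction A rule: infinite_finite_induct) (simp_all add: pairing_zero pairing_add)

lemma pairing_zmon: "pairing (zmon \<xi>) \<nu> = mom (\<xi> - \<nu>)"
 by (simp add: pairing_def zmon_def)

text \<open>By \<open>hecke_weight\<close>, \<open>T\<^sub>i\<close> is symmetric for the bilinear form \<open>f, h \<mapsto> \<integral> f h \<Delta>\<close>; so it can be applied to
 \<open>z\<^bsup>-\<nu>\<^esup>\<close> instead of \<open>f\<close>.\<close>

theorem pairing_hecke:
 assumes i: "i \<in> {1..n}"
 shows "pairing (hecke n t a b i f) \<nu> = (\<Sum>k\<in>string_set (pair_root n i (- \<nu>)).
   string_coeff n t a b i (pair_root n i (- \<nu>)) k * pairing f (\<nu> - rootvec n i k))"
proof -
 have mon: "pairing (hecke_mon n t a b i \<xi>) \<nu> = (\<Sum>k\<in>string_set (pair_root n i (- \<nu>)).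
   string_coeff n t a b i (pair_root n i (- \<nu>)) k * mom (\<xi> - (\<nu> - rootvec n i k)))" for \<xi>
 proof -
  have "pairing (hecke_mon n t a b i \<xi>) \<nu>
    = (\<Sum>k\<in>string_set (pair_root n i \<xi>). string_coeff n t a b i (pair_root n i \<xi>) k * mom (\<xi> + (- \<nu>) + rootvec n i k))"
   unfolding hecke_mon_def pairing_sum pairing_const_mult pairing_zmon by (simp add: algebra_simps)
  also have "\<dots> = eta n t a b i * mom (\<xi> + (- \<nu>)) + rest_moment i (refl_comp n i \<xi> + (- \<nu>)) - rest_moment i (\<xi> + (- \<nu>))"
   by (rule moment_hecke[OF i])
  also have "rest_moment i (refl_comp n i \<xi> + (- \<nu>)) = rest_moment i (refl_comp n i (- \<nu>) + \<xi>)"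
   using rest_moment_refl[OF i, of "refl_comp n i \<xi> + (- \<nu>)"] by (simp only: refl_add refl_refl add.commute)
  also have "eta n t a b i * mom (\<xi> + (- \<nu>)) + rest_moment i (refl_comp n i (- \<nu>) + \<xi>) - rest_moment i (\<xi> + (- \<nu>))
    = (\<Sum>k\<in>string_set (pair_root n i (- \<nu>)). string_coeff n t a b i (pair_root n i (- \<nu>)) k * mom (- \<nu> + \<xi> + rootvec n i k))"
   using moment_hecke[OF i, of "- \<nu>" \<xi>] by (simp add: add.commute)
  finally show ?thesis by (simp add: algebra_simps)
 qed
 show ?thesis
  unfolding hecke_expansion[OF i] pairing_sum pairing_const_mult mon
  unfolding pairing_def sum_distrib_left by (subst sum.swap) (simp add: mult_ac)
qed

end

section \<open>The polynomials at partitions\<close>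

lemma lookup_zmon_mult: "lk (zmon \<nu> * f) \<xi> = lk f (\<xi> - \<nu>)" for f :: "'k::field laurent"
proof -
 have "lk (Poly_Mapping.single \<nu> 1 * f) (\<nu> + k) = lk f k" for k
  by (simp add: lookup_mult lookup_single when_mult Sum_any_when_equal prod_fun_def)
 from this[of "\<xi> - \<nu>"] show ?thesis by (simp add: zmon_def)
qed

definition factor_weight :: "'k::field \<Rightarrow> 'k \<Rightarrow> int \<Rightarrow> int \<Rightarrow> 'k" where
 "factor_weight c d x y =
   (if y = x then 1 else if 0 < x \<and> y = x - 1 then - (c + d) else if 0 < x \<and> y = x - 2 then c * d else 0)"

lemma lookup_factor_product:
 fixes c d :: "'k::field"
 assumes "finite A" "\<And>j. j \<in> A \<Longrightarrow> 0 < lk \<sigma> j"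
 shows "lk (\<Prod>i\<in>A. zvar i (lk \<sigma> i) * (1 - const c * zvar i (-1)) * (1 - const d * zvar i (-1))) \<xi>
  = (if \<forall>j. j \<notin> A \<longrightarrow> lk \<xi> j = 0 then \<Prod>j\<in>A. factor_weight c d (lk \<sigma> j) (lk \<xi> j) else 0)"
 using assms
proof (induction A arbitrary: \<xi> rule: finite_induct)
 case empty
 have "(\<forall>j. lk \<xi> j = 0) \<longleftrightarrow> \<xi> = 0" by (auto intro: poly_mapping_eqI)
 then show ?case by (simp add: lookup_one when_def)
next
 case (insert i A)
 let ?F = "\<Prod>i\<in>A. zvar i (lk \<sigma> i) * (1 - const c * zvar i (-1)) * (1 - const d * zvar i (-1)) :: 'k laurent"
 let ?x = "lk \<sigma> i" and ?S = "Poly_Mapping.single i :: int \<Rightarrow> comp"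
 define w where "w = (\<Prod>j\<in>A. factor_weight c d (lk \<sigma> j) (lk \<xi> j))"
 define C where "C \<longleftrightarrow> (\<forall>j. j \<notin> insert i A \<longrightarrow> lk \<xi> j = 0)"
 have pos: "0 < ?x" using insert.prems by simp
 have z: "zvar i (k + l) = zvar i k * (zvar i l :: 'k laurent)" for k l
  by (simp add: zvar_def zmon_add single_add)
 have "zvar i ?x * (1 - const c * zvar i (-1)) * (1 - const d * zvar i (-1))
   = zvar i ?x - const (c + d) * (zvar i ?x * zvar i (-1)) + const (c * d) * (zvar i ?x * zvar i (-1) * (zvar i (-1) :: 'k laurent))"
  unfolding const_add const_mult by (simp add: algebra_simps)
 also have "\<dots> = zmon (?S ?x) - const (c + d) * zmon (?S (?x - 1)) + const (c * d) * zmon (?S (?x - 2))"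
  unfolding z[symmetric] by (simp add: zvar_def)
 finally have X: "zvar i ?x * (1 - const c * zvar i (-1)) * (1 - const d * zvar i (-1))
   = zmon (?S ?x) - const (c + d) * zmon (?S (?x - 1)) + const (c * d) * (zmon (?S (?x - 2)) :: 'k laurent)" .
 have "lk ((zvar i ?x * (1 - const c * zvar i (-1)) * (1 - const d * zvar i (-1))) * G) \<xi>
   = lk G (\<xi> - ?S ?x) - (c + d) * lk G (\<xi> - ?S (?x - 1)) + c * d * lk G (\<xi> - ?S (?x - 2))" for G
  unfolding X by (simp only: distrib_right left_diff_distrib mult.assoc lookup_add lookup_minus lookup_const_mult lookup_zmon_mult)
 from this[of ?F] have "lk (\<Prod>i\<in>insert i A. zvar i (lk \<sigma> i) * (1 - const c * zvar i (-1)) * (1 - const d * zvar i (-1))) \<xi>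
   = lk ?F (\<xi> - ?S ?x) - (c + d) * lk ?F (\<xi> - ?S (?x - 1)) + c * d * lk ?F (\<xi> - ?S (?x - 2))"
  unfolding prod.insert[OF insert.hyps] .
 moreover have "lk ?F (\<xi> - ?S y) = (if C \<and> lk \<xi> i = y then w else 0)" for y
 proof -
  have l: "lk (\<xi> - ?S y) j = (if j = i then lk \<xi> i - y else lk \<xi> j)" for j
   by (simp add: lookup_minus lookup_single when_def)
  have "(\<forall>j. j \<notin> A \<longrightarrow> lk (\<xi> - ?S y) j = 0) \<longleftrightarrow> C \<and> lk \<xi> i = y"
   unfolding l C_def using insert.hyps(2) by auto
  moreover have "(\<Prod>j\<in>A. factor_weight c d (lk \<sigma> j) (lk (\<xi> - ?S y) j)) = w"
   unfolding w_def by (rule prod.cong) (use insert.hyps(2) l in auto)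
  ultimately show ?thesis by (subst insert.IH) (use insert.prems in auto)
 qed
 ultimately have "lk (\<Prod>i\<in>insert i A. zvar i (lk \<sigma> i) * (1 - const c * zvar i (-1)) * (1 - const d * zvar i (-1))) \<xi>
   = (if C then factor_weight c d ?x (lk \<xi> i) * w else 0)"
  using pos by (auto simp: factor_weight_def ring_distribs)
 then show ?case unfolding C_def prod.insert[OF insert.hyps, of "\<lambda>j. factor_weight c d (lk \<sigma> j) (lk \<xi> j)"] w_def .
qed

lemma lookup_E_partition:
 assumes "is_partition n \<sigma>" "\<xi> \<in> compositions n"
 shows "lk (E_partition n c d \<sigma>) \<xi> = (\<Prod>j\<in>{1..n}. factor_weight c d (lk \<sigma> j) (lk \<xi> j))"
proof -
 let ?A = "{i \<in> {1..n}. 0 < lk \<sigma> i}" and ?w = "\<lambda>j. factor_weight c d (lk \<sigma> j) (lk \<xi> j)"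
 have "(\<Prod>j\<in>{1..n}. ?w j) = (\<Prod>j\<in>?A. ?w j) * (\<Prod>j\<in>{1..n} - ?A. ?w j)"
  by (subst mult.commute, rule prod.subset_diff) auto
 also have "(\<Prod>j\<in>{1..n} - ?A. ?w j) = (\<Prod>j\<in>{1..n} - ?A. if lk \<xi> j = 0 then 1 else 0)"
 proof (rule prod.cong[OF refl])
  fix j assume "j \<in> {1..n} - ?A"
  then have "lk \<sigma> j = 0" using partition_nonneg[OF assms(1), of j] by auto
  then show "?w j = (if lk \<xi> j = 0 then 1 else 0)" by (simp add: factor_weight_def)
 qed
 also have "\<dots> = (if \<forall>j. j \<notin> ?A \<longrightarrow> lk \<xi> j = 0 then 1 else 0)"
 proof -
  have "(\<forall>j. j \<notin> ?A \<longrightarrow> lk \<xi> j = 0) \<longleftrightarrow> (\<forall>j\<in>{1..n} - ?A. lk \<xi> j = 0)"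
  proof (intro iffI allI impI ballI)
   fix j assume "\<forall>j\<in>{1..n} - ?A. lk \<xi> j = 0" "j \<notin> ?A"
   then show "lk \<xi> j = 0" using lookup_outside[OF assms(2), of j] by (cases "j \<in> {1..n}") blast+
  qed blast
  then show ?thesis by (auto simp: prod_zero_iff)
 qed
 finally show ?thesis unfolding E_partition_def
  by (subst lookup_factor_product) auto
qed

lemma E_partition_composition:
 assumes "is_partition n \<sigma>" "\<xi> \<in> supp (E_partition n c d \<sigma>)"
 shows "\<xi> \<in> compositions n"
proof (rule compositionsI)
 fix j assume "j \<notin> {1..n}"
 then show "lk \<xi> j = 0" using assms(2) unfolding E_partition_def in_keys_iff
  by (subst (asm) lookup_factor_product) (auto split: if_splits)
qed

lemma factor_weight_nonzero: "factor_weight c d x y \<noteq> 0 \<Longrightarrow> 0 \<le> x \<Longrightarrow> \<bar>y\<bar> \<le> x"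
 by (auto simp: factor_weight_def split: if_splits)

lemma E_partition_below:
 assumes "is_partition n \<sigma>"
 shows "E_partition n c d \<sigma> \<in> laurent_below n \<sigma>"
 unfolding laurent_below_def
proof (clarify, intro conjI)
 fix \<xi> assume k: "\<xi> \<in> supp (E_partition n c d \<sigma>)"
 show kc: "\<xi> \<in> compositions n" by (rule E_partition_composition[OF assms k])
 have "(\<Prod>j\<in>{1..n}. factor_weight c d (lk \<sigma> j) (lk \<xi> j)) \<noteq> 0"
  using k unfolding in_keys_iff lookup_E_partition[OF assms kc] .
 then have "\<bar>lk \<xi> j\<bar> \<le> \<bar>lk \<sigma> j\<bar>" if "j \<in> {1..n}" for j
  using that factor_weight_nonzero[of c d "lk \<sigma> j" "lk \<xi> j"] partition_nonneg[OF assms, of j] by auto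
 then show "submaj n \<xi> \<sigma>" unfolding submaj_def excess_def by (auto intro!: sum_mono max.mono)
qed

lemma same_orbit_abs_eq:
 assumes "same_orbit n \<xi> \<sigma>" "\<And>j. j \<in> {1..n} \<Longrightarrow> \<bar>lk \<xi> j\<bar> \<le> \<bar>lk \<sigma> j\<bar>" "i \<in> {1..n}"
 shows "\<bar>lk \<xi> i\<bar> = \<bar>lk \<sigma> i\<bar>"
proof -
 have "excess n 0 \<xi> = excess n 0 \<sigma>" using assms(1) unfolding same_orbit_def by blast
 then have "(\<Sum>j\<in>{1..n}. \<bar>lk \<sigma> j\<bar> - \<bar>lk \<xi> j\<bar>) = 0" by (simp add: excess_def sum_subtractf)
 then have "\<forall>j\<in>{1..n}. \<bar>lk \<sigma> j\<bar> - \<bar>lk \<xi> j\<bar> = 0"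
  by (subst (asm) sum_nonneg_eq_0_iff) (use assms(2) in auto)
 then show ?thesis using assms(3) by auto
qed

lemma lookup_E_partition_top:
 assumes \<sigma>: "is_partition n \<sigma>" and k: "\<xi> \<in> compositions n" "same_orbit n \<xi> \<sigma>"
 shows "lk (E_partition n c d \<sigma>) \<xi> = top_base n (c * d) \<sigma> \<xi>"
proof (cases "\<forall>j\<in>{1..n}. factor_weight c d (lk \<sigma> j) (lk \<xi> j) \<noteq> 0")
 case True
 have nn: "0 \<le> lk \<sigma> j" for j by (rule partition_nonneg[OF \<sigma>])
 have "\<bar>lk \<xi> j\<bar> = \<bar>lk \<sigma> j\<bar>" if "j \<in> {1..n}" for j
  by (rule same_orbit_abs_eq[OF k(2) _ that]) (use True factor_weight_nonzero nn in fastforce)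
 then have "factor_weight c d (lk \<sigma> j) (lk \<xi> j) = top_weight (c * d) (lk \<sigma> j) (lk \<xi> j)" if "j \<in> {1..n}" for j
  using that nn[of j] by (force simp: factor_weight_def top_weight_def)
 then show ?thesis unfolding lookup_E_partition[OF \<sigma> k(1)] top_base_def by (rule prod.cong[OF refl]) simp
next
 case False
 then obtain j where j: "j \<in> {1..n}" "factor_weight c d (lk \<sigma> j) (lk \<xi> j) = 0" by blast
 then have "top_weight (c * d) (lk \<sigma> j) (lk \<xi> j) = 0"
  by (auto simp: factor_weight_def top_weight_def split: if_splits)
 then have ex: "\<exists>j\<in>{1..n}. top_weight (c * d) (lk \<sigma> j) (lk \<xi> j) = 0" "\<exists>j\<in>{1..n}. factor_weight c d (lk \<sigma> j) (lk \<xi> j) = 0"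
  using j by blast+
 show ?thesis unfolding lookup_E_partition[OF \<sigma> k(1)] top_base_def
  using prod_zero[OF _ ex(1)] prod_zero[OF _ ex(2)] by (simp only: finite_atLeastAtMost)
qed

section \<open>The recursive family of Laurent polynomials\<close>

definition hecke_step :: "nat \<Rightarrow> 'k::field \<Rightarrow> 'k \<Rightarrow> 'k \<Rightarrow> 'k \<Rightarrow> 'k \<Rightarrow> nat \<Rightarrow> comp \<Rightarrow> 'k laurent \<Rightarrow> 'k laurent" where
 "hecke_step n t a b c d i \<mu> f =
   const (inverse (q_coeff n t a b c d i \<mu>)) * (hecke n t a b i f - const (p_coeff n t a b c d i \<mu>) * f)"

definition hecke_fam :: "nat \<Rightarrow> 'k::field \<Rightarrow> 'k \<Rightarrow> 'k \<Rightarrow> 'k \<Rightarrow> 'k \<Rightarrow> comp \<Rightarrow> 'k laurent" where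
 "hecke_fam n t a b c d = path_fam n (E_partition n c d) (hecke_step n t a b c d)"

lemma path_fam_partition: "is_partition n \<mu> \<Longrightarrow> path_fam n B st \<mu> = B \<mu>"
 by (rule path_fam_dominant) (simp add: is_partition_iff)

lemma laurent_below_add: "f \<in> laurent_below n \<sigma> \<Longrightarrow> g \<in> laurent_below n \<sigma> \<Longrightarrow> f + g \<in> laurent_below n \<sigma>"
 unfolding laurent_below_def using keys_add[of f g] by blast

lemma laurent_below_const_mult: "f \<in> laurent_below n \<sigma> \<Longrightarrow> const x * f \<in> laurent_below n \<sigma>"
 unfolding laurent_below_def using in_keys_iff[of _ f] by (auto simp: in_keys_iff lookup_const_mult)

lemma laurent_below_diff: "f \<in> laurent_below n \<sigma> \<Longrightarrow> g \<in> laurent_below n \<sigma> \<Longrightarrow> f - g \<in> laurent_below n \<sigma>"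
 using laurent_below_add[OF _ laurent_below_const_mult[of g n \<sigma> "-1"], of f]
 by (simp add: const_uminus const_1)

lemma laurent_below_orbit: "same_orbit n \<mu> \<sigma> \<Longrightarrow> laurent_below n \<mu> = laurent_below n \<sigma>"
 unfolding laurent_below_def same_orbit_iff using submaj_trans by blast

lemma hecke_step_below:
 "i \<in> {1..n} \<Longrightarrow> f \<in> laurent_below n \<sigma> \<Longrightarrow> hecke_step n t a b c d i \<mu> f \<in> laurent_below n \<sigma>"
 unfolding hecke_step_def by (intro laurent_below_const_mult laurent_below_diff hecke_below)

context hecke_point
begin

text \<open>On its own orbit the Laurent polynomial has the coefficients of the orbit family, as both follow
 the same path.\<close>

lemma hecke_fam_top:
 assumes "\<mu> \<in> compositions n"
 shows "hecke_fam n t a b c d \<mu> \<in> laurent_below n \<mu> \<and>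
  (\<forall>\<xi>\<in>compositions n. same_orbit n \<xi> \<mu> \<longrightarrow> lk (hecke_fam n t a b c d \<mu>) \<xi> = e \<mu> \<xi>)"
 using assms
proof (induction \<mu> rule: descend_induct[where ?'v = "'k laurent" and ?'w = "comp \<Rightarrow> 'k", consumes 1, case_names dominant ascent])
 case (dominant \<mu>)
 then have "hecke_fam n t a b c d \<mu> = E_partition n c d \<mu>" "e \<mu> = top_base n (c * d) \<mu>"
  unfolding hecke_fam_def orbit_fam_def by (simp_all add: path_fam_partition)
 then show ?case using E_partition_below[OF dominant, where c = c and d = d] lookup_E_partition_top[OF dominant, where c = c and d = d] by simp
next
 case (ascent \<mu> i)
 let ?E = "hecke_fam n t a b c d" and ?s = "s i \<mu>"
 have E: "?E \<mu> = hecke_step n t a b c d i ?s (?E ?s)"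
  unfolding hecke_fam_def by (rule ascent.hyps(5))
 have e: "e \<mu> = st i ?s (e ?s)" unfolding orbit_fam_def by (rule ascent.hyps(6))
 have o: "same_orbit n ?s \<mu>" by (rule same_orbit_refl_comp[OF ascent.hyps(2)])
 have b: "?E ?s \<in> laurent_below n \<mu>" using conjunct1[OF ascent.IH] by (simp add: laurent_below_orbit[OF o])
 have "lk (?E \<mu>) \<xi> = e \<mu> \<xi>" if k: "\<xi> \<in> compositions n" "same_orbit n \<xi> \<mu>" for \<xi>
 proof -
  have 1: "lk (?E ?s) \<xi>' = e ?s \<xi>'" if "\<xi>' \<in> compositions n" "same_orbit n \<xi>' \<mu>" for \<xi>'
   using ascent.IH that same_orbit_trans[OF that(2)] o by (meson same_orbit_iff)
  have "s i \<xi> \<in> compositions n" "same_orbit n (s i \<xi>) \<mu>"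
   using refl_composition[OF ascent.hyps(2) k(1)] same_orbit_trans[OF same_orbit_refl_comp[OF ascent.hyps(2)] k(2)] by auto
  then have "Op i (lk (?E ?s)) \<xi> = Op i (e ?s) \<xi>" unfolding orbit_op_def by (simp add: 1 k)
  then show ?thesis
   unfolding E e hecke_step_def st_def step_op_def lookup_const_mult lookup_minus
    lookup_hecke_top[OF ascent.hyps(2) b k(2)] 1[OF k] by (simp add: divide_inverse mult.commute)
 qed
 then show ?case unfolding E using hecke_step_below[OF ascent.hyps(2) b] by (simp add: E)
qed

lemmas hecke_fam_below = hecke_fam_top[THEN conjunct1]

lemma lookup_hecke_fam_top: "\<mu> \<in> compositions n \<Longrightarrow> \<xi> \<in> compositions n \<Longrightarrow> same_orbit n \<xi> \<mu> \<Longrightarrow> lk (hecke_fam n t a b c d \<mu>) \<xi> = e \<mu> \<xi>"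
 using hecke_fam_top by blast

end

section \<open>Orthogonality at \<open>q = 0\<close>\<close>

definition lvalue :: "nat \<Rightarrow> complex laurent \<Rightarrow> (nat \<Rightarrow> complex) \<Rightarrow> complex" where
 "lvalue n f z = (\<Sum>\<xi>\<in>supp f. lk f \<xi> * zpow n \<xi> z)"

lemma lvalue_superset:
 assumes "finite A" "supp f \<subseteq> A"
 shows "lvalue n f z = (\<Sum>\<xi>\<in>A. lk f \<xi> * zpow n \<xi> z)"
 unfolding lvalue_def by (rule sum.mono_neutral_left) (use assms in \<open>auto simp: in_keys_iff\<close>)

lemma lvalue_add: "lvalue n (f + g) z = lvalue n f z + lvalue n g z"
 using keys_add[of f g]
 by (simp add: lvalue_superset[of "supp f \<union> supp g"] lookup_add distrib_right sum.distrib)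

lemma lvalue_const_mult: "lvalue n (const x * f) z = x * lvalue n f z"
proof -
 have "supp (const x * f) \<subseteq> supp f" by (auto simp: in_keys_iff lookup_const_mult)
 then show ?thesis
  by (simp add: lvalue_superset[of "supp f"] lookup_const_mult sum_distrib_left mult.assoc)
qed

lemma lvalue_sum: "lvalue n (\<Sum>i\<in>A. f i) z = (\<Sum>i\<in>A. lvalue n (f i) z)"
 by (induction A rule: infinite_finite_induct) (simp_all add: lvalue_add, simp_all add: lvalue_def)

lemma lvalue_zmon: "lvalue n (zmon \<xi>) z = zpow n \<xi> z"
 by (simp add: lvalue_def zmon_def)

lemma lvalue_mult:
 assumes z: "on_torus z"
 shows "lvalue n (f * g) z = lvalue n f z * lvalue n g z"
proof -
 have 1: "lvalue n (zmon \<xi> * g) z = zpow n \<xi> z * lvalue n g z" for \<xi>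
 proof -
  have "zmon \<xi> * g = (\<Sum>\<nu>\<in>supp g. const (lk g \<nu>) * zmon (\<xi> + \<nu>))"
   by (subst laurent_expansion[of g]) (simp add: sum_distrib_left zmon_add mult_ac)
  then show ?thesis
   by (simp add: lvalue_sum lvalue_const_mult lvalue_zmon zpow_add[OF z] lvalue_def[of n g] sum_distrib_left mult_ac)
 qed
 have "f * g = (\<Sum>\<xi>\<in>supp f. const (lk f \<xi>) * (zmon \<xi> * g))"
  by (subst laurent_expansion[of f]) (simp add: sum_distrib_right mult.assoc)
 then show ?thesis by (simp add: lvalue_sum lvalue_const_mult 1 lvalue_def[of n f] sum_distrib_right mult.assoc)
qed

lemma lvalue_one: "lvalue n 1 z = 1"
 using lvalue_zmon[of n 0 z] by (simp add: zmon_0)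

lemma lvalue_prod:
 assumes "on_torus z"
 shows "lvalue n (\<Prod>i\<in>A. f i) z = (\<Prod>i\<in>A. lvalue n (f i) z)"
 by (induction A rule: infinite_finite_induct) (simp_all add: lvalue_mult[OF assms] lvalue_one)

lemma lvalue_zvar: "i \<in> {1..n} \<Longrightarrow> lvalue n (zvar i k) z = z i powi k"
 unfolding zvar_def lvalue_zmon zpow_def
 by (subst prod.remove[of _ i]) (auto intro!: prod.neutral simp: lookup_single when_def)

lemma lvalue_E_partition:
 assumes "on_torus z"
 shows "lvalue n (E_partition n c d \<sigma>) z
  = (\<Prod>i\<in>{i \<in> {1..n}. 0 < lk \<sigma> i}. z i powi lk \<sigma> i * ((1 - c / z i) * (1 - d / z i)))"
 unfolding E_partition_def lvalue_prod[OF assms]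
proof (rule prod.cong[OF refl], goal_cases)
 case (1 i)
 have "lvalue n (1 - const x * zvar i (-1)) z = 1 - x / z i" for x
 proof -
  have "1 - const x * zvar i (-1) = 1 + const (- x) * zvar i (-1)" by (simp add: const_uminus)
  then show ?thesis using 1
   by (simp only: lvalue_add lvalue_const_mult lvalue_one) (simp add: lvalue_zvar power_int_minus divide_inverse)
 qed
 then show ?case using 1 by (simp add: lvalue_mult[OF assms] lvalue_zvar)
qed

text \<open>If \<open>\<sigma>\<^sub>l\<close> were zero at the first difference \<open>l\<close>, the entries of \<open>\<nu>\<close> before \<open>l\<close> would exhaust the sum of
 absolute values.\<close>

lemma submaj_less_partition:
 assumes \<sigma>: "is_partition n \<sigma>" and \<nu>: "\<nu> \<in> compositions n" "submaj n \<nu> \<sigma>" "\<nu> \<noteq> \<sigma>"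
 obtains l where "l \<in> {1..n}" "\<forall>j. 1 \<le> j \<and> j < l \<longrightarrow> lk \<nu> j = lk \<sigma> j" "lk \<nu> l < lk \<sigma> l" "0 < lk \<sigma> l"
proof -
 define l where "l = (LEAST l. l \<in> {1..n} \<and> lk \<nu> l \<noteq> lk \<sigma> l)"
 have \<sigma>c: "\<sigma> \<in> compositions n" using \<sigma> by (simp add: is_partition_def)
 have "\<exists>l. l \<in> {1..n} \<and> lk \<nu> l \<noteq> lk \<sigma> l" using composition_eqI[OF \<nu>(1) \<sigma>c] \<nu>(3) by blast
 then have l: "l \<in> {1..n}" "lk \<nu> l \<noteq> lk \<sigma> l" unfolding l_def by (metis (mono_tags, lifting) LeastI)+
 have lt: "lk \<nu> j = lk \<sigma> j" if "1 \<le> j" "j < l" for j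
  using not_less_Least[of j "\<lambda>l. l \<in> {1..n} \<and> lk \<nu> l \<noteq> lk \<sigma> l"] that l(1) unfolding l_def[symmetric] by auto
 have sp: "{1..l} = insert l {1..<l}" using l(1) by auto
 have eq: "(\<Sum>j\<in>{1..<l}. lk \<nu> j) = (\<Sum>j\<in>{1..<l}. lk \<sigma> j)" by (rule sum.cong) (use lt in auto)
 have "lk \<nu> l \<le> lk \<sigma> l"
  using submaj_partition_partial_sums[OF \<sigma> \<nu>(2), of l] l(1) eq unfolding sp by simp
 then have less: "lk \<nu> l < lk \<sigma> l" using l(2) by simp
 have pos: "0 < lk \<sigma> l"
 proof (rule ccontr)
  assume "\<not> ?thesis"
  then have z: "lk \<sigma> l = 0" using partition_nonneg[OF \<sigma>, of l] by simp
  have "(\<Sum>j\<in>{1..n}. \<bar>lk \<nu> j\<bar>) \<le> (\<Sum>j\<in>{1..n}. \<bar>lk \<sigma> j\<bar>)"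
   using \<nu>(2) unfolding submaj_def excess_def by (auto dest!: spec[of _ 0])
  also have "\<dots> = (\<Sum>j\<in>{1..<l}. \<bar>lk \<sigma> j\<bar>)"
  proof (rule sum.mono_neutral_right)
   show "\<forall>j\<in>{1..n} - {1..<l}. \<bar>lk \<sigma> j\<bar> = 0"
   proof
    fix j assume "j \<in> {1..n} - {1..<l}"
    then show "\<bar>lk \<sigma> j\<bar> = 0"
     using partition_decreasing[OF \<sigma>, of l j] partition_nonneg[OF \<sigma>, of j] z l(1) by auto
   qed
  qed (use l(1) in auto)
  also have "\<dots> = (\<Sum>j\<in>{1..<l}. \<bar>lk \<nu> j\<bar>)" by (rule sum.cong) (use lt in auto)
  also have "\<dots> < (\<Sum>j\<in>{1..l}. \<bar>lk \<nu> j\<bar>)" unfolding sp using less z by simp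
  also have "\<dots> \<le> (\<Sum>j\<in>{1..n}. \<bar>lk \<nu> j\<bar>)" by (rule sum_mono2) (use l(1) in auto)
  finally show False by simp
 qed
 show ?thesis by (rule that[OF l(1) _ less pos]) (use lt in blast)
qed

context unit_params
begin

lemma pairing_integral: "pairing f \<nu> = tint {1..n} (\<lambda>_. 1) (\<lambda>z. lvalue n f z * zpow n (- \<nu>) z * \<Delta> z)"
proof -
 note T = torus_fun_mult torus_fun_zpow torus_fun_weight torus_fun_const
 have "pairing f \<nu> = tint {1..n} (\<lambda>_. 1) (\<lambda>z. \<Sum>\<xi>\<in>supp f. lk f \<xi> * (zpow n (\<xi> - \<nu>) z * \<Delta> z))"
  unfolding pairing_def moment_def by (subst tint_sum) (auto intro!: T simp: tint_mult_left)
 also have "\<dots> = tint {1..n} (\<lambda>_. 1) (\<lambda>z. lvalue n f z * zpow n (- \<nu>) z * \<Delta> z)"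
 proof (rule tint_cong)
  fix z assume z: "on_torus z"
  have "zpow n (\<xi> - \<nu>) z = zpow n \<xi> z * zpow n (- \<nu>) z" for \<xi> using zpow_add[OF z, of n \<xi> "- \<nu>"] by simp
  then show "(\<Sum>\<xi>\<in>supp f. lk f \<xi> * (zpow n (\<xi> - \<nu>) z * \<Delta> z)) = lvalue n f z * zpow n (- \<nu>) z * \<Delta> z"
   unfolding lvalue_def sum_distrib_right by (simp add: mult.assoc)
 qed simp
 finally show ?thesis .
qed

text \<open>Where \<open>\<sigma>\<^sub>j > 0\<close> the factors of \<open>E\<^sub>\<sigma>\<close> cancel the poles \<open>c\<close> and \<open>d\<close>. So \<open>z\<^sub>1, z\<^sub>2, \<dots>\<close> can be set to zero one after the
 other, until the first \<open>l\<close> with \<open>\<nu>\<^sub>l \<noteq> \<sigma>\<^sub>l\<close>, where a positive power of \<open>z\<^sub>l\<close> is left.\<close>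

lemma pairing_E_partition:
 assumes \<sigma>: "is_partition n \<sigma>" and \<nu>: "\<nu> \<in> compositions n" "submaj n \<nu> \<sigma>" "\<nu> \<noteq> \<sigma>"
 shows "pairing (E_partition n c d \<sigma>) \<nu> = 0"
proof -
 obtain l where l: "l \<in> {1..n}" "\<forall>j. 1 \<le> j \<and> j < l \<longrightarrow> lk \<nu> j = lk \<sigma> j" "lk \<nu> l < lk \<sigma> l" "0 < lk \<sigma> l"
  by (rule submaj_less_partition[OF assms])
 define g where "g j x = (if 0 < lk \<sigma> j then (1 - x ^ 2) * ker [a,b,c,d] [] x else var_weight a b c d x)" for j x
 have "mean_at_zero (\<lambda>x. (1 - x ^ 2) * ker [a,b,c,d] [] x)" by (rule mean_at_zero_one_sided) (use norms in auto)
 then have g: "mean_at_zero (g j)" if "0 < lk \<sigma> j" for j unfolding g_def using that by simp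
 have gc: "circle_fun (g j)" for j
  using g[of j] circle_fun_var_weight by (cases "0 < lk \<sigma> j") (auto simp: mean_at_zero_def g_def[abs_def])
 have "pairing (E_partition n c d \<sigma>) \<nu> = tint {1..n} (\<lambda>_. 1) (staged n t g (lk (\<sigma> - \<nu>)) 1)"
  unfolding pairing_integral
 proof (rule tint_cong)
  fix z assume z: "on_torus z"
  have nz: "z j \<noteq> 0" for j by (rule on_torus_nz[OF z])
  have L: "lvalue n (E_partition n c d \<sigma>) z
   = (\<Prod>j\<in>{1..n}. if 0 < lk \<sigma> j then z j powi lk \<sigma> j * ((1 - c / z j) * (1 - d / z j)) else 1)"
   unfolding lvalue_E_partition[OF z] by (rule prod.inter_filter) simp
  have F: "(if 0 < lk \<sigma> j then z j powi lk \<sigma> j * ((1 - c / z j) * (1 - d / z j)) else 1)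
    * (z j powi - lk \<nu> j * var_weight a b c d (z j)) = z j powi lk (\<sigma> - \<nu>) j * g j (z j)" for j
  proof (cases "0 < lk \<sigma> j")
   case True
   have "norm (x / z j) < 1" if "norm x < 1" for x using that z by (simp add: norm_divide on_torus_norm)
   then have "1 - c / z j \<noteq> 0" "1 - d / z j \<noteq> 0" by (auto intro!: one_minus_nz norms simp del: right_minus_eq)
   moreover have "ker [a,b,c,d] [c,d] (z j) = ker [a,b,c,d] [] (z j) * (inverse (1 - c / z j) * inverse (1 - d / z j))"
    by (simp add: ker_def)
   moreover have "u * v * (K * (inverse u * inverse v)) = K" if "u \<noteq> 0" "v \<noteq> 0" for u v K :: complex
    using that by (simp add: field_simps)
   ultimately have k: "(1 - c / z j) * (1 - d / z j) * ker [a,b,c,d] [c,d] (z j) = ker [a,b,c,d] [] (z j)"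
    by (simp only:)
   have p: "z j powi lk (\<sigma> - \<nu>) j = z j powi lk \<sigma> j * z j powi - lk \<nu> j"
    using power_int_add[of "z j" "lk \<sigma> j" "- lk \<nu> j"] nz by (simp add: lookup_minus)
   show ?thesis using True unfolding p g_def var_weight_def k[symmetric] by (simp add: mult_ac)
  next
   case False
   then have "lk \<sigma> j = 0" using partition_nonneg[OF \<sigma>, of j] by simp
   then show ?thesis by (simp add: g_def lookup_minus)
  qed
  show "lvalue n (E_partition n c d \<sigma>) z * zpow n (- \<nu>) z * \<Delta> z = staged n t g (lk (\<sigma> - \<nu>)) 1 z"
   unfolding staged_def F[symmetric] prod.distrib L zpow_def weight0_alt prod_pairs[symmetric]
   by (simp only: lookup_uminus mult.assoc)
 qed simp
 also have "\<dots> = 0"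
 proof (rule staged_vanish[OF norms(1) gc, of _ 1 l])
  show "mean_at_zero (g j)" if "1 \<le> j" "j \<le> l" for j
   using g[of j] partition_decreasing[OF \<sigma> that] l(4) by simp
 qed (use l in \<open>auto simp: lookup_minus\<close>)
 finally show ?thesis .
qed

text \<open>The exponents that occur in \<open>pairing_hecke\<close>.\<close>

lemma string_shift:
 assumes i: "i \<in> {1..n}" and k: "k \<in> string_set (pair_root n i (- \<nu>))" and \<nu>: "\<nu> \<in> compositions n"
 shows "\<nu> - rootvec n i k \<in> compositions n" "submaj n (\<nu> - rootvec n i k) \<nu>"
  "k \<noteq> 0 \<Longrightarrow> k \<noteq> pair_root n i (- \<nu>) \<Longrightarrow> strict_submaj n (\<nu> - rootvec n i k) \<nu>"
  "k = pair_root n i (- \<nu>) \<Longrightarrow> \<nu> - rootvec n i k = refl_comp n i \<nu>"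
proof -
 have eq: "\<nu> - rootvec n i k = - (- \<nu> + rootvec n i k)" by simp
 have k': "in_string (pair_root n i (- \<nu>)) k" using k by (simp add: string_set_iff)
 show "\<nu> - rootvec n i k \<in> compositions n" by (intro compositions_diff \<nu> rootvec_composition i)
 show "submaj n (\<nu> - rootvec n i k) \<nu>"
  using string_submaj[OF i k'] submaj_uminus[of n "- \<nu> + rootvec n i k" "- \<nu>"] unfolding eq by simp
 show "strict_submaj n (\<nu> - rootvec n i k) \<nu>" if "k \<noteq> 0" "k \<noteq> pair_root n i (- \<nu>)"
  using string_interior_strict[OF i k' that] strict_submaj_uminus[of n "- \<nu> + rootvec n i k" "- \<nu>"] unfolding eq by simp
 show "\<nu> - rootvec n i k = refl_comp n i \<nu>" if "k = pair_root n i (- \<nu>)"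
 proof -
  have "- \<nu> + rootvec n i k = refl_comp n i (- \<nu>)" using refl_eq_rootvec[of n i "- \<nu>"] that by simp
  then show ?thesis unfolding eq by (simp add: refl_comp_uminus)
 qed
qed

end

locale regular_point = unit_params n t a b c d + hecke_point n t a b c d
 for n :: nat and t a b c d :: complex
begin

abbreviation E where "E \<equiv> hecke_fam n t a b c d"

lemma pairing_diff: "pairing (f - g) \<nu> = pairing f \<nu> - pairing g \<nu>"
 using pairing_add[of "f - g" g \<nu>] by simp

lemma pairing_hecke_step:
 assumes "i \<in> {1..n}" "\<And>k. k \<in> string_set (dd i (- \<nu>)) \<Longrightarrow> pairing f (\<nu> - rootvec n i k) = 0"
 shows "pairing (hecke_step n t a b c d i \<mu> f) \<nu> = 0"
proof -
 have "0 \<in> string_set (dd i (- \<nu>))" by (simp add: string_set_def)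
 then have "pairing f \<nu> = 0" using assms(2)[of 0] by simp
 then show ?thesis unfolding hecke_step_def pairing_const_mult pairing_diff pairing_hecke[OF assms(1)]
  by (simp add: assms(2))
qed

text \<open>By \<open>pairing_hecke\<close> the exponent stays in the lower set of \<open>\<nu>\<close>.\<close>

lemma pairing_strict:
 assumes "\<mu> \<in> compositions n"
 shows "\<forall>\<nu>\<in>compositions n. strict_submaj n \<nu> \<mu> \<longrightarrow> pairing (E \<mu>) \<nu> = 0"
 using assms
proof (induction \<mu> rule: descend_induct[where ?'v = "complex laurent" and ?'w = "complex laurent", consumes 1, case_names dominant ascent])
 case (dominant \<mu>)
 then have "E \<mu> = E_partition n c d \<mu>" unfolding hecke_fam_def by (simp add: path_fam_partition)
 then show ?case using pairing_E_partition[OF dominant]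
  by (auto simp: strict_submaj_def same_orbit_def)
next
 case (ascent \<mu> i)
 have E: "E \<mu> = hecke_step n t a b c d i (s i \<mu>) (E (s i \<mu>))"
  unfolding hecke_fam_def by (rule ascent.hyps(5))
 show ?case
 proof (intro ballI impI)
  fix \<nu> assume \<nu>: "\<nu> \<in> compositions n" "strict_submaj n \<nu> \<mu>"
  have \<nu>': "strict_submaj n \<nu> (s i \<mu>)"
   by (rule strict_submaj_trans2[OF \<nu>(2)]) (use same_orbit_refl_comp[OF ascent.hyps(2)] in \<open>simp add: same_orbit_iff\<close>)
  show "pairing (E \<mu>) \<nu> = 0" unfolding E
  proof (rule pairing_hecke_step[OF ascent.hyps(2)])
   fix k assume k: "k \<in> string_set (dd i (- \<nu>))"
   show "pairing (E (s i \<mu>)) (\<nu> - rootvec n i k) = 0"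
    using ascent.IH string_shift(1,2)[OF ascent.hyps(2) k \<nu>(1)] strict_submaj_trans1[OF _ \<nu>'] by blast
  qed
 qed
qed

text \<open>If the step reaches \<open>\<mu>\<close> from the larger \<open>s\<^sub>i \<mu>\<close>, then neither \<open>\<nu>\<close> nor \<open>s\<^sub>i \<nu>\<close> is above
 \<open>s\<^sub>i \<mu>\<close>: the first by transitivity, the second by the lifting property.\<close>

lemma pairing_orbit:
 assumes "\<mu> \<in> compositions n"
 shows "\<forall>\<nu>\<in>compositions n. same_orbit n \<nu> \<mu> \<and> \<not> bruhat n \<mu> \<nu> \<longrightarrow> pairing (E \<mu>) \<nu> = 0"
 using assms
proof (induction \<mu> rule: descend_induct[where ?'v = "complex laurent" and ?'w = "complex laurent", consumes 1, case_names dominant ascent])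
 case (dominant \<mu>)
 then have "E \<mu> = E_partition n c d \<mu>" unfolding hecke_fam_def by (simp add: path_fam_partition)
 then show ?case using pairing_E_partition[OF dominant]
  by (auto simp: same_orbit_iff bruhat_def)
next
 case (ascent \<mu> i)
 note i = ascent.hyps(2)
 have E: "E \<mu> = hecke_step n t a b c d i (s i \<mu>) (E (s i \<mu>))"
  unfolding hecke_fam_def by (rule ascent.hyps(5))
 have pos: "0 < dd i (s i \<mu>)" using ascent.hyps(3) by simp
 have low: "bruhat n \<mu> (s i \<mu>)" using bruhat_refl_lower[of i n "s i \<mu>"] i pos by simp
 have o: "same_orbit n (s i \<mu>) \<mu>" by (rule same_orbit_refl_comp[OF i])
 show ?case
 proof (intro ballI impI, elim conjE)
  fix \<nu> assume \<nu>: "\<nu> \<in> compositions n" "same_orbit n \<nu> \<mu>" "\<not> bruhat n \<mu> \<nu>"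
  have \<nu>': "same_orbit n \<nu> (s i \<mu>)" using same_orbit_trans[OF \<nu>(2)] o by (simp add: same_orbit_iff)
  have s\<nu>: "s i \<nu> \<in> compositions n" "same_orbit n (s i \<nu>) (s i \<mu>)"
   using refl_composition[OF i \<nu>(1)] same_orbit_trans[OF same_orbit_refl_comp[OF i] \<nu>'] by auto
  have n1: "\<not> bruhat n (s i \<mu>) \<nu>" using bruhat_trans[OF low] \<nu>(3) by blast
  have n2: "\<not> bruhat n (s i \<mu>) (s i \<nu>)"
  proof
   assume "bruhat n (s i \<mu>) (s i \<nu>)"
   from bruhat_lift_down[OF this _ i pos] s\<nu>(2) have "bruhat n \<mu> \<nu>" by (simp add: same_orbit_iff)
   then show False using \<nu>(3) by simp
  qed
  show "pairing (E \<mu>) \<nu> = 0" unfolding E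
  proof (rule pairing_hecke_step[OF i])
   fix k assume k: "k \<in> string_set (dd i (- \<nu>))"
   show "pairing (E (s i \<mu>)) (\<nu> - rootvec n i k) = 0"
   proof (cases "k = 0 \<or> k = dd i (- \<nu>)")
    case True
    then have "\<nu> - rootvec n i k = \<nu> \<or> \<nu> - rootvec n i k = s i \<nu>"
     using string_shift(4)[OF i k \<nu>(1)] by auto
    then show ?thesis using ascent.IH n1 n2 \<nu> \<nu>' s\<nu> by auto
   next
    case False
    have "strict_submaj n (\<nu> - rootvec n i k) (s i \<mu>)"
     by (rule strict_submaj_trans2[OF string_shift(3)[OF i k \<nu>(1)]]) (use False \<nu>' in \<open>auto simp: same_orbit_iff\<close>)
    then show ?thesis using pairing_strict[OF ascent.hyps(4)] string_shift(1)[OF i k \<nu>(1)] by blast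
   qed
  qed
 qed
qed

theorem hecke_fam_orthogonal:
 assumes \<mu>: "\<mu> \<in> compositions n" and \<nu>: "\<nu> \<in> compositions n" "prec n \<nu> \<mu>"
 shows "pairing (E \<mu>) \<nu> = 0"
proof -
 consider "strict_submaj n \<nu> \<mu>" | "same_orbit n \<nu> \<mu>" "dom_le n \<nu> \<mu>" "\<nu> \<noteq> \<mu>"
  using \<nu>(2) by (auto simp: prec_iff)
 then show ?thesis
 proof cases
  case 1 then show ?thesis using pairing_strict[OF \<mu>] \<nu>(1) by blast
 next
  case 2
  then have "\<not> bruhat n \<mu> \<nu>" using bruhat_dom_le dom_le_antisym[OF 2(2)] \<mu> \<nu>(1) by blast
  then show ?thesis using pairing_orbit[OF \<mu>] \<nu>(1) 2(1) by blast
 qed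
qed

theorem hecke_fam_triangular:
 assumes \<mu>: "\<mu> \<in> compositions n"
 shows "supp (E \<mu> - zmon \<mu>) \<subseteq> {\<nu> \<in> compositions n. prec n \<nu> \<mu>}"
proof
 fix \<xi> assume "\<xi> \<in> supp (E \<mu> - zmon \<mu>)"
 then have k: "lk (E \<mu>) \<xi> - (if \<xi> = \<mu> then 1 else 0) \<noteq> 0"
  by (auto simp: in_keys_iff lookup_minus zmon_def lookup_single when_def)
 have tt: "lk (E \<mu>) \<mu> = 1"
  using lookup_hecke_fam_top[OF \<mu> \<mu>] orbit_fam_triangular(1)[OF \<mu>] by (simp add: same_orbit_def)
 have ne: "\<xi> \<noteq> \<mu>" using k tt by auto
 then have "\<xi> \<in> supp (E \<mu>)" using k by (simp add: in_keys_iff)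
 then have sub: "\<xi> \<in> compositions n" "submaj n \<xi> \<mu>" using hecke_fam_below[OF \<mu>] by (auto simp: laurent_below_def)
 have "strict_submaj n \<xi> \<mu> \<or> same_orbit n \<xi> \<mu> \<and> dom_le n \<xi> \<mu>"
 proof (cases "same_orbit n \<xi> \<mu>")
  case True
  then have "e \<mu> \<xi> \<noteq> 0" using lookup_hecke_fam_top[OF \<mu> sub(1)] k ne by auto
  then show ?thesis using orbit_fam_triangular(2)[OF \<mu> sub(1) True] bruhat_dom_le True by blast
 qed (use sub in \<open>simp add: strict_submaj_def\<close>)
 then show "\<xi> \<in> {\<nu> \<in> compositions n. prec n \<nu> \<mu>}" using sub ne by (simp add: prec_iff)
qed

text \<open>The difference of the two sides has no coefficient on the orbit, by \<open>orbit_fam_relation\<close>, and it is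
 orthogonal to all monomials of smaller orbits.\<close>

theorem hecke_fam_relation:
 assumes \<mu>: "\<mu> \<in> compositions n" and i: "i \<in> {1..n}"
  and nondeg: "\<And>f. supp f \<subseteq> {\<nu> \<in> compositions n. strict_submaj n \<nu> \<mu>} \<Longrightarrow>
    (\<And>\<nu>. \<nu> \<in> compositions n \<Longrightarrow> strict_submaj n \<nu> \<mu> \<Longrightarrow> pairing f \<nu> = 0) \<Longrightarrow> f = 0"
 shows "hecke n t a b i (E \<mu>) = const (P i \<mu>) * E \<mu> + const (Q i \<mu>) * E (s i \<mu>)"
proof -
 let ?r = "hecke n t a b i (E \<mu>) - (const (P i \<mu>) * E \<mu> + const (Q i \<mu>) * E (s i \<mu>))"
 have o: "same_orbit n (s i \<mu>) \<mu>" by (rule same_orbit_refl_comp[OF i])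
 have s\<mu>: "s i \<mu> \<in> compositions n" by (rule refl_composition[OF i \<mu>])
 have b1: "E \<mu> \<in> laurent_below n \<mu>" by (rule hecke_fam_below[OF \<mu>])
 have b2: "E (s i \<mu>) \<in> laurent_below n \<mu>" using hecke_fam_below[OF s\<mu>] by (simp add: laurent_below_orbit[OF o])
 have b: "?r \<in> laurent_below n \<mu>"
  by (intro laurent_below_diff laurent_below_add laurent_below_const_mult hecke_below i b1 b2)
 have "?r = 0"
 proof (rule nondeg)
  show "supp ?r \<subseteq> {\<nu> \<in> compositions n. strict_submaj n \<nu> \<mu>}"
  proof
   fix \<xi> assume k: "\<xi> \<in> supp ?r"
   then have kc: "\<xi> \<in> compositions n" "submaj n \<xi> \<mu>" using b by (auto simp: laurent_below_def)
   have "\<not> same_orbit n \<xi> \<mu>"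
   proof
    assume so: "same_orbit n \<xi> \<mu>"
    have so': "same_orbit n \<xi> (s i \<mu>)" using same_orbit_trans[OF so] o by (simp add: same_orbit_iff)
    have so2: "same_orbit n (s i \<xi>) \<mu>" by (rule same_orbit_trans[OF same_orbit_refl_comp[OF i] so])
    have "lk (hecke n t a b i (E \<mu>)) \<xi> = Op i (e \<mu>) \<xi>"
     unfolding lookup_hecke_top[OF i b1 so] orbit_op_def
     by (simp add: lookup_hecke_fam_top \<mu> kc so so2 refl_composition[OF i kc(1)])
    then have "lk ?r \<xi> = 0"
     by (simp add: lookup_minus lookup_add lookup_const_mult lookup_hecke_fam_top \<mu> s\<mu> kc so so' orbit_fam_relation[OF i])
    then show False using k by (simp add: in_keys_iff)
   qed
   then show "\<xi> \<in> {\<nu> \<in> compositions n. strict_submaj n \<nu> \<mu>}" using kc by (simp add: strict_submaj_def)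
  qed
 next
  fix \<nu> assume \<nu>: "\<nu> \<in> compositions n" "strict_submaj n \<nu> \<mu>"
  have 1: "pairing (E \<mu>) \<xi> = 0" "pairing (E (s i \<mu>)) \<xi> = 0" if "\<xi> \<in> compositions n" "submaj n \<xi> \<nu>" for \<xi>
  proof -
   have "strict_submaj n \<xi> \<mu>" by (rule strict_submaj_trans1[OF that(2) \<nu>(2)])
   moreover from this have "strict_submaj n \<xi> (s i \<mu>)"
    by (rule strict_submaj_trans2) (use o in \<open>simp add: same_orbit_iff\<close>)
   ultimately show "pairing (E \<mu>) \<xi> = 0" "pairing (E (s i \<mu>)) \<xi> = 0"
    using pairing_strict[OF \<mu>] pairing_strict[OF s\<mu>] that by blast+
  qed
  have "submaj n \<nu> \<nu>" by (simp add: submaj_def)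
  then show "pairing ?r \<nu> = 0"
   unfolding pairing_diff pairing_add pairing_const_mult pairing_hecke[OF i]
   using 1 \<nu>(1) string_shift(1,2)[OF i _ \<nu>(1)] by simp
 qed
 then show ?thesis by simp
qed

end

section \<open>Linear systems indexed by a finite set\<close>

definition gram_mat :: "'a::linorder set \<Rightarrow> ('a \<Rightarrow> 'a \<Rightarrow> complex) \<Rightarrow> complex Matrix.mat" where
 "gram_mat D K = Matrix.mat (card D) (card D)
   (\<lambda>(i, j). K (sorted_list_of_set D ! i) (sorted_list_of_set D ! j))"

abbreviation gram_det :: "'a::linorder set \<Rightarrow> ('a \<Rightarrow> 'a \<Rightarrow> complex) \<Rightarrow> complex" where
 "gram_det D K \<equiv> Determinant.det (gram_mat D K)"

lemma gram_mat_carrier [simp]: "gram_mat D K \<in> carrier_mat (card D) (card D)"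
 by (simp add: gram_mat_def)

lemma gram_mat_index:
 "i < card D \<Longrightarrow> j < card D \<Longrightarrow> gram_mat D K $$ (i, j) = K (sorted_list_of_set D ! i) (sorted_list_of_set D ! j)"
 by (simp add: gram_mat_def)

lemma sum_sorted_nth:
 assumes "finite D"
 shows "(\<Sum>i<card D. f (sorted_list_of_set D ! i)) = sum f D"
 using sum.reindex_bij_betw[OF bij_betw_nth[of "sorted_list_of_set D" "{..<card D}" D], of f] assms by simp

lemma sorted_nth_member: "finite D \<Longrightarrow> i < card D \<Longrightarrow> sorted_list_of_set D ! i \<in> D"
 using nth_mem[of i "sorted_list_of_set D"] by simp

lemma obtain_sorted_index:
 assumes "finite D" "x \<in> D"
 obtains i where "i < card D" "x = sorted_list_of_set D ! i"
 using assms by (metis in_set_conv_nth length_sorted_list_of_set set_sorted_list_of_set)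

lemma scalar_product_sum:
 fixes A B :: "complex Matrix.mat"
 assumes A: "A \<in> carrier_mat N N" and B: "B \<in> carrier_mat N N" and AB: "A * B = x \<cdot>\<^sub>m 1\<^sub>m N" and i: "i < N"
 shows "(\<Sum>j<N. A $$ (i, j) * (\<Sum>k<N. B $$ (j, k) * y k)) = x * y i"
proof -
 have ent: "(\<Sum>j<N. A $$ (i, j) * B $$ (j, k)) = (if i = k then x else 0)" if "k < N" for k
 proof -
  have "(A * B) $$ (i, k) = (\<Sum>j<N. A $$ (i, j) * B $$ (j, k))"
   using A B i that by (auto simp: times_mat_def scalar_prod_def lessThan_atLeast0 intro!: sum.cong)
  moreover have "(x \<cdot>\<^sub>m 1\<^sub>m N) $$ (i, k) = (if i = k then x else 0)" using i that by simp
  ultimately show ?thesis unfolding AB by (rule trans[OF sym])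
 qed
 have "(\<Sum>j<N. A $$ (i, j) * (\<Sum>k<N. B $$ (j, k) * y k)) = (\<Sum>k<N. (\<Sum>j<N. A $$ (i, j) * B $$ (j, k)) * y k)"
  unfolding sum_distrib_left sum_distrib_right by (subst sum.swap) (simp add: mult_ac)
 also have "\<dots> = (\<Sum>k<N. (if i = k then x else 0) * y k)" by (rule sum.cong) (simp_all add: ent)
 also have "\<dots> = x * y i" using i by (simp add: if_distrib[of "\<lambda>x. x * _"] cong: if_cong)
 finally show ?thesis .
qed

text \<open>Cramer's rule in terms of the adjugate, whose entries are polynomials in those of the matrix.\<close>

lemma gram_cramer:
 assumes D: "finite D" and sol: "\<forall>\<nu>\<in>D. (\<Sum>\<xi>\<in>D. K \<nu> \<xi> * x \<xi>) = y \<nu>" and i: "i < card D"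
 shows "(\<Sum>j<card D. adj_mat (gram_mat D K) $$ (i, j) * y (sorted_list_of_set D ! j))
   = gram_det D K * x (sorted_list_of_set D ! i)"
proof -
 let ?xs = "sorted_list_of_set D" and ?A = "gram_mat D K"
 have "y (?xs ! j) = (\<Sum>k<card D. ?A $$ (j, k) * x (?xs ! k))" if "j < card D" for j
 proof -
  have "y (?xs ! j) = (\<Sum>\<xi>\<in>D. K (?xs ! j) \<xi> * x \<xi>)" using sol sorted_nth_member[OF D that] by simp
  then show ?thesis using that unfolding sum_sorted_nth[OF D, symmetric] by (simp add: gram_mat_index)
 qed
 then show ?thesis
  using scalar_product_sum[OF adj_mat(1)[OF gram_mat_carrier] gram_mat_carrier adj_mat(3)[OF gram_mat_carrier] i, of K "\<lambda>k. x (?xs ! k)"]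
  by simp
qed

lemma gram_unique:
 assumes D: "finite D" "gram_det D K \<noteq> 0" and sol: "\<forall>\<nu>\<in>D. (\<Sum>\<xi>\<in>D. K \<nu> \<xi> * x \<xi>) = 0" and \<xi>: "\<xi> \<in> D"
 shows "x \<xi> = 0"
proof -
 obtain i where i: "i < card D" "\<xi> = sorted_list_of_set D ! i" by (rule obtain_sorted_index[OF D(1) \<xi>])
 show ?thesis using gram_cramer[OF D(1) sol i(1)] D(2) i(2) by simp
qed

lemma gram_exists:
 assumes D: "finite D" "gram_det D K \<noteq> 0"
 obtains x where "\<forall>\<nu>\<in>D. (\<Sum>\<xi>\<in>D. K \<nu> \<xi> * x \<xi>) = y \<nu>"
proof -
 let ?xs = "sorted_list_of_set D" and ?A = "gram_mat D K"
 define index where "index \<xi> = (THE i. i < card D \<and> ?xs ! i = \<xi>)" for \<xi>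
 have index: "index (?xs ! i) = i" if "i < card D" for i
  unfolding index_def by (rule the_equality) (use that in \<open>auto simp: nth_eq_iff_index_eq\<close>)
 define x where "x \<xi> = (\<Sum>l<card D. adj_mat ?A $$ (index \<xi>, l) * y (?xs ! l)) / Determinant.det ?A" for \<xi>
 have "(\<Sum>\<xi>\<in>D. K \<nu> \<xi> * x \<xi>) = y \<nu>" if \<nu>: "\<nu> \<in> D" for \<nu>
 proof -
  obtain i where i: "i < card D" "\<nu> = ?xs ! i" by (rule obtain_sorted_index[OF D(1) \<nu>])
  have "(\<Sum>\<xi>\<in>D. K \<nu> \<xi> * x \<xi>) = (\<Sum>k<card D. ?A $$ (i, k) * (\<Sum>l<card D. adj_mat ?A $$ (k, l) * y (?xs ! l))) / Determinant.det ?A"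
   unfolding sum_sorted_nth[OF D(1), symmetric] sum_divide_distrib
   by (rule sum.cong) (simp_all add: i x_def index gram_mat_index)
  also have "\<dots> = y \<nu>"
   using scalar_product_sum[OF gram_mat_carrier adj_mat(1)[OF gram_mat_carrier] adj_mat(2)[OF gram_mat_carrier] i(1), of K "\<lambda>l. y (?xs ! l)"] D(2) i(2)
   by simp
  finally show ?thesis .
 qed
 then show ?thesis by (intro that ballI)
qed

lemma det_tendsto:
 fixes A :: "'q \<Rightarrow> complex Matrix.mat"
 assumes "\<And>q. A q \<in> carrier_mat N N" "A0 \<in> carrier_mat N N"
  and "\<And>i j. i < N \<Longrightarrow> j < N \<Longrightarrow> ((\<lambda>q. A q $$ (i, j)) \<longlongrightarrow> A0 $$ (i, j)) F"
 shows "((\<lambda>q. Determinant.det (A q)) \<longlongrightarrow> Determinant.det A0) F"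
 unfolding det_def'[OF assms(1)] det_def'[OF assms(2)]
proof (intro tendsto_sum tendsto_mult tendsto_const tendsto_prod)
 fix p i assume "p \<in> {p. p permutes {0..<N}}" "i \<in> {0..<N}"
 then show "((\<lambda>q. A q $$ (i, p i)) \<longlongrightarrow> A0 $$ (i, p i)) F"
  using assms(3)[of i "p i"] permutes_in_image[of p "{0..<N}" i] by auto
qed

lemma adj_tendsto:
 fixes A :: "'q \<Rightarrow> complex Matrix.mat"
 assumes A: "\<And>q. A q \<in> carrier_mat N N" "A0 \<in> carrier_mat N N"
  and lim: "\<And>i j. i < N \<Longrightarrow> j < N \<Longrightarrow> ((\<lambda>q. A q $$ (i, j)) \<longlongrightarrow> A0 $$ (i, j)) F" and ij: "i < N" "j < N"
 shows "((\<lambda>q. adj_mat (A q) $$ (i, j)) \<longlongrightarrow> adj_mat A0 $$ (i, j)) F"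
proof -
 have dims: "dim_row (A q) = N" "dim_col (A q) = N" "dim_row A0 = N" "dim_col A0 = N" for q
  using A(1)[of q] A(2) by auto
 have "((\<lambda>q. (-1)^(j + i) * Determinant.det (mat_delete (A q) j i)) \<longlongrightarrow> (-1)^(j + i) * Determinant.det (mat_delete A0 j i)) F"
 proof (intro tendsto_mult tendsto_const det_tendsto[where N = "N - 1"])
  fix k l assume kl: "k < N - 1" "l < N - 1"
  then have "((\<lambda>q. A q $$ (if k < j then k else Suc k, if l < i then l else Suc l))
    \<longlongrightarrow> A0 $$ (if k < j then k else Suc k, if l < i then l else Suc l)) F"
   by (intro lim) auto
  then show "((\<lambda>q. mat_delete (A q) j i $$ (k, l)) \<longlongrightarrow> mat_delete A0 j i $$ (k, l)) F"
   using kl by (simp add: mat_delete_def dims)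
 qed (simp_all add: mat_delete_def dims)
 then show ?thesis using ij by (simp add: adj_mat_def cofactor_def dims)
qed

lemma gram_det_tendsto:
 assumes "finite D" "\<And>\<nu> \<xi>. \<nu> \<in> D \<Longrightarrow> \<xi> \<in> D \<Longrightarrow> ((\<lambda>q. K q \<nu> \<xi>) \<longlongrightarrow> K0 \<nu> \<xi>) F"
 shows "((\<lambda>q. gram_det D (K q)) \<longlongrightarrow> gram_det D K0) F"
 by (rule det_tendsto[where N = "card D"]) (use assms sorted_nth_member in \<open>auto simp: gram_mat_index\<close>)

lemma gram_solution_tendsto:
 assumes D: "finite D" "gram_det D K0 \<noteq> 0"
  and K: "\<And>\<nu> \<xi>. \<nu> \<in> D \<Longrightarrow> \<xi> \<in> D \<Longrightarrow> ((\<lambda>q. K q \<nu> \<xi>) \<longlongrightarrow> K0 \<nu> \<xi>) F"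
  and y: "\<And>\<nu>. \<nu> \<in> D \<Longrightarrow> ((\<lambda>q. y q \<nu>) \<longlongrightarrow> y0 \<nu>) F"
  and sol: "\<forall>\<^sub>F q in F. \<forall>\<nu>\<in>D. (\<Sum>\<xi>\<in>D. K q \<nu> \<xi> * x q \<xi>) = y q \<nu>"
  and sol0: "\<forall>\<nu>\<in>D. (\<Sum>\<xi>\<in>D. K0 \<nu> \<xi> * x0 \<xi>) = y0 \<nu>" and \<xi>: "\<xi> \<in> D"
 shows "((\<lambda>q. x q \<xi>) \<longlongrightarrow> x0 \<xi>) F"
proof -
 obtain i where i: "i < card D" "\<xi> = sorted_list_of_set D ! i" by (rule obtain_sorted_index[OF D(1) \<xi>])
 have d: "((\<lambda>q. gram_det D (K q)) \<longlongrightarrow> gram_det D K0) F" by (rule gram_det_tendsto[OF D(1) K])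
 have ent: "((\<lambda>q. gram_mat D (K q) $$ (k, l)) \<longlongrightarrow> gram_mat D K0 $$ (k, l)) F" if "k < card D" "l < card D" for k l
  using that K[OF sorted_nth_member[OF D(1) that(1)] sorted_nth_member[OF D(1) that(2)]] by (simp add: gram_mat_index)
 have num: "((\<lambda>q. \<Sum>j<card D. adj_mat (gram_mat D (K q)) $$ (i, j) * y q (sorted_list_of_set D ! j))
   \<longlongrightarrow> (\<Sum>j<card D. adj_mat (gram_mat D K0) $$ (i, j) * y0 (sorted_list_of_set D ! j))) F"
  by (intro tendsto_sum tendsto_mult adj_tendsto[OF gram_mat_carrier gram_mat_carrier ent] y)
    (use i(1) sorted_nth_member[OF D(1)] in auto)
 have q: "((\<lambda>q. (\<Sum>j<card D. adj_mat (gram_mat D (K q)) $$ (i, j) * y q (sorted_list_of_set D ! j)) / gram_det D (K q))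
   \<longlongrightarrow> (\<Sum>j<card D. adj_mat (gram_mat D K0) $$ (i, j) * y0 (sorted_list_of_set D ! j)) / gram_det D K0) F"
  by (rule tendsto_divide[OF num d D(2)])
 have v: "(\<Sum>j<card D. adj_mat (gram_mat D K0) $$ (i, j) * y0 (sorted_list_of_set D ! j)) / gram_det D K0 = x0 \<xi>"
  using gram_cramer[OF D(1) sol0 i(1)] D(2) i(2) by simp
 have "\<forall>\<^sub>F q in F. (\<Sum>j<card D. adj_mat (gram_mat D (K q)) $$ (i, j) * y q (sorted_list_of_set D ! j)) / gram_det D (K q) = x q \<xi>"
  using sol tendsto_imp_eventually_ne[OF d D(2)]
 proof eventually_elim
  case (elim p)
  show ?case using gram_cramer[OF D(1) elim(1) i(1)] elim(2) i(2) by simp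
 qed
 from tendsto_cong[OF this, of "x0 \<xi>"] q show ?thesis unfolding v by simp
qed

section \<open>The Gram determinant at \<open>q = 0\<close>\<close>

lemma comp_less_iff: "\<nu> < \<xi> \<longleftrightarrow> (\<exists>k. lk \<nu> k < lk \<xi> k \<and> (\<forall>j<k. lk \<nu> j = lk \<xi> j))" for \<nu> \<xi> :: comp
 by (simp add: less_poly_mapping.rep_eq less_fun_def)

text \<open>The order on finitely supported functions is lexicographic, and for \<open>\<nu> < \<xi>\<close> the first
 nonzero entry of \<open>\<xi> - \<nu>\<close> is positive.\<close>

lemma gram_det_one_sided:
 assumes D: "finite D" "D \<subseteq> compositions n"
 shows "gram_det D (\<lambda>\<nu> \<xi>. moment n 0 0 0 0 0 (\<xi> - \<nu>)) = 1"
proof -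
 let ?A = "gram_mat D (\<lambda>\<nu> \<xi>. moment n 0 0 0 0 0 (\<xi> - \<nu>))" and ?xs = "sorted_list_of_set D"
 have "Determinant.det ?A = prod_list (diag_mat ?A)"
 proof (rule det_lower_triangular[OF _ gram_mat_carrier])
  fix i j assume ij: "i < j" "j < card D"
  have "?xs ! i < ?xs ! j"
   using sorted_wrt_nth_less[OF strict_sorted_list_of_set ij(1)] ij D(1) by simp
  then obtain k where k: "lk (?xs ! i) k < lk (?xs ! j) k" "\<forall>l<k. lk (?xs ! i) l = lk (?xs ! j) l"
   unfolding comp_less_iff by blast
  have mem: "?xs ! i \<in> compositions n" "?xs ! j \<in> compositions n"
   using sorted_nth_member[OF D(1)] ij D(2) by (meson less_trans subsetD)+
  have "k \<in> {1..n}" using k(1) lookup_outside[OF mem(1), of k] lookup_outside[OF mem(2), of k] by force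
  then have "moment n 0 0 0 0 0 (?xs ! j - ?xs ! i) = 0"
   using k by (intro moment_one_sided(2)[where l = k]) (auto simp: lookup_minus)
  then show "?A $$ (i, j) = 0" using ij by (simp add: gram_mat_index)
 qed
 also have "diag_mat ?A = map (\<lambda>_. 1) [0..<card D]"
  unfolding diag_mat_def by (simp add: gram_mat_def moment_one_sided(1))
 also have "prod_list (map (\<lambda>_. 1::complex) [0..<card D]) = 1" by (induction "card D") (simp_all add: map_replicate_const)
 finally show ?thesis .
qed

lemma gram_det_generic:
 assumes D: "finite D" "D \<subseteq> compositions n"
 obtains P where "P \<noteq> 0" "\<And>t a b c d. norm t < 1 \<Longrightarrow> norm a < 1 \<Longrightarrow> norm b < 1 \<Longrightarrow> norm c < 1 \<Longrightarrow> norm d < 1 \<Longrightarrow>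
   par_eval P t a b c d \<noteq> 0 \<Longrightarrow> gram_det D (\<lambda>\<nu> \<xi>. moment n t a b c d (\<xi> - \<nu>)) \<noteq> 0"
proof -
 define g where "g p = gram_det D (\<lambda>\<nu> \<xi>. moment_at n (\<xi> - \<nu>) p)" for p
 have ent: "(\<lambda>p. gram_mat D (\<lambda>\<nu> \<xi>. moment_at n (\<xi> - \<nu>) p) $$ (i, j)) \<in> rat_funs" if "i < card D" "j < card D" for i j
  using that moment_rational by (simp add: gram_mat_index)
 have "g \<in> rat_funs" unfolding g_def[abs_def] det_def'[OF gram_mat_carrier]
 proof (intro function_ring_sum function_ring_mult function_ring_const function_ring_prod function_ring_rat_funs)
  fix p i assume "p \<in> {p. p permutes {0..<card D}}" "i \<in> {0..<card D}"
  then show "(\<lambda>x. gram_mat D (\<lambda>\<nu> \<xi>. moment_at n (\<xi> - \<nu>) x) $$ (i, p i)) \<in> rat_funs"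
   using permutes_in_image[of p "{0..<card D}" i] by (intro ent) auto
 qed
 then obtain E Q where E: "E \<in> poly_funs" "Q \<in> poly_funs" "\<And>p. p \<in> polydisc \<Longrightarrow> E p \<noteq> 0" "\<And>p. p \<in> polydisc \<Longrightarrow> E p * g p = Q p"
  by (rule rat_funsE) (rule that)
 obtain P where P: "\<And>t a b c d. Q (t,a,b,c,d) = par_eval P t a b c d" using E(2) unfolding poly_funs_def by blast
 have "(0,0,0,0,0) \<in> polydisc" by (simp add: polydisc_def)
 from E(3)[OF this] E(4)[OF this] have "par_eval P 0 0 0 0 0 \<noteq> 0"
  unfolding P[symmetric] g_def moment_at_def by (simp add: gram_det_one_sided[OF D])
 then have "P \<noteq> 0" by (auto simp: par_eval_def)
 moreover have "gram_det D (\<lambda>\<nu> \<xi>. moment n t a b c d (\<xi> - \<nu>)) \<noteq> 0"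
  if "norm t < 1" "norm a < 1" "norm b < 1" "norm c < 1" "norm d < 1" "par_eval P t a b c d \<noteq> 0" for t a b c d
 proof -
  have "(t,a,b,c,d) \<in> polydisc" using that by (simp add: polydisc_def)
  from E(4)[OF this] that(6) show ?thesis unfolding P[symmetric] g_def moment_at_def by auto
 qed
 ultimately show ?thesis by (rule that)
qed

section \<open>The limit \<open>q \<rightarrow> 0\<close> of the inner product\<close>

lemma qpoch_partial_products:
 assumes "norm q < 1"
 shows "(\<lambda>N. \<Prod>i\<le>N. 1 - x * q ^ i) \<longlonglongrightarrow> qpoch q x"
proof -
 have "summable (\<lambda>i. norm (x * q ^ i))"
  unfolding norm_mult norm_power by (intro summable_mult summable_geometric) (use assms in simp)
 then have "abs_convergent_prod (\<lambda>i. 1 - x * q ^ i)" by (simp add: abs_convergent_prod_conv_summable)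
 then show ?thesis unfolding qpoch_def by (intro convergent_prod_LIMSEQ abs_convergent_prod_imp_convergent_prod)
qed

lemma qpoch_estimate:
 assumes q: "norm q \<le> 1/2" and x: "norm x \<le> 1"
 shows "norm (qpoch q x - (1 - x)) \<le> 2 * (exp (2 * norm q) - 1)"
proof -
 let ?e = "exp (2 * norm q) - 1"
 have e0: "0 \<le> ?e" by simp
 have q1: "norm q < 1" using q by simp
 have "norm ((\<Prod>i\<le>N. 1 - x * q ^ i) - (1 - x)) \<le> 2 * ?e" for N
 proof -
  let ?T = "\<Prod>i<N. 1 + - (x * q ^ Suc i)"
  have "(\<Sum>i<N. norm (- (x * q ^ Suc i))) \<le> (\<Sum>i<N. norm q * norm q ^ i)"
   using x by (intro sum_mono) (auto simp: norm_mult norm_power intro!: mult_left_le_one_le)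
  also have "\<dots> \<le> suminf (\<lambda>i. norm q * norm q ^ i)"
   by (rule sum_le_suminf) (use q1 in \<open>auto intro!: summable_mult summable_geometric\<close>)
  also have "\<dots> = norm q * (1 / (1 - norm q))" using q1 by (simp add: suminf_mult suminf_geometric summable_geometric)
  also have "\<dots> \<le> norm q * 2" using q by (intro mult_left_mono) (auto simp: field_simps)
  finally have s: "(\<Sum>i<N. norm (- (x * q ^ Suc i))) \<le> 2 * norm q" by simp
  have "norm (?T - 1) \<le> (\<Prod>i<N. 1 + norm (- (x * q ^ Suc i))) - 1" by (rule norm_prod_minus1_le_prod_minus1)
  also have "(\<Prod>i<N. 1 + norm (- (x * q ^ Suc i))) \<le> exp (\<Sum>i<N. norm (- (x * q ^ Suc i)))"
   by (rule prod_le_exp_sum) simp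
  also have "\<dots> \<le> exp (2 * norm q)" using s by (simp only: exp_le_cancel_iff)
  finally have T: "norm (?T - 1) \<le> ?e" by simp
  have "(\<Prod>i\<le>N. 1 - x * q ^ i) = (1 - x) * ?T" by (simp add: prod.atMost_shift)
  then have "(\<Prod>i\<le>N. 1 - x * q ^ i) - (1 - x) = (1 - x) * (?T - 1)" by (simp add: algebra_simps)
  moreover have "norm (1 - x) \<le> 2" using norm_triangle_ineq4[of 1 x] x by simp
  ultimately show ?thesis using T by (simp only: norm_mult) (intro mult_mono, auto)
 qed
 then show ?thesis
  by (intro LIMSEQ_le_const2[OF tendsto_norm[OF tendsto_diff[OF qpoch_partial_products[OF q1] tendsto_const]]]) blast
qed

lemma torus_fun_qpoch:
 assumes f: "torus_fun f" "\<And>z. on_torus z \<Longrightarrow> norm (f z) \<le> 1" and q: "norm q \<le> 1/2"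
 shows "torus_fun (\<lambda>z. qpoch q (f z))"
 unfolding torus_fun_def
proof (intro conjI allI impI exI)
 fix z assume z: "on_torus z"
 have "norm (qpoch q (f z)) \<le> norm (qpoch q (f z) - (1 - f z)) + norm (1 - f z)"
  using norm_triangle_ineq[of "qpoch q (f z) - (1 - f z)" "1 - f z"] by simp
 also have "\<dots> \<le> 2 * (exp (2 * norm q) - 1) + 2"
  using qpoch_estimate[OF q f(2)[OF z]] norm_triangle_ineq4[of 1 "f z"] f(2)[OF z] by (intro add_mono) simp_all
 finally show "norm (qpoch q (f z)) \<le> 2 * (exp (2 * norm q) - 1) + 2" .
next
 fix I w assume I: "finite (I::nat set)" and w: "on_torus w"
 have "torus_fun (\<lambda>z. \<Prod>i\<le>N. 1 - f z * q ^ i)" for N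
  by (intro torus_fun_prod torus_fun_diff torus_fun_mult torus_fun_const f)
 from torus_fun_meas[OF this I w]
 have m: "(\<lambda>\<theta>. \<Prod>i\<le>N. 1 - f (torus_point I w \<theta>) * q ^ i) \<in> borel_measurable (Pi\<^sub>M I (\<lambda>_. unit_measure))" for N .
 show "(\<lambda>\<theta>. qpoch q (f (torus_point I w \<theta>))) \<in> borel_measurable (Pi\<^sub>M I (\<lambda>_. unit_measure))"
  by (rule borel_measurable_LIMSEQ_metric[OF m]) (use q in \<open>auto intro!: qpoch_partial_products\<close>)
qed

text \<open>Uniform convergence on the torus as \<open>q \<rightarrow> 0\<close>, together with integrability for small \<open>q\<close>. The weight is
 built from \<open>q\<close>-shifted factorials by operations that preserve this.\<close>

definition torus_limit :: "(complex \<Rightarrow> (nat \<Rightarrow> complex) \<Rightarrow> complex) \<Rightarrow> bool" where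
 "torus_limit F \<longleftrightarrow> torus_fun (F 0) \<and> (\<forall>\<^sub>F q in at 0. torus_fun (F q)) \<and> uniform_limit {z. on_torus z} F (F 0) (at 0)"

lemma torus_limit_fun: "torus_fun f \<Longrightarrow> torus_limit (\<lambda>_. f)"
 by (simp add: torus_limit_def uniform_limit_const)

lemma torus_limit_q: "torus_limit (\<lambda>q _. q)"
proof -
 have "\<forall>\<^sub>F q in at (0::complex). norm q < e" if "0 < e" for e
  using that by (auto simp: eventually_at dist_norm intro!: exI[of _ e])
 then show ?thesis by (auto simp: torus_limit_def uniform_limit_iff)
qed

lemma torus_fun_bounded: "torus_fun f \<Longrightarrow> bounded (f ` {z. on_torus z})"
 using torus_fun_bound[of f] by (auto simp: bounded_iff)

lemma torus_limit_mult: "torus_limit F \<Longrightarrow> torus_limit G \<Longrightarrow> torus_limit (\<lambda>q z. F q z * G q z)"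
 unfolding torus_limit_def
 by (auto intro!: uniform_lim_mult torus_fun_mult torus_fun_bounded elim: eventually_elim2)

lemma torus_limit_prod:
 "(\<And>i. i \<in> A \<Longrightarrow> torus_limit (F i)) \<Longrightarrow> torus_limit (\<lambda>q z. \<Prod>i\<in>A. F i q z)"
 by (induction A rule: infinite_finite_induct) (auto intro: torus_limit_mult torus_limit_fun)

lemma torus_limit_inverse:
 assumes F: "torus_limit F" and d: "0 < \<delta>" "\<And>z. on_torus z \<Longrightarrow> \<delta> \<le> norm (F 0 z)"
 shows "torus_limit (\<lambda>q z. inverse (F q z))"
proof -
 have f: "torus_fun (F 0)" "\<forall>\<^sub>F q in at 0. torus_fun (F q)" "uniform_limit {z. on_torus z} F (F 0) (at 0)"
  using F by (simp_all add: torus_limit_def)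
 have "\<forall>\<^sub>F q in at 0. torus_fun (\<lambda>z. inverse (F q z))"
  using f(2) uniform_limitD[OF f(3) half_gt_zero[OF d(1)]]
 proof eventually_elim
  case (elim q)
  show ?case
  proof (rule torus_fun_inverse[OF elim(1), of "\<delta> / 2"])
   fix z assume z: "on_torus z"
   have "norm (F 0 z) \<le> norm (F q z) + dist (F q z) (F 0 z)"
    using norm_triangle_ineq2[of "F 0 z" "F q z"] by (simp add: dist_norm norm_minus_commute)
   then show "\<delta> / 2 \<le> norm (F q z)" using elim(2) z d(2)[OF z] by fastforce
  qed (use d in simp)
 qed
 then show ?thesis using torus_fun_inverse[OF f(1) d] uniform_lim_inverse[OF f(3), of \<delta>] d
  by (auto simp: torus_limit_def comp_def)
qed

lemma torus_limit_divide:
 "torus_limit F \<Longrightarrow> torus_limit (\<lambda>q z. inverse (G q z)) \<Longrightarrow> torus_limit (\<lambda>q z. F q z / G q z)"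
 unfolding divide_inverse by (rule torus_limit_mult)

lemma torus_limit_inverse_mult:
 "torus_limit (\<lambda>q z. inverse (F q z)) \<Longrightarrow> torus_limit (\<lambda>q z. inverse (G q z)) \<Longrightarrow> torus_limit (\<lambda>q z. inverse (F q z * G q z))"
 unfolding inverse_mult_distrib by (rule torus_limit_mult)

lemma torus_limit_qpoch:
 assumes G: "torus_limit G" and b: "\<And>q z. norm q \<le> 1/2 \<Longrightarrow> on_torus z \<Longrightarrow> norm (G q z) \<le> 1"
 shows "torus_limit (\<lambda>q z. qpoch q (G q z))"
proof -
 have g: "torus_fun (G 0)" "\<forall>\<^sub>F q in at 0. torus_fun (G q)" "uniform_limit {z. on_torus z} G (G 0) (at 0)"
  using G by (simp_all add: torus_limit_def)
 have small: "\<forall>\<^sub>F q in at (0::complex). norm q \<le> 1/2"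
  by (auto simp: eventually_at dist_norm intro!: exI[of _ "1/2"])
 have ex: "\<forall>\<^sub>F q in at (0::complex). 2 * (exp (2 * norm q) - 1) < e" if "0 < e" for e
 proof -
  have "((\<lambda>q::complex. 2 * (exp (2 * norm q) - 1)) \<longlongrightarrow> 2 * (exp (2 * norm (0::complex)) - 1)) (at 0)"
   by (intro tendsto_intros)
  then show ?thesis using that by (intro order_tendstoD(2)) simp_all
 qed
 have "uniform_limit {z. on_torus z} (\<lambda>q z. qpoch q (G q z)) (\<lambda>z. qpoch 0 (G 0 z)) (at 0)"
 proof (rule uniform_limitI)
  fix e :: real assume e: "0 < e"
  show "\<forall>\<^sub>F q in at 0. \<forall>z\<in>{z. on_torus z}. dist (qpoch q (G q z)) (qpoch 0 (G 0 z)) < e"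
   using small ex[OF half_gt_zero[OF e]] uniform_limitD[OF g(3) half_gt_zero[OF e]]
  proof eventually_elim
   case (elim q)
   show ?case
   proof
    fix z assume "z \<in> {z. on_torus z}"
    then have z: "on_torus z" by simp
    have "dist (qpoch q (G q z)) (qpoch 0 (G 0 z)) \<le> norm (qpoch q (G q z) - (1 - G q z)) + norm (G q z - G 0 z)"
     using dist_triangle[of "qpoch q (G q z)" "1 - G 0 z" "1 - G q z"]
     by (simp add: qpoch_zero dist_norm norm_minus_commute)
    also have "norm (qpoch q (G q z) - (1 - G q z)) \<le> 2 * (exp (2 * norm q) - 1)"
     by (rule qpoch_estimate[OF elim(1) b[OF elim(1) z]])
    finally show "dist (qpoch q (G q z)) (qpoch 0 (G 0 z)) < e"
     using elim(2) bspec[OF elim(3), of z] z by (simp add: dist_norm)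
   qed
  qed
 qed
 moreover have "\<forall>\<^sub>F q in at 0. torus_fun (\<lambda>z. qpoch q (G q z))"
  using small g(2) by eventually_elim (rule torus_fun_qpoch, auto intro: b)
 moreover have "torus_fun (\<lambda>z. qpoch 0 (G 0 z))" by (rule torus_fun_qpoch[OF g(1)]) (use b[of 0] in auto)
 ultimately show ?thesis by (simp add: torus_limit_def)
qed

lemma torus_limit_inverse_qpoch:
 assumes G: "torus_limit G" and b: "\<And>q z. norm q \<le> 1/2 \<Longrightarrow> on_torus z \<Longrightarrow> norm (G q z) \<le> 1"
  and r: "\<rho> < 1" "\<And>z. on_torus z \<Longrightarrow> norm (G 0 z) \<le> \<rho>"
 shows "torus_limit (\<lambda>q z. inverse (qpoch q (G q z)))"
proof (rule torus_limit_inverse[OF torus_limit_qpoch[OF G b], of "1 - \<rho>"])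
 show "1 - \<rho> \<le> norm (qpoch 0 (G 0 z))" if "on_torus z" for z
  using norm_one_minus_ge[of "G 0 z"] r(2)[OF that] by (simp add: qpoch_zero)
qed (use r in auto)

lemma tint_bound:
 assumes "torus_fun f" "finite I" "on_torus w" "\<And>z. on_torus z \<Longrightarrow> norm (f z) \<le> B"
 shows "norm (tint I w f) \<le> B"
proof -
 interpret P: prob_space "Pi\<^sub>M I (\<lambda>_. unit_measure)" by (rule prob_space_PiM_unit)
 have "norm (tint I w f) \<le> (\<integral>\<theta>. norm (f (torus_point I w \<theta>)) \<partial>Pi\<^sub>M I (\<lambda>_. unit_measure))"
  unfolding tint_def by (rule integral_norm_bound)
 also have "\<dots> \<le> B"
  by (intro P.integral_le_const integrable_norm torus_fun_integrable assms) (auto intro!: assms(4) on_torus_point assms(3))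
 finally show ?thesis .
qed

lemma torus_limit_tint:
 assumes F: "torus_limit F" and I: "finite I" "on_torus w"
 shows "((\<lambda>q. tint I w (F q)) \<longlongrightarrow> tint I w (F 0)) (at 0)"
proof (rule tendstoI)
 fix e :: real assume e: "0 < e"
 have f: "torus_fun (F 0)" "\<forall>\<^sub>F q in at 0. torus_fun (F q)" "uniform_limit {z. on_torus z} F (F 0) (at 0)"
  using F by (simp_all add: torus_limit_def)
 show "\<forall>\<^sub>F q in at 0. dist (tint I w (F q)) (tint I w (F 0)) < e"
  using f(2) uniform_limitD[OF f(3) half_gt_zero[OF e]]
 proof eventually_elim
  case (elim q)
  have "tint I w (F q) - tint I w (F 0) = tint I w (\<lambda>z. F q z - F 0 z)" by (rule tint_diff[symmetric, OF elim(1) f(1) I])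
  moreover have "norm (tint I w (\<lambda>z. F q z - F 0 z)) \<le> e/2"
   by (rule tint_bound[OF torus_fun_diff[OF elim(1) f(1)] I]) (use elim(2) in \<open>auto simp: dist_norm intro: less_imp_le\<close>)
  ultimately show ?case using e by (simp add: dist_norm)
 qed
qed

section \<open>The inner product in terms of moments\<close>

text \<open>In \<open>torus_integral\<close> the coordinates outside \<open>{1..n}\<close> have this value.\<close>

definition base_point :: "nat \<Rightarrow> complex" where "base_point = (\<lambda>_. cis1 undefined)"

lemma on_torus_base_point: "on_torus base_point" by (simp add: on_torus_def base_point_def)

lemma torus_integral_tint: "torus_integral n h = tint {1..n} base_point h"
proof -
 have eq: "(\<lambda>j. cis (2 * pi * \<theta> j)) = torus_point {1..n} base_point \<theta>"
  if "\<theta> \<in> space (Pi\<^sub>M {1..n} (\<lambda>_. unit_measure))" for \<theta>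
 proof
  fix j show "cis (2 * pi * \<theta> j) = torus_point {1..n} base_point \<theta> j"
  proof (cases "j \<in> {1..n}")
   case False
   then have "\<theta> j = undefined" using that by (auto simp: space_PiM PiE_def extensional_def)
   then show ?thesis using False by (simp add: torus_point_def base_point_def)
  qed (simp add: torus_point_def)
 qed
 show ?thesis unfolding torus_integral_def tint_def unit_measure_def[symmetric]
  by (rule Bochner_Integration.integral_cong[OF refl]) (simp add: eq)
qed

context unit_params
begin

abbreviation \<Delta>q where "\<Delta>q q \<equiv> koornwinder_weight n q t a b c d"

lemma torus_limit_weight: "torus_limit \<Delta>q"
proof -
 have S: "norm x \<le> 1" "norm x * norm q \<le> 1" "norm q * norm x \<le> 1" if "norm x < 1" "norm q \<le> 1/2" for x q :: complex
  using that by (auto intro: mult_le_one)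
 note L = torus_limit_mult torus_limit_q torus_limit_fun torus_fun_coord torus_fun_coord_inverse torus_fun_const torus_fun_power
 have V: "torus_limit (\<lambda>q z. qpoch q (z i ^ 2))" "torus_limit (\<lambda>q z. qpoch q (q / z i ^ 2))" for i
  unfolding divide_inverse power_inverse[symmetric]
  by (rule torus_limit_qpoch; (intro L | simp add: norm_mult norm_power norm_inverse on_torus_norm))+
 have A: "torus_limit (\<lambda>q z. inverse (qpoch q (x * z i)))" "torus_limit (\<lambda>q z. inverse (qpoch q (x * q / z i)))"
  "torus_limit (\<lambda>q z. inverse (qpoch q (x / z i)))" if x: "norm x < 1" for x i
  unfolding divide_inverse
  by (rule torus_limit_inverse_qpoch[OF _ _ x]; (intro L | use S[OF x] in \<open>simp add: norm_mult norm_inverse on_torus_norm\<close>))+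
 have W: "torus_limit (\<lambda>q z. qpoch q (z i * z j))" "torus_limit (\<lambda>q z. qpoch q (z i / z j))"
  "torus_limit (\<lambda>q z. qpoch q (q * z j / z i))" "torus_limit (\<lambda>q z. qpoch q (q / (z i * z j)))" for i j
  unfolding divide_inverse inverse_mult_distrib
  by (rule torus_limit_qpoch; (intro L | simp add: norm_mult norm_inverse on_torus_norm))+
 have B: "torus_limit (\<lambda>q z. inverse (qpoch q (t * z i * z j)))" "torus_limit (\<lambda>q z. inverse (qpoch q (t * z i / z j)))"
  "torus_limit (\<lambda>q z. inverse (qpoch q (q * t * z j / z i)))" "torus_limit (\<lambda>q z. inverse (qpoch q (q * t / (z i * z j))))" for i j
  unfolding divide_inverse inverse_mult_distrib
  by (rule torus_limit_inverse_qpoch[OF _ _ norms(1)]; (intro L | use S[OF norms(1)] in \<open>simp add: norm_mult norm_inverse on_torus_norm\<close>))+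
 show ?thesis unfolding koornwinder_weight_def
  by (intro torus_limit_mult torus_limit_prod torus_limit_divide torus_limit_inverse_mult V W A B norms)
qed

definition moment_q :: "complex \<Rightarrow> comp \<Rightarrow> complex" where
 "moment_q q \<beta> = tint {1..n} base_point (\<lambda>z. zpow n \<beta> z * \<Delta>q q z)"

lemma moment_q_tendsto: "((\<lambda>q. moment_q q \<beta>) \<longlongrightarrow> mom \<beta>) (at 0)"
proof -
 have "((\<lambda>q. moment_q q \<beta>) \<longlongrightarrow> moment_q 0 \<beta>) (at 0)" unfolding moment_q_def
  by (rule torus_limit_tint[of "\<lambda>q z. zpow n \<beta> z * \<Delta>q q z"])
    (auto intro!: torus_limit_mult torus_limit_fun torus_fun_zpow torus_limit_weight on_torus_base_point)
 also have "moment_q 0 \<beta> = mom \<beta>"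
 proof -
  have "torus_point {1..n} base_point \<theta> j = torus_point {1..n} (\<lambda>_. 1) \<theta> j" if "j \<in> {1..n}" for \<theta> j
   using that by (simp add: torus_point_def)
  then have "zpow n \<beta> (torus_point {1..n} base_point \<theta>) * \<Delta>q 0 (torus_point {1..n} base_point \<theta>)
   = zpow n \<beta> (torus_point {1..n} (\<lambda>_. 1) \<theta>) * \<Delta> (torus_point {1..n} (\<lambda>_. 1) \<theta>)" for \<theta>
   unfolding koornwinder_weight_zero zpow_def weight0_def
   by (intro arg_cong2[of _ _ _ _ "(*)"] prod.cong refl arg_cong2[of _ _ _ _ "pair_weight t"]) auto
  then show ?thesis unfolding moment_q_def moment_def tint_def by simp
 qed
 finally show ?thesis .
qed

lemma leval_lvalue:
 assumes "supp f \<subseteq> compositions n"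
 shows "leval f z = lvalue n f z"
 unfolding leval_def lvalue_def zpow_def
proof (intro sum.cong refl arg_cong2[of _ _ _ _ "(*)"])
 fix \<xi> assume "\<xi> \<in> supp f"
 then have "supp \<xi> \<subseteq> {1..n}" using assms by (auto simp: compositions_def)
 then show "(\<Prod>j\<in>supp \<xi>. z j powi lk \<xi> j) = (\<Prod>j\<in>{1..n}. z j powi lk \<xi> j)"
  by (intro prod.mono_neutral_left) (auto simp: in_keys_iff)
qed

lemma koornwinder_inner_moments:
 assumes w: "torus_fun (\<Delta>q q)" and A: "finite A" "supp u \<subseteq> A" "A \<subseteq> compositions n" and \<nu>: "\<nu> \<in> compositions n"
 shows "koornwinder_inner n q t a b c d (\<lambda>_ _ _ _ _ _. u) (\<lambda>_ _ _ _ _ _. zmon \<nu>)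
  = (\<Sum>\<xi>\<in>A. lk u \<xi> * moment_q q (\<xi> - \<nu>))"
proof -
 note T = torus_fun_mult torus_fun_zpow w torus_fun_const
 have bar: "bar (zmon \<nu>) = (zmon (- \<nu>) :: complex laurent)" by (simp add: bar_def zmon_def)
 have lz: "leval (zmon (- \<nu>)) z = zpow n (- \<nu>) z" for z
  using leval_lvalue[of "zmon (- \<nu>)" z] compositions_uminus[OF \<nu>] by (simp add: lvalue_zmon) (simp add: zmon_def)
 have lu: "leval u z = (\<Sum>\<xi>\<in>A. lk u \<xi> * zpow n \<xi> z)" for z
  using leval_lvalue[of u z] lvalue_superset[OF A(1,2)] A by auto
 have "koornwinder_inner n q t a b c d (\<lambda>_ _ _ _ _ _. u) (\<lambda>_ _ _ _ _ _. zmon \<nu>)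
   = tint {1..n} base_point (\<lambda>z. (\<Sum>\<xi>\<in>A. lk u \<xi> * zpow n \<xi> z) * zpow n (- \<nu>) z * \<Delta>q q z)"
  by (simp add: koornwinder_inner_def torus_integral_tint iota_def bar lz lu)
 also have "\<dots> = tint {1..n} base_point (\<lambda>z. \<Sum>\<xi>\<in>A. lk u \<xi> * (zpow n (\<xi> - \<nu>) z * \<Delta>q q z))"
 proof (rule tint_cong[OF _ on_torus_base_point])
  fix z assume z: "on_torus z"
  have "zpow n (\<xi> - \<nu>) z = zpow n \<xi> z * zpow n (- \<nu>) z" for \<xi> using zpow_add[OF z, of n \<xi> "- \<nu>"] by simp
  then show "(\<Sum>\<xi>\<in>A. lk u \<xi> * zpow n \<xi> z) * zpow n (- \<nu>) z * \<Delta>q q z = (\<Sum>\<xi>\<in>A. lk u \<xi> * (zpow n (\<xi> - \<nu>) z * \<Delta>q q z))"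
   unfolding sum_distrib_right by (simp add: mult.assoc)
 qed
 also have "\<dots> = (\<Sum>\<xi>\<in>A. lk u \<xi> * moment_q q (\<xi> - \<nu>))"
  unfolding moment_q_def by (subst tint_sum) (auto intro!: T on_torus_base_point simp: tint_mult_left)
 finally show ?thesis .
qed

definition below :: "comp \<Rightarrow> comp set" where "below \<mu> = {\<nu> \<in> compositions n. prec n \<nu> \<mu>}"

lemma below: "finite (below \<mu>)" "\<mu> \<notin> below \<mu>" "below \<mu> \<subseteq> compositions n"
 unfolding below_def using finite_prec by (auto simp: prec_def)

text \<open>The conditions on \<open>u\<close> are a linear system for the coefficients at the smaller exponents; the
 coefficient of \<open>z\<^sup>\<mu>\<close> gives the right-hand side.\<close>

lemma is_koornwinder_iff:
 assumes w: "torus_fun (\<Delta>q q)" and \<mu>: "\<mu> \<in> compositions n"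
 shows "is_koornwinder n q t a b c d \<mu> u \<longleftrightarrow>
   supp (u - zmon \<mu>) \<subseteq> below \<mu> \<and>
   (\<forall>\<nu>\<in>below \<mu>. (\<Sum>\<xi>\<in>below \<mu>. moment_q q (\<xi> - \<nu>) * lk u \<xi>) = - moment_q q (\<mu> - \<nu>))"
proof -
 have "koornwinder_inner n q t a b c d (\<lambda>_ _ _ _ _ _. u) (\<lambda>_ _ _ _ _ _. zmon \<nu>)
   = moment_q q (\<mu> - \<nu>) + (\<Sum>\<xi>\<in>below \<mu>. moment_q q (\<xi> - \<nu>) * lk u \<xi>)"
  if k: "supp (u - zmon \<mu>) \<subseteq> below \<mu>" and \<nu>: "\<nu> \<in> below \<mu>" for \<nu>
 proof -
  have "lk (u - zmon \<mu>) \<mu> = 0" using k below(2) by (auto simp: in_keys_iff)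
  then have top: "lk u \<mu> = 1" by (simp add: lookup_minus zmon_def)
  have "supp u \<subseteq> insert \<mu> (below \<mu>)"
  proof
   fix \<xi> assume "\<xi> \<in> supp u"
   then show "\<xi> \<in> insert \<mu> (below \<mu>)"
    using k by (cases "\<xi> = \<mu>") (auto simp: in_keys_iff lookup_minus zmon_def lookup_single when_def)
  qed
  then show ?thesis
   by (subst koornwinder_inner_moments[OF w, of "insert \<mu> (below \<mu>)"])
     (use below[of \<mu>] \<mu> \<nu> top in \<open>auto simp: mult.commute\<close>)
 qed
 then show ?thesis unfolding is_koornwinder_def below_def[symmetric]
  by (auto simp: below_def add_eq_0_iff)
qed

end

context regular_point
begin

text \<open>Near \<open>q = 0\<close> the Gram matrix stays nonsingular, and the solution depends continuously on it. At
 \<open>q = 0\<close> the solution is given by \<open>hecke_fam_orthogonal\<close>.\<close>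

theorem koornwinder_limit:
 assumes \<mu>: "\<mu> \<in> compositions n" and det: "gram_det (below \<mu>) (\<lambda>\<nu> \<xi>. mom (\<xi> - \<nu>)) \<noteq> 0"
 shows "\<forall>\<^sub>F q in at 0. \<exists>!u. is_koornwinder n q t a b c d \<mu> u"
  and "((\<lambda>q. lk (koornwinder n q t a b c d \<mu>) \<nu>) \<longlongrightarrow> lk (E \<mu>) \<nu>) (at 0)"
proof -
 let ?D = "below \<mu>" and ?K = "\<lambda>q \<nu> \<xi>. moment_q q (\<xi> - \<nu>)" and ?U = "\<lambda>q. koornwinder n q t a b c d \<mu>"
 have K: "((\<lambda>q. ?K q \<nu> \<xi>) \<longlongrightarrow> mom (\<xi> - \<nu>)) (at 0)" for \<nu> \<xi> by (rule moment_q_tendsto)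
 have "((\<lambda>q. gram_det ?D (?K q)) \<longlongrightarrow> gram_det ?D (\<lambda>\<nu> \<xi>. mom (\<xi> - \<nu>))) (at 0)"
  by (rule gram_det_tendsto[OF below(1) K])
 from tendsto_imp_eventually_ne[OF this det] torus_limit_weight
 have ev: "\<forall>\<^sub>F q in at 0. gram_det ?D (?K q) \<noteq> 0 \<and> torus_fun (\<Delta>q q)"
  unfolding torus_limit_def by (auto intro: eventually_conj)
 have ex1: "\<exists>!u. is_koornwinder n q t a b c d \<mu> u" if q: "gram_det ?D (?K q) \<noteq> 0" "torus_fun (\<Delta>q q)" for q
 proof -
  obtain x where x: "\<forall>\<nu>\<in>?D. (\<Sum>\<xi>\<in>?D. ?K q \<nu> \<xi> * x \<xi>) = - moment_q q (\<mu> - \<nu>)"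
   by (rule gram_exists[OF below(1) q(1), of "\<lambda>\<nu>. - moment_q q (\<mu> - \<nu>)"])
  define u where "u = zmon \<mu> + (\<Sum>\<xi>\<in>?D. Poly_Mapping.single \<xi> (x \<xi>))"
  have lku: "lk (u - zmon \<mu>) \<xi> = (if \<xi> \<in> ?D then x \<xi> else 0)" for \<xi>
   using below(1)[of \<mu>] by (simp add: u_def lookup_sum lookup_single when_def)
  have lku': "lk u \<xi> = x \<xi>" if "\<xi> \<in> ?D" for \<xi>
   using lku[of \<xi>] that below(2)[of \<mu>] by (auto simp: lookup_minus zmon_def lookup_single when_def split: if_splits)
  have "is_koornwinder n q t a b c d \<mu> u" unfolding is_koornwinder_iff[OF q(2) \<mu>]
   using x by (auto simp: in_keys_iff lku lku' split: if_splits)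
  moreover have "v = v'" if v: "is_koornwinder n q t a b c d \<mu> v" "is_koornwinder n q t a b c d \<mu> v'" for v v'
  proof (rule poly_mapping_eqI)
   fix \<xi>
   note k = v[unfolded is_koornwinder_iff[OF q(2) \<mu>]]
   show "lk v \<xi> = lk v' \<xi>"
   proof (cases "\<xi> \<in> ?D")
    case True
    have "lk v \<xi> - lk v' \<xi> = 0"
     by (rule gram_unique[OF below(1) q(1) _ True, of "\<lambda>\<xi>. lk v \<xi> - lk v' \<xi>"])
       (use k in \<open>simp add: right_diff_distrib sum_subtractf\<close>)
    then show ?thesis by simp
   next
    case False
    then have "lk (v - zmon \<mu>) \<xi> = 0" "lk (v' - zmon \<mu>) \<xi> = 0" using k by (auto simp: in_keys_iff)
    then show ?thesis by (simp add: lookup_minus)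
   qed
  qed
  ultimately show ?thesis by blast
 qed
 show "\<forall>\<^sub>F q in at 0. \<exists>!u. is_koornwinder n q t a b c d \<mu> u"
  using ev by eventually_elim (use ex1 in blast)
 have U: "is_koornwinder n q t a b c d \<mu> (?U q)" if "gram_det ?D (?K q) \<noteq> 0" "torus_fun (\<Delta>q q)" for q
  unfolding koornwinder_def by (rule theI'[OF ex1[OF that]])
 have out: "lk f \<nu> = (if \<nu> = \<mu> then 1 else 0)" if "supp (f - zmon \<mu>) \<subseteq> ?D" "\<nu> \<notin> ?D" for f :: "complex laurent" and \<nu>
 proof -
  have "lk (f - zmon \<mu>) \<nu> = 0" using that by (auto simp: in_keys_iff)
  then show ?thesis by (auto simp: lookup_minus zmon_def lookup_single when_def)
 qed
 have tri: "supp (E \<mu> - zmon \<mu>) \<subseteq> ?D" unfolding below_def by (rule hecke_fam_triangular[OF \<mu>])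
 show "((\<lambda>q. lk (?U q) \<nu>) \<longlongrightarrow> lk (E \<mu>) \<nu>) (at 0)"
 proof (cases "\<nu> \<in> ?D")
  case True
  show ?thesis
  proof (rule gram_solution_tendsto[OF below(1) det K, of "\<lambda>q \<nu>. - moment_q q (\<mu> - \<nu>)" "\<lambda>\<nu>. - mom (\<mu> - \<nu>)"])
   show "((\<lambda>q. - moment_q q (\<mu> - \<nu>)) \<longlongrightarrow> - mom (\<mu> - \<nu>)) (at 0)" for \<nu>
    by (intro tendsto_minus moment_q_tendsto)
   show "\<forall>\<^sub>F q in at 0. \<forall>\<nu>\<in>?D. (\<Sum>\<xi>\<in>?D. ?K q \<nu> \<xi> * lk (?U q) \<xi>) = - moment_q q (\<mu> - \<nu>)"
    using ev by eventually_elim (use U is_koornwinder_iff[OF _ \<mu>] in blast)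
   show "\<forall>\<nu>\<in>?D. (\<Sum>\<xi>\<in>?D. mom (\<xi> - \<nu>) * lk (E \<mu>) \<xi>) = - mom (\<mu> - \<nu>)"
   proof
    fix \<nu> assume \<nu>: "\<nu> \<in> ?D"
    have "supp (E \<mu>) \<subseteq> insert \<mu> ?D"
     using out[OF tri] by (auto simp: in_keys_iff split: if_splits)
    then have "pairing (E \<mu>) \<nu> = (\<Sum>\<xi>\<in>insert \<mu> ?D. lk (E \<mu>) \<xi> * mom (\<xi> - \<nu>))"
     by (intro pairing_superset) (use below(1) in auto)
    also have "\<dots> = mom (\<mu> - \<nu>) + (\<Sum>\<xi>\<in>?D. mom (\<xi> - \<nu>) * lk (E \<mu>) \<xi>)"
     using below(1,2)[of \<mu>] out[OF tri below(2)] by (simp add: mult.commute)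
    finally show "(\<Sum>\<xi>\<in>?D. mom (\<xi> - \<nu>) * lk (E \<mu>) \<xi>) = - mom (\<mu> - \<nu>)"
     using hecke_fam_orthogonal[OF \<mu>, of \<nu>] \<nu> by (simp add: below_def add_eq_0_iff)
   qed
  qed (rule True)
 next
  case False
  have "\<forall>\<^sub>F q in at 0. lk (?U q) \<nu> = lk (E \<mu>) \<nu>"
   using ev
  proof eventually_elim
   case (elim q)
   then show ?case using U[of q] is_koornwinder_iff[of q \<mu> "?U q"] \<mu> out[OF tri False] out[OF _ False] by simp
  qed
  then show ?thesis by (rule tendsto_eventually)
 qed
qed

end

section \<open>Specializing rational functions\<close>

lemma par_eval_ring:
 "par_eval 0 t a b c d = 0" "par_eval 1 t a b c d = 1" "par_eval (- P) t a b c d = - par_eval P t a b c d"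
 by (simp_all add: par_eval_def)

lemma par_eval_prod: "par_eval (P * Q) t a b c d \<noteq> 0 \<longleftrightarrow> par_eval P t a b c d \<noteq> 0 \<and> par_eval Q t a b c d \<noteq> 0"
 by (simp add: par_eval_mult)

lemma poly_zero_on_disc:
 fixes P :: "'a::idom poly" and f :: "complex \<Rightarrow> 'a"
 assumes "inj f" "\<And>x. norm x < 1 \<Longrightarrow> poly P (f x) = 0"
 shows "P = 0"
proof (rule ccontr)
 assume "P \<noteq> 0"
 then have "finite {y. poly P y = 0}" by (rule poly_roots_finite)
 moreover have "f ` ball 0 1 \<subseteq> {y. poly P y = 0}" using assms(2) by auto
 ultimately have "finite (f ` ball 0 1)" by (rule finite_subset[rotated])
 then have "finite (ball (0::complex) 1)" using assms(1) by (simp add: finite_image_iff inj_on_subset)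
 then show False using uncountable_ball[of 1 "0::complex"] by (simp add: countable_finite)
qed

text \<open>One variable after the other, as a polynomial over a domain has finitely many roots.\<close>

lemma par_poly_zero:
 assumes "\<And>t a b c d. norm t < 1 \<Longrightarrow> norm a < 1 \<Longrightarrow> norm b < 1 \<Longrightarrow> norm c < 1 \<Longrightarrow> norm d < 1 \<Longrightarrow> par_eval P t a b c d = 0"
 shows "P = 0"
proof (rule poly_zero_on_disc[of "\<lambda>d. [:[:[:[:d:]:]:]:]"])
 fix d :: complex assume d: "norm d < 1"
 let ?P = "poly P [:[:[:[:d:]:]:]:]"
 show "?P = 0"
 proof (rule poly_zero_on_disc[of "\<lambda>c. [:[:[:c:]:]:]"])
  fix c :: complex assume c: "norm c < 1"
  let ?P = "poly ?P [:[:[:c:]:]:]"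
  show "?P = 0"
  proof (rule poly_zero_on_disc[of "\<lambda>b. [:[:b:]:]"])
   fix b :: complex assume b: "norm b < 1"
   let ?P = "poly ?P [:[:b:]:]"
   show "?P = 0"
   proof (rule poly_zero_on_disc[of "\<lambda>a. [:a:]"])
    fix a :: complex assume a: "norm a < 1"
    let ?P = "poly ?P [:a:]"
    show "?P = 0"
     by (rule poly_zero_on_disc[of "\<lambda>t. t"]) (use assms a b c d in \<open>auto simp: par_eval_def\<close>)
   qed (simp add: inj_def)
  qed (simp add: inj_def)
 qed (simp add: inj_def)
qed (simp add: inj_def)

locale par_point =
 fixes t a b c d :: complex
begin

abbreviation hv where "hv r v \<equiv> ratfun_has_value r t a b c d v"
abbreviation pe where "pe P \<equiv> par_eval P t a b c d"

lemma hv_Fract: "pe D \<noteq> 0 \<Longrightarrow> hv (Fract N D) (pe N / pe D)"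
 by (auto simp: ratfun_has_value_def)

lemma pe_nonzero: "pe D \<noteq> 0 \<Longrightarrow> D \<noteq> 0"
 by (auto simp: par_eval_ring)

lemma hvE:
 assumes "hv r v"
 obtains N D where "r = Fract N D" "pe D \<noteq> 0" "D \<noteq> 0" "v = pe N / pe D"
 using assms pe_nonzero unfolding ratfun_has_value_def by blast

lemma hv_unique: "hv r v \<Longrightarrow> hv r w \<Longrightarrow> v = w"
proof (elim hvE)
 fix N D N' D' assume *: "r = Fract N D" "pe D \<noteq> 0" "D \<noteq> 0" "v = pe N / pe D"
  "r = Fract N' D'" "pe D' \<noteq> 0" "D' \<noteq> 0" "w = pe N' / pe D'"
 then have "N * D' = N' * D" by (simp add: eq_fract)
 from arg_cong[OF this, of pe] show "v = w" using * by (simp add: par_eval_mult frac_eq_eq)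
qed

lemma hv_poly: "hv (Fract N 1) (pe N)"
 using hv_Fract[of 1 N] by (simp add: par_eval_ring)

lemma hv_0: "hv 0 0" and hv_1: "hv 1 1"
 using hv_poly[of 0] hv_poly[of 1] by (simp_all add: Zero_fract_def One_fract_def par_eval_ring)

lemma hv_vars: "hv tX t" "hv aX a" "hv bX b" "hv cX c" "hv dX d"
 using hv_poly unfolding tX_def aX_def bX_def cX_def dX_def by (metis par_eval_variables)+

lemma hv_add: "hv r v \<Longrightarrow> hv s w \<Longrightarrow> hv (r + s) (v + w)"
proof (elim hvE, hypsubst)
 fix N D N' D' assume "pe D \<noteq> 0" "D \<noteq> 0" "pe D' \<noteq> 0" "D' \<noteq> 0"
 then show "hv (Fract N D + Fract N' D') (pe N / pe D + pe N' / pe D')"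
  using hv_Fract[of "D * D'" "N * D' + N' * D"]
  by (simp add: par_eval_mult par_eval_add add_frac_eq)
qed

lemma hv_mult: "hv r v \<Longrightarrow> hv s w \<Longrightarrow> hv (r * s) (v * w)"
proof (elim hvE, hypsubst)
 fix N D N' D' assume "pe D \<noteq> 0" "pe D' \<noteq> 0"
 then show "hv (Fract N D * Fract N' D') (pe N / pe D * (pe N' / pe D'))"
  using hv_Fract[of "D * D'" "N * N'"] by (simp add: par_eval_mult)
qed

lemma hv_minus: "hv r v \<Longrightarrow> hv (- r) (- v)"
proof (elim hvE, hypsubst)
 fix N D assume "pe D \<noteq> 0"
 then show "hv (- Fract N D) (- (pe N / pe D))" using hv_Fract[of D "- N"] by (simp add: par_eval_ring)
qed

lemma hv_diff: "hv r v \<Longrightarrow> hv s w \<Longrightarrow> hv (r - s) (v - w)"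
 using hv_add[of r v "- s" "- w"] hv_minus[of s w] by simp

lemma hv_inverse: "hv r v \<Longrightarrow> v \<noteq> 0 \<Longrightarrow> hv (inverse r) (inverse v)"
proof (elim hvE, hypsubst)
 fix N D assume "pe D \<noteq> 0" "pe N / pe D \<noteq> 0"
 then show "hv (inverse (Fract N D)) (inverse (pe N / pe D))" using hv_Fract[of N D] by simp
qed

lemma hv_divide: "hv r v \<Longrightarrow> hv s w \<Longrightarrow> w \<noteq> 0 \<Longrightarrow> hv (r / s) (v / w)"
 unfolding divide_inverse by (intro hv_mult hv_inverse)

lemma hv_power: "hv r v \<Longrightarrow> hv (r ^ k) (v ^ k)"
 by (induction k) (auto intro: hv_1 hv_mult)

lemma hv_powi: "hv r v \<Longrightarrow> v \<noteq> 0 \<Longrightarrow> hv (r powi k) (v powi k)"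
 unfolding power_int_def by (auto intro: hv_power hv_inverse)

lemma hv_sum: "(\<And>i. i \<in> A \<Longrightarrow> hv (f i) (g i)) \<Longrightarrow> hv (\<Sum>i\<in>A. f i) (\<Sum>i\<in>A. g i)"
 by (induction A rule: infinite_finite_induct) (auto intro: hv_0 hv_add)

lemma hv_prod: "(\<And>i. i \<in> A \<Longrightarrow> hv (f i) (g i)) \<Longrightarrow> hv (\<Prod>i\<in>A. f i) (\<Prod>i\<in>A. g i)"
 by (induction A rule: infinite_finite_induct) (auto intro: hv_1 hv_mult)

lemma hv_if: "(C \<Longrightarrow> hv r v) \<Longrightarrow> (\<not> C \<Longrightarrow> hv r' v') \<Longrightarrow> hv (if C then r else r') (if C then v else v')"
 by simp

lemma hv_nonzero: "hv r v \<Longrightarrow> v \<noteq> 0 \<Longrightarrow> r \<noteq> 0"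
 using hv_unique[OF _ hv_0] by blast

lemmas hv_ring = hv_0 hv_1 hv_vars hv_add hv_mult hv_minus hv_diff

text \<open>Coefficientwise specialization of the parameters.\<close>

definition lspec :: "ratfun laurent \<Rightarrow> complex laurent \<Rightarrow> bool" where
 "lspec f g \<longleftrightarrow> (\<forall>\<xi>. hv (lk f \<xi>) (lk g \<xi>))"

lemma lspecD: "lspec f g \<Longrightarrow> hv (lk f \<xi>) (lk g \<xi>)"
 by (simp add: lspec_def)

lemma lspec_add: "lspec f g \<Longrightarrow> lspec f' g' \<Longrightarrow> lspec (f + f') (g + g')"
 unfolding lspec_def lookup_add by (auto intro: hv_add)

lemma lspec_diff: "lspec f g \<Longrightarrow> lspec f' g' \<Longrightarrow> lspec (f - f') (g - g')"
 unfolding lspec_def lookup_minus by (auto intro: hv_diff)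

lemma lspec_const_mult: "hv r v \<Longrightarrow> lspec f g \<Longrightarrow> lspec (const r * f) (const v * g)"
 unfolding lspec_def lookup_const_mult by (auto intro: hv_mult)

lemma hv_string_coeff: "hv (string_coeff n tX aX bX i e k) (string_coeff n t a b i e k)"
 unfolding string_coeff_def gap_coeff_def eta_def by (intro hv_if hv_ring)

lemma lspec_hecke:
 assumes i: "i \<in> {1..n}" and f: "lspec f g"
 shows "lspec (hecke n tX aX bX i f) (hecke n t a b i g)"
 unfolding lspec_def
proof
 fix \<xi>
 let ?A = "supp f \<union> supp g"
 have m: "hv (lk (hecke_mon n tX aX bX i \<mu>) \<xi>) (lk (hecke_mon n t a b i \<mu>) \<xi>)" for \<mu>
  unfolding hecke_mon_def lookup_sum const_zmon lookup_single when_def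
  by (intro hv_sum hv_if hv_string_coeff hv_0)
 show "hv (lk (hecke n tX aX bX i f) \<xi>) (lk (hecke n t a b i g) \<xi>)"
  by (subst (1 2) lookup_hecke[OF i, of ?A]) (auto intro!: hv_sum hv_mult m lspecD[OF f])
qed

lemma lspec_E_partition:
 assumes "is_partition n \<sigma>"
 shows "lspec (E_partition n cX dX \<sigma>) (E_partition n c d \<sigma>)"
 unfolding lspec_def
proof
 fix \<xi>
 show "hv (lk (E_partition n cX dX \<sigma>) \<xi>) (lk (E_partition n c d \<sigma>) \<xi>)"
 proof (cases "\<xi> \<in> compositions n")
  case True
  show ?thesis unfolding lookup_E_partition[OF assms True] factor_weight_def
   by (intro hv_prod hv_if hv_ring)
 next
  case False
  then have "\<xi> \<notin> supp (E_partition n cX dX \<sigma>)" "\<xi> \<notin> supp (E_partition n c d \<sigma>)"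
   using E_partition_composition[OF assms] by blast+
  then show ?thesis by (simp add: in_keys_iff hv_0)
 qed
qed

context
 fixes n :: nat
 assumes good: "good_params n t a b c d"
begin

lemma t_nonzero: "t \<noteq> 0" using good by (simp add: good_params_def)

lemma denominator_nonzero:
 assumes "i \<in> {1..n}" "i < n"
 shows "a * b * c * d - t powi n_exp n i \<mu> \<noteq> 0"
proof -
 have "n_exp n i \<mu> \<in> {- 3 * int n - 3..3 * int n + 3}" using n_exp_bounds[of i n \<mu>] assms by auto
 then show ?thesis using good unfolding good_params_def by auto
qed

lemma hv_p_coeff: "i \<in> {1..n} \<Longrightarrow> hv (p_coeff n tX aX bX cX dX i \<mu>) (p_coeff n t a b c d i \<mu>)"
 unfolding p_coeff_def pn_coeff_def Let_def
 by (intro hv_if hv_divide hv_ring hv_powi t_nonzero denominator_nonzero)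

lemma hv_q_coeff: "i \<in> {1..n} \<Longrightarrow> hv (q_coeff n tX aX bX cX dX i \<mu>) (q_coeff n t a b c d i \<mu>)"
 unfolding q_coeff_def qn_coeff_def Let_def
 by (intro hv_if hv_divide hv_ring hv_power hv_powi t_nonzero) (simp add: denominator_nonzero[unfolded right_minus_eq])

lemma good_params_generic: "good_params n tX aX bX cX dX"
 unfolding good_params_def
proof (intro conjI ballI)
 show "tX \<noteq> 0" "aX \<noteq> 0" "bX \<noteq> 0"
  using hv_nonzero[OF hv_vars(1)] hv_nonzero[OF hv_vars(2)] hv_nonzero[OF hv_vars(3)] good by (auto simp: good_params_def)
 fix N assume N: "N \<in> {- 3 * int n - 3..3 * int n + 3}"
 have "hv (aX * bX * cX * dX - tX powi N) (a * b * c * d - t powi N)" "hv (cX * dX - tX powi N) (c * d - t powi N)"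
  by (intro hv_ring hv_powi t_nonzero)+
 moreover have "a * b * c * d - t powi N \<noteq> 0" "c * d - t powi N \<noteq> 0" using good N by (auto simp: good_params_def)
 ultimately show "aX * bX * cX * dX \<noteq> tX powi N" "cX * dX \<noteq> tX powi N"
  using hv_nonzero by (metis right_minus_eq)+
qed

lemma lspec_hecke_fam:
 assumes "\<mu> \<in> compositions n"
 shows "lspec (hecke_fam n tX aX bX cX dX \<mu>) (hecke_fam n t a b c d \<mu>)"
 using assms
proof (induction \<mu> rule: descend_induct[where ?'v = "ratfun laurent" and ?'w = "complex laurent", consumes 1, case_names dominant ascent])
 case (dominant \<mu>)
 then show ?case unfolding hecke_fam_def path_fam_partition[OF dominant] by (rule lspec_E_partition)
next
 case (ascent \<mu> i)
 have "0 < pair_root n i (refl_comp n i \<mu>)" using ascent.hyps(3) by simp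
 then have q: "q_coeff n t a b c d i (refl_comp n i \<mu>) \<noteq> 0" by (rule coeff_lower(4)[OF ascent.hyps(2) _ good])
 have 1: "hecke_fam n tX aX bX cX dX \<mu> = hecke_step n tX aX bX cX dX i (refl_comp n i \<mu>) (hecke_fam n tX aX bX cX dX (refl_comp n i \<mu>))"
  unfolding hecke_fam_def by (rule ascent.hyps(5))
 have 2: "hecke_fam n t a b c d \<mu> = hecke_step n t a b c d i (refl_comp n i \<mu>) (hecke_fam n t a b c d (refl_comp n i \<mu>))"
  unfolding hecke_fam_def by (rule ascent.hyps(6))
 show ?case unfolding 1 2 hecke_step_def
  by (intro lspec_const_mult lspec_diff lspec_hecke hv_inverse hv_p_coeff hv_q_coeff q ascent.IH ascent.hyps(2))
qed

end

end

section \<open>Generic parameters\<close>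

lemma generic_good_params:
 obtains P where "P \<noteq> 0" "\<And>t a b c d. par_eval P t a b c d \<noteq> 0 \<Longrightarrow> good_params n t a b c d"
proof -
 define T A B C D :: "par \<Rightarrow> complex" where coords: "T = (\<lambda>(t,a,b,c,d). t)" "A = (\<lambda>(t,a,b,c,d). a)"
  "B = (\<lambda>(t,a,b,c,d). b)" "C = (\<lambda>(t,a,b,c,d). c)" "D = (\<lambda>(t,a,b,c,d). d)"
 define f where "f p = T p * A p * B p * (\<Prod>N\<in>{..3 * n + 3}.
  (A p * B p * C p * D p - T p ^ N) * (A p * B p * C p * D p * T p ^ N - 1) * ((C p * D p - T p ^ N) * (C p * D p * T p ^ N - 1)))" for p
 have f_eval: "f (t,a,b,c,d) = t * a * b * (\<Prod>N\<in>{..3 * n + 3}.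
  (a * b * c * d - t ^ N) * (a * b * c * d * t ^ N - 1) * ((c * d - t ^ N) * (c * d * t ^ N - 1)))" for t a b c d
  by (simp add: f_def coords)
 note fr = function_ring_poly_funs
 have "f \<in> poly_funs" unfolding f_def[abs_def]
  by (intro function_ring_mult[OF fr] function_ring_prod[OF fr] function_ring_diff[OF fr] function_ring_power[OF fr]
   function_ring_const[OF fr] poly_funs_coords[folded coords])
 then obtain P where P: "\<And>t a b c d. f (t,a,b,c,d) = par_eval P t a b c d" unfolding poly_funs_def by blast
 \<comment> \<open>At this point \<open>a b c d\<close> and \<open>c d\<close> vanish and no power of \<open>t\<close> does.\<close>
 have "f (1/2, 1/2, 1/2, 0, 0) \<noteq> 0" by (simp add: f_eval)
 then have "P \<noteq> 0" unfolding P by (auto simp: par_eval_ring)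
 moreover have "good_params n t a b c d" if nz: "par_eval P t a b c d \<noteq> 0" for t a b c d
 proof -
  have *: "t \<noteq> 0" "a \<noteq> 0" "b \<noteq> 0"
   "\<forall>N\<in>{..3 * n + 3}. a * b * c * d \<noteq> t ^ N \<and> a * b * c * d * t ^ N \<noteq> 1 \<and> c * d \<noteq> t ^ N \<and> c * d * t ^ N \<noteq> 1"
   using nz unfolding P[symmetric] f_eval by auto
  have "x \<noteq> t powi N" if N: "N \<in> {- 3 * int n - 3..3 * int n + 3}"
   and x: "\<forall>N\<in>{..3 * n + 3}. x \<noteq> t ^ N \<and> x * t ^ N \<noteq> 1" for x N
  proof (cases "0 \<le> N")
   case True
   then have "nat N \<in> {..3 * n + 3}" using N by auto
   then show ?thesis using x True by (auto simp: power_int_def)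
  next
   case False
   then have "nat (- N) \<in> {..3 * n + 3}" using N by auto
   then have "x * t ^ nat (- N) \<noteq> 1" using x by blast
   moreover have "t powi N * t ^ nat (- N) = 1" using False *(1) by (simp add: power_int_def power_inverse)
   ultimately show ?thesis by auto
  qed
  then show ?thesis unfolding good_params_def using * by blast
 qed
 ultimately show ?thesis by (rule that)
qed

text \<open>An equation between rational functions would survive specialization.\<close>

lemma good_params_ratfun: "good_params n tX aX bX cX dX"
proof -
 obtain P where P: "P \<noteq> 0" "\<And>t a b c d. par_eval P t a b c d \<noteq> 0 \<Longrightarrow> good_params n t a b c d"
  by (rule generic_good_params[of n]) (rule that)
 obtain t a b c d where "par_eval P t a b c d \<noteq> 0" using par_poly_zero[of P] P(1) by blast
 from par_point.good_params_generic[OF P(2)[OF this]] show ?thesis .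
qed

text \<open>The numerator, multiplied by the denominator and by \<open>G\<close>, vanishes on the whole polydisc.\<close>

lemma ratfun_zero_if_generic:
 fixes r :: ratfun
 assumes G: "G \<noteq> 0"
  and v: "\<And>t a b c d. norm t < 1 \<Longrightarrow> norm a < 1 \<Longrightarrow> norm b < 1 \<Longrightarrow> norm c < 1 \<Longrightarrow> norm d < 1 \<Longrightarrow>
   par_eval G t a b c d \<noteq> 0 \<Longrightarrow> ratfun_has_value r t a b c d 0"
 shows "r = 0"
proof -
 obtain N D where r: "r = Fract N D" "D \<noteq> 0" by (cases r) auto
 have "N * (D * G) = 0"
 proof (rule par_poly_zero)
  fix t a b c d :: complex
  assume *: "norm t < 1" "norm a < 1" "norm b < 1" "norm c < 1" "norm d < 1"
  show "par_eval (N * (D * G)) t a b c d = 0"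
  proof (cases "par_eval D t a b c d \<noteq> 0 \<and> par_eval G t a b c d \<noteq> 0")
   case True
   have "par_eval N t a b c d / par_eval D t a b c d = 0"
    by (rule par_point.hv_unique[OF par_point.hv_Fract]) (use True v[OF *] r in auto)
   then show ?thesis using True by (simp add: par_eval_mult)
  qed (auto simp: par_eval_mult)
 qed
 then have "N = 0" using r(2) G by simp
 then show ?thesis using r by (simp add: Zero_fract_def eq_fract)
qed

lemma strict_gram_nondegenerate:
 assumes "unit_params t a b c d"
  and det: "gram_det {\<nu> \<in> compositions n. strict_submaj n \<nu> \<mu>} (\<lambda>\<nu> \<xi>. moment n t a b c d (\<xi> - \<nu>)) \<noteq> 0"
  and f: "supp f \<subseteq> {\<nu> \<in> compositions n. strict_submaj n \<nu> \<mu>}"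
  and orth: "\<And>\<nu>. \<nu> \<in> compositions n \<Longrightarrow> strict_submaj n \<nu> \<mu> \<Longrightarrow> unit_params.pairing n t a b c d f \<nu> = 0"
 shows "f = 0"
proof -
 interpret unit_params n t a b c d by fact
 let ?D = "{\<nu> \<in> compositions n. strict_submaj n \<nu> \<mu>}"
 have fin: "finite ?D"
  by (rule finite_subset[OF _ finite_submaj[of n \<mu>]]) (auto simp: strict_submaj_def)
 have "lk f \<xi> = 0" for \<xi>
 proof (cases "\<xi> \<in> ?D")
  case True
  show ?thesis
  proof (rule gram_unique[OF fin det _ True])
   show "\<forall>\<nu>\<in>?D. (\<Sum>\<xi>\<in>?D. mom (\<xi> - \<nu>) * lk f \<xi>) = 0"
    using orth pairing_superset[OF fin f] by (simp add: mult.commute)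
  qed
 next
  case False
  then show ?thesis using f by (auto simp: in_keys_iff)
 qed
 then show ?thesis by (intro poly_mapping_eqI) simp
qed

text \<open>Both sides specialize to those of \<open>hecke_fam_relation\<close> at all points where the latter holds, and
 these are generic.\<close>

theorem hecke_fam_relation_ratfun:
 assumes \<mu>: "\<mu> \<in> compositions n" and i: "i \<in> {1..n}"
 shows "hecke n tX aX bX i (hecke_fam n tX aX bX cX dX \<mu>)
  = const (p_coeff n tX aX bX cX dX i \<mu>) * hecke_fam n tX aX bX cX dX \<mu>
   + const (q_coeff n tX aX bX cX dX i \<mu>) * hecke_fam n tX aX bX cX dX (refl_comp n i \<mu>)" (is "?L = ?R")
proof (rule poly_mapping_eqI)
 fix \<xi>
 let ?D = "{\<nu> \<in> compositions n. strict_submaj n \<nu> \<mu>}"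
 have fin: "finite ?D"
  by (rule finite_subset[OF _ finite_submaj[of n \<mu>]]) (auto simp: strict_submaj_def)
 obtain P where P: "P \<noteq> 0" "\<And>t a b c d. par_eval P t a b c d \<noteq> 0 \<Longrightarrow> good_params n t a b c d"
  by (rule generic_good_params[of n]) (rule that)
 obtain G where G: "G \<noteq> 0" "\<And>t a b c d. norm t < 1 \<Longrightarrow> norm a < 1 \<Longrightarrow> norm b < 1 \<Longrightarrow> norm c < 1 \<Longrightarrow> norm d < 1 \<Longrightarrow>
   par_eval G t a b c d \<noteq> 0 \<Longrightarrow> gram_det ?D (\<lambda>\<nu> \<xi>. moment n t a b c d (\<xi> - \<nu>)) \<noteq> 0"
  by (rule gram_det_generic[OF fin, of n]) auto
 have "lk (?L - ?R) \<xi> = 0"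
 proof (rule ratfun_zero_if_generic)
  show "P * G \<noteq> 0" using P G by simp
  fix t a b c d :: complex
  assume norms: "norm t < 1" "norm a < 1" "norm b < 1" "norm c < 1" "norm d < 1"
   and nz: "par_eval (P * G) t a b c d \<noteq> 0"
  have good: "good_params n t a b c d" using P(2) nz by (simp add: par_eval_prod)
  have det: "gram_det ?D (\<lambda>\<nu> \<xi>. moment n t a b c d (\<xi> - \<nu>)) \<noteq> 0" using G(2)[OF norms] nz by (simp add: par_eval_prod)
  interpret par_point t a b c d .
  interpret regular_point n t a b c d
   by unfold_locales (use norms good in auto)
  have up: "unit_params t a b c d" by unfold_locales
  have rel: "hecke n t a b i (E \<mu>) = const (p_coeff n t a b c d i \<mu>) * E \<mu> + const (q_coeff n t a b c d i \<mu>) * E (refl_comp n i \<mu>)"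
   by (rule hecke_fam_relation[OF \<mu> i]) (rule strict_gram_nondegenerate[OF up det])
  have "lspec (?L - ?R) (hecke n t a b i (E \<mu>) - (const (p_coeff n t a b c d i \<mu>) * E \<mu> + const (q_coeff n t a b c d i \<mu>) * E (refl_comp n i \<mu>)))"
   by (intro lspec_diff lspec_add lspec_const_mult lspec_hecke i hv_p_coeff hv_q_coeff good lspec_hecke_fam \<mu> refl_composition)
  from lspecD[OF this, of \<xi>] show "hv (lk (?L - ?R) \<xi>) 0" unfolding rel by simp
 qed
 then show "lk ?L \<xi> = lk ?R \<xi>" by (simp add: lookup_minus)
qed

theorem is_E_family_hecke_fam:
 "is_E_family n tX aX bX cX dX (restrict (hecke_fam n tX aX bX cX dX) (compositions n))"
proof -
 interpret hecke_point n tX aX bX cX dX by unfold_locales (rule good_params_ratfun)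
 let ?E = "hecke_fam n tX aX bX cX dX"
 have "?E \<mu> \<in> laurent_polys n" if "\<mu> \<in> compositions n" for \<mu>
  using hecke_fam_below[OF that] by (auto simp: laurent_below_def laurent_polys_def)
 then have "restrict ?E (compositions n) \<in> compositions n \<rightarrow>\<^sub>E laurent_polys n" by auto
 moreover have "restrict ?E (compositions n) \<mu> = E_partition n cX dX \<mu>" if "is_partition n \<mu>" for \<mu>
  using that unfolding hecke_fam_def by (simp add: path_fam_partition is_partition_def)
 moreover have "hecke n tX aX bX i (restrict ?E (compositions n) \<mu>)
   = const (P i \<mu>) * restrict ?E (compositions n) \<mu> + const (Q i \<mu>) * restrict ?E (compositions n) (s i \<mu>)"
  if "\<mu> \<in> compositions n" "i \<in> {1..n}" for \<mu> i
  using hecke_fam_relation_ratfun[OF that] that refl_composition[OF that(2,1)] by simp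
 ultimately show ?thesis unfolding is_E_family_def by blast
qed

text \<open>Every composition is reached from a partition by ascents, and there \<open>q\<^sub>i \<noteq> 0\<close>.\<close>

theorem is_E_family_unique:
 assumes E: "is_E_family n t a b c d E" and good: "good_params n t a b c d" and \<mu>: "\<mu> \<in> compositions n"
 shows "E \<mu> = hecke_fam n t a b c (d::'k::field) \<mu>"
 using \<mu>
proof (induction \<mu> rule: descend_induct[where ?'v = "'k laurent" and ?'w = "'k laurent", consumes 1, case_names dominant ascent])
 case (dominant \<mu>)
 then show ?case using E unfolding hecke_fam_def path_fam_partition[OF dominant] is_E_family_def by blast
next
 case (ascent \<mu> i)
 let ?s = "refl_comp n i \<mu>"
 have "0 < pair_root n i ?s" using ascent.hyps(3) by simp
 then have q: "q_coeff n t a b c d i ?s \<noteq> 0" by (rule coeff_lower(4)[OF ascent.hyps(2) _ good])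
 have "hecke n t a b i (E ?s) = const (p_coeff n t a b c d i ?s) * E ?s + const (q_coeff n t a b c d i ?s) * E (refl_comp n i ?s)"
  using E ascent.hyps(2,4) unfolding is_E_family_def by blast
 then have "const (inverse (q_coeff n t a b c d i ?s)) * (hecke n t a b i (E ?s) - const (p_coeff n t a b c d i ?s) * E ?s)
   = const (inverse (q_coeff n t a b c d i ?s) * q_coeff n t a b c d i ?s) * E \<mu>"
  by (simp add: const_mult mult.assoc)
 then have "E \<mu> = hecke_step n t a b c d i ?s (E ?s)" using q by (simp add: hecke_step_def const_1)
 also have "\<dots> = hecke_fam n t a b c d \<mu>"
  unfolding ascent.IH hecke_fam_def by (rule ascent.hyps(5)[symmetric])
 finally show ?case .
qed

lemma E_family_ex1: "\<exists>!E. is_E_family n tX aX bX cX dX E"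
proof (rule ex1I)
 show "is_E_family n tX aX bX cX dX (restrict (hecke_fam n tX aX bX cX dX) (compositions n))"
  by (rule is_E_family_hecke_fam)
 fix E assume E: "is_E_family n tX aX bX cX dX E"
 show "E = restrict (hecke_fam n tX aX bX cX dX) (compositions n)"
 proof
  fix \<mu>
  show "E \<mu> = restrict (hecke_fam n tX aX bX cX dX) (compositions n) \<mu>"
  proof (cases "\<mu> \<in> compositions n")
   case True
   then show ?thesis using is_E_family_unique[OF E good_params_ratfun] by simp
  next
   case False
   then show ?thesis using E by (auto simp: is_E_family_def PiE_def extensional_def)
  qed
 qed
qed

lemma E_poly_hecke_fam: "\<mu> \<in> compositions n \<Longrightarrow> E_poly n \<mu> = hecke_fam n tX aX bX cX dX \<mu>"
 using theI'[OF E_family_ex1[of n]] is_E_family_unique[OF _ good_params_ratfun] unfolding E_poly_def by blast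

theorem theorem3p10:
 fixes n :: nat
 assumes "n \<ge> 1"
 shows "(\<exists>!E. is_E_family n tX aX bX cX dX E) \<and>
  (\<forall>\<mu>\<in>compositions n. generic_in_polydisc (\<lambda>t a b c d.
    (\<forall>\<^sub>F q in at 0. \<exists>!u. is_koornwinder n q t a b c d \<mu> u) \<and>
    (\<forall>\<nu>. \<exists>v. ratfun_has_value (Poly_Mapping.lookup (E_poly n \<mu>) \<nu>) t a b c d v \<and>
     ((\<lambda>q. Poly_Mapping.lookup (koornwinder n q t a b c d \<mu>) \<nu>) \<longlongrightarrow> v) (at 0))))"
proof (intro conjI ballI)
 show "\<exists>!E. is_E_family n tX aX bX cX dX E" by (rule E_family_ex1)
 fix \<mu> assume \<mu>: "\<mu> \<in> compositions n"
 let ?D = "{\<nu> \<in> compositions n. prec n \<nu> \<mu>}"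
 obtain P where P: "P \<noteq> 0" "\<And>t a b c d. par_eval P t a b c d \<noteq> 0 \<Longrightarrow> good_params n t a b c d"
  by (rule generic_good_params[of n]) (rule that)
 obtain G where G: "G \<noteq> 0" "\<And>t a b c d. norm t < 1 \<Longrightarrow> norm a < 1 \<Longrightarrow> norm b < 1 \<Longrightarrow> norm c < 1 \<Longrightarrow> norm d < 1 \<Longrightarrow>
   par_eval G t a b c d \<noteq> 0 \<Longrightarrow> gram_det ?D (\<lambda>\<nu> \<xi>. moment n t a b c d (\<xi> - \<nu>)) \<noteq> 0"
  by (rule gram_det_generic[OF finite_prec, of n]) auto
 show "generic_in_polydisc (\<lambda>t a b c d.
    (\<forall>\<^sub>F q in at 0. \<exists>!u. is_koornwinder n q t a b c d \<mu> u) \<and>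
    (\<forall>\<nu>. \<exists>v. ratfun_has_value (lk (E_poly n \<mu>) \<nu>) t a b c d v \<and>
     ((\<lambda>q. lk (koornwinder n q t a b c d \<mu>) \<nu>) \<longlongrightarrow> v) (at 0)))"
  unfolding generic_in_polydisc_def
 proof (intro exI[of _ "P * G"] conjI allI impI; (elim conjE)?)
  show "P * G \<noteq> 0" using P G by simp
  fix t a b c d :: complex
  assume norms: "norm t < 1" "norm a < 1" "norm b < 1" "norm c < 1" "norm d < 1"
   and nz: "par_eval (P * G) t a b c d \<noteq> 0"
  have good: "good_params n t a b c d" using P(2) nz by (simp add: par_eval_prod)
  interpret par_point t a b c d .
  interpret regular_point n t a b c d
   by unfold_locales (use norms good in auto)
  have det: "gram_det (below \<mu>) (\<lambda>\<nu> \<xi>. mom (\<xi> - \<nu>)) \<noteq> 0"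
   unfolding below_def using G(2)[OF norms] nz by (simp add: par_eval_prod)
  show "\<forall>\<^sub>F q in at 0. \<exists>!u. is_koornwinder n q t a b c d \<mu> u" by (rule koornwinder_limit(1)[OF \<mu> det])
  fix \<nu>
  show "\<exists>v. hv (lk (E_poly n \<mu>) \<nu>) v \<and> ((\<lambda>q. lk (koornwinder n q t a b c d \<mu>) \<nu>) \<longlongrightarrow> v) (at 0)"
   unfolding E_poly_hecke_fam[OF \<mu>]
   using lspecD[OF lspec_hecke_fam[OF good \<mu>]] koornwinder_limit(2)[OF \<mu> det] by blast
 qed
qed

end
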